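(* Let $\sigma:\tilde M\to M$ be the blowing-up of $C$, with the set-up and notation of the context. For $Q\subsetneq K$, the map $$H_{\tilde Q}^{\mathrm{alog}}:\tilde N^\star_{\tilde Q|\tilde D^\circ_{\tilde Q}}\to\pi^{-1}(N^\star_{K\setminus Q|C})\times_C N^\star_{Q|C},\qquad H_{\tilde Q}^{\mathrm{alog}}(\tilde x,\tilde v;\tilde v_q,q\in Q)=(v(\tilde x,\tilde v);\ \tilde v\tilde v_q,\ q\in Q),$$ is a bijection and, with $$h_{\tilde Q}^{\mathrm{alog}}:\pi^{-1}(N^\star_{K\setminus Q|C})\times_C N^\star_{Q|C}\to N^\star_{K|C},\qquad h_{\tilde Q}^{\mathrm{alog}}(v;v_q,q\in Q)=(\pi_k(v),k\in K\setminus Q;\ v_q,q\in Q),$$ the following diagram commutes: one has $\sigma_N^{\mathrm{alog}}=h_{\tilde Q}^{\mathrm{alog}}\circ H_{\tilde Q}^{\mathrm{alog}}$, where $\sigma_N^{\mathrm{alog}}:\tilde N^\star_{\tilde Q|\tilde D^\circ_{\tilde Q}}\to N^\star_{K|C}$ is the map corresponding to $\sigma^{\mathrm{alog}}:(\tilde M,\tilde D)^{\mathrm{alog}}_{|\tilde D^\circ_{\tilde Q}}\to(M,D)^{\mathrm{alog}}_{|C}$ under the identifications $(\tilde M,\tilde D)^{\mathrm{alog}}_{|\tilde D^\circ_{\tilde Q}}\simeq\tilde N^\star_{\tilde Q|\tilde D^\circ_{\tilde Q}}$ and $(M,D)^{\mathrm{alog}}_{|C}\simeq N^\star_{K|C}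$.
   Context: **Set-up.** $M$ is a nonsingular complex algebraic variety, $D=\bigcup_{k\in K}D_k$ ($K$ finite, nonempty) a divisor with simple normal crossings, $D_K=\bigcap_{k\in K}D_k$, and $C\subset D_K$ a nonsingular subvariety in normal crossings with $D$ (so all components contain $C$). $\sigma:\tilde M\to M$ is the blowing-up of $C$, $E$ the exceptional divisor, $\tilde D_k$ the strict transform of $D_k$, $\tilde D=\sigma^{-1}(D)=E\cup\bigcup_k\tilde D_k$. For $Q\subset K$, $\tilde Q=Q\cup\{0\}$ and $\tilde D^\circ_{\tilde Q}=(E\cap\bigcap_{q\in Q}\tilde D_q)\setminus\bigcup_{k\in K\setminus Q}\tilde D_k$. **Log-spaces.** $\mathcal M(U)=\{g\in\mathcal O_M(U):g_{|U\setminus D}\text{ invertible}\}$ and $(M,D)^{\mathrm{alog}}=\{(x,\Phi):x\in M,\ \Phi\in\mathrm{Hom}_{\mathrm{mon}}(\mathcal M_x,\mathbb C^* ),\ \Phi(g)=g(x)\ \forall g\in\mathcal O_x^*\}$; similarly for $(\tilde M,\tilde D)$. $\sigma^{\mathrm{alog}}(\tilde x,\tilde\Phi)=(\sigma(\tilde x),\ g\mapsto\tilde\Phi(g\circ\sigma))$. **Normal bundles.** $N=N_{M,C}$ is the normal bundle of $C$ in $M$, $N_k$ that of $D_k$ in $M$, $N_{D_K,C}$ that of $C$ in $D_K$, $\tilde N$ that of $E$ in $\tilde M$, $\tilde N_k$ that of $\tilde D_k$ in $\tilde M$. A superscript $*$ removes the zero section. There is an exact sequence $0\to N_{D_K,C}\to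 N\xrightarrow{\pi}\bigoplus_{k\in K}N_{k|C}\to0$, with components $\pi_k:N\to N_{k|C}$. For $Q\subset K$, $N^\star_{Q|C}$ is the fibre product over $C$ of the $N^*_{q|C}$, $q\in Q$; $\pi^{-1}(N^\star_{K\setminus Q|C})$ is the set of $v\in N$ with $\pi_k(v)\ne0$ for $k\in K\setminus Q$ and $\pi_q(v)=0$ for $q\in Q$. $\tilde N^\star_{\tilde Q|\tilde D^\circ_{\tilde Q}}$ is the fibre product over $\tilde D^\circ_{\tilde Q}$ of $\tilde N^*$ and the $\tilde N_q^*$, $q\in Q$; its points are written $(\tilde x,\tilde v;\tilde v_q,q\in Q)$. **Canonical identifications.** (a) $(M,D)^{\mathrm{alog}}_{|C}\simeq N^\star_{K|C}$: $(x,\Phi)\leftrightarrow(v_k)_{k\in K}$ with $\Phi(g)=\partial_{v_k}g(x)$ for any generator $g\in\mathcal O_x$ of the ideal of $D_k$; likewise $(\tilde M,\tilde D)^{\mathrm{alog}}_{|\tilde D^\circ_{\tilde Q}}\simeq\tilde N^\star_{\tilde Q|\tilde D^\circ_{\tilde Q}}$. (b) There is a canonical bijection $N^*\to\tilde N^*$, $v\mapsto([v],\tilde v)$: if $\gamma$ is a complex arc with $\gamma(0)=x\in C$ and $\gamma'(0)$ of class $v\ne0$ in $N_x$, and $\tilde\gamma$ is its lift to $\tilde M$, then $[v]=\tilde\gamma(0)\in E=\mathbb P(N)$ and $\tilde v$ is the class of $\tilde\gamma'(0)$ in $\tilde N$; $v(\tilde x,\tilde v)$ denotes the preimage of $(\tilde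 x,\tilde v)$. (c) Over $E\cap\tilde D_k$ there is a canonical isomorphism $\tilde N\otimes\tilde N_k\simeq\sigma^*N_k$: $\tilde v\tilde v_k$ is the vector $v_k\in N_{k,\sigma(\tilde x)}$ with $\partial_{v_k}g_k(x)=\partial_{\tilde v}\tilde g(\tilde x)\cdot\partial_{\tilde v_k}\tilde g_k(\tilde x)$, where $g_k,\tilde g,\tilde g_k$ are local equations of $D_k,E,\tilde D_k$ with $g_k\circ\sigma=\tilde g\tilde g_k$. *)

theory Defs
  imports "HOL-Analysis.Analysis"
begin

section \<open>Spaces with functions and complex algebraic varieties\<close>

text \<open>
  Varieties over the complex numbers are treated in the classical way, as topological spaces with a
  sheaf of complex valued functions that are locally isomorphic to closed algebraic subsets of
  affine space. The sections over an open set are represented by total functions whose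
  values outside of that set are irrelevant.
\<close>

record 'a func_space =
  zar :: "'a topology"
  reg :: "'a set \<Rightarrow> ('a \<Rightarrow> complex) set"

definition function_sheaf :: "'a func_space \<Rightarrow> bool" where
  "function_sheaf X \<longleftrightarrow>
     (\<forall>U f g. openin (zar X) U \<and> f \<in> reg X U \<and> (\<forall>x\<in>U. f x = g x) \<longrightarrow> g \<in> reg X U) \<and>
     (\<forall>U V. openin (zar X) U \<and> openin (zar X) V \<and> V \<subseteq> U \<longrightarrow> reg X U \<subseteq> reg X V) \<and>
     (\<forall>U f. openin (zar X) U \<and>
        (\<forall>x\<in>U. \<exists>V. openin (zar X) V \<and> x \<in> V \<and> V \<subseteq> U \<and> f \<in> reg X V) \<longrightarrow> f \<in> reg X U)"

definition morphism :: "'a func_space \<Rightarrow> 'b func_space \<Rightarrow> ('a \<Rightarrow> 'b) \<Rightarrow> bool" where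
  "morphism X Y \<phi> \<longleftrightarrow> continuous_map (zar X) (zar Y) \<phi> \<and>
     (\<forall>V f. openin (zar Y) V \<and> f \<in> reg Y V \<longrightarrow> f \<circ> \<phi> \<in> reg X {x \<in> topspace (zar X). \<phi> x \<in> V})"

definition isomorphism :: "'a func_space \<Rightarrow> 'b func_space \<Rightarrow> ('a \<Rightarrow> 'b) \<Rightarrow> bool" where
  "isomorphism X Y \<phi> \<longleftrightarrow> morphism X Y \<phi> \<and>
     (\<exists>\<psi>. morphism Y X \<psi> \<and> (\<forall>x\<in>topspace (zar X). \<psi> (\<phi> x) = x) \<and>
          (\<forall>y\<in>topspace (zar Y). \<phi> (\<psi> y) = y))"

text \<open>
  The structure induced on a (locally closed) subset: a function is regular if locally it is the
  restriction of a regular function of the ambient space.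
\<close>

definition induced :: "'a func_space \<Rightarrow> 'a set \<Rightarrow> 'a func_space" where
  "induced X S = \<lparr> zar = subtopology (zar X) S,
     reg = (\<lambda>W. {f. \<forall>x\<in>W. \<exists>U g. openin (zar X) U \<and> x \<in> U \<and> g \<in> reg X U \<and>
                         (\<forall>y\<in>U \<inter> W. f y = g y)}) \<rparr>"

text \<open>Points of affine \<open>n\<close>-space are sequences that vanish from index \<open>n\<close> on.\<close>

definition affine_points :: "nat \<Rightarrow> (nat \<Rightarrow> complex) set" where
  "affine_points n = {p. \<forall>i\<ge>n. p i = 0}"

inductive_set polyfun :: "nat \<Rightarrow> ((nat \<Rightarrow> complex) \<Rightarrow> complex) set" for n :: nat where
  const: "(\<lambda>p. c) \<in> polyfun n"
| coord: "i < n \<Longrightarrow> (\<lambda>p. p i) \<in> polyfun n"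
| add: "f \<in> polyfun n \<Longrightarrow> g \<in> polyfun n \<Longrightarrow> (\<lambda>p. f p + g p) \<in> polyfun n"
| mult: "f \<in> polyfun n \<Longrightarrow> g \<in> polyfun n \<Longrightarrow> (\<lambda>p. f p * g p) \<in> polyfun n"

definition affine_space :: "nat \<Rightarrow> (nat \<Rightarrow> complex) func_space" where
  "affine_space n = \<lparr>
     zar = topology_generated_by {{p \<in> affine_points n. f p \<noteq> 0} |f. f \<in> polyfun n},
     reg = (\<lambda>W. {f. \<forall>x\<in>W. \<exists>a\<in>polyfun n. \<exists>b\<in>polyfun n. b x \<noteq> 0 \<and>
                         (\<forall>y\<in>W. b y \<noteq> 0 \<longrightarrow> f y = a y / b y)}) \<rparr>"

definition zeros :: "nat \<Rightarrow> ((nat \<Rightarrow> complex) \<Rightarrow> complex) set \<Rightarrow> (nat \<Rightarrow> complex) set" where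
  "zeros n F = {p \<in> affine_points n. \<forall>f\<in>F. f p = 0}"

definition affine_open :: "'a func_space \<Rightarrow> 'a set \<Rightarrow> bool" where
  "affine_open X U \<longleftrightarrow> openin (zar X) U \<and>
     (\<exists>n F \<phi>. F \<subseteq> polyfun n \<and>
        isomorphism (induced X U) (induced (affine_space n) (zeros n F)) \<phi>)"

text \<open>
  The diagonal is closed in the product variety, whose topology has the basic open sets
  \<open>{(z, w) \<in> U \<times> V. (\<Sum>i<m. a i z * b i w) \<noteq> 0}\<close> with \<open>a i\<close> and \<open>b i\<close> regular on \<open>U\<close> and \<open>V\<close>.
\<close>

definition separated :: "'a func_space \<Rightarrow> bool" where
  "separated X \<longleftrightarrow> (\<forall>x\<in>topspace (zar X). \<forall>y\<in>topspace (zar X). x \<noteq> y \<longrightarrow>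
     (\<exists>U V m a b. openin (zar X) U \<and> openin (zar X) V \<and> x \<in> U \<and> y \<in> V \<and>
        (\<forall>i<(m::nat). a i \<in> reg X U \<and> b i \<in> reg X V) \<and>
        (\<Sum>i<m. a i x * b i y) \<noteq> 0 \<and> (\<forall>z\<in>U \<inter> V. (\<Sum>i<m. a i z * b i z) = 0)))"

definition variety :: "'a func_space \<Rightarrow> bool" where
  "variety X \<longleftrightarrow> function_sheaf X \<and> separated X \<and>
     (\<exists>\<U>. finite \<U> \<and> (\<forall>U\<in>\<U>. affine_open X U) \<and> \<Union>\<U> = topspace (zar X))"

definition pderiv_at :: "nat \<Rightarrow> ((nat \<Rightarrow> complex) \<Rightarrow> complex) \<Rightarrow> (nat \<Rightarrow> complex) \<Rightarrow> complex" where
  "pderiv_at i f p = deriv (\<lambda>z. f (p(i := z))) (p i)"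

text \<open>
  The Jacobian criterion: near every point the variety is given in some affine \<open>n\<close>-space by \<open>r\<close>
  equations whose Jacobian matrix has rank \<open>r\<close> along their common zero set.
\<close>

definition nonsingular :: "'a func_space \<Rightarrow> bool" where
  "nonsingular X \<longleftrightarrow> (\<forall>x\<in>topspace (zar X). \<exists>U n r F \<phi>. openin (zar X) U \<and> x \<in> U \<and>
     (\<forall>j<(r::nat). F j \<in> polyfun n) \<and>
     (\<forall>p\<in>zeros n (F ` {..<r}). \<forall>c.
        (\<forall>i<n. (\<Sum>j<r. c j * pderiv_at i (F j) p) = 0) \<longrightarrow> (\<forall>j<r. c j = 0)) \<and>
     isomorphism (induced X U) (induced (affine_space n) (zeros n (F ` {..<r}))) \<phi>)"


section \<open>Germs and ideals\<close>

text \<open>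
  Elements of the local ring at \<open>x\<close> are represented by functions that are regular near \<open>x\<close>, with
  \<open>eq_near\<close> being equality of germs.
\<close>

definition stalk :: "'a func_space \<Rightarrow> 'a \<Rightarrow> ('a \<Rightarrow> complex) set" where
  "stalk X x = {f. \<exists>U. openin (zar X) U \<and> x \<in> U \<and> f \<in> reg X U}"

definition eq_near :: "'a func_space \<Rightarrow> 'a \<Rightarrow> ('a \<Rightarrow> complex) \<Rightarrow> ('a \<Rightarrow> complex) \<Rightarrow> bool" where
  "eq_near X x f g \<longleftrightarrow> (\<exists>U. openin (zar X) U \<and> x \<in> U \<and> (\<forall>y\<in>U. f y = g y))"

definition stalk_units :: "'a func_space \<Rightarrow> 'a \<Rightarrow> ('a \<Rightarrow> complex) set" where
  "stalk_units X x = {f \<in> stalk X x. \<exists>h\<in>stalk X x. eq_near X x (\<lambda>y. f y * h y) (\<lambda>y. 1)}"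

definition ideal_span :: "'a func_space \<Rightarrow> 'a \<Rightarrow> ('a \<Rightarrow> complex) set \<Rightarrow> ('a \<Rightarrow> complex) set" where
  "ideal_span X x G = {f \<in> stalk X x. \<exists>S a. finite S \<and> S \<subseteq> G \<and> (\<forall>g\<in>S. a g \<in> stalk X x) \<and>
     eq_near X x f (\<lambda>y. \<Sum>g\<in>S. a g y * g y)}"

definition generates :: "'a func_space \<Rightarrow> 'a \<Rightarrow> ('a \<Rightarrow> complex) set \<Rightarrow> ('a \<Rightarrow> complex) set \<Rightarrow> bool" where
  "generates X x G I \<longleftrightarrow> G \<subseteq> stalk X x \<and> I = ideal_span X x G"

definition max_ideal :: "'a func_space \<Rightarrow> 'a \<Rightarrow> ('a \<Rightarrow> complex) set" where
  "max_ideal X x = {f \<in> stalk X x. f x = 0}"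

definition ideal_at :: "'a func_space \<Rightarrow> 'a set \<Rightarrow> 'a \<Rightarrow> ('a \<Rightarrow> complex) set" where
  "ideal_at X Z x = {f \<in> stalk X x. \<exists>U. openin (zar X) U \<and> x \<in> U \<and> (\<forall>y\<in>U \<inter> Z. f y = 0)}"

definition local_equation :: "'a func_space \<Rightarrow> 'a set \<Rightarrow> 'a \<Rightarrow> ('a \<Rightarrow> complex) \<Rightarrow> bool" where
  "local_equation X Z x g \<longleftrightarrow> generates X x {g} (ideal_at X Z x)"


section \<open>Local coordinates and normal crossings\<close>

text \<open>
  A regular system of parameters: generators of the maximal ideal that are linearly independent
  modulo its square.
\<close>

definition regular_parameters :: "'a func_space \<Rightarrow> 'a \<Rightarrow> nat \<Rightarrow> (nat \<Rightarrow> 'a \<Rightarrow> complex) \<Rightarrow> bool" where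
  "regular_parameters X x n w \<longleftrightarrow> generates X x (w ` {..<n}) (max_ideal X x) \<and>
     (\<forall>c. (\<lambda>y. \<Sum>i<n. c i * w i y) \<in>
            ideal_span X x {(\<lambda>y. f y * g y) |f g. f \<in> max_ideal X x \<and> g \<in> max_ideal X x} \<longrightarrow>
          (\<forall>i<n. c i = 0))"

definition local_coordinates :: "'a func_space \<Rightarrow> 'a set \<Rightarrow> nat \<Rightarrow> (nat \<Rightarrow> 'a \<Rightarrow> complex) \<Rightarrow> bool" where
  "local_coordinates X U n u \<longleftrightarrow> openin (zar X) U \<and> (\<forall>i<n. u i \<in> reg X U) \<and>
     (\<forall>y\<in>U. regular_parameters X y n (\<lambda>i z. u i z - u i y))"

text \<open>
  Near every point the components through that point are pairwise different coordinate hyperplanes,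
  the ideal sheaf of the component \<open>D k\<close> being generated by the coordinate \<open>u (i k)\<close>. The components
  are thus nonsingular; they are not required to be connected.
\<close>

definition simple_normal_crossings :: "'a func_space \<Rightarrow> 'k set \<Rightarrow> ('k \<Rightarrow> 'a set) \<Rightarrow> bool" where
  "simple_normal_crossings X K D \<longleftrightarrow> (\<forall>k\<in>K. closedin (zar X) (D k)) \<and>
     (\<forall>x\<in>topspace (zar X). \<exists>U n u i. x \<in> U \<and> local_coordinates X U n u \<and>
        inj_on i {k \<in> K. x \<in> D k} \<and>
        (\<forall>k\<in>K. x \<in> D k \<longrightarrow> i k < n \<and> (\<forall>y\<in>U. local_equation X (D k) y (u (i k)))))"

definition normal_crossings_with ::
    "'a func_space \<Rightarrow> 'k set \<Rightarrow> ('k \<Rightarrow> 'a set) \<Rightarrow> 'a set \<Rightarrow> bool" where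
  "normal_crossings_with X K D C \<longleftrightarrow>
     (\<forall>x\<in>C. \<exists>U n u i J. x \<in> U \<and> local_coordinates X U n u \<and>
        inj_on i {k \<in> K. x \<in> D k} \<and>
        (\<forall>k\<in>K. x \<in> D k \<longrightarrow> i k < n \<and> (\<forall>y\<in>U. local_equation X (D k) y (u (i k)))) \<and>
        J \<subseteq> {..<n} \<and> (\<forall>y\<in>U. generates X y (u ` J) (ideal_at X C y)))"


section \<open>Blowing-up\<close>

text \<open>
  Projective \<open>r\<close>-space, with homogeneous coordinates indexed by \<open>0, \<dots>, r\<close>; a point is the set of all
  its coordinate vectors.
\<close>

definition proj_class :: "(nat \<Rightarrow> complex) \<Rightarrow> (nat \<Rightarrow> complex) set" where
  "proj_class \<xi> = {(\<lambda>i. c * \<xi> i) |c. c \<noteq> 0}"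

definition proj_space :: "nat \<Rightarrow> (nat \<Rightarrow> complex) set set" where
  "proj_space r = {proj_class \<xi> |\<xi>. (\<forall>i>r. \<xi> i = 0) \<and> (\<exists>i\<le>r. \<xi> i \<noteq> 0)}"

text \<open>Forms of degree \<open>d\<close> in the homogeneous coordinates, with coefficients regular on \<open>V\<close>.\<close>

inductive form :: "'a func_space \<Rightarrow> 'a set \<Rightarrow> nat \<Rightarrow> nat \<Rightarrow> ('a \<Rightarrow> (nat \<Rightarrow> complex) \<Rightarrow> complex) \<Rightarrow> bool"
  for X :: "'a func_space" and V :: "'a set" and r :: nat where
  coeff: "a \<in> reg X V \<Longrightarrow> form X V r 0 (\<lambda>x \<xi>. a x)"
| coord: "form X V r d F \<Longrightarrow> i \<le> r \<Longrightarrow> form X V r (Suc d) (\<lambda>x \<xi>. \<xi> i * F x \<xi>)"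
| add: "form X V r d F \<Longrightarrow> form X V r d G \<Longrightarrow> form X V r d (\<lambda>x \<xi>. F x \<xi> + G x \<xi>)"

definition nonvanishing ::
    "'a set \<Rightarrow> nat \<Rightarrow> ('a \<Rightarrow> (nat \<Rightarrow> complex) \<Rightarrow> complex) \<Rightarrow> ('a \<times> (nat \<Rightarrow> complex) set) set" where
  "nonvanishing V r F = {(x, l). x \<in> V \<and> l \<in> proj_space r \<and> (\<forall>\<xi>\<in>l. F x \<xi> \<noteq> 0)}"

definition times_proj :: "'a func_space \<Rightarrow> nat \<Rightarrow> ('a \<times> (nat \<Rightarrow> complex) set) func_space" where
  "times_proj X r = \<lparr>
     zar = topology_generated_by
       {nonvanishing V r F |V F. openin (zar X) V \<and> (\<exists>d. form X V r d F)},
     reg = (\<lambda>W. {f. \<forall>p\<in>W. \<exists>V d F G. openin (zar X) V \<and> form X V r d F \<and> form X V r d G \<and>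
       p \<in> nonvanishing V r G \<and>
       (\<forall>(y, l) \<in> W \<inter> nonvanishing V r G. \<forall>\<xi>\<in>l. f (y, l) = F y \<xi> / G y \<xi>)}) \<rparr>"

text \<open>
  The blowing-up of \<open>C\<close>: over an open set \<open>U\<close> on which the ideal sheaf of \<open>C\<close> is generated by
  \<open>g 0, \<dots>, g r\<close> it is the closure in \<open>U \<times> P^r\<close> of the graph of \<open>[g 0 : \<dots> : g r]\<close> on \<open>U - C\<close>.
  Up to a unique isomorphism over \<open>U\<close> this closure depends on the ideal only, so all such \<open>U\<close> and all
  systems of generators may be admitted.
\<close>

definition graph_closure ::
    "'a func_space \<Rightarrow> 'a set \<Rightarrow> nat \<Rightarrow> (nat \<Rightarrow> 'a \<Rightarrow> complex) \<Rightarrow> ('a \<times> (nat \<Rightarrow> complex) set) func_space" where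
  "graph_closure U C r g = induced (times_proj U r)
     (zar (times_proj U r) closure_of
        {(x, proj_class (\<lambda>i. if i \<le> r then g i x else 0)) |x. x \<in> topspace (zar U) - C})"

definition blowing_up ::
    "'a func_space \<Rightarrow> 'a set \<Rightarrow> 'b func_space \<Rightarrow> ('b \<Rightarrow> 'a) \<Rightarrow> bool" where
  "blowing_up M C M' \<sigma> \<longleftrightarrow> variety M' \<and> morphism M' M \<sigma> \<and>
     (\<forall>U r g. openin (zar M) U \<and> (\<forall>i\<le>r. g i \<in> reg M U) \<and>
        (\<forall>x\<in>U. generates M x (g ` {..r}) (ideal_at M C x)) \<longrightarrow>
        (\<exists>\<theta>. isomorphism (induced M' {x \<in> topspace (zar M'). \<sigma> x \<in> U})
                 (graph_closure (induced M U) C r g) \<theta> \<and>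
             (\<forall>x\<in>topspace (zar M'). \<sigma> x \<in> U \<longrightarrow> fst (\<theta> x) = \<sigma> x)))"

definition inverse_image :: "'b func_space \<Rightarrow> ('b \<Rightarrow> 'a) \<Rightarrow> 'a set \<Rightarrow> 'b set" where
  "inverse_image M' \<sigma> Z = {x \<in> topspace (zar M'). \<sigma> x \<in> Z}"

definition strict_transform :: "'b func_space \<Rightarrow> ('b \<Rightarrow> 'a) \<Rightarrow> 'a set \<Rightarrow> 'a set \<Rightarrow> 'b set" where
  "strict_transform M' \<sigma> C Z = zar M' closure_of inverse_image M' \<sigma> (Z - C)"


section \<open>Tangent and normal vectors\<close>

text \<open>
  Tangent vectors are the derivations of the local ring, extended by zero to functions that are not
  regular at the point. Normal vectors are classes of tangent vectors of the ambient space modulo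
  tangent vectors of the subvariety.
\<close>

type_synonym 'a tangent = "('a \<Rightarrow> complex) \<Rightarrow> complex"
type_synonym 'a normal = "'a tangent set"

definition tangent_space :: "'a func_space \<Rightarrow> 'a \<Rightarrow> 'a tangent set" where
  "tangent_space X x = {v.
     (\<forall>f. f \<notin> stalk X x \<longrightarrow> v f = 0) \<and>
     (\<forall>f\<in>stalk X x. \<forall>g\<in>stalk X x. eq_near X x f g \<longrightarrow> v f = v g) \<and>
     (\<forall>c. \<forall>f\<in>stalk X x. v (\<lambda>y. c * f y) = c * v f) \<and>
     (\<forall>f\<in>stalk X x. \<forall>g\<in>stalk X x. v (\<lambda>y. f y + g y) = v f + v g \<and>
        v (\<lambda>y. f y * g y) = f x * v g + g x * v f)}"

definition tangent_sub :: "'a func_space \<Rightarrow> 'a set \<Rightarrow> 'a \<Rightarrow> 'a tangent set" where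
  "tangent_sub X Z x = {v \<in> tangent_space X x. \<forall>f\<in>ideal_at X Z x. v f = 0}"

definition normal_class :: "'a func_space \<Rightarrow> 'a set \<Rightarrow> 'a \<Rightarrow> 'a tangent \<Rightarrow> 'a normal" where
  "normal_class X Z x v = {w \<in> tangent_space X x. (\<lambda>f. w f - v f) \<in> tangent_sub X Z x}"

definition normal_space :: "'a func_space \<Rightarrow> 'a set \<Rightarrow> 'a \<Rightarrow> 'a normal set" where
  "normal_space X Z x = normal_class X Z x ` tangent_space X x"

definition zero_normal :: "'a func_space \<Rightarrow> 'a set \<Rightarrow> 'a \<Rightarrow> 'a normal" where
  "zero_normal X Z x = normal_class X Z x (\<lambda>f. 0)"

definition nonzero_normals :: "'a func_space \<Rightarrow> 'a set \<Rightarrow> 'a \<Rightarrow> 'a normal set" where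
  "nonzero_normals X Z x = normal_space X Z x - {zero_normal X Z x}"

text \<open>
  Derivative along a normal vector of a germ vanishing on the subvariety; it does not depend on the
  representing tangent vector.
\<close>

definition normal_deriv :: "'a normal \<Rightarrow> ('a \<Rightarrow> complex) \<Rightarrow> complex" where
  "normal_deriv \<nu> g = (THE c. \<forall>w\<in>\<nu>. w g = c)"

text \<open>For \<open>C \<subseteq> Z\<close> the projection from the normal space of \<open>C\<close> to that of \<open>Z\<close>.\<close>

definition normal_proj :: "'a func_space \<Rightarrow> 'a set \<Rightarrow> 'a \<Rightarrow> 'a normal \<Rightarrow> 'a normal" where
  "normal_proj X Z x \<nu> = (\<Union>w\<in>\<nu>. normal_class X Z x w)"

definition normal_bundle :: "'a func_space \<Rightarrow> 'a set \<Rightarrow> ('a \<times> 'a normal) set" where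
  "normal_bundle X Z = (SIGMA x:Z. normal_space X Z x)"

definition normal_bundle_nz :: "'a func_space \<Rightarrow> 'a set \<Rightarrow> ('a \<times> 'a normal) set" where
  "normal_bundle_nz X Z = (SIGMA x:Z. nonzero_normals X Z x)"

text \<open>The fibre product over \<open>C\<close> of the punctured normal bundles of the \<open>D q\<close>, \<open>q \<in> Q\<close>.\<close>

definition normal_star ::
    "'a func_space \<Rightarrow> ('k \<Rightarrow> 'a set) \<Rightarrow> 'a set \<Rightarrow> 'k set \<Rightarrow> ('a \<times> ('k \<Rightarrow> 'a normal)) set" where
  "normal_star X D C Q = (SIGMA x:C. \<Pi>\<^sub>E q\<in>Q. nonzero_normals X (D q) x)"


section \<open>Log-spaces\<close>

definition log_stalk :: "'a func_space \<Rightarrow> 'a set \<Rightarrow> 'a \<Rightarrow> ('a \<Rightarrow> complex) set" where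
  "log_stalk X Z x = {g. \<exists>U. openin (zar X) U \<and> x \<in> U \<and> g \<in> reg X U \<and>
     (\<exists>h\<in>reg X (U - Z). \<forall>y\<in>U - Z. g y * h y = 1)}"

text \<open>
  The maps \<open>\<Phi>\<close> are monoid homomorphisms from the germs in \<open>log_stalk\<close> to the nonzero complex numbers.
\<close>

definition alog :: "'a func_space \<Rightarrow> 'a set \<Rightarrow> ('a \<times> (('a \<Rightarrow> complex) \<Rightarrow> complex)) set" where
  "alog X Z = {(x, \<Phi>). x \<in> topspace (zar X) \<and> \<Phi> \<in> extensional (log_stalk X Z x) \<and>
     (\<forall>f\<in>log_stalk X Z x. \<Phi> f \<noteq> 0) \<and>
     (\<forall>f\<in>log_stalk X Z x. \<forall>g\<in>log_stalk X Z x. eq_near X x f g \<longrightarrow> \<Phi> f = \<Phi> g) \<and>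
     \<Phi> (\<lambda>y. 1) = 1 \<and>
     (\<forall>f\<in>log_stalk X Z x. \<forall>g\<in>log_stalk X Z x. \<Phi> (\<lambda>y. f y * g y) = \<Phi> f * \<Phi> g) \<and>
     (\<forall>g\<in>stalk_units X x. \<Phi> g = g x)}"

definition alog_over ::
    "'a func_space \<Rightarrow> 'a set \<Rightarrow> 'a set \<Rightarrow> ('a \<times> (('a \<Rightarrow> complex) \<Rightarrow> complex)) set" where
  "alog_over X Z S = {p \<in> alog X Z. fst p \<in> S}"

definition alog_map :: "'a func_space \<Rightarrow> 'a set \<Rightarrow> ('b \<Rightarrow> 'a) \<Rightarrow>
    'b \<times> (('b \<Rightarrow> complex) \<Rightarrow> complex) \<Rightarrow> 'a \<times> (('a \<Rightarrow> complex) \<Rightarrow> complex)" where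
  "alog_map M Z \<sigma> = (\<lambda>(x, \<Phi>). (\<sigma> x, restrict (\<lambda>g. \<Phi> (g \<circ> \<sigma>)) (log_stalk M Z (\<sigma> x))))"

text \<open>
  For each component \<open>Z\<close> through \<open>x\<close>, the normal vector \<open>\<nu>\<close> along which the derivative of any local
  equation \<open>g\<close> of \<open>Z\<close> is \<open>\<Phi> g\<close>.
\<close>

definition log_normal :: "'a func_space \<Rightarrow> 'a set \<Rightarrow> 'a \<Rightarrow> (('a \<Rightarrow> complex) \<Rightarrow> complex) \<Rightarrow> 'a normal" where
  "log_normal X Z x \<Phi> = (THE \<nu>. \<nu> \<in> nonzero_normals X Z x \<and>
     (\<forall>g. local_equation X Z x g \<longrightarrow> \<Phi> g = normal_deriv \<nu> g))"

definition alog_ident :: "'a func_space \<Rightarrow> 'k set \<Rightarrow> ('k \<Rightarrow> 'a set) \<Rightarrow>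
    'a \<times> (('a \<Rightarrow> complex) \<Rightarrow> complex) \<Rightarrow> 'a \<times> ('k \<Rightarrow> 'a normal)" where
  "alog_ident M K D = (\<lambda>(x, \<Phi>). (x, \<lambda>k\<in>K. log_normal M (D k) x \<Phi>))"


section \<open>Arcs and their lifts\<close>

text \<open>
  A germ at \<open>0\<close> of a holomorphic arc: regular functions near the origin of the arc pull back to
  holomorphic functions.
\<close>

definition holomorphic_arc :: "'a func_space \<Rightarrow> (complex \<Rightarrow> 'a) \<Rightarrow> bool" where
  "holomorphic_arc X \<gamma> \<longleftrightarrow> \<gamma> 0 \<in> topspace (zar X) \<and>
     (\<forall>U f. openin (zar X) U \<and> \<gamma> 0 \<in> U \<and> f \<in> reg X U \<longrightarrow>
        (\<exists>e>0. \<gamma> ` ball 0 e \<subseteq> U \<and> (f \<circ> \<gamma>) holomorphic_on ball 0 e))"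

definition velocity :: "'a func_space \<Rightarrow> (complex \<Rightarrow> 'a) \<Rightarrow> 'a tangent" where
  "velocity X \<gamma> = (\<lambda>f. if f \<in> stalk X (\<gamma> 0) then deriv (f \<circ> \<gamma>) 0 else 0)"

definition arc_lift :: "'a func_space \<Rightarrow> 'b func_space \<Rightarrow> ('b \<Rightarrow> 'a) \<Rightarrow>
    (complex \<Rightarrow> 'a) \<Rightarrow> (complex \<Rightarrow> 'b) \<Rightarrow> bool" where
  "arc_lift M M' \<sigma> \<gamma> \<gamma>' \<longleftrightarrow> holomorphic_arc M \<gamma> \<and> holomorphic_arc M' \<gamma>' \<and>
     (\<exists>e>0. \<forall>t\<in>ball 0 e. \<sigma> (\<gamma>' t) = \<gamma> t)"

text \<open>
  The bijection between the punctured normal bundles of \<open>C\<close> and of the exceptional divisor, which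
  sends the class of the velocity of an arc to the class of the velocity of the lifted arc.
\<close>

definition lift_normal :: "'a func_space \<Rightarrow> 'a set \<Rightarrow> 'b func_space \<Rightarrow> ('b \<Rightarrow> 'a) \<Rightarrow>
    'a \<times> 'a normal \<Rightarrow> 'b \<times> 'b normal" where
  "lift_normal M C M' \<sigma> = (\<lambda>(x, \<nu>). THE p. \<exists>\<gamma> \<gamma>'. arc_lift M M' \<sigma> \<gamma> \<gamma>' \<and>
     \<gamma> 0 = x \<and> normal_class M C x (velocity M \<gamma>) = \<nu> \<and>
     p = (\<gamma>' 0, normal_class M' (inverse_image M' \<sigma> C) (\<gamma>' 0) (velocity M' \<gamma>')))"

definition unlift_normal :: "'a func_space \<Rightarrow> 'a set \<Rightarrow> 'b func_space \<Rightarrow> ('b \<Rightarrow> 'a) \<Rightarrow>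
    'b \<times> 'b normal \<Rightarrow> 'a \<times> 'a normal" where
  "unlift_normal M C M' \<sigma> = inv_into (normal_bundle_nz M C) (lift_normal M C M' \<sigma>)"

text \<open>
  For \<open>x'\<close> in \<open>E \<inter> Z'\<close>, where \<open>E\<close> is the exceptional divisor and \<open>Z'\<close> the strict transform of \<open>Z\<close>,
  the product of a normal vector \<open>\<nu>\<close> of \<open>E\<close> and a normal vector \<open>\<mu>\<close> of \<open>Z'\<close>, as a normal vector of \<open>Z\<close>.
\<close>

definition normal_mult :: "'a func_space \<Rightarrow> 'a set \<Rightarrow> 'b func_space \<Rightarrow> ('b \<Rightarrow> 'a) \<Rightarrow> 'a set \<Rightarrow>
    'b \<Rightarrow> 'b normal \<Rightarrow> 'b normal \<Rightarrow> 'a normal" where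
  "normal_mult M C M' \<sigma> Z x' \<nu> \<mu> = (THE \<kappa>. \<kappa> \<in> normal_space M Z (\<sigma> x') \<and>
     (\<forall>g e h. local_equation M Z (\<sigma> x') g \<and>
        local_equation M' (inverse_image M' \<sigma> C) x' e \<and>
        local_equation M' (strict_transform M' \<sigma> C Z) x' h \<and>
        eq_near M' x' (g \<circ> \<sigma>) (\<lambda>y. e y * h y) \<longrightarrow>
        normal_deriv \<kappa> g = normal_deriv \<nu> e * normal_deriv \<mu> h))"


section \<open>The strata and the maps between them\<close>

definition exc_stratum :: "'k set \<Rightarrow> ('k \<Rightarrow> 'a set) \<Rightarrow> 'a set \<Rightarrow> 'b func_space \<Rightarrow> ('b \<Rightarrow> 'a) \<Rightarrow>
    'k set \<Rightarrow> 'b set" where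
  "exc_stratum K D C M' \<sigma> Q =
     (inverse_image M' \<sigma> C \<inter> (\<Inter>q\<in>Q. strict_transform M' \<sigma> C (D q))) -
     (\<Union>k\<in>K - Q. strict_transform M' \<sigma> C (D k))"

text \<open>
  The index \<open>0\<close> of the exceptional divisor is not made an element of the index set; the normal vector
  of the exceptional divisor is a separate component.
\<close>

definition exc_normal_star :: "'k set \<Rightarrow> ('k \<Rightarrow> 'a set) \<Rightarrow> 'a set \<Rightarrow> 'b func_space \<Rightarrow> ('b \<Rightarrow> 'a) \<Rightarrow>
    'k set \<Rightarrow> ('b \<times> 'b normal \<times> ('k \<Rightarrow> 'b normal)) set" where
  "exc_normal_star K D C M' \<sigma> Q = (SIGMA x':exc_stratum K D C M' \<sigma> Q.
     nonzero_normals M' (inverse_image M' \<sigma> C) x' \<times>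
     (\<Pi>\<^sub>E q\<in>Q. nonzero_normals M' (strict_transform M' \<sigma> C (D q)) x'))"

definition exc_alog_ident :: "('k \<Rightarrow> 'a set) \<Rightarrow> 'a set \<Rightarrow> 'b func_space \<Rightarrow> ('b \<Rightarrow> 'a) \<Rightarrow> 'k set \<Rightarrow>
    'b \<times> (('b \<Rightarrow> complex) \<Rightarrow> complex) \<Rightarrow> 'b \<times> 'b normal \<times> ('k \<Rightarrow> 'b normal)" where
  "exc_alog_ident D C M' \<sigma> Q = (\<lambda>(x', \<Phi>).
     (x', log_normal M' (inverse_image M' \<sigma> C) x' \<Phi>,
      \<lambda>q\<in>Q. log_normal M' (strict_transform M' \<sigma> C (D q)) x' \<Phi>))"

text \<open>The preimage in the normal bundle of \<open>C\<close> of the vectors with nonzero components exactly in \<open>K - Q\<close>.\<close>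

definition normal_part :: "'a func_space \<Rightarrow> 'k set \<Rightarrow> ('k \<Rightarrow> 'a set) \<Rightarrow> 'a set \<Rightarrow> 'k set \<Rightarrow>
    ('a \<times> 'a normal) set" where
  "normal_part M K D C Q = {(x, \<nu>) \<in> normal_bundle M C.
     (\<forall>k\<in>K - Q. normal_proj M (D k) x \<nu> \<noteq> zero_normal M (D k) x) \<and>
     (\<forall>q\<in>Q. normal_proj M (D q) x \<nu> = zero_normal M (D q) x)}"

definition mixed_star :: "'a func_space \<Rightarrow> 'k set \<Rightarrow> ('k \<Rightarrow> 'a set) \<Rightarrow> 'a set \<Rightarrow> 'k set \<Rightarrow>
    (('a \<times> 'a normal) \<times> ('a \<times> ('k \<Rightarrow> 'a normal))) set" where
  "mixed_star M K D C Q =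
     {(v, w). v \<in> normal_part M K D C Q \<and> w \<in> normal_star M D C Q \<and> fst v = fst w}"

definition H_alog :: "'a func_space \<Rightarrow> ('k \<Rightarrow> 'a set) \<Rightarrow> 'a set \<Rightarrow> 'b func_space \<Rightarrow> ('b \<Rightarrow> 'a) \<Rightarrow>
    'k set \<Rightarrow> 'b \<times> 'b normal \<times> ('k \<Rightarrow> 'b normal) \<Rightarrow>
    ('a \<times> 'a normal) \<times> ('a \<times> ('k \<Rightarrow> 'a normal))" where
  "H_alog M D C M' \<sigma> Q = (\<lambda>(x', \<nu>, \<mu>).
     (unlift_normal M C M' \<sigma> (x', \<nu>),
      (\<sigma> x', \<lambda>q\<in>Q. normal_mult M C M' \<sigma> (D q) x' \<nu> (\<mu> q))))"

definition h_alog :: "'a func_space \<Rightarrow> 'k set \<Rightarrow> ('k \<Rightarrow> 'a set) \<Rightarrow> 'k set \<Rightarrow>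
    ('a \<times> 'a normal) \<times> ('a \<times> ('k \<Rightarrow> 'a normal)) \<Rightarrow> 'a \<times> ('k \<Rightarrow> 'a normal)" where
  "h_alog M K D Q = (\<lambda>((x, \<nu>), (y, \<omega>)).
     (x, \<lambda>k\<in>K. if k \<in> Q then \<omega> k else normal_proj M (D k) x \<nu>))"

text \<open>The map on normal vectors that corresponds to \<open>alog_map\<close> under the identifications.\<close>

definition sigma_N_alog :: "'a func_space \<Rightarrow> 'k set \<Rightarrow> ('k \<Rightarrow> 'a set) \<Rightarrow> 'a set \<Rightarrow>
    'b func_space \<Rightarrow> ('b \<Rightarrow> 'a) \<Rightarrow> 'k set \<Rightarrow>
    'b \<times> 'b normal \<times> ('k \<Rightarrow> 'b normal) \<Rightarrow> 'a \<times> ('k \<Rightarrow> 'a normal)" where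
  "sigma_N_alog M K D C M' \<sigma> Q p = alog_ident M K D (alog_map M (\<Union>k\<in>K. D k) \<sigma>
     (inv_into (alog_over M' (inverse_image M' \<sigma> (\<Union>k\<in>K. D k)) (exc_stratum K D C M' \<sigma> Q))
        (exc_alog_ident D C M' \<sigma> Q) p))"

end

theory Submission
  imports Defs "HOL-Complex_Analysis.Complex_Analysis"
begin

text \<open>
  A normal vector is determined by the derivatives along it of generators of the ideal, so all maps
  are computed on generators. Near a point of \<open>C\<close> let \<open>g 0, \<dots>, g r\<close> be the local coordinates that
  generate the ideal of \<open>C\<close>; the equation of each \<open>D k\<close> is one of them, \<open>g (\<kappa> k)\<close>. Since \<open>M\<close> is
  nonsingular, there are holomorphic arcs along which the coordinates are prescribed functions; the
  arcs \<open>g i (\<gamma> t) = \<xi> i * t\<close> show that the whole of \<open>P^r\<close> lies over every point of \<open>C\<close>, and the arcs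
  \<open>g i (\<gamma> t) = a * t * (\<xi> i + b i * t)\<close> lift to arcs with arbitrary transversal velocities.

  In the chart \<open>\<xi> j \<noteq> 0\<close>, with \<open>q i = \<xi> i / \<xi> j\<close> and \<open>e = g j \<circ> \<sigma>\<close>, the exceptional divisor has the
  equation \<open>e\<close>: the numerator of a function vanishing on it is a form that vanishes on \<open>C \<times> P^r\<close>, so its
  coefficients lie in the ideal of \<open>C\<close>. The strict transform of \<open>D k\<close> has the equation \<open>q (\<kappa> k)\<close>: for \<open>f\<close>
  vanishing on it, the equation of \<open>D k\<close> in \<open>M\<close> shows that \<open>q (\<kappa> k)\<close> divides some \<open>e ^ N * f\<close>, and the
  powers of \<open>e\<close> cancel because \<open>q (\<kappa> k)\<close> is no zero divisor on the exceptional divisor.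

  Normal vectors \<open>\<nu>\<close> of \<open>C\<close> and \<open>\<nu>'\<close> of the exceptional divisor then correspond to each other if
  \<open>\<nu> (g i) = q i * \<nu>' e\<close>, and since \<open>g (\<kappa> k) \<circ> \<sigma> = q (\<kappa> k) * e\<close>, the product of \<open>\<nu>'\<close> and \<open>\<mu>\<close> takes the
  value \<open>\<nu>' e * \<mu> (q (\<kappa> k))\<close> on \<open>g (\<kappa> k)\<close>; this makes the bijection explicit. A point \<open>\<Phi>\<close> of the
  log-space with prescribed normal vectors consists of the leading coefficients of functions along an
  arc, and the diagram commutes by \<open>\<Phi> (g (\<kappa> k) \<circ> \<sigma>) = \<Phi> (q (\<kappa> k)) * \<Phi> e\<close>.
\<close>

section \<open>Rings of regular functions\<close>

text \<open>The canonical maps are given by descriptions that carry no information until existence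
  and uniqueness are known: \<open>lift_normal\<close> is a definite description over all arcs with
  a given class, \<open>unlift_normal\<close> and the map inside \<open>sigma_N_alog\<close> are
  inverses on whole bundles. Two obstacles shape the proof. Zariski open sets are too coarse to
  provide arcs, so existence rests on a holomorphic implicit function theorem, applied at once to
  the equations of the variety and to the coordinates. And divisibility in the local rings has to be
  controlled by hand: cofactors are cancelled because the complement of the exceptional divisor is
  dense, and units are recognised by testing on normal vectors that arcs provide. Charts are local
  on \<open>C\<close> while the inverses are global, so injectivity of \<open>lift_normal\<close> on
  the whole punctured bundle is a hypothesis in the chart and is proved by patching charts at the
  end. The choice of \<Phi> hidden in \<open>sigma_N_alog\<close> does no harm, since the normal
  vectors determine \<Phi> on the equations of the components.\<close>

lemma generated_topology_basis:
  assumes inter: "\<And>A B p. A \<in> S \<Longrightarrow> B \<in> S \<Longrightarrow> p \<in> A \<Longrightarrow> p \<in> B \<Longrightarrow> \<exists>C\<in>S. p \<in> C \<and> C \<subseteq> A \<inter> B"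
    and W: "openin (topology_generated_by S) W" and p: "p \<in> W"
  shows "\<exists>A\<in>S. p \<in> A \<and> A \<subseteq> W"
proof -
  have "generate_topology_on S W"
    using W by (simp add: openin_topology_generated_by_iff)
  then show ?thesis
    using p
  proof (induction arbitrary: p)
    case Empty
    then show ?case by simp
  next
    case (Int A B)
    then obtain A' B' where "A' \<in> S" "p \<in> A'" "A' \<subseteq> A" "B' \<in> S" "p \<in> B'" "B' \<subseteq> B"
      by (meson IntD1 IntD2)
    then show ?case
      using inter[of A' B' p] by blast
  next
    case (UN \<K>)
    then show ?case by (meson Sup_upper2 UnionE order_refl order_trans)
  next
    case (Basis A)
    then show ?case by blast
  qed
qed

section \<open>Zariski topology of affine space and induced structures\<close>

lemma openin_zar_basic:
  "f \<in> polyfun n \<Longrightarrow> openin (zar (affine_space n)) {p \<in> affine_points n. f p \<noteq> 0}"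
  unfolding affine_space_def by (auto intro: topology_generated_by_Basis)

text \<open>The product of two polynomials cuts out the intersection of their principal open sets,
  so these form a basis and not only a subbasis.\<close>

lemma zar_affine_space_basis:
  assumes W: "openin (zar (affine_space n)) W" and p: "p \<in> W"
  obtains f where "f \<in> polyfun n" "f p \<noteq> 0" "p \<in> affine_points n"
    "{q \<in> affine_points n. f q \<noteq> 0} \<subseteq> W"
proof -
  have W': "openin (topology_generated_by {{p \<in> affine_points n. f p \<noteq> 0} |f. f \<in> polyfun n}) W"
    using W by (simp add: affine_space_def)
  have "\<exists>A\<in>{{p \<in> affine_points n. f p \<noteq> 0} |f. f \<in> polyfun n}. p \<in> A \<and> A \<subseteq> W"
  proof (rule generated_topology_basis[OF _ W' p])
    fix A B :: "(nat \<Rightarrow> complex) set" and q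
    assume "A \<in> {{p \<in> affine_points n. f p \<noteq> 0} |f. f \<in> polyfun n}"
      "B \<in> {{p \<in> affine_points n. f p \<noteq> 0} |f. f \<in> polyfun n}" and q: "q \<in> A" "q \<in> B"
    then obtain f g where f: "f \<in> polyfun n" "A = {p \<in> affine_points n. f p \<noteq> 0}"
      and g: "g \<in> polyfun n" "B = {p \<in> affine_points n. g p \<noteq> 0}"
      by auto
    have "(\<lambda>p. f p * g p) \<in> polyfun n" using f g polyfun.mult by blast
    then show "\<exists>C\<in>{{p \<in> affine_points n. f p \<noteq> 0} |f. f \<in> polyfun n}. q \<in> C \<and> C \<subseteq> A \<inter> B"
      using q f g by (intro bexI[of _ "{p \<in> affine_points n. f p * g p \<noteq> 0}"] CollectI exI[of _ "\<lambda>p. f p * g p"]) auto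
  qed
  then show ?thesis using that by blast
qed

lemma topspace_zar_affine_space [simp]: "topspace (zar (affine_space n)) = affine_points n"
proof -
  have "affine_points n \<in> {{p \<in> affine_points n. f p \<noteq> 0} |f. f \<in> polyfun n}"
    by (rule CollectI, rule exI[of _ "\<lambda>p. 1"]) (auto intro: polyfun.const)
  then show ?thesis
    by (auto simp: affine_space_def topology_generated_by_topspace)
qed

lemma zar_induced [simp]: "zar (induced X S) = subtopology (zar X) S"
  by (simp add: induced_def)

lemma reg_induced_iff:
  "f \<in> reg (induced X S) W \<longleftrightarrow>
     (\<forall>x\<in>W. \<exists>U g. openin (zar X) U \<and> x \<in> U \<and> g \<in> reg X U \<and> (\<forall>y\<in>U \<inter> W. f y = g y))"
  by (simp add: induced_def)

lemma reg_imp_reg_induced: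
  "f \<in> reg X U \<Longrightarrow> openin (zar X) U \<Longrightarrow> W \<subseteq> U \<Longrightarrow> f \<in> reg (induced X S) W"
  by (auto simp: reg_induced_iff)

lemma function_sheaf_cong:
  "\<lbrakk>function_sheaf X; openin (zar X) U; f \<in> reg X U; \<And>x. x \<in> U \<Longrightarrow> f x = g x\<rbrakk> \<Longrightarrow> g \<in> reg X U"
  unfolding function_sheaf_def by metis

lemma function_sheaf_mono:
  "\<lbrakk>function_sheaf X; openin (zar X) U; openin (zar X) V; V \<subseteq> U; f \<in> reg X U\<rbrakk> \<Longrightarrow> f \<in> reg X V"
  unfolding function_sheaf_def by blast

lemma function_sheaf_glue:
  assumes "function_sheaf X" and U: "openin (zar X) U"
    and loc: "\<And>x. x \<in> U \<Longrightarrow> \<exists>V. openin (zar X) V \<and> x \<in> V \<and> V \<subseteq> U \<and> f \<in> reg X V"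
  shows "f \<in> reg X U"
proof -
  have "\<forall>U f. openin (zar X) U \<and>
        (\<forall>x\<in>U. \<exists>V. openin (zar X) V \<and> x \<in> V \<and> V \<subseteq> U \<and> f \<in> reg X V) \<longrightarrow> f \<in> reg X U"
    using assms(1) unfolding function_sheaf_def by (elim conjE)
  from this[rule_format, OF conjI, OF U] loc show ?thesis by simp
qed

text \<open>An induced section agrees near each point with a regular function of the ambient space;
  over an open set these local functions glue by the sheaf axiom.\<close>

lemma reg_induced_open:
  assumes sh: "function_sheaf X" and U: "openin (zar X) U" and W: "openin (zar X) W"
  shows "reg (induced X U) W = reg X W"
proof (intro equalityI subsetI)
  fix f assume f: "f \<in> reg (induced X U) W"
  show "f \<in> reg X W"
  proof (rule function_sheaf_glue[OF sh W])
    fix x assume x: "x \<in> W"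
    then obtain V g where V: "openin (zar X) V" "x \<in> V" "g \<in> reg X V" "\<forall>y\<in>V \<inter> W. f y = g y"
      using f by (force simp: reg_induced_iff)
    have VW: "openin (zar X) (V \<inter> W)" using V W by blast
    have g: "g \<in> reg X (V \<inter> W)" using function_sheaf_mono[OF sh V(1) VW _ V(3)] by blast
    have "f \<in> reg X (V \<inter> W)"
      by (rule function_sheaf_cong[OF sh VW g]) (use V(4) in auto)
    then show "\<exists>V. openin (zar X) V \<and> x \<in> V \<and> V \<subseteq> W \<and> f \<in> reg X V"
      using VW V(2) x by blast
  qed
next
  fix f assume "f \<in> reg X W"
  then show "f \<in> reg (induced X U) W" using W reg_imp_reg_induced by blast
qed

section \<open>Polynomial functions and affine charts\<close>

lemma polyfun_minus: "f \<in> polyfun n \<Longrightarrow> (\<lambda>p. - f p) \<in> polyfun n"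
  using polyfun.mult[OF polyfun.const[of "-1"], of f] by simp

lemma polyfun_diff: "f \<in> polyfun n \<Longrightarrow> g \<in> polyfun n \<Longrightarrow> (\<lambda>p. f p - g p) \<in> polyfun n"
  using polyfun.add[OF _ polyfun_minus, of f n g] by simp

lemma polyfun_sum:
  "(\<And>i. i \<in> A \<Longrightarrow> f i \<in> polyfun n) \<Longrightarrow> (\<lambda>p. \<Sum>i\<in>A. f i p) \<in> polyfun n"
  by (induction A rule: infinite_finite_induct) (auto intro: polyfun.intros)

lemma reg_affine_space_quotient:
  assumes "a \<in> polyfun n" "b \<in> polyfun n" "\<And>p. p \<in> W \<Longrightarrow> b p \<noteq> 0"
  shows "(\<lambda>p. a p / b p) \<in> reg (affine_space n) W"
  using assms by (auto simp: affine_space_def)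

text \<open>An isomorphism onto a piece of affine space together with a chosen inverse. It serves
  both the affine open sets of \<open>variety\<close> and the pieces of the Jacobian criterion in
  \<open>nonsingular\<close>.\<close>

definition affine_chart ::
  "'a func_space \<Rightarrow> 'a set \<Rightarrow> nat \<Rightarrow> (nat \<Rightarrow> complex) set \<Rightarrow> ('a \<Rightarrow> nat \<Rightarrow> complex) \<Rightarrow>
     ((nat \<Rightarrow> complex) \<Rightarrow> 'a) \<Rightarrow> bool" where
  "affine_chart X U n Z \<phi> \<psi> \<longleftrightarrow> openin (zar X) U \<and> Z \<subseteq> affine_points n \<and>
     morphism (induced X U) (induced (affine_space n) Z) \<phi> \<and>
     morphism (induced (affine_space n) Z) (induced X U) \<psi> \<and>
     (\<forall>x\<in>U. \<psi> (\<phi> x) = x) \<and> (\<forall>z\<in>Z. \<phi> (\<psi> z) = z)"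

lemma zeros_subset: "zeros n F \<subseteq> affine_points n"
  by (auto simp: zeros_def)

lemma topspace_induced_open: "openin (zar X) U \<Longrightarrow> topspace (zar (induced X U)) = U"
  using openin_subset by auto

lemma isomorphism_imp_affine_chart:
  assumes "openin (zar X) U" "isomorphism (induced X U) (induced (affine_space n) (zeros n F)) \<phi>"
  obtains \<psi> where "affine_chart X U n (zeros n F) \<phi> \<psi>"
proof -
  have "topspace (zar (induced (affine_space n) (zeros n F))) = zeros n F"
    using zeros_subset[of n F] by auto
  then show ?thesis
    using assms that zeros_subset[of n F] topspace_induced_open[OF assms(1)]
    unfolding isomorphism_def affine_chart_def by metis
qed

lemma affine_chart_mem:
  assumes "affine_chart X U n Z \<phi> \<psi>"
  shows "x \<in> U \<Longrightarrow> \<phi> x \<in> Z" "z \<in> Z \<Longrightarrow> \<psi> z \<in> U"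
proof -
  have *: "continuous_map (zar (induced X U)) (zar (induced (affine_space n) Z)) \<phi>"
    "continuous_map (zar (induced (affine_space n) Z)) (zar (induced X U)) \<psi>"
    using assms by (auto simp: affine_chart_def morphism_def)
  have "topspace (zar (induced X U)) = U" "topspace (zar (induced (affine_space n) Z)) = Z"
    using assms topspace_induced_open by (auto simp: affine_chart_def)
  then show "x \<in> U \<Longrightarrow> \<phi> x \<in> Z" "z \<in> Z \<Longrightarrow> \<psi> z \<in> U"
    using continuous_map_funspace[OF *(1)] continuous_map_funspace[OF *(2)] by auto
qed

lemma affine_chart_open_nonzero:
  assumes ch: "affine_chart X U n Z \<phi> \<psi>" and b: "b \<in> polyfun n" and W: "openin (zar X) W"
    and WU: "W \<subseteq> U"
  shows "openin (zar X) {y \<in> W. b (\<phi> y) \<noteq> 0}"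
proof -
  have U: "openin (zar X) U" and c: "continuous_map (zar (induced X U)) (zar (induced (affine_space n) Z)) \<phi>"
    using ch by (auto simp: affine_chart_def morphism_def)
  have "openin (zar (induced (affine_space n) Z)) ({p \<in> affine_points n. b p \<noteq> 0} \<inter> Z)"
    using openin_zar_basic[OF b] by (auto simp: openin_subtopology)
  from openin_continuous_map_preimage[OF c this]
  have "openin (zar (induced X U)) {y \<in> U. \<phi> y \<in> {p \<in> affine_points n. b p \<noteq> 0} \<inter> Z}"
    by (simp only: topspace_induced_open[OF U])
  moreover have "{y \<in> U. \<phi> y \<in> {p \<in> affine_points n. b p \<noteq> 0} \<inter> Z} = {y \<in> U. b (\<phi> y) \<noteq> 0}"
    using affine_chart_mem(1)[OF ch] ch by (auto simp: affine_chart_def)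
  ultimately have "openin (zar X) {y \<in> U. b (\<phi> y) \<noteq> 0}"
    using U by (simp add: openin_open_subtopology)
  then have "openin (zar X) (W \<inter> {y \<in> U. b (\<phi> y) \<noteq> 0})" using W by blast
  moreover have "W \<inter> {y \<in> U. b (\<phi> y) \<noteq> 0} = {y \<in> W. b (\<phi> y) \<noteq> 0}" using WU by auto
  ultimately show ?thesis by simp
qed

text \<open>Pulled back along \<open>\<psi>\<close>, a regular function is near the image point the
  restriction of a regular function of affine space, hence a fraction. \<open>V\<close> is shrunk to
  the locus where the denominator does not vanish, so that the fraction is valid on all of
  it.\<close>

lemma affine_chart_germ:
  assumes sh: "function_sheaf X" and ch: "affine_chart X U n Z \<phi> \<psi>" and x: "x \<in> U" "x \<in> W"
    and W: "openin (zar X) W" and f: "f \<in> reg X W"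
  obtains a b V where "a \<in> polyfun n" "b \<in> polyfun n" "openin (zar X) V" "x \<in> V" "V \<subseteq> U \<inter> W"
    "\<forall>y\<in>V. b (\<phi> y) \<noteq> 0 \<and> f y = a (\<phi> y) / b (\<phi> y)"
proof -
  have U: "openin (zar X) U" and ZA: "Z \<subseteq> affine_points n"
    and m: "morphism (induced X U) (induced (affine_space n) Z) \<phi>"
      "morphism (induced (affine_space n) Z) (induced X U) \<psi>"
    and inv: "\<And>x. x \<in> U \<Longrightarrow> \<psi> (\<phi> x) = x" "\<And>z. z \<in> Z \<Longrightarrow> \<phi> (\<psi> z) = z"
    using ch by (auto simp: affine_chart_def)
  have UW: "openin (zar (induced X U)) (U \<inter> W)" using U W by (auto simp: openin_subtopology)
  have "f \<in> reg (induced X U) (U \<inter> W)" using reg_imp_reg_induced[OF f W] by blast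
  then have "f \<circ> \<psi> \<in> reg (induced (affine_space n) Z)
      {z \<in> topspace (zar (induced (affine_space n) Z)). \<psi> z \<in> U \<inter> W}"
    using m(2) UW unfolding morphism_def by blast
  then have "f \<circ> \<psi> \<in> reg (induced (affine_space n) Z) {z \<in> Z. \<psi> z \<in> U \<inter> W}"
    using ZA by (simp add: Int_absorb1)
  moreover have "\<phi> x \<in> {z \<in> Z. \<psi> z \<in> U \<inter> W}" using x inv affine_chart_mem[OF ch] by auto
  ultimately obtain T g where T: "openin (zar (affine_space n)) T" "\<phi> x \<in> T" "g \<in> reg (affine_space n) T"
    and fg: "\<forall>z\<in>T \<inter> {z \<in> Z. \<psi> z \<in> U \<inter> W}. (f \<circ> \<psi>) z = g z"
    unfolding reg_induced_iff by blast
  obtain a b where ab: "a \<in> polyfun n" "b \<in> polyfun n" "b (\<phi> x) \<noteq> 0"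
    "\<forall>y\<in>T. b y \<noteq> 0 \<longrightarrow> g y = a y / b y"
    using T(2,3) by (auto simp: affine_space_def)
  have "openin (zar (induced X U)) {y \<in> topspace (zar (induced X U)). \<phi> y \<in> T \<inter> Z}"
    using m(1) T(1) unfolding morphism_def
    by (intro openin_continuous_map_preimage[where Y = "zar (induced (affine_space n) Z)"])
       (auto simp: openin_subtopology)
  then have "openin (zar (induced X U)) {y \<in> U. \<phi> y \<in> T \<inter> Z}"
    by (simp only: topspace_induced_open[OF U])
  then have "openin (zar X) {y \<in> U. \<phi> y \<in> T \<inter> Z}"
    using U by (simp add: openin_open_subtopology)
  moreover have "{y \<in> U. \<phi> y \<in> T \<inter> Z} = {y \<in> U. \<phi> y \<in> T}"
    using affine_chart_mem[OF ch] by auto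
  ultimately have *: "openin (zar X) ({y \<in> U. \<phi> y \<in> T} \<inter> W)" using W by auto
  define V where "V = {y \<in> {y \<in> U. \<phi> y \<in> T} \<inter> W. b (\<phi> y) \<noteq> 0}"
  have "openin (zar X) V"
    unfolding V_def by (rule affine_chart_open_nonzero[OF ch ab(2) *]) auto
  moreover have "f y = a (\<phi> y) / b (\<phi> y)" if "y \<in> V" for y
  proof -
    have "\<phi> y \<in> T \<inter> {z \<in> Z. \<psi> z \<in> U \<inter> W}"
      using that affine_chart_mem[OF ch] inv by (auto simp: V_def)
    then have "f (\<psi> (\<phi> y)) = g (\<phi> y)" using fg by auto
    then show ?thesis using that ab(4) inv by (auto simp: V_def)
  qed
  ultimately show ?thesis
    using that[OF ab(1,2)] T(2) x ab(3) by (auto simp: V_def)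
qed

text \<open>The passage back from fractions; together with \<open>affine_chart_germ\<close> it makes
  regularity a statement on fractions of polynomials in the chart.\<close>

lemma affine_chart_quotient_reg:
  assumes sh: "function_sheaf X" and ch: "affine_chart X U n Z \<phi> \<psi>" and V: "openin (zar X) V" "V \<subseteq> U"
    and ab: "a \<in> polyfun n" "b \<in> polyfun n" and nz: "\<And>y. y \<in> V \<Longrightarrow> b (\<phi> y) \<noteq> 0"
  shows "(\<lambda>y. a (\<phi> y) / b (\<phi> y)) \<in> reg X V"
proof -
  define T where "T = {p \<in> affine_points n. b p \<noteq> 0}"
  have U: "openin (zar X) U" and m: "morphism (induced X U) (induced (affine_space n) Z) \<phi>"
    and ZA: "Z \<subseteq> affine_points n"
    using ch by (auto simp: affine_chart_def)
  have "(\<lambda>p. a p / b p) \<in> reg (affine_space n) T"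
    using ab by (intro reg_affine_space_quotient) (auto simp: T_def)
  then have "(\<lambda>p. a p / b p) \<in> reg (induced (affine_space n) Z) (T \<inter> Z)"
    using openin_zar_basic[OF ab(2)] by (intro reg_imp_reg_induced[where U = T]) (auto simp: T_def)
  moreover have "openin (zar (induced (affine_space n) Z)) (T \<inter> Z)"
    using openin_zar_basic[OF ab(2)] by (auto simp: T_def openin_subtopology)
  ultimately have "(\<lambda>p. a p / b p) \<circ> \<phi> \<in> reg (induced X U) {x \<in> topspace (zar (induced X U)). \<phi> x \<in> T \<inter> Z}"
    using m unfolding morphism_def by blast
  also have "{x \<in> topspace (zar (induced X U)). \<phi> x \<in> T \<inter> Z} = {x \<in> U. b (\<phi> x) \<noteq> 0}"
    using topspace_induced_open[OF U] affine_chart_mem[OF ch] ZA by (auto simp: T_def)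
  also have "reg (induced X U) \<dots> = reg X \<dots>"
    by (rule reg_induced_open[OF sh U affine_chart_open_nonzero[OF ch ab(2) U]]) auto
  finally have "(\<lambda>p. a p / b p) \<circ> \<phi> \<in> reg X {x \<in> U. b (\<phi> x) \<noteq> 0}" .
  then have "(\<lambda>p. a p / b p) \<circ> \<phi> \<in> reg X V"
    using function_sheaf_mono[OF sh affine_chart_open_nonzero[OF ch ab(2) U] V(1)] V(2) nz by blast
  then show ?thesis by (simp add: o_def)
qed

text \<open>What the local arguments use of a variety, valid for \<open>M\<close> and for the
  blown-up space alike. Once \<open>variety_regular_functions\<close> is available, affine charts
  return only for the construction of arcs.\<close>

locale regular_functions =
  fixes X :: "'a func_space"
  assumes sheaf: "function_sheaf X"
    and reg_const: "openin (zar X) U \<Longrightarrow> (\<lambda>_. c) \<in> reg X U"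
    and reg_add: "openin (zar X) U \<Longrightarrow> f \<in> reg X U \<Longrightarrow> g \<in> reg X U \<Longrightarrow> (\<lambda>x. f x + g x) \<in> reg X U"
    and reg_mult: "openin (zar X) U \<Longrightarrow> f \<in> reg X U \<Longrightarrow> g \<in> reg X U \<Longrightarrow> (\<lambda>x. f x * g x) \<in> reg X U"
    and reg_inverse: "openin (zar X) U \<Longrightarrow> f \<in> reg X U \<Longrightarrow> (\<And>x. x \<in> U \<Longrightarrow> f x \<noteq> 0) \<Longrightarrow>
        (\<lambda>x. inverse (f x)) \<in> reg X U"
    and open_nonzero: "openin (zar X) U \<Longrightarrow> f \<in> reg X U \<Longrightarrow> openin (zar X) {x \<in> U. f x \<noteq> 0}"

lemma variety_chart:
  assumes "variety X" "x \<in> topspace (zar X)"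
  obtains U n F \<phi> \<psi> where "x \<in> U" "affine_chart X U n (zeros n F) \<phi> \<psi>"
proof -
  obtain U where "affine_open X U" "x \<in> U"
    using assms unfolding variety_def by blast
  then show ?thesis
    using that unfolding affine_open_def by (metis isomorphism_imp_affine_chart)
qed

text \<open>Regularity can be tested in affine charts, where regular functions are local fractions:
  each closure property becomes arithmetic of numerators and denominators, and a nonvanishing locus
  is locally that of the numerator.\<close>

lemma variety_regular_functions:
  assumes X: "variety X"
  shows "regular_functions X"
proof
  show sh: "function_sheaf X" using X by (simp add: variety_def)
  have glue: "h \<in> reg X W"
    if W: "openin (zar X) W"
      and *: "\<And>x U n Z \<phi> \<psi>. x \<in> W \<Longrightarrow> x \<in> U \<Longrightarrow> affine_chart X U n Z \<phi> \<psi> \<Longrightarrow>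
            \<exists>a b V. a \<in> polyfun n \<and> b \<in> polyfun n \<and> openin (zar X) V \<and> x \<in> V \<and> V \<subseteq> U \<inter> W \<and>
             (\<forall>y\<in>V. b (\<phi> y) \<noteq> 0 \<and> h y = a (\<phi> y) / b (\<phi> y))" for h W
  proof (rule function_sheaf_glue[OF sh W])
    fix x assume x: "x \<in> W"
    then have "x \<in> topspace (zar X)" using W openin_subset by blast
    then obtain U n F \<phi> \<psi> where xU: "x \<in> U" and ch: "affine_chart X U n (zeros n F) \<phi> \<psi>"
      using variety_chart[OF X] by blast
    obtain a b V where ab: "a \<in> polyfun n" "b \<in> polyfun n" and V: "openin (zar X) V" "x \<in> V" "V \<subseteq> U \<inter> W"
      and q: "\<forall>y\<in>V. b (\<phi> y) \<noteq> 0 \<and> h y = a (\<phi> y) / b (\<phi> y)"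
      using *[OF x xU ch] by blast
    have *: "(\<lambda>y. a (\<phi> y) / b (\<phi> y)) \<in> reg X V"
      by (rule affine_chart_quotient_reg[OF sh ch V(1) _ ab]) (use V q in auto)
    have "h \<in> reg X V" by (rule function_sheaf_cong[OF sh V(1) *]) (use q in auto)
    then show "\<exists>V. openin (zar X) V \<and> x \<in> V \<and> V \<subseteq> W \<and> h \<in> reg X V" using V by blast
  qed
  fix U :: "'a set" assume U: "openin (zar X) U"
  show "(\<lambda>_. c) \<in> reg X U" for c
  proof (rule glue[OF U])
    fix x U' n Z \<phi> \<psi> assume a: "x \<in> U" "x \<in> U'" "affine_chart X U' n Z \<phi> \<psi>"
    then have "openin (zar X) (U' \<inter> U)" using U by (auto simp: affine_chart_def)
    then show "\<exists>a b V. a \<in> polyfun n \<and> b \<in> polyfun n \<and> openin (zar X) V \<and> x \<in> V \<and> V \<subseteq> U' \<inter> U \<and>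
             (\<forall>y\<in>V. b (\<phi> y) \<noteq> 0 \<and> c = a (\<phi> y) / b (\<phi> y))"
      using a by (intro exI[of _ "\<lambda>_. c"] exI[of _ "\<lambda>_. 1"] exI[of _ "U' \<inter> U"]) (auto intro: polyfun.const)
  qed
  fix f assume f: "f \<in> reg X U"
  show "(\<lambda>x. inverse (f x)) \<in> reg X U" if nz: "\<And>x. x \<in> U \<Longrightarrow> f x \<noteq> 0"
  proof (rule glue[OF U])
    fix x U' n Z \<phi> \<psi> assume x: "x \<in> U" "x \<in> U'" "affine_chart X U' n Z \<phi> \<psi>"
    obtain a b V where ab: "a \<in> polyfun n" "b \<in> polyfun n" and V: "openin (zar X) V" "x \<in> V" "V \<subseteq> U' \<inter> U"
      and q: "\<forall>y\<in>V. b (\<phi> y) \<noteq> 0 \<and> f y = a (\<phi> y) / b (\<phi> y)"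
      by (rule affine_chart_germ[OF sh x(3,2,1) U f])
    have "\<forall>y\<in>V. a (\<phi> y) \<noteq> 0 \<and> inverse (f y) = b (\<phi> y) / a (\<phi> y)"
      using q nz V(3) by (metis div_by_0 divide_eq_0_iff inf.boundedE inverse_divide subsetD)
    then show "\<exists>a b V. a \<in> polyfun n \<and> b \<in> polyfun n \<and> openin (zar X) V \<and> x \<in> V \<and> V \<subseteq> U' \<inter> U \<and>
             (\<forall>y\<in>V. b (\<phi> y) \<noteq> 0 \<and> inverse (f y) = a (\<phi> y) / b (\<phi> y))"
      using ab V by blast
  qed
  show "openin (zar X) {x \<in> U. f x \<noteq> 0}"
  proof (subst openin_subopen, intro ballI)
    fix x assume x: "x \<in> {x \<in> U. f x \<noteq> 0}"
    then have xU2: "x \<in> U" by simp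
    then have "x \<in> topspace (zar X)" using U openin_subset by blast
    then obtain U' n F \<phi> \<psi> where xU: "x \<in> U'" and ch: "affine_chart X U' n (zeros n F) \<phi> \<psi>"
      using variety_chart[OF X] by blast
    obtain a b V where ab: "a \<in> polyfun n" "b \<in> polyfun n" and V: "openin (zar X) V" "x \<in> V" "V \<subseteq> U' \<inter> U"
      and q: "\<forall>y\<in>V. b (\<phi> y) \<noteq> 0 \<and> f y = a (\<phi> y) / b (\<phi> y)"
      by (rule affine_chart_germ[OF sh ch xU xU2 U f])
    have "openin (zar X) {y \<in> V. a (\<phi> y) \<noteq> 0}"
      by (rule affine_chart_open_nonzero[OF ch ab(1) V(1)]) (use V in auto)
    moreover have "x \<in> {y \<in> V. a (\<phi> y) \<noteq> 0}" "{y \<in> V. a (\<phi> y) \<noteq> 0} \<subseteq> {x \<in> U. f x \<noteq> 0}"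
      using x V q by auto
    ultimately show "\<exists>T. openin (zar X) T \<and> x \<in> T \<and> T \<subseteq> {x \<in> U. f x \<noteq> 0}" by blast
  qed
  fix g assume g: "g \<in> reg X U"
  \<comment> \<open>Fractions for \<open>f\<close> and \<open>g\<close> on a common neighbourhood,
    as sums and products require.\<close>
  have two: "\<exists>a b c d V. a \<in> polyfun n \<and> b \<in> polyfun n \<and> c \<in> polyfun n \<and> d \<in> polyfun n \<and>
      openin (zar X) V \<and> x \<in> V \<and> V \<subseteq> U' \<inter> U \<and>
      (\<forall>y\<in>V. b (\<phi> y) \<noteq> 0 \<and> d (\<phi> y) \<noteq> 0 \<and> f y = a (\<phi> y) / b (\<phi> y) \<and> g y = c (\<phi> y) / d (\<phi> y))"
    if x: "x \<in> U" "x \<in> U'" "affine_chart X U' n Z \<phi> \<psi>" for x U' n Z \<phi> \<psi>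
  proof -
    obtain a b V where ab: "a \<in> polyfun n" "b \<in> polyfun n" and V: "openin (zar X) V" "x \<in> V" "V \<subseteq> U' \<inter> U"
      and q: "\<forall>y\<in>V. b (\<phi> y) \<noteq> 0 \<and> f y = a (\<phi> y) / b (\<phi> y)"
      by (rule affine_chart_germ[OF sh x(3,2,1) U f])
    obtain c d V' where cd: "c \<in> polyfun n" "d \<in> polyfun n" and V': "openin (zar X) V'" "x \<in> V'" "V' \<subseteq> U' \<inter> U"
      and q': "\<forall>y\<in>V'. d (\<phi> y) \<noteq> 0 \<and> g y = c (\<phi> y) / d (\<phi> y)"
      by (rule affine_chart_germ[OF sh x(3,2,1) U g])
    have *: "openin (zar X) (V \<inter> V')" "x \<in> V \<inter> V'" "V \<inter> V' \<subseteq> U' \<inter> U"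
      "\<forall>y\<in>V \<inter> V'. b (\<phi> y) \<noteq> 0 \<and> d (\<phi> y) \<noteq> 0 \<and> f y = a (\<phi> y) / b (\<phi> y) \<and> g y = c (\<phi> y) / d (\<phi> y)"
      using V V' q q' by blast+
    show ?thesis
      by (rule exI[of _ a], rule exI[of _ b], rule exI[of _ c], rule exI[of _ d],
          rule exI[of _ "V \<inter> V'"]) (use ab cd * in blast)
  qed
  show "(\<lambda>x. f x + g x) \<in> reg X U"
  proof (rule glue[OF U])
    fix x U' n Z \<phi> \<psi> assume "x \<in> U" "x \<in> U'" "affine_chart X U' n Z \<phi> \<psi>"
    then obtain a b c d V where p: "a \<in> polyfun n" "b \<in> polyfun n" "c \<in> polyfun n" "d \<in> polyfun n"
      and V: "openin (zar X) V" "x \<in> V" "V \<subseteq> U' \<inter> U" and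
      q: "\<forall>y\<in>V. b (\<phi> y) \<noteq> 0 \<and> d (\<phi> y) \<noteq> 0 \<and> f y = a (\<phi> y) / b (\<phi> y) \<and> g y = c (\<phi> y) / d (\<phi> y)"
      using two by metis
    show "\<exists>a b V. a \<in> polyfun n \<and> b \<in> polyfun n \<and> openin (zar X) V \<and> x \<in> V \<and> V \<subseteq> U' \<inter> U \<and>
             (\<forall>y\<in>V. b (\<phi> y) \<noteq> 0 \<and> f y + g y = a (\<phi> y) / b (\<phi> y))"
      using p V q by (intro exI[of _ "\<lambda>p. a p * d p + c p * b p"] exI[of _ "\<lambda>p. b p * d p"] exI[of _ V])
        (auto intro!: polyfun.add polyfun.mult simp: add_frac_eq)
  qed
  show "(\<lambda>x. f x * g x) \<in> reg X U"
  proof (rule glue[OF U])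
    fix x U' n Z \<phi> \<psi> assume "x \<in> U" "x \<in> U'" "affine_chart X U' n Z \<phi> \<psi>"
    then obtain a b c d V where p: "a \<in> polyfun n" "b \<in> polyfun n" "c \<in> polyfun n" "d \<in> polyfun n"
      and V: "openin (zar X) V" "x \<in> V" "V \<subseteq> U' \<inter> U" and
      q: "\<forall>y\<in>V. b (\<phi> y) \<noteq> 0 \<and> d (\<phi> y) \<noteq> 0 \<and> f y = a (\<phi> y) / b (\<phi> y) \<and> g y = c (\<phi> y) / d (\<phi> y)"
      using two by metis
    show "\<exists>a b V. a \<in> polyfun n \<and> b \<in> polyfun n \<and> openin (zar X) V \<and> x \<in> V \<and> V \<subseteq> U' \<inter> U \<and>
             (\<forall>y\<in>V. b (\<phi> y) \<noteq> 0 \<and> f y * g y = a (\<phi> y) / b (\<phi> y))"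
      using p V q by (intro exI[of _ "\<lambda>p. a p * c p"] exI[of _ "\<lambda>p. b p * d p"] exI[of _ V])
        (auto intro!: polyfun.mult)
  qed
qed

section \<open>Germs, tangent and normal vectors\<close>

lemma eq_nearI: "openin (zar X) U \<Longrightarrow> x \<in> U \<Longrightarrow> (\<And>y. y \<in> U \<Longrightarrow> f y = g y) \<Longrightarrow> eq_near X x f g"
  unfolding eq_near_def by blast

lemma eq_nearE:
  assumes "eq_near X x f g"
  obtains U where "openin (zar X) U" "x \<in> U" "\<And>y. y \<in> U \<Longrightarrow> f y = g y"
  using assms unfolding eq_near_def by blast

lemma eq_near_point: "eq_near X x f g \<Longrightarrow> f x = g x"
  unfolding eq_near_def by blast

lemma eq_near_refl: "x \<in> topspace (zar X) \<Longrightarrow> eq_near X x f f"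
  unfolding eq_near_def by blast

lemma eq_near_sym: "eq_near X x f g \<Longrightarrow> eq_near X x g f"
  unfolding eq_near_def by metis

lemma eq_near_combine:
  assumes "eq_near X x f f'" "eq_near X x g g'" "\<And>y. f y = f' y \<Longrightarrow> g y = g' y \<Longrightarrow> h y = h' y"
  shows "eq_near X x h h'"
proof -
  obtain U V where "openin (zar X) U" "x \<in> U" "\<And>y. y \<in> U \<Longrightarrow> f y = f' y"
    "openin (zar X) V" "x \<in> V" "\<And>y. y \<in> V \<Longrightarrow> g y = g' y"
    using assms(1,2) by (meson eq_nearE)
  then show ?thesis
    using assms(3) by (intro eq_nearI[of X "U \<inter> V"]) auto
qed

lemma eq_near_mono: "eq_near X x f f' \<Longrightarrow> (\<And>y. f y = f' y \<Longrightarrow> h y = h' y) \<Longrightarrow> eq_near X x h h'"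
  using eq_near_combine[of X x f f' f f' h h'] by blast

lemma eq_near_trans: "eq_near X x f g \<Longrightarrow> eq_near X x g h \<Longrightarrow> eq_near X x f h"
  by (erule (1) eq_near_combine) simp

lemma eq_near_add:
  "eq_near X x f f' \<Longrightarrow> eq_near X x g g' \<Longrightarrow> eq_near X x (\<lambda>y. f y + g y) (\<lambda>y. f' y + g' y)"
  by (erule (1) eq_near_combine) simp

lemma eq_near_mult:
  "eq_near X x f f' \<Longrightarrow> eq_near X x g g' \<Longrightarrow> eq_near X x (\<lambda>y. f y * g y) (\<lambda>y. f' y * g' y)"
  by (erule (1) eq_near_combine) simp

lemma eq_near_sum:
  "x \<in> topspace (zar X) \<Longrightarrow> (\<And>i. i \<in> A \<Longrightarrow> eq_near X x (f i) (g i)) \<Longrightarrow>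
     eq_near X x (\<lambda>y. \<Sum>i\<in>A. f i y) (\<lambda>y. \<Sum>i\<in>A. g i y)"
proof (induction A rule: infinite_finite_induct)
  case (insert a A)
  then show ?case using eq_near_add[of X x "f a" "g a"] by simp
qed (simp_all add: eq_near_refl)

lemma stalkI: "openin (zar X) U \<Longrightarrow> x \<in> U \<Longrightarrow> f \<in> reg X U \<Longrightarrow> f \<in> stalk X x"
  unfolding stalk_def by blast

lemma stalkE:
  assumes "f \<in> stalk X x"
  obtains U where "openin (zar X) U" "x \<in> U" "f \<in> reg X U"
  using assms unfolding stalk_def by blast

lemma stalk_topspace: "f \<in> stalk X x \<Longrightarrow> x \<in> topspace (zar X)"
  unfolding stalk_def using openin_subset by blast

lemma ideal_at_stalk: "f \<in> ideal_at X Z x \<Longrightarrow> f \<in> stalk X x"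
  by (simp add: ideal_at_def)

lemma ideal_at_zero: "f \<in> ideal_at X Z x \<Longrightarrow> x \<in> Z \<Longrightarrow> f x = 0"
  by (auto simp: ideal_at_def)

lemma ideal_at_mono: "Z \<subseteq> Z' \<Longrightarrow> ideal_at X Z' x \<subseteq> ideal_at X Z x"
  unfolding ideal_at_def by blast

lemma ideal_span_finite:
  assumes f: "f \<in> ideal_span X x (w ` A)" and A: "finite A" and one: "(\<lambda>_. 0) \<in> stalk X x"
  obtains a where "\<forall>i\<in>A. a i \<in> stalk X x" "eq_near X x f (\<lambda>y. \<Sum>i\<in>A. a i y * w i y)"
proof -
  obtain S a where S: "finite S" "S \<subseteq> w ` A" "\<forall>g\<in>S. a g \<in> stalk X x"
    "eq_near X x f (\<lambda>y. \<Sum>g\<in>S. a g y * g y)"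
    using f unfolding ideal_span_def by blast
  \<comment> \<open>Different indices may name the same generator. Each generator in
    \<open>S\<close> gets one index in \<open>B\<close>, and the remaining indices get the
    coefficient zero.\<close>
  obtain B where B: "B \<subseteq> A" "inj_on w B" "S = w ` B"
    using S(2) by (auto simp: subset_image_inj)
  have "(\<Sum>g\<in>S. a g y * g y) = (\<Sum>i\<in>A. (if i \<in> B then a (w i) else (\<lambda>_. 0)) y * w i y)" for y
  proof -
    have "(\<Sum>i\<in>A. (if i \<in> B then a (w i) else (\<lambda>_. 0)) y * w i y) = (\<Sum>i\<in>B. a (w i) y * w i y)"
      using A B(1) by (intro sum.mono_neutral_cong_right) auto
    then show ?thesis using B by (simp add: sum.reindex)
  qed
  then have "eq_near X x f (\<lambda>y. \<Sum>i\<in>A. (if i \<in> B then a (w i) else (\<lambda>_. 0)) y * w i y)"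
    using S(4) by (simp only:)
  moreover have "(if i \<in> B then a (w i) else (\<lambda>_. 0)) \<in> stalk X x" for i
    using S(3) B(3) one by simp
  ultimately show ?thesis
    using that[of "\<lambda>i. if i \<in> B then a (w i) else (\<lambda>_. 0)"] by blast
qed

section \<open>Local rings and their ideals\<close>

context regular_functions
begin

lemma stalk_const: "x \<in> topspace (zar X) \<Longrightarrow> (\<lambda>_. c) \<in> stalk X x"
  by (rule stalkI[OF openin_topspace _ reg_const[OF openin_topspace]])

lemma reg_restrict:
  "openin (zar X) U \<Longrightarrow> openin (zar X) V \<Longrightarrow> V \<subseteq> U \<Longrightarrow> f \<in> reg X U \<Longrightarrow> f \<in> reg X V"
  using function_sheaf_mono[OF sheaf] by blast

lemma stalk2:
  assumes "f \<in> stalk X x" "g \<in> stalk X x"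
  obtains U where "openin (zar X) U" "x \<in> U" "f \<in> reg X U" "g \<in> reg X U"
proof -
  obtain U V where *: "openin (zar X) U" "x \<in> U" "f \<in> reg X U" "openin (zar X) V" "x \<in> V" "g \<in> reg X V"
    using assms by (meson stalkE)
  have "openin (zar X) (U \<inter> V)" using * by blast
  then show ?thesis
    by (rule that[of "U \<inter> V", OF _ _ reg_restrict[OF *(1) _ _ *(3)] reg_restrict[OF *(4) _ _ *(6)]])
       (use * in auto)
qed

lemma stalk_add: "f \<in> stalk X x \<Longrightarrow> g \<in> stalk X x \<Longrightarrow> (\<lambda>y. f y + g y) \<in> stalk X x"
  by (erule (1) stalk2, rule stalkI, assumption, assumption, rule reg_add)

lemma stalk_mult: "f \<in> stalk X x \<Longrightarrow> g \<in> stalk X x \<Longrightarrow> (\<lambda>y. f y * g y) \<in> stalk X x"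
  by (erule (1) stalk2, rule stalkI, assumption, assumption, rule reg_mult)

lemma stalk_cmult: "f \<in> stalk X x \<Longrightarrow> (\<lambda>y. c * f y) \<in> stalk X x"
  by (rule stalk_mult[OF stalk_const[OF stalk_topspace]])

lemma stalk_minus: "f \<in> stalk X x \<Longrightarrow> (\<lambda>y. - f y) \<in> stalk X x"
  using stalk_cmult[of f x "-1"] by simp

lemma stalk_diff: "f \<in> stalk X x \<Longrightarrow> g \<in> stalk X x \<Longrightarrow> (\<lambda>y. f y - g y) \<in> stalk X x"
  using stalk_add[OF _ stalk_minus, of f x g] by simp

lemma stalk_power: "f \<in> stalk X x \<Longrightarrow> (\<lambda>y. f y ^ n) \<in> stalk X x"
  by (induction n) (auto intro: stalk_mult stalk_const stalk_topspace)

lemma stalk_sum: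
  "x \<in> topspace (zar X) \<Longrightarrow> (\<And>i. i \<in> A \<Longrightarrow> f i \<in> stalk X x) \<Longrightarrow> (\<lambda>y. \<Sum>i\<in>A. f i y) \<in> stalk X x"
  by (induction A rule: infinite_finite_induct) (auto intro: stalk_add stalk_const)

lemma stalk_nonzero_nbhd:
  assumes "f \<in> stalk X x" "f x \<noteq> 0"
  obtains U where "openin (zar X) U" "x \<in> U" "f \<in> reg X U" "\<And>y. y \<in> U \<Longrightarrow> f y \<noteq> 0"
proof -
  obtain U where U: "openin (zar X) U" "x \<in> U" "f \<in> reg X U" using assms stalkE by metis
  have o: "openin (zar X) {y \<in> U. f y \<noteq> 0}" using open_nonzero U by blast
  have f: "f \<in> reg X {y \<in> U. f y \<noteq> 0}" by (rule reg_restrict[OF U(1) o]) (use U in auto)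
  show ?thesis by (rule that[OF o _ f]) (use U assms in auto)
qed

lemma stalk_inverse: "f \<in> stalk X x \<Longrightarrow> f x \<noteq> 0 \<Longrightarrow> (\<lambda>y. inverse (f y)) \<in> stalk X x"
  by (erule (1) stalk_nonzero_nbhd, rule stalkI, assumption, assumption, rule reg_inverse)

lemma eq_near_nonzero:
  assumes "f \<in> stalk X x" "f x \<noteq> 0" "\<And>y. f y \<noteq> 0 \<Longrightarrow> g y = h y"
  shows "eq_near X x g h"
  using assms by (elim stalk_nonzero_nbhd) (auto intro: eq_nearI)

lemma stalk_eq_near:
  assumes "f \<in> stalk X x" "eq_near X x f g"
  shows "g \<in> stalk X x"
proof -
  obtain U V where *: "openin (zar X) U" "x \<in> U" "f \<in> reg X U"
    "openin (zar X) V" "x \<in> V" "\<And>y. y \<in> V \<Longrightarrow> f y = g y"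
    using assms by (meson stalkE eq_nearE)
  have UV: "openin (zar X) (U \<inter> V)" using * by blast
  have "f \<in> reg X (U \<inter> V)" using reg_restrict[OF *(1) UV] * by blast
  then have g: "g \<in> reg X (U \<inter> V)"
    by (rule function_sheaf_cong[OF sheaf UV]) (use * in auto)
  show ?thesis by (rule stalkI[OF UV _ g]) (use * in auto)
qed

lemma stalk_units_iff: "f \<in> stalk_units X x \<longleftrightarrow> f \<in> stalk X x \<and> f x \<noteq> 0"
proof
  assume "f \<in> stalk_units X x"
  then obtain h where "f \<in> stalk X x" and h: "eq_near X x (\<lambda>y. f y * h y) (\<lambda>y. 1)"
    unfolding stalk_units_def by (elim CollectE conjE bexE)
  moreover have "f x * h x = 1" using eq_near_point[OF h] by simp
  ultimately show "f \<in> stalk X x \<and> f x \<noteq> 0" by auto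
next
  assume f: "f \<in> stalk X x \<and> f x \<noteq> 0"
  have "eq_near X x (\<lambda>y. f y * inverse (f y)) (\<lambda>y. 1)"
    by (rule eq_near_nonzero[of f x]) (use f in auto)
  then show "f \<in> stalk_units X x"
    using f stalk_inverse[of f x] unfolding stalk_units_def
    by (intro CollectI conjI bexI[of _ "\<lambda>y. inverse (f y)"]) simp_all
qed

lemma ideal_span_single:
  assumes "g \<in> stalk X x"
  shows "f \<in> ideal_span X x {g} \<longleftrightarrow> f \<in> stalk X x \<and> (\<exists>a\<in>stalk X x. eq_near X x f (\<lambda>y. a y * g y))"
    (is "?L \<longleftrightarrow> ?R")
proof
  assume L: ?L
  then have f: "f \<in> stalk X x" by (simp add: ideal_span_def)
  have "f \<in> ideal_span X x ((\<lambda>_. g) ` {0::nat})" using L by simp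
  then obtain a where "\<forall>i\<in>{0::nat}. a i \<in> stalk X x" "eq_near X x f (\<lambda>y. \<Sum>i\<in>{0}. a i y * g y)"
    by (rule ideal_span_finite[OF _ _ stalk_const[OF stalk_topspace[OF f]]]) simp_all
  then show ?R using f by auto
next
  assume ?R
  then obtain a where "a \<in> stalk X x" "eq_near X x f (\<lambda>y. a y * g y)" "f \<in> stalk X x" by blast
  then show ?L unfolding ideal_span_def
    by (intro CollectI conjI exI[of _ "{g}"] exI[of _ "\<lambda>_. a"]) auto
qed

lemma ideal_span_base: "g \<in> G \<Longrightarrow> g \<in> stalk X x \<Longrightarrow> g \<in> ideal_span X x G"
  unfolding ideal_span_def
  by (intro CollectI conjI exI[of _ "{g}"] exI[of _ "\<lambda>_ _. 1"])
     (auto intro: stalk_const stalk_topspace eq_near_refl)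

lemma ideal_span_eq_near:
  "f \<in> ideal_span X x G \<Longrightarrow> eq_near X x f g \<Longrightarrow> g \<in> ideal_span X x G"
  unfolding ideal_span_def
proof (elim CollectE conjE exE, intro CollectI conjI exI)
  fix S a assume fg: "f \<in> stalk X x" "eq_near X x f g"
    and S: "eq_near X x f (\<lambda>y. \<Sum>g\<in>S. a g y * g y)"
  show "g \<in> stalk X x" by (rule stalk_eq_near[OF fg])
  show "eq_near X x g (\<lambda>y. \<Sum>g\<in>S. a g y * g y)" by (rule eq_near_trans[OF eq_near_sym[OF fg(2)] S])
qed

lemma ideal_span_add:
  assumes G: "G \<subseteq> stalk X x" and "f \<in> ideal_span X x G" "g \<in> ideal_span X x G"
  shows "(\<lambda>y. f y + g y) \<in> ideal_span X x G"
proof -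
  obtain S a T b where S: "finite S" "S \<subseteq> G" "\<forall>g\<in>S. a g \<in> stalk X x"
    "eq_near X x f (\<lambda>y. \<Sum>g\<in>S. a g y * g y)"
    and T: "finite T" "T \<subseteq> G" "\<forall>g\<in>T. b g \<in> stalk X x" "eq_near X x g (\<lambda>y. \<Sum>g\<in>T. b g y * g y)"
    and fg: "f \<in> stalk X x" "g \<in> stalk X x"
    using assms unfolding ideal_span_def by blast
  have x: "x \<in> topspace (zar X)" by (rule stalk_topspace[OF fg(1)])
  define c where "c = (\<lambda>h y. (if h \<in> S then a h y else 0) + (if h \<in> T then b h y else 0))"
  have c: "c h \<in> stalk X x" if "h \<in> S \<union> T" for h
  proof -
    have "(\<lambda>y. if h \<in> S then a h y else 0) \<in> stalk X x" "(\<lambda>y. if h \<in> T then b h y else 0) \<in> stalk X x"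
      using S(3) T(3) stalk_const[OF x, of 0] by (cases "h \<in> S"; cases "h \<in> T"; simp)+
    then show ?thesis unfolding c_def by (rule stalk_add)
  qed
  have "(\<Sum>h\<in>S. a h y * h y) + (\<Sum>h\<in>T. b h y * h y) = (\<Sum>h\<in>S \<union> T. c h y * h y)" for y
  proof -
    have "(\<Sum>h\<in>S. a h y * h y) = (\<Sum>h\<in>S \<union> T. (if h \<in> S then a h y else 0) * h y)"
      using S(1) T(1) by (intro sum.mono_neutral_cong_left) auto
    moreover have "(\<Sum>h\<in>T. b h y * h y) = (\<Sum>h\<in>S \<union> T. (if h \<in> T then b h y else 0) * h y)"
      using S(1) T(1) by (intro sum.mono_neutral_cong_left) auto
    ultimately show ?thesis by (simp add: c_def sum.distrib distrib_right)
  qed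
  then have "eq_near X x (\<lambda>y. f y + g y) (\<lambda>y. \<Sum>h\<in>S \<union> T. c h y * h y)"
    using eq_near_add[OF S(4) T(4)] by simp
  then show ?thesis
    unfolding ideal_span_def using S T c fg
    by (intro CollectI conjI exI[of _ "S \<union> T"] exI[of _ c]) (auto intro: stalk_add)
qed

lemma ideal_span_mult:
  assumes h: "h \<in> stalk X x" and "f \<in> ideal_span X x G"
  shows "(\<lambda>y. h y * f y) \<in> ideal_span X x G"
proof -
  obtain S a where S: "finite S" "S \<subseteq> G" "\<forall>g\<in>S. a g \<in> stalk X x"
    "eq_near X x f (\<lambda>y. \<Sum>g\<in>S. a g y * g y)" "f \<in> stalk X x"
    using assms unfolding ideal_span_def by blast
  have "eq_near X x (\<lambda>y. h y * f y) (\<lambda>y. \<Sum>g\<in>S. (h y * a g y) * g y)"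
    using S(4) by (rule eq_near_mono) (simp add: sum_distrib_left mult.assoc)
  then show ?thesis
    unfolding ideal_span_def using S h
    by (intro CollectI conjI exI[of _ S] exI[of _ "\<lambda>g y. h y * a g y"]) (auto intro: stalk_mult)
qed

lemma ideal_span_sum:
  assumes "G \<subseteq> stalk X x" "x \<in> topspace (zar X)" "\<And>i. i \<in> A \<Longrightarrow> f i \<in> ideal_span X x G"
  shows "(\<lambda>y. \<Sum>i\<in>A. f i y) \<in> ideal_span X x G"
  using assms(3)
proof (induction A rule: infinite_finite_induct)
  case (insert a A)
  then show ?case using ideal_span_add[OF assms(1), of "f a"] by simp
next
  case empty
  show ?case unfolding ideal_span_def
    by (intro CollectI conjI exI[of _ "{}"]) (auto intro: stalk_const assms eq_near_refl)
next
  case (infinite A)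
  then show ?case unfolding ideal_span_def
    by (intro CollectI conjI exI[of _ "{}"]) (auto intro: stalk_const assms eq_near_refl)
qed

lemma ideal_at_eq_near:
  assumes "f \<in> ideal_at X Z x" "eq_near X x f g"
  shows "g \<in> ideal_at X Z x"
proof -
  obtain U where U: "openin (zar X) U" "x \<in> U" "\<forall>y\<in>U \<inter> Z. f y = 0"
    using assms(1) unfolding ideal_at_def by blast
  obtain V where V: "openin (zar X) V" "x \<in> V" "\<And>y. y \<in> V \<Longrightarrow> f y = g y"
    using assms(2) eq_nearE by metis
  have "openin (zar X) (U \<inter> V)" "\<forall>y\<in>(U \<inter> V) \<inter> Z. g y = 0"
    using U V by (blast, metis IntD1 IntD2 IntI)
  moreover have "g \<in> stalk X x"
    using stalk_eq_near[OF ideal_at_stalk[OF assms(1)] assms(2)] .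
  ultimately show ?thesis using U(2) V(2) unfolding ideal_at_def by blast
qed

lemma ideal_at_mult:
  "f \<in> ideal_at X Z x \<Longrightarrow> a \<in> stalk X x \<Longrightarrow> (\<lambda>y. a y * f y) \<in> ideal_at X Z x"
  unfolding ideal_at_def by (elim CollectE conjE exE, intro CollectI conjI stalk_mult exI) auto

text \<open>Being generated by one germ amounts to divisibility, which is how equations of divisors
  are established and applied in the sequel.\<close>

lemma local_equation_iff:
  "local_equation X Z x g \<longleftrightarrow>
     g \<in> ideal_at X Z x \<and> (\<forall>f\<in>ideal_at X Z x. \<exists>a\<in>stalk X x. eq_near X x f (\<lambda>y. a y * g y))"
  (is "?L \<longleftrightarrow> ?R")
proof
  assume ?L
  then have g: "g \<in> stalk X x" and I: "ideal_at X Z x = ideal_span X x {g}"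
    by (auto simp: local_equation_def generates_def)
  then show ?R using ideal_span_base[of g "{g}" x] ideal_span_single[OF g] by auto
next
  assume R: ?R
  then have g: "g \<in> stalk X x" using ideal_at_stalk[of g X Z x] by simp
  have "ideal_at X Z x = ideal_span X x {g}"
  proof (intro equalityI subsetI)
    fix f assume "f \<in> ideal_at X Z x"
    then show "f \<in> ideal_span X x {g}"
      using R ideal_at_stalk[of f X Z x] by (simp add: ideal_span_single[OF g])
  next
    fix f assume "f \<in> ideal_span X x {g}"
    then obtain a where a: "a \<in> stalk X x" "eq_near X x f (\<lambda>y. a y * g y)"
      by (auto simp: ideal_span_single[OF g])
    show "f \<in> ideal_at X Z x"
      by (rule ideal_at_eq_near[OF ideal_at_mult[OF _ a(1)] eq_near_sym[OF a(2)]]) (use R in simp)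
  qed
  then show ?L using g by (simp add: local_equation_def generates_def)
qed

lemma generates_finiteE:
  assumes "generates X x (g ` A) I" "finite A" "f \<in> I"
  obtains a where "\<forall>i\<in>A. a i \<in> stalk X x" "eq_near X x f (\<lambda>y. \<Sum>i\<in>A. a i y * g i y)"
proof -
  have f: "f \<in> ideal_span X x (g ` A)" using assms by (simp add: generates_def)
  then have "f \<in> stalk X x" by (simp add: ideal_span_def)
  then show ?thesis
    by (rule ideal_span_finite[OF f assms(2) stalk_const[OF stalk_topspace]]) (rule that)
qed

lemma generates_mem: "generates X x G I \<Longrightarrow> g \<in> G \<Longrightarrow> g \<in> I"
  unfolding generates_def by (metis ideal_span_base subsetD)

section \<open>Derivations of the local ring\<close>

context
  fixes x v
  assumes v: "v \<in> tangent_space X x"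
begin

lemma tangent_cong: "f \<in> stalk X x \<Longrightarrow> eq_near X x f g \<Longrightarrow> v f = v g"
  using v stalk_eq_near[of f x g] unfolding tangent_space_def by blast

lemma tangent_scale: "f \<in> stalk X x \<Longrightarrow> v (\<lambda>y. c * f y) = c * v f"
  using v unfolding tangent_space_def by blast

lemma tangent_add: "f \<in> stalk X x \<Longrightarrow> g \<in> stalk X x \<Longrightarrow> v (\<lambda>y. f y + g y) = v f + v g"
  using v unfolding tangent_space_def by blast

lemma tangent_mult: "f \<in> stalk X x \<Longrightarrow> g \<in> stalk X x \<Longrightarrow> v (\<lambda>y. f y * g y) = f x * v g + g x * v f"
  using v unfolding tangent_space_def by blast

lemma tangent_const: "x \<in> topspace (zar X) \<Longrightarrow> v (\<lambda>y. c) = 0"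
proof -
  assume x: "x \<in> topspace (zar X)"
  have "v (\<lambda>y. 1) = v (\<lambda>y. 1) + v (\<lambda>y. 1)"
    using tangent_mult[OF stalk_const stalk_const, OF x x, of 1 1] by simp
  then show ?thesis using tangent_scale[OF stalk_const[OF x], of c 1] by simp
qed

lemma tangent_sum:
  "x \<in> topspace (zar X) \<Longrightarrow> (\<And>i. i \<in> A \<Longrightarrow> f i \<in> stalk X x) \<Longrightarrow> v (\<lambda>y. \<Sum>i\<in>A. f i y) = (\<Sum>i\<in>A. v (f i))"
proof (induction A rule: infinite_finite_induct)
  case (insert a A)
  then show ?case using tangent_add[of "f a" "\<lambda>y. \<Sum>i\<in>A. f i y"] stalk_sum[of x A f] by simp
qed (simp_all add: tangent_const)

text \<open>In the product rule the terms that differentiate a coefficient carry the factor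
  \<open>w i x = 0\<close>, so only the values of the coefficients at \<open>x\<close>
  survive.\<close>

lemma tangent_combination:
  assumes "finite A" "\<And>i. i \<in> A \<Longrightarrow> a i \<in> stalk X x" "\<And>i. i \<in> A \<Longrightarrow> w i \<in> stalk X x"
    "\<And>i. i \<in> A \<Longrightarrow> w i x = 0" "x \<in> topspace (zar X)" "eq_near X x f (\<lambda>y. \<Sum>i\<in>A. a i y * w i y)"
  shows "v f = (\<Sum>i\<in>A. a i x * v (w i))"
proof -
  have s: "(\<lambda>y. a i y * w i y) \<in> stalk X x" if "i \<in> A" for i using assms that stalk_mult by blast
  have "v f = v (\<lambda>y. \<Sum>i\<in>A. a i y * w i y)"
    using tangent_cong[OF stalk_sum[OF assms(5) s] eq_near_sym[OF assms(6)]] by simp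
  also have "\<dots> = (\<Sum>i\<in>A. v (\<lambda>y. a i y * w i y))" by (rule tangent_sum[OF assms(5) s])
  also have "\<dots> = (\<Sum>i\<in>A. a i x * v (w i))"
    using assms by (intro sum.cong) (auto simp: tangent_mult)
  finally show ?thesis .
qed

end

lemma tangent_space_diff:
  assumes "v \<in> tangent_space X x" "w \<in> tangent_space X x"
  shows "(\<lambda>f. v f - w f) \<in> tangent_space X x"
  unfolding tangent_space_def
proof (intro CollectI conjI allI ballI impI)
  fix f assume "f \<notin> stalk X x"
  then show "v f - w f = 0" using assms unfolding tangent_space_def by simp
next
  fix f g assume "f \<in> stalk X x" "g \<in> stalk X x" "eq_near X x f g"
  then show "v f - w f = v g - w g" using assms tangent_cong by metis
next
  fix c f assume "f \<in> stalk X x"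
  then show "v (\<lambda>y. c * f y) - w (\<lambda>y. c * f y) = c * (v f - w f)"
    by (simp add: tangent_scale[OF assms(1)] tangent_scale[OF assms(2)] algebra_simps)
next
  fix f g assume fg: "f \<in> stalk X x" "g \<in> stalk X x"
  then show "v (\<lambda>y. f y + g y) - w (\<lambda>y. f y + g y) = v f - w f + (v g - w g)"
    by (simp add: tangent_add[OF assms(1)] tangent_add[OF assms(2)])
  show "v (\<lambda>y. f y * g y) - w (\<lambda>y. f y * g y) = f x * (v g - w g) + g x * (v f - w f)"
    using fg by (simp add: tangent_mult[OF assms(1)] tangent_mult[OF assms(2)] algebra_simps)
qed

lemma tangent_space_zero: "(\<lambda>f. 0) \<in> tangent_space X x"
  unfolding tangent_space_def by simp

section \<open>Normal vectors as functionals on the ideal\<close>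

lemma normal_class_self: "v \<in> tangent_space X x \<Longrightarrow> v \<in> normal_class X Z x v"
  unfolding normal_class_def tangent_sub_def using tangent_space_zero by simp

lemma normal_class_mem_iff:
  assumes "v \<in> tangent_space X x"
  shows "w \<in> normal_class X Z x v \<longleftrightarrow> w \<in> tangent_space X x \<and> (\<forall>f\<in>ideal_at X Z x. w f = v f)"
  using assms tangent_space_diff unfolding normal_class_def tangent_sub_def by auto

lemma normal_deriv_class:
  assumes "v \<in> tangent_space X x" "f \<in> ideal_at X Z x"
  shows "normal_deriv (normal_class X Z x v) f = v f"
  unfolding normal_deriv_def
proof (rule the_equality)
  show "\<forall>w\<in>normal_class X Z x v. w f = v f"
    using assms by (simp add: normal_class_mem_iff)
  fix c assume "\<forall>w\<in>normal_class X Z x v. w f = c"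
  then show "c = v f" using normal_class_self[OF assms(1), of Z] by simp
qed

lemma normal_spaceE:
  assumes "\<nu> \<in> normal_space X Z x"
  obtains v where "v \<in> tangent_space X x" "\<nu> = normal_class X Z x v"
    "\<And>f. f \<in> ideal_at X Z x \<Longrightarrow> normal_deriv \<nu> f = v f"
  using assms normal_deriv_class unfolding normal_space_def by auto

lemma normal_space_eqI:
  assumes "\<nu> \<in> normal_space X Z x" "\<mu> \<in> normal_space X Z x"
    and "\<And>f. f \<in> ideal_at X Z x \<Longrightarrow> normal_deriv \<nu> f = normal_deriv \<mu> f"
  shows "\<nu> = \<mu>"
proof -
  obtain v w where "v \<in> tangent_space X x" "\<nu> = normal_class X Z x v"
    "w \<in> tangent_space X x" "\<mu> = normal_class X Z x w"
    "\<And>f. f \<in> ideal_at X Z x \<Longrightarrow> v f = w f"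
    using assms by (metis normal_spaceE)
  then show ?thesis by (auto simp: normal_class_mem_iff)
qed

lemma zero_normal_space: "zero_normal X Z x \<in> normal_space X Z x"
  using tangent_space_zero by (auto simp: zero_normal_def normal_space_def)

lemma normal_deriv_zero: "f \<in> ideal_at X Z x \<Longrightarrow> normal_deriv (zero_normal X Z x) f = 0"
  unfolding zero_normal_def using normal_deriv_class[OF tangent_space_zero] .

lemma normal_deriv_combination:
  assumes \<nu>: "\<nu> \<in> normal_space X Z x" and x: "x \<in> Z" "x \<in> topspace (zar X)" and A: "finite A"
    and a: "\<And>i. i \<in> A \<Longrightarrow> a i \<in> stalk X x" and g: "\<And>i. i \<in> A \<Longrightarrow> g i \<in> ideal_at X Z x"
    and f: "f \<in> ideal_at X Z x" "eq_near X x f (\<lambda>y. \<Sum>i\<in>A. a i y * g i y)"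
  shows "normal_deriv \<nu> f = (\<Sum>i\<in>A. a i x * normal_deriv \<nu> (g i))"
proof -
  obtain v where v: "v \<in> tangent_space X x" "\<And>f. f \<in> ideal_at X Z x \<Longrightarrow> normal_deriv \<nu> f = v f"
    using normal_spaceE[OF \<nu>] by metis
  have "v f = (\<Sum>i\<in>A. a i x * v (g i))"
    by (rule tangent_combination[OF v(1) A a _ _ x(2) f(2)])
       (use ideal_at_stalk[OF g] ideal_at_zero[OF g x(1)] in auto)
  then show ?thesis using v(2) f g by simp
qed

lemma normal_deriv_mult:
  assumes "\<nu> \<in> normal_space X Z x" "x \<in> Z" "a \<in> stalk X x" "g \<in> ideal_at X Z x"
    "eq_near X x f (\<lambda>y. a y * g y)"
  shows "normal_deriv \<nu> f = a x * normal_deriv \<nu> g"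
proof -
  have "f \<in> ideal_at X Z x"
    using ideal_at_eq_near[OF ideal_at_mult[OF assms(4,3)] eq_near_sym[OF assms(5)]] .
  then show ?thesis
    using normal_deriv_combination[OF assms(1,2) stalk_topspace[OF assms(3)], of "{0::nat}" "\<lambda>_. a" "\<lambda>_. g" f]
      assms by simp
qed

lemma normal_eq_generators:
  assumes "\<nu> \<in> normal_space X Z x" "\<mu> \<in> normal_space X Z x" "x \<in> Z" "x \<in> topspace (zar X)" "finite A"
    "generates X x (g ` A) (ideal_at X Z x)" "\<And>i. i \<in> A \<Longrightarrow> normal_deriv \<nu> (g i) = normal_deriv \<mu> (g i)"
  shows "\<nu> = \<mu>"
proof (rule normal_space_eqI[OF assms(1,2)])
  fix f assume f: "f \<in> ideal_at X Z x"
  obtain a where a: "\<forall>i\<in>A. a i \<in> stalk X x" "eq_near X x f (\<lambda>y. \<Sum>i\<in>A. a i y * g i y)"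
    by (rule generates_finiteE[OF assms(6,5) f])
  have g: "\<And>i. i \<in> A \<Longrightarrow> g i \<in> ideal_at X Z x" by (rule generates_mem[OF assms(6)]) simp
  show "normal_deriv \<nu> f = normal_deriv \<mu> f"
    using normal_deriv_combination[OF assms(1,3,4,5) _ g f a(2)]
      normal_deriv_combination[OF assms(2,3,4,5) _ g f a(2)] a(1) assms(7) by (simp cong: sum.cong)
qed

lemma normal_eq_local_equation:
  assumes "\<nu> \<in> normal_space X Z x" "\<mu> \<in> normal_space X Z x" "x \<in> Z" "x \<in> topspace (zar X)"
    "local_equation X Z x g" "normal_deriv \<nu> g = normal_deriv \<mu> g"
  shows "\<nu> = \<mu>"
  using normal_eq_generators[OF assms(1-4), of "{0::nat}" "\<lambda>_. g"] assms(5,6)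
  by (simp add: local_equation_def)

lemma nonzero_normals_iff:
  assumes "x \<in> Z" "x \<in> topspace (zar X)" "local_equation X Z x g"
  shows "\<nu> \<in> nonzero_normals X Z x \<longleftrightarrow> \<nu> \<in> normal_space X Z x \<and> normal_deriv \<nu> g \<noteq> 0"
proof -
  have g: "g \<in> ideal_at X Z x" using assms(3) by (simp add: local_equation_iff)
  show ?thesis
    using normal_eq_local_equation[OF _ zero_normal_space assms] normal_deriv_zero[OF g]
    by (auto simp: nonzero_normals_def)
qed

lemma normal_proj_space:
  assumes "\<nu> \<in> normal_space X Z x" "Z \<subseteq> Z'"
  shows "normal_proj X Z' x \<nu> \<in> normal_space X Z' x"
    "f \<in> ideal_at X Z' x \<Longrightarrow> normal_deriv (normal_proj X Z' x \<nu>) f = normal_deriv \<nu> f"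
proof -
  obtain v where v: "v \<in> tangent_space X x" "\<nu> = normal_class X Z x v"
    "\<And>f. f \<in> ideal_at X Z x \<Longrightarrow> normal_deriv \<nu> f = v f"
    using normal_spaceE[OF assms(1)] by metis
  \<comment> \<open>The ideal of the larger set \<open>Z'\<close> lies in that of \<open>Z\<close>,
    so all representatives of \<open>\<nu>\<close> have the same class for \<open>Z'\<close>, and
    the union in \<open>normal_proj\<close> collapses to one class.\<close>
  have eq: "normal_class X Z' x w = normal_class X Z' x v" if "w \<in> \<nu>" for w
    using that v ideal_at_mono[OF assms(2)] by (auto simp: normal_class_mem_iff subset_iff)
  have ne: "\<nu> \<noteq> {}" using normal_class_self[OF v(1), of Z] v(2) by blast
  have "normal_proj X Z' x \<nu> = (\<Union>w\<in>\<nu>. normal_class X Z' x v)"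
    unfolding normal_proj_def by (rule SUP_cong[OF refl eq])
  then have *: "normal_proj X Z' x \<nu> = normal_class X Z' x v" using ne by simp
  then show "normal_proj X Z' x \<nu> \<in> normal_space X Z' x" using v(1) by (simp add: normal_space_def)
  show "f \<in> ideal_at X Z' x \<Longrightarrow> normal_deriv (normal_proj X Z' x \<nu>) f = normal_deriv \<nu> f"
    using v(3)[OF subsetD[OF ideal_at_mono[OF assms(2)]]] normal_deriv_class[OF v(1), of f Z'] by (simp add: *)
qed

section \<open>Holomorphic arcs and their velocities\<close>

lemma holomorphic_arc_stalk:
  assumes "holomorphic_arc X \<gamma>" "f \<in> stalk X (\<gamma> 0)"
  obtains e where "e > 0" "(f \<circ> \<gamma>) holomorphic_on ball 0 e"
  using assms stalkE unfolding holomorphic_arc_def by metis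

lemma holomorphic_arc_near:
  assumes "holomorphic_arc X \<gamma>" "openin (zar X) U" "\<gamma> 0 \<in> U"
  shows "eventually (\<lambda>t. \<gamma> t \<in> U) (nhds 0)"
proof -
  \<comment> \<open>The definition of an arc yields a radius only together with a regular function
    on \<open>U\<close>; the zero function serves.\<close>
  have "(\<lambda>_. 0) \<in> reg X U" by (rule reg_const[OF assms(2)])
  then obtain e where "e > 0" "\<gamma> ` ball 0 e \<subseteq> U"
    using assms unfolding holomorphic_arc_def by blast
  then show ?thesis
    unfolding eventually_nhds_metric by (metis dist_commute image_subset_iff mem_ball)
qed

lemma holomorphic_arc_eq_near:
  assumes "holomorphic_arc X \<gamma>" "eq_near X (\<gamma> 0) f g"
  shows "eventually (\<lambda>t. f (\<gamma> t) = g (\<gamma> t)) (nhds 0)"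
  using assms(2)
proof (rule eq_nearE)
  fix U assume U: "openin (zar X) U" "\<gamma> 0 \<in> U" "\<And>y. y \<in> U \<Longrightarrow> f y = g y"
  show ?thesis by (rule eventually_mono[OF holomorphic_arc_near[OF assms(1) U(1,2)]]) (rule U(3))
qed

lemma holomorphic_arc_deriv:
  assumes "holomorphic_arc X \<gamma>" "f \<in> stalk X (\<gamma> 0)"
  shows "((\<lambda>t. f (\<gamma> t)) has_field_derivative velocity X \<gamma> f) (at 0)"
proof -
  obtain e where "e > 0" "(f \<circ> \<gamma>) holomorphic_on ball 0 e" using holomorphic_arc_stalk[OF assms] .
  then have "(f \<circ> \<gamma>) field_differentiable at 0"
    using holomorphic_on_imp_differentiable_at by (metis centre_in_ball open_ball)
  then have "((f \<circ> \<gamma>) has_field_derivative velocity X \<gamma> f) (at 0)"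
    using assms(2) field_differentiable_derivI unfolding velocity_def by auto
  then show ?thesis by (simp add: o_def)
qed

lemma velocity_eqI:
  assumes "((\<lambda>t. f (\<gamma> t)) has_field_derivative c) (at 0)" "f \<in> stalk X (\<gamma> 0)"
  shows "velocity X \<gamma> f = c"
  using assms(2) DERIV_imp_deriv[OF assms(1)] by (simp add: velocity_def o_def)

lemma velocity_eventuallyI:
  assumes "f \<in> stalk X (\<gamma> 0)" "eventually (\<lambda>t. f (\<gamma> t) = h t) (nhds 0)" "(h has_field_derivative c) (at 0)"
  shows "velocity X \<gamma> f = c"
proof (rule velocity_eqI[where f = f and \<gamma> = \<gamma>, OF _ assms(1)])
  show "((\<lambda>t. f (\<gamma> t)) has_field_derivative c) (at 0)"
    using DERIV_cong_ev[OF refl assms(2) refl] assms(3) by simp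
qed

lemma velocity_tangent:
  assumes \<gamma>: "holomorphic_arc X \<gamma>"
  shows "velocity X \<gamma> \<in> tangent_space X (\<gamma> 0)"
  unfolding tangent_space_def
proof (intro CollectI conjI allI ballI impI)
  fix f assume "f \<notin> stalk X (\<gamma> 0)"
  then show "velocity X \<gamma> f = 0" by (simp add: velocity_def)
next
  fix f g assume *: "f \<in> stalk X (\<gamma> 0)" "g \<in> stalk X (\<gamma> 0)" "eq_near X (\<gamma> 0) f g"
  show "velocity X \<gamma> f = velocity X \<gamma> g"
    by (rule velocity_eventuallyI[where \<gamma> = \<gamma>, OF *(1) holomorphic_arc_eq_near[OF \<gamma> *(3)] holomorphic_arc_deriv[OF \<gamma> *(2)]])
next
  fix c f assume *: "f \<in> stalk X (\<gamma> 0)"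
  show "velocity X \<gamma> (\<lambda>y. c * f y) = c * velocity X \<gamma> f"
    by (rule velocity_eqI[where \<gamma> = \<gamma>, OF DERIV_cmult[OF holomorphic_arc_deriv[OF \<gamma> *]] stalk_cmult[OF *]])
next
  fix f g assume *: "f \<in> stalk X (\<gamma> 0)" "g \<in> stalk X (\<gamma> 0)"
  show "velocity X \<gamma> (\<lambda>y. f y + g y) = velocity X \<gamma> f + velocity X \<gamma> g"
    by (rule velocity_eqI[where \<gamma> = \<gamma>, OF DERIV_add[OF holomorphic_arc_deriv[OF \<gamma> *(1)] holomorphic_arc_deriv[OF \<gamma> *(2)]]
          stalk_add[OF *]])
  show "velocity X \<gamma> (\<lambda>y. f y * g y) = f (\<gamma> 0) * velocity X \<gamma> g + g (\<gamma> 0) * velocity X \<gamma> f"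
    by (rule trans[OF velocity_eqI[where \<gamma> = \<gamma>, OF DERIV_mult[OF holomorphic_arc_deriv[OF \<gamma> *(1)] holomorphic_arc_deriv[OF \<gamma> *(2)]]
          stalk_mult[OF *]]]) (simp add: algebra_simps)
qed

end

section \<open>Holomorphic arcs with prescribed coordinates\<close>

text \<open>A matrix with independent rows has a right inverse. For the Jacobian matrix it supplies
  directions in which each equation can be varied separately to first order, and so reduces a system
  with more unknowns than equations to a square one.\<close>

lemma dual_vectors:
  fixes c :: "nat \<Rightarrow> nat \<Rightarrow> complex"
  assumes "\<And>d. (\<forall>i<N. (\<Sum>l<m. d l * c l i) = 0) \<Longrightarrow> (\<forall>l<m. d l = 0)"
  shows "\<exists>b. \<forall>l<m. \<forall>k<m. (\<Sum>i<N. c l i * b k i) = (if l = k then 1 else 0)"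
  using assms
proof (induction m)
  case (Suc m)
  have "\<forall>l<m. d l = 0" if d: "\<forall>i<N. (\<Sum>l<m. d l * c l i) = 0" for d
  proof -
    have "\<forall>i<N. (\<Sum>l<Suc m. (d(m := 0)) l * c l i) = 0" using d by simp
    from Suc.prems[OF this] show ?thesis by (metis fun_upd_apply less_SucI less_irrefl_nat)
  qed
  then obtain b where b: "\<And>l k. l < m \<Longrightarrow> k < m \<Longrightarrow> (\<Sum>i<N. c l i * b k i) = (if l = k then 1 else 0)"
    using Suc.IH by blast
  define s where "s = (\<lambda>l. \<Sum>i<N. c m i * b l i)"
  have "\<exists>i<N. c m i - (\<Sum>l<m. s l * c l i) \<noteq> 0"
  proof (rule ccontr)
    assume "\<not> ?thesis"
    then have "\<forall>i<N. (\<Sum>l<Suc m. (\<lambda>l. if l = m then 1 else - s l) l * c l i) = 0"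
      by (simp add: sum_negf)
    then show False using Suc.prems[of "\<lambda>l. if l = m then 1 else - s l"] by auto
  qed
  then obtain i0 where i0: "i0 < N" "c m i0 - (\<Sum>l<m. s l * c l i0) \<noteq> 0" by blast
  define r where "r = c m i0 - (\<Sum>l<m. s l * c l i0)"
  \<comment> \<open>The unit vector of index \<open>i0\<close> is projected to the common kernel of
    the first \<open>m\<close> rows along the span of the \<open>b k\<close>, and divided by
    \<open>r\<close> so that the new row takes the value 1 on it.\<close>
  define v where "v = (\<lambda>i. ((if i = i0 then 1 else 0) - (\<Sum>k<m. c k i0 * b k i)) / r)"
  have pair: "(\<Sum>i<N. c l i * v i) = (c l i0 - (\<Sum>k<m. c k i0 * (\<Sum>i<N. c l i * b k i))) / r" for l
  proof -
    have "(\<Sum>i<N. c l i * v i) = (\<Sum>i<N. (c l i * (if i = i0 then 1 else 0) - (\<Sum>k<m. c l i * (c k i0 * b k i))) / r)"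
      by (simp add: v_def sum_distrib_left algebra_simps)
    also have "\<dots> = ((\<Sum>i<N. c l i * (if i = i0 then 1 else 0)) - (\<Sum>i<N. \<Sum>k<m. c l i * (c k i0 * b k i))) / r"
      by (simp only: sum_divide_distrib[symmetric] sum_subtractf)
    also have "(\<Sum>i<N. c l i * (if i = i0 then 1 else 0)) = c l i0"
      using i0(1) by (simp add: if_distrib sum.delta cong: if_cong)
    also have "(\<Sum>i<N. \<Sum>k<m. c l i * (c k i0 * b k i)) = (\<Sum>k<m. c k i0 * (\<Sum>i<N. c l i * b k i))"
      by (subst sum.swap) (simp add: sum_distrib_left mult.left_commute)
    finally show ?thesis .
  qed
  have v0: "(\<Sum>i<N. c l i * v i) = 0" if "l < m" for l
  proof -
    have "(\<Sum>k<m. c k i0 * (\<Sum>i<N. c l i * b k i)) = (\<Sum>k<m. if l = k then c k i0 else 0)"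
      using b[OF that] by (intro sum.cong) auto
    then show ?thesis using that by (simp add: pair)
  qed
  have "(\<Sum>k<m. c k i0 * (\<Sum>i<N. c m i * b k i)) = (\<Sum>l<m. s l * c l i0)"
    by (simp add: s_def mult.commute)
  then have v1: "(\<Sum>i<N. c m i * v i) = 1"
    using i0(2) by (simp add: pair r_def)
  \<comment> \<open>Multiples of \<open>v\<close> correct the old dual vectors on the new row and
    leave their values on the first \<open>m\<close> rows unchanged.\<close>
  define b' where "b' = (\<lambda>k i. if k = m then v i else b k i - s k * v i)"
  have *: "(\<Sum>i<N. c l i * (b k i - s k * v i)) = (\<Sum>i<N. c l i * b k i) - s k * (\<Sum>i<N. c l i * v i)" for l k
    by (simp add: right_diff_distrib sum_subtractf sum_distrib_left mult.left_commute)
  have "(\<Sum>i<N. c l i * b' k i) = (if l = k then 1 else 0)" if "l < Suc m" "k < Suc m" for l k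
  proof (cases "k = m")
    case True
    then show ?thesis using v0[of l] v1 that by (auto simp: b'_def less_Suc_eq)
  next
    case False
    then have "(\<Sum>i<N. c l i * b' k i) = (\<Sum>i<N. c l i * b k i) - s k * (\<Sum>i<N. c l i * v i)"
      by (simp add: b'_def *)
    then show ?thesis using False that b[of l k] v0[of l] v1 by (auto simp: s_def less_Suc_eq)
  qed
  then show ?case by blast
qed auto

section \<open>Partial derivatives and divided differences of polynomials\<close>

lemma polyfun_has_derivative:
  assumes "f \<in> polyfun n"
  shows "((\<lambda>z. f (p(i := z))) has_field_derivative pderiv_at i f p) (at (p i))"
proof -
  have "\<exists>c. ((\<lambda>z. f (p(i := z))) has_field_derivative c) (at (p i))"
    using assms
  proof induction
    case (const c)
    show ?case by (intro exI[of _ 0]) (auto intro!: derivative_eq_intros)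
  next
    case (coord j)
    show ?case
      by (cases "i = j"; intro exI[of _ "if i = j then 1 else 0"]) (auto intro!: derivative_eq_intros)
  next
    case (add f g)
    then show ?case using DERIV_add by blast
  next
    case (mult f g)
    then show ?case using DERIV_mult by blast
  qed
  then show ?thesis unfolding pderiv_at_def by (metis DERIV_imp_deriv)
qed

lemma pderiv_at_const: "pderiv_at i (\<lambda>p. c) p = 0"
  by (simp add: pderiv_at_def)

lemma pderiv_at_coord: "pderiv_at i (\<lambda>p. p j) p = (if i = j then 1 else 0)"
  by (simp add: pderiv_at_def)

lemma pderiv_at_add:
  "f \<in> polyfun n \<Longrightarrow> g \<in> polyfun n \<Longrightarrow>
     pderiv_at i (\<lambda>p. f p + g p) p = pderiv_at i f p + pderiv_at i g p"
  unfolding pderiv_at_def[of i "\<lambda>p. f p + g p"]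
  by (intro DERIV_imp_deriv DERIV_add polyfun_has_derivative)

lemma pderiv_at_mult:
  assumes "f \<in> polyfun n" "g \<in> polyfun n"
  shows "pderiv_at i (\<lambda>p. f p * g p) p = f p * pderiv_at i g p + g p * pderiv_at i f p"
  unfolding pderiv_at_def[of i "\<lambda>p. f p * g p"]
  using DERIV_mult[OF polyfun_has_derivative[OF assms(1), of p i] polyfun_has_derivative[OF assms(2), of p i]]
  by (intro DERIV_imp_deriv) (simp add: algebra_simps)

lemma pderiv_at_sum:
  assumes "\<And>l. l \<in> A \<Longrightarrow> f l \<in> polyfun n"
  shows "pderiv_at i (\<lambda>p. \<Sum>l\<in>A. d l * f l p) p = (\<Sum>l\<in>A. d l * pderiv_at i (f l) p)"
  using assms
proof (induction A rule: infinite_finite_induct)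
  case (insert a A)
  have "(\<lambda>p. d a * f a p) \<in> polyfun n" "(\<lambda>p. \<Sum>l\<in>A. d l * f l p) \<in> polyfun n"
    using insert.prems by (auto intro!: polyfun_sum polyfun.mult polyfun.const)
  then show ?case
    using insert pderiv_at_mult[OF polyfun.const, of "f a" n i "d a" p]
    by (simp add: pderiv_at_add pderiv_at_const)
qed (simp_all add: pderiv_at_const)

lemma polyfun_tendsto:
  assumes "f \<in> polyfun n" "\<And>i. i < n \<Longrightarrow> ((\<lambda>x. z x i) \<longlongrightarrow> P i) G"
  shows "((\<lambda>x. f (z x)) \<longlongrightarrow> f P) G"
  using assms(1) by induction (auto intro: tendsto_intros assms(2))

lemma polyfun_holomorphic:
  assumes "f \<in> polyfun n" "\<And>i. i < n \<Longrightarrow> (\<lambda>t. z t i) holomorphic_on S"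
  shows "(\<lambda>t. f (z t)) holomorphic_on S"
  using assms(1) by induction (auto intro: holomorphic_intros assms(2))

text \<open>An algebraic substitute for the mean value theorem. Since both arguments run along
  families tending to \<open>P\<close>, closeness of the quotients to the partial derivatives at
  \<open>P\<close> is a limit along \<open>G\<close>, from which Lipschitz constants are read off
  later.\<close>

lemma polyfun_divided_differences:
  assumes z: "\<And>i. i < n \<Longrightarrow> ((\<lambda>x. z x i) \<longlongrightarrow> P i) G" and z': "\<And>i. i < n \<Longrightarrow> ((\<lambda>x. z' x i) \<longlongrightarrow> P i) G"
    and "f \<in> polyfun n"
  shows "\<exists>q. (\<forall>u v. f u - f v = (\<Sum>i<n. q i u v * (u i - v i))) \<and>
           (\<forall>i<n. ((\<lambda>x. q i (z x) (z' x)) \<longlongrightarrow> pderiv_at i f P) G)"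
  using assms(3)
proof induction
  case (const c)
  show ?case by (intro exI[of _ "\<lambda>_ _ _. 0"]) (simp add: pderiv_at_const)
next
  case (coord j)
  then have "u j - v j = (\<Sum>i<n. (if i = j then 1 else 0) * (u i - v i))" for u v :: "nat \<Rightarrow> complex"
    by (simp add: if_distrib if_distribR sum.delta cong: if_cong)
  then show ?case by (intro exI[of _ "\<lambda>i _ _. if i = j then 1 else 0"]) (simp add: pderiv_at_coord)
next
  case (add f g)
  then obtain q r where "\<forall>u v. f u - f v = (\<Sum>i<n. q i u v * (u i - v i))"
    "\<forall>u v. g u - g v = (\<Sum>i<n. r i u v * (u i - v i))"
    and t: "\<forall>i<n. ((\<lambda>x. q i (z x) (z' x)) \<longlongrightarrow> pderiv_at i f P) G"
    "\<forall>i<n. ((\<lambda>x. r i (z x) (z' x)) \<longlongrightarrow> pderiv_at i g P) G" by blast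
  then have "f u + g u - (f v + g v) = (\<Sum>i<n. (q i u v + r i u v) * (u i - v i))" for u v
    by (simp add: distrib_right sum.distrib) (metis add_diff_add)
  then show ?case
    using t pderiv_at_add[OF add(1,2)]
    by (intro exI[of _ "\<lambda>i u v. q i u v + r i u v"]) (auto intro!: tendsto_intros)
next
  case (mult f g)
  then obtain q r where "\<forall>u v. f u - f v = (\<Sum>i<n. q i u v * (u i - v i))"
    "\<forall>u v. g u - g v = (\<Sum>i<n. r i u v * (u i - v i))"
    and t: "\<forall>i<n. ((\<lambda>x. q i (z x) (z' x)) \<longlongrightarrow> pderiv_at i f P) G"
    "\<forall>i<n. ((\<lambda>x. r i (z x) (z' x)) \<longlongrightarrow> pderiv_at i g P) G" by blast
  \<comment> \<open>The difference is telescoped through the mixed term \<open>f u * g v\<close>;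
    hence \<open>f\<close> is evaluated along the first family and \<open>g\<close> along the
    second.\<close>
  moreover have "f u * g u - f v * g v = f u * (g u - g v) + g v * (f u - f v)" for u v
    by (simp add: algebra_simps)
  ultimately have "f u * g u - f v * g v = (\<Sum>i<n. (f u * r i u v + g v * q i u v) * (u i - v i))" for u v
    by (simp add: distrib_right sum.distrib sum_distrib_left mult.assoc)
  then show ?case
    using t pderiv_at_mult[OF mult(1,2)] polyfun_tendsto[OF mult(1) z] polyfun_tendsto[OF mult(2) z']
    by (intro exI[of _ "\<lambda>i u v. f u * r i u v + g v * q i u v"]) (auto intro!: tendsto_intros)
qed

text \<open>Banach's fixed point theorem with a holomorphic parameter. The bound
  \<open>\<delta> / 2\<close> at the origin together with the contraction factor 1/2 keeps all
  iterates within \<open>\<delta>\<close>; they converge uniformly in \<open>t\<close>, so the limit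
  is holomorphic by Weierstrass. The last conclusion, that the solution is zero where zero is
  already fixed, later determines the initial point of the arcs.\<close>

lemma holomorphic_fixed_point:
  fixes T :: "nat \<Rightarrow> complex \<Rightarrow> (nat \<Rightarrow> complex) \<Rightarrow> complex"
  assumes \<delta>: "\<delta> > 0"
    and lip: "\<And>t y y' d l. t \<in> ball 0 \<epsilon> \<Longrightarrow> (\<forall>k. cmod (y k) \<le> \<delta>) \<Longrightarrow> (\<forall>k. cmod (y' k) \<le> \<delta>) \<Longrightarrow>
       (\<forall>k<m. cmod (y k - y' k) \<le> d) \<Longrightarrow> l < m \<Longrightarrow> cmod (T l t y - T l t y') \<le> d / 2"
    and zero: "\<And>t l. t \<in> ball 0 \<epsilon> \<Longrightarrow> l < m \<Longrightarrow> cmod (T l t (\<lambda>_. 0)) \<le> \<delta> / 2"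
    and hol: "\<And>Y l. l < m \<Longrightarrow> (\<And>k. (\<lambda>t. Y t k) holomorphic_on ball 0 \<epsilon>) \<Longrightarrow>
       (\<lambda>t. T l t (Y t)) holomorphic_on ball 0 \<epsilon>"
  obtains Y where "\<And>k. (\<lambda>t. Y t k) holomorphic_on ball 0 \<epsilon>"
    "\<And>t l. t \<in> ball 0 \<epsilon> \<Longrightarrow> l < m \<Longrightarrow> T l t (Y t) = Y t l"
    "\<And>t. t \<in> ball 0 \<epsilon> \<Longrightarrow> (\<forall>l<m. T l t (\<lambda>_. 0) = 0) \<Longrightarrow> Y t = (\<lambda>_. 0)"
proof -
  \<comment> \<open>Coordinates from \<open>m\<close> on are kept at zero, so that the bounds and
    the limit hold for every index and not only for the first \<open>m\<close>.\<close>
  define W where "W = rec_nat (\<lambda>_ _. 0) (\<lambda>_ w t l. if l < m then T l t (w t) else 0)"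
  have W0: "W 0 = (\<lambda>_ _. 0)" and WS: "W (Suc n) = (\<lambda>t l. if l < m then T l t (W n t) else 0)" for n
    by (simp_all add: W_def fun_eq_iff)
  have bound: "cmod (W n t k) \<le> \<delta>" if t: "t \<in> ball 0 \<epsilon>" for n t k
  proof (induction n arbitrary: k)
    case 0
    then show ?case using \<delta> by (simp add: W0)
  next
    case (Suc n)
    show ?case
    proof (cases "k < m")
      case True
      have "cmod (T k t (W n t) - T k t (\<lambda>_. 0)) \<le> \<delta> / 2"
        using Suc.IH \<delta> True by (intro lip[OF t]) auto
      moreover have "cmod (T k t (W n t)) \<le> cmod (T k t (W n t) - T k t (\<lambda>_. 0)) + cmod (T k t (\<lambda>_. 0))"
        by (metis diff_add_cancel norm_triangle_ineq)
      ultimately show ?thesis using zero[OF t True] True by (simp add: WS)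
    qed (use \<delta> in \<open>simp add: WS\<close>)
  qed
  have step: "cmod (W (Suc n) t k - W n t k) \<le> \<delta> * (1/2) ^ n" if t: "t \<in> ball 0 \<epsilon>" for n t k
  proof (induction n arbitrary: k)
    case 0
    then show ?case using bound[OF t, of 1 k] by (simp add: W0)
  next
    case (Suc n)
    show ?case
    proof (cases "k < m")
      case True
      have "cmod (T k t (W (Suc n) t) - T k t (W n t)) \<le> (\<delta> * (1/2) ^ n) / 2"
        using Suc.IH bound[OF t] True by (intro lip[OF t]) auto
      then show ?thesis using True by (subst (1 2) WS) simp
    qed (use \<delta> in \<open>simp add: WS\<close>)
  qed
  \<comment> \<open>The limit is written as the telescoping series of differences of iterates, to
    which the Weierstrass test applies with a geometric majorant.\<close>
  define Y where "Y = (\<lambda>t k. \<Sum>n. W (Suc n) t k - W n t k)"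
  have "uniform_limit (ball 0 \<epsilon>) (\<lambda>n t. \<Sum>i<n. W (Suc i) t k - W i t k) (\<lambda>t. Y t k) sequentially" for k
    unfolding Y_def
  proof (rule Weierstrass_m_test)
    show "cmod (W (Suc n) t k - W n t k) \<le> \<delta> * (1/2) ^ n" if "t \<in> ball 0 \<epsilon>" for n t
      using step[OF that] .
    show "summable (\<lambda>n. \<delta> * (1/2) ^ n)" by (intro summable_mult summable_geometric) simp
  qed
  moreover have "(\<Sum>i<n. W (Suc i) t k - W i t k) = W n t k" for n t k
    using sum_lessThan_telescope[of "\<lambda>i. W i t k" n] by (simp add: W0)
  ultimately have lim: "uniform_limit (ball 0 \<epsilon>) (\<lambda>n t. W n t k) (\<lambda>t. Y t k) sequentially" for k
    by (simp only:)
  have Whol: "(\<lambda>t. W n t k) holomorphic_on ball 0 \<epsilon>" for n k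
  proof (induction n arbitrary: k)
    case 0
    then show ?case by (simp add: W0)
  next
    case (Suc n)
    then show ?case using hol[of k "W n"] by (cases "k < m") (simp_all add: WS)
  qed
  have Yhol: "(\<lambda>t. Y t k) holomorphic_on ball 0 \<epsilon>" for k
  proof (rule holomorphic_uniform_sequence[OF open_ball Whol])
    fix t assume "t \<in> ball (0::complex) \<epsilon>"
    then obtain d where "d > 0" "cball t d \<subseteq> ball 0 \<epsilon>" using open_contains_cball open_ball by blast
    then show "\<exists>d>0. cball t d \<subseteq> ball 0 \<epsilon> \<and> uniform_limit (cball t d) (\<lambda>n t. W n t k) (\<lambda>t. Y t k) sequentially"
      using uniform_limit_on_subset[OF lim] by blast
  qed
  have ptlim: "(\<lambda>n. W n t k) \<longlonglongrightarrow> Y t k" if "t \<in> ball 0 \<epsilon>" for t k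
    using tendsto_uniform_limitI[OF lim that] .
  have Ybound: "cmod (Y t k) \<le> \<delta>" if "t \<in> ball 0 \<epsilon>" for t k
    using bound[OF that] by (intro tendsto_upperbound[OF tendsto_norm[OF ptlim[OF that]]]) auto
  have fix_pt: "T l t (Y t) = Y t l" if t: "t \<in> ball 0 \<epsilon>" and l: "l < m" for t l
  proof -
    have "(\<lambda>n. T l t (W n t)) \<longlonglongrightarrow> T l t (Y t)"
    proof (rule LIMSEQ_I)
      fix e :: real assume e: "e > 0"
      \<comment> \<open>The Lipschitz bound compares only the first \<open>m\<close> coordinates, so
        convergence in each of these finitely many coordinates is enough.\<close>
      have "eventually (\<lambda>n. \<forall>k\<in>{..<m}. cmod (W n t k - Y t k) < e) sequentially"
      proof (rule eventually_ball_finite)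
        show "\<forall>k\<in>{..<m}. eventually (\<lambda>n. cmod (W n t k - Y t k) < e) sequentially"
          using tendstoD[OF ptlim[OF t] e] by (simp add: dist_norm)
      qed simp
      then obtain n0 where n0: "\<And>n. n \<ge> n0 \<Longrightarrow> \<forall>k\<in>{..<m}. cmod (W n t k - Y t k) < e"
        unfolding eventually_sequentially by blast
      show "\<exists>n0. \<forall>n\<ge>n0. cmod (T l t (W n t) - T l t (Y t)) < e"
      proof (intro exI[of _ n0] allI impI)
        fix n assume "n \<ge> n0"
        then have "\<forall>k<m. cmod (W n t k - Y t k) \<le> e" using n0 by (simp add: less_imp_le)
        then have "cmod (T l t (W n t) - T l t (Y t)) \<le> e / 2"
          using bound[OF t] Ybound[OF t] by (intro lip[OF t _ _ _ l]) auto
        then show "cmod (T l t (W n t) - T l t (Y t)) < e" using e by linarith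
      qed
    qed
    moreover have "(\<lambda>n. T l t (W n t)) \<longlonglongrightarrow> Y t l"
      using LIMSEQ_Suc[OF ptlim[OF t, of l]] l by (simp add: WS)
    ultimately show ?thesis using LIMSEQ_unique by blast
  qed
  have "Y t = (\<lambda>_. 0)" if t: "t \<in> ball 0 \<epsilon>" and T0: "\<forall>l<m. T l t (\<lambda>_. 0) = 0" for t
  proof -
    have "W n t = (\<lambda>_. 0)" for n
      by (induction n) (use T0 in \<open>auto simp: W0 WS\<close>)
    then have "(\<lambda>n. W n t k) \<longlonglongrightarrow> 0" for k by simp
    then show ?thesis using ptlim[OF t] LIMSEQ_unique by blast
  qed
  then show ?thesis using that Yhol fix_pt by blast
qed

text \<open>An implicit function theorem by a simplified Newton iteration. With a right inverse
  \<open>b\<close> of the Jacobian matrix, subtracting the residual of the equations from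
  \<open>y\<close> gives a map whose derivative in \<open>y\<close> vanishes at the origin, hence a
  contraction nearby. The right-hand sides \<open>p l t * B l\<close> impose the value of a fraction
  without dividing by its denominator.\<close>

lemma holomorphic_solution:
  fixes P :: "nat \<Rightarrow> complex" and A B :: "nat \<Rightarrow> (nat \<Rightarrow> complex) \<Rightarrow> complex"
  assumes A: "\<And>l. l < m \<Longrightarrow> A l \<in> polyfun N" and B: "\<And>l. l < m \<Longrightarrow> B l \<in> polyfun N"
    and p: "\<And>l. l < m \<Longrightarrow> p l holomorphic_on UNIV" and p0: "\<And>l. l < m \<Longrightarrow> p l 0 = 0"
    and AP: "\<And>l. l < m \<Longrightarrow> A l P = 0" and P: "P \<in> affine_points N"
    and indep: "\<And>d. (\<forall>i<N. (\<Sum>l<m. d l * pderiv_at i (A l) P) = 0) \<Longrightarrow> (\<forall>l<m. d l = 0)"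
  obtains \<epsilon> z where "\<epsilon> > 0" "\<And>i. (\<lambda>t. z t i) holomorphic_on ball 0 \<epsilon>" "z 0 = P"
    "\<And>t. z t \<in> affine_points N"
    "\<And>t l. t \<in> ball 0 \<epsilon> \<Longrightarrow> l < m \<Longrightarrow> A l (z t) = p l t * B l (z t)"
proof -
  obtain b where b': "\<forall>l<m. \<forall>k<m. (\<Sum>i<N. pderiv_at i (A l) P * b k i) = (if l = k then 1 else 0)"
    using dual_vectors[where N = N and m = m and c = "\<lambda>l i. pderiv_at i (A l) P", OF indep] by blast
  have b: "(\<Sum>i<N. pderiv_at i (A l) P * b k i) = (if l = k then 1 else 0)" if "l < m" "k < m" for l k
    using b' that by blast
  \<comment> \<open>Solutions are sought only in the sum of \<open>P\<close> and the span of the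
    \<open>b k\<close>; coordinates from \<open>N\<close> on vanish, as \<open>affine_points\<close>
    demands.\<close>
  define Z where "Z = (\<lambda>y i. if i < N then P i + (\<Sum>k<m. y k * b k i) else 0)"
  define T where "T = (\<lambda>l t y. y l - (A l (Z y) - p l t * B l (Z y)))"
  \<comment> \<open>The filter of triples \<open>(t, y, y')\<close> that tend to zero uniformly in
    all coordinates; by \<open>evG\<close> a limit along it is an estimate on a whole small
    polydisc.\<close>
  define G :: "(complex \<times> (nat \<Rightarrow> complex) \<times> (nat \<Rightarrow> complex)) filter" where
    "G = (INF \<delta>\<in>{0<..}. principal {(t, y, y'). cmod t \<le> \<delta> \<and> (\<forall>k. cmod (y k) \<le> \<delta> \<and> cmod (y' k) \<le> \<delta>)})"
  have evG: "eventually R G \<longleftrightarrow> (\<exists>\<delta>>0. \<forall>t y y'. cmod t \<le> \<delta> \<longrightarrow>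
      (\<forall>k. cmod (y k) \<le> \<delta> \<and> cmod (y' k) \<le> \<delta>) \<longrightarrow> R (t, y, y'))" for R
  proof -
    have "eventually R G \<longleftrightarrow> (\<exists>\<delta>\<in>{0<..}. eventually R
      (principal {(t, y, y'). cmod t \<le> \<delta> \<and> (\<forall>k. cmod (y k) \<le> \<delta> \<and> cmod (y' k) \<le> \<delta>)}))"
      unfolding G_def
    proof (rule eventually_INF_base)
      fix a b :: real assume "a \<in> {0<..}" "b \<in> {0<..}"
      then show "\<exists>x\<in>{0<..}.
         principal {(t, y, y'). cmod t \<le> x \<and> (\<forall>k. cmod (y k) \<le> x \<and> cmod (y' k) \<le> x)}
         \<le> inf (principal {(t, y, y'). cmod t \<le> a \<and> (\<forall>k. cmod (y k) \<le> a \<and> cmod (y' k) \<le> a)})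
               (principal {(t, y, y'). cmod t \<le> b \<and> (\<forall>k. cmod (y k) \<le> b \<and> cmod (y' k) \<le> b)})"
        by (intro bexI[of _ "min a b"]) auto
    qed auto
    then show ?thesis by (auto simp: eventually_principal)
  qed
  have t0: "(fst \<longlongrightarrow> 0) G"
    unfolding tendsto_iff evG dist_norm by (metis diff_zero field_lbound_gt_zero fst_conv le_less_trans dense)
  have y0: "((\<lambda>x. fst (snd x) k) \<longlongrightarrow> 0) G" for k
    unfolding tendsto_iff evG dist_norm by simp (meson dense le_less_trans)
  have y'0: "((\<lambda>x. snd (snd x) k) \<longlongrightarrow> 0) G" for k
    unfolding tendsto_iff evG dist_norm by simp (meson dense le_less_trans)
  have Z0: "Z (\<lambda>_. 0) = P" using P by (auto simp: Z_def affine_points_def)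
  have ZP: "((\<lambda>x. Z (fst (snd x)) i) \<longlongrightarrow> P i) G" "((\<lambda>x. Z (snd (snd x)) i) \<longlongrightarrow> P i) G" if "i < N" for i
    using that unfolding Z_def by (auto intro!: tendsto_eq_intros y0 y'0)
  have pt: "((\<lambda>x. p l (fst x)) \<longlongrightarrow> 0) G" if "l < m" for l
  proof -
    have "isCont (p l) 0"
      using holomorphic_on_imp_continuous_on[OF p[OF that]] by (simp add: continuous_on_eq_continuous_at)
    then show ?thesis using isCont_tendsto_compose[OF _ t0] p0[OF that] by metis
  qed
  have "\<exists>q. l < m \<longrightarrow> (\<forall>u v. A l u - A l v = (\<Sum>i<N. q i u v * (u i - v i))) \<and>
           (\<forall>i<N. ((\<lambda>x. q i (Z (fst (snd x))) (Z (snd (snd x)))) \<longlongrightarrow> pderiv_at i (A l) P) G)" for l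
    by (cases "l < m") (use polyfun_divided_differences[OF ZP A[of l]] in simp_all)
  then obtain q where q': "l < m \<longrightarrow> (\<forall>u v. A l u - A l v = (\<Sum>i<N. q l i u v * (u i - v i))) \<and>
           (\<forall>i<N. ((\<lambda>x. q l i (Z (fst (snd x))) (Z (snd (snd x)))) \<longlongrightarrow> pderiv_at i (A l) P) G)" for l
    using choice[of "\<lambda>l q. l < m \<longrightarrow> (\<forall>u v. A l u - A l v = (\<Sum>i<N. q i u v * (u i - v i))) \<and>
           (\<forall>i<N. ((\<lambda>x. q i (Z (fst (snd x))) (Z (snd (snd x)))) \<longlongrightarrow> pderiv_at i (A l) P) G)"] by blast
  have q: "\<And>l u v. l < m \<Longrightarrow> A l u - A l v = (\<Sum>i<N. q l i u v * (u i - v i))"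
    "\<And>l i. l < m \<Longrightarrow> i < N \<Longrightarrow> ((\<lambda>x. q l i (Z (fst (snd x))) (Z (snd (snd x)))) \<longlongrightarrow> pderiv_at i (A l) P) G"
    using q' by blast+
  have "\<exists>q. l < m \<longrightarrow> (\<forall>u v. B l u - B l v = (\<Sum>i<N. q i u v * (u i - v i))) \<and>
           (\<forall>i<N. ((\<lambda>x. q i (Z (fst (snd x))) (Z (snd (snd x)))) \<longlongrightarrow> pderiv_at i (B l) P) G)" for l
    by (cases "l < m") (use polyfun_divided_differences[OF ZP B[of l]] in simp_all)
  then obtain r where q': "l < m \<longrightarrow> (\<forall>u v. B l u - B l v = (\<Sum>i<N. r l i u v * (u i - v i))) \<and>
           (\<forall>i<N. ((\<lambda>x. r l i (Z (fst (snd x))) (Z (snd (snd x)))) \<longlongrightarrow> pderiv_at i (B l) P) G)" for l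
    using choice[of "\<lambda>l q. l < m \<longrightarrow> (\<forall>u v. B l u - B l v = (\<Sum>i<N. q i u v * (u i - v i))) \<and>
           (\<forall>i<N. ((\<lambda>x. q i (Z (fst (snd x))) (Z (snd (snd x)))) \<longlongrightarrow> pderiv_at i (B l) P) G)"] by blast
  have r: "\<And>l u v. l < m \<Longrightarrow> B l u - B l v = (\<Sum>i<N. r l i u v * (u i - v i))"
    "\<And>l i. l < m \<Longrightarrow> i < N \<Longrightarrow> ((\<lambda>x. r l i (Z (fst (snd x))) (Z (snd (snd x)))) \<longlongrightarrow> pderiv_at i (B l) P) G"
    using q' by blast+
  \<comment> \<open>The coefficients of a difference of two values of \<open>T\<close>, expressed by
    divided differences; by the choice of \<open>b\<close> they tend to zero along
    \<open>G\<close>.\<close>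
  define R where "R = (\<lambda>l k x. (if l = k then 1 else 0) -
     (\<Sum>i<N. (q l i (Z (fst (snd x))) (Z (snd (snd x))) - p l (fst x) * r l i (Z (fst (snd x))) (Z (snd (snd x)))) * b k i))"
  have TR: "T l t y - T l t y' = (\<Sum>k<m. R l k (t, y, y') * (y k - y' k))" if l: "l < m" for l t y y'
  proof -
    define s where "s = (\<lambda>i. q l i (Z y) (Z y') - p l t * r l i (Z y) (Z y'))"
    have d: "Z y i - Z y' i = (\<Sum>k<m. b k i * (y k - y' k))" if "i < N" for i
      using that by (simp add: Z_def sum_subtractf[symmetric] algebra_simps)
    have "T l t y - T l t y' = (y l - y' l) - ((A l (Z y) - A l (Z y')) - p l t * (B l (Z y) - B l (Z y')))"
      by (simp add: T_def algebra_simps)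
    also have "(A l (Z y) - A l (Z y')) - p l t * (B l (Z y) - B l (Z y')) = (\<Sum>i<N. s i * (Z y i - Z y' i))"
      by (simp add: q(1)[OF l] r(1)[OF l] s_def sum_distrib_left sum_subtractf[symmetric] algebra_simps)
    also have "\<dots> = (\<Sum>i<N. \<Sum>k<m. s i * (b k i * (y k - y' k)))"
      by (simp add: d sum_distrib_left)
    also have "\<dots> = (\<Sum>k<m. (\<Sum>i<N. s i * b k i) * (y k - y' k))"
      by (subst sum.swap) (simp add: sum_distrib_right mult.assoc)
    also have "y l - y' l = (\<Sum>k<m. (if l = k then 1 else 0) * (y k - y' k))"
    proof -
      have "(\<Sum>k<m. (if l = k then 1 else 0) * (y k - y' k)) = (\<Sum>k<m. if l = k then y k - y' k else 0)"
        by (intro sum.cong) auto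
      then show ?thesis using l by simp
    qed
    finally show ?thesis by (simp add: R_def s_def left_diff_distrib sum_subtractf)
  qed
  have Rlim: "(R l k \<longlongrightarrow> 0) G" if "l < m" "k < m" for l k
  proof -
    have "(R l k \<longlongrightarrow> (if l = k then 1 else 0) - (\<Sum>i<N. (pderiv_at i (A l) P - 0 * pderiv_at i (B l) P) * b k i)) G"
      unfolding R_def using that by (intro tendsto_intros q(2) r(2) pt) auto
    then show ?thesis using b[OF that] by simp
  qed
  \<comment> \<open>With \<open>m\<close> summands this bound gives the contraction factor 1/2; the
    successor avoids a division by zero for \<open>m = 0\<close>.\<close>
  have "eventually (\<lambda>x. \<forall>l\<in>{..<m}. \<forall>k\<in>{..<m}. cmod (R l k x) < 1 / (2 * real (Suc m))) G"
    using tendstoD[OF Rlim, of _ _ "1 / (2 * real (Suc m))"]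
    by (intro eventually_ball_finite ballI) (auto simp: dist_norm)
  then obtain \<delta> where \<delta>: "\<delta> > 0" and R: "\<And>t y y' l k. cmod t \<le> \<delta> \<Longrightarrow>
      (\<And>k. cmod (y k) \<le> \<delta>) \<Longrightarrow> (\<And>k. cmod (y' k) \<le> \<delta>) \<Longrightarrow> l < m \<Longrightarrow> k < m \<Longrightarrow>
      cmod (R l k (t, y, y')) < 1 / (2 * real (Suc m))"
    unfolding evG by auto
  have "eventually (\<lambda>t. \<forall>l\<in>{..<m}. cmod (T l t (\<lambda>_. 0)) < \<delta> / 2) (nhds 0)"
  proof (intro eventually_ball_finite ballI)
    fix l assume "l \<in> {..<m}"
    then have l: "l < m" by simp
    have "isCont (p l) 0"
      using holomorphic_on_imp_continuous_on[OF p[OF l]] by (simp add: continuous_on_eq_continuous_at)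
    then have "isCont (\<lambda>t. p l t * B l P) 0" by (intro continuous_intros)
    then have "((\<lambda>t. p l t * B l P) \<longlongrightarrow> 0) (nhds 0)"
      using tendsto_at_iff_tendsto_nhds[of "\<lambda>t. p l t * B l P" 0] by (simp add: isCont_def p0[OF l])
    then show "eventually (\<lambda>t. cmod (T l t (\<lambda>_. 0)) < \<delta> / 2) (nhds 0)"
      using tendstoD[of "\<lambda>t. p l t * B l P" 0 "nhds 0" "\<delta> / 2"] \<delta> AP[OF l] by (simp add: T_def Z0 dist_norm)
  qed simp
  then obtain \<epsilon>' where \<epsilon>': "\<epsilon>' > 0" "\<And>t l. cmod t < \<epsilon>' \<Longrightarrow> l < m \<Longrightarrow> cmod (T l t (\<lambda>_. 0)) < \<delta> / 2"
    unfolding eventually_nhds_metric by (auto simp: dist_norm)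
  define \<epsilon> where "\<epsilon> = min \<delta> \<epsilon>'"
  have \<epsilon>: "\<epsilon> > 0" using \<delta> \<epsilon>' by (simp add: \<epsilon>_def)
  have Zhol: "(\<lambda>t. Z (Y t) i) holomorphic_on S" if "\<And>k. (\<lambda>t. Y t k) holomorphic_on S" for Y S i
    using that by (cases "i < N") (auto simp: Z_def intro!: holomorphic_intros)
  obtain Y where Y: "\<And>k. (\<lambda>t. Y t k) holomorphic_on ball 0 \<epsilon>"
    "\<And>t l. t \<in> ball 0 \<epsilon> \<Longrightarrow> l < m \<Longrightarrow> T l t (Y t) = Y t l"
    "\<And>t. t \<in> ball 0 \<epsilon> \<Longrightarrow> (\<forall>l<m. T l t (\<lambda>_. 0) = 0) \<Longrightarrow> Y t = (\<lambda>_. 0)"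
  proof (rule holomorphic_fixed_point[OF \<delta>, of \<epsilon> m T])
    fix t y y' d l
    assume t: "t \<in> ball (0::complex) \<epsilon>" and y: "\<forall>k. cmod (y k) \<le> \<delta>" "\<forall>k. cmod (y' k) \<le> \<delta>"
      and d: "\<forall>k<m. cmod (y k - y' k) \<le> d" and l: "l < m"
    have "d \<ge> 0" using d l norm_ge_zero order_trans by blast
    have "cmod (T l t y - T l t y') \<le> (\<Sum>k<m. cmod (R l k (t, y, y') * (y k - y' k)))"
      unfolding TR[OF l] by (rule norm_sum)
    also have "\<dots> \<le> (\<Sum>k<m. 1 / (2 * real (Suc m)) * d)"
    proof (rule sum_mono)
      fix k assume k: "k \<in> {..<m}"
      have "cmod (R l k (t, y, y')) \<le> 1 / (2 * real (Suc m))"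
        using R[of t y y' l k] t y l k by (auto simp: \<epsilon>_def less_imp_le)
      then show "cmod (R l k (t, y, y') * (y k - y' k)) \<le> 1 / (2 * real (Suc m)) * d"
        unfolding norm_mult using d k by (intro mult_mono) auto
    qed
    also have "\<dots> \<le> d / 2" using \<open>d \<ge> 0\<close> by (simp add: field_simps)
    finally show "cmod (T l t y - T l t y') \<le> d / 2" .
  next
    fix t l assume "t \<in> ball (0::complex) \<epsilon>" "l < m"
    then show "cmod (T l t (\<lambda>_. 0)) \<le> \<delta> / 2" using \<epsilon>'(2)[of t l] by (auto simp: \<epsilon>_def)
  next
    fix Y :: "complex \<Rightarrow> nat \<Rightarrow> complex" and l assume l: "l < m" and Y: "\<And>k. (\<lambda>t. Y t k) holomorphic_on ball (0::complex) \<epsilon>"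
    show "(\<lambda>t. T l t (Y t)) holomorphic_on ball 0 \<epsilon>"
      unfolding T_def using Y
      by (intro holomorphic_intros polyfun_holomorphic[OF A[OF l]] polyfun_holomorphic[OF B[OF l]] Zhol
          holomorphic_on_subset[OF p[OF l]]) auto
  qed blast
  show ?thesis
  proof (rule that[OF \<epsilon>, of "\<lambda>t. Z (Y t)"])
    show "(\<lambda>t. Z (Y t) i) holomorphic_on ball 0 \<epsilon>" for i by (rule Zhol) (rule Y(1))
    \<comment> \<open>At \<open>t = 0\<close> the point \<open>P\<close> already solves the system,
      since all \<open>p l\<close> vanish there.\<close>
    have "Y 0 = (\<lambda>_. 0)" using \<epsilon> p0 AP by (intro Y(3)) (auto simp: T_def Z0)
    then show "Z (Y 0) = P" by (simp add: Z0)
    show "Z (Y t) \<in> affine_points N" for t by (simp add: Z_def affine_points_def)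
    show "A l (Z (Y t)) = p l t * B l (Z (Y t))" if "t \<in> ball 0 \<epsilon>" "l < m" for t l
      using Y(2)[OF that] by (simp add: T_def)
  qed
qed


text \<open>In the chart a regular function is a fraction of polynomials in the coordinates of
  \<open>z\<close>, hence holomorphic along the arc. That the arc stays in a given Zariski open set
  near \<open>0\<close> follows by continuity from one polynomial \<open>h\<close> that does not
  vanish at \<open>z 0\<close>.\<close>

lemma holomorphic_arc_chart:
  assumes sh: "function_sheaf X" and ch: "affine_chart X U n Z \<phi> \<psi>" and \<epsilon>: "\<epsilon> > 0"
    and hol: "\<And>i. i < n \<Longrightarrow> (\<lambda>t. z t i) holomorphic_on ball 0 \<epsilon>"
    and z: "\<And>t. t \<in> ball 0 \<epsilon> \<Longrightarrow> z t \<in> Z"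
  shows "holomorphic_arc X (\<lambda>t. \<psi> (z t))"
proof -
  have U: "openin (zar X) U" and ZA: "Z \<subseteq> affine_points n"
    and c: "continuous_map (zar (induced (affine_space n) Z)) (zar (induced X U)) \<psi>"
    and inv: "\<And>z. z \<in> Z \<Longrightarrow> \<phi> (\<psi> z) = z"
    using ch by (auto simp: affine_chart_def morphism_def)
  have z0: "z 0 \<in> Z" using z \<epsilon> by simp
  then have \<psi>0: "\<psi> (z 0) \<in> U" using affine_chart_mem[OF ch] by blast
  have polyhol: "(\<lambda>t. g (z t)) holomorphic_on ball 0 \<epsilon>" if "g \<in> polyfun n" for g
    by (rule polyfun_holomorphic[OF that hol])
  show ?thesis
    unfolding holomorphic_arc_def
  proof (intro conjI allI impI)
    show "\<psi> (z 0) \<in> topspace (zar X)" using \<psi>0 U openin_subset by blast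
    fix W f assume *: "openin (zar X) W \<and> \<psi> (z 0) \<in> W \<and> f \<in> reg X W"
    then have W: "openin (zar X) W" and xW: "\<psi> (z 0) \<in> W" and f: "f \<in> reg X W" by auto
    obtain a b V where ab: "a \<in> polyfun n" "b \<in> polyfun n" and V: "openin (zar X) V" "\<psi> (z 0) \<in> V" "V \<subseteq> U \<inter> W"
      and q: "\<forall>y\<in>V. b (\<phi> y) \<noteq> 0 \<and> f y = a (\<phi> y) / b (\<phi> y)"
      by (rule affine_chart_germ[OF sh ch \<psi>0 xW W f])
    have "openin (zar (induced X U)) V"
      using V U by (simp add: openin_open_subtopology)
    from openin_continuous_map_preimage[OF c this]
    obtain T where T: "openin (zar (affine_space n)) T"
      "{p \<in> topspace (zar (induced (affine_space n) Z)). \<psi> p \<in> V} = T \<inter> Z"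
      by (auto simp: openin_subtopology)
    then have TZ: "T \<inter> Z = {p \<in> Z. \<psi> p \<in> V}" using ZA by auto
    then have "z 0 \<in> T" using z0 V by auto
    then obtain h where h: "h \<in> polyfun n" "h (z 0) \<noteq> 0" "z 0 \<in> affine_points n" "{q \<in> affine_points n. h q \<noteq> 0} \<subseteq> T"
      by (rule zar_affine_space_basis[OF T(1)])
    have "continuous_on (ball 0 \<epsilon>) (\<lambda>t. h (z t))"
      by (rule holomorphic_on_imp_continuous_on[OF polyhol[OF h(1)]])
    then have "isCont (\<lambda>t. h (z t)) 0" using \<epsilon> by (simp add: continuous_on_eq_continuous_at)
    then have "eventually (\<lambda>t. h (z t) \<noteq> 0) (at 0)"
      using h(2) by (simp add: isCont_def tendsto_imp_eventually_ne)
    then obtain d where d: "d > 0" "\<And>t. t \<noteq> 0 \<Longrightarrow> cmod t < d \<Longrightarrow> h (z t) \<noteq> 0"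
      by (auto simp: eventually_at dist_norm)
    define e where "e = min \<epsilon> d"
    have e: "e > 0" "ball 0 e \<subseteq> ball (0::complex) \<epsilon>" using \<epsilon> d by (auto simp: e_def)
    have inV: "\<psi> (z t) \<in> V" if "t \<in> ball 0 e" for t
    proof -
      have "h (z t) \<noteq> 0" using that d(2)[of t] h(2) by (cases "t = 0") (auto simp: e_def)
      moreover have "z t \<in> Z" using that e z by blast
      ultimately show ?thesis using h(4) ZA TZ by blast
    qed
    have val: "f (\<psi> (z t)) = a (z t) / b (z t)" "b (z t) \<noteq> 0" if "t \<in> ball 0 e" for t
    proof -
      have "z t \<in> Z" using that e z by blast
      then have "\<phi> (\<psi> (z t)) = z t" by (rule inv)
      then show "f (\<psi> (z t)) = a (z t) / b (z t)" "b (z t) \<noteq> 0"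
        using bspec[OF q inV[OF that]] by auto
    qed
    have "(\<lambda>t. a (z t) / b (z t)) holomorphic_on ball 0 e"
      by (intro holomorphic_intros holomorphic_on_subset[OF polyhol] ab e) (use val in auto)
    then have "(f \<circ> (\<lambda>t. \<psi> (z t))) holomorphic_on ball 0 e"
      by (rule holomorphic_transform) (use val in auto)
    then show "\<exists>e>0. (\<lambda>t. \<psi> (z t)) ` ball 0 e \<subseteq> W \<and> (f \<circ> (\<lambda>t. \<psi> (z t))) holomorphic_on ball 0 e"
      using e inV V(3) by (intro exI[of _ e]) auto
  qed
qed

lemma sum_lessThan_add: "(\<Sum>l<r + n. h l) = (\<Sum>l<r. h l) + (\<Sum>i<n. h (r + i))"
  for h :: "nat \<Rightarrow> 'a::comm_monoid_add"
  by (induction n) (simp_all add: add_ac)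

section \<open>Arcs through nonsingular points\<close>

context regular_functions
begin

lemma affine_chart_stalk:
  assumes "affine_chart X U n Z \<phi> \<psi>" "x \<in> U" "a \<in> polyfun n"
  shows "(\<lambda>y. a (\<phi> y)) \<in> stalk X x"
proof -
  have U: "openin (zar X) U" using assms by (simp add: affine_chart_def)
  have "(\<lambda>y. a (\<phi> y) / 1) \<in> reg X U"
    by (rule affine_chart_quotient_reg[OF sheaf assms(1) U order_refl assms(3) polyfun.const]) simp
  then show ?thesis using stalkI[OF U assms(2)] by simp
qed

text \<open>Generators of the square of the maximal ideal, written as in
  \<open>regular_parameters\<close> so that its condition applies after unfolding.\<close>

definition square_gens :: "'a \<Rightarrow> ('a \<Rightarrow> complex) set" where
  "square_gens x = {(\<lambda>y. f y * g y) |f g. f \<in> max_ideal X x \<and> g \<in> max_ideal X x}"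

lemma square_gens_stalk: "square_gens x \<subseteq> stalk X x"
  unfolding square_gens_def max_ideal_def using stalk_mult by auto

lemma square_span_mult:
  assumes "f \<in> stalk X x" "g \<in> stalk X x" "f x = 0" "g x = 0"
  shows "(\<lambda>y. f y * g y) \<in> ideal_span X x (square_gens x)"
proof (rule ideal_span_base)
  show "(\<lambda>y. f y * g y) \<in> square_gens x"
    using assms unfolding square_gens_def max_ideal_def
    by (intro CollectI exI[of _ f] exI[of _ g]) simp
  show "(\<lambda>y. f y * g y) \<in> stalk X x" using assms by (simp add: stalk_mult)
qed

lemma square_span_zero: "x \<in> topspace (zar X) \<Longrightarrow> (\<lambda>y. 0) \<in> ideal_span X x (square_gens x)"
  using square_span_mult[OF stalk_const stalk_const, of x 0 0] by simp

text \<open>Links the partial derivatives of the Jacobian criterion with the algebraic condition on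
  regular parameters: the restriction of a polynomial with zero value and zero differential lies in
  the square of the maximal ideal.\<close>

lemma first_order_taylor:
  assumes ch: "affine_chart X U n Z \<phi> \<psi>" and x: "x \<in> U" and "f \<in> polyfun n"
  shows "(\<lambda>y. f (\<phi> y) - f (\<phi> x) - (\<Sum>i<n. pderiv_at i f (\<phi> x) * (\<phi> y i - \<phi> x i)))
           \<in> ideal_span X x (square_gens x)"
  using assms(3)
proof induction
  have xt: "x \<in> topspace (zar X)"
    using ch x openin_subset by (fastforce simp: affine_chart_def)
  {
    case (const c)
    show ?case using square_span_zero[OF xt] by (simp add: pderiv_at_const)
  next
    case (coord j)
    have "(\<Sum>i<n. pderiv_at i (\<lambda>p. p j) (\<phi> x) * (\<phi> y i - \<phi> x i)) = \<phi> y j - \<phi> x j" for y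
    proof -
      have "(\<Sum>i<n. pderiv_at i (\<lambda>p. p j) (\<phi> x) * (\<phi> y i - \<phi> x i)) =
          (\<Sum>i<n. if i = j then \<phi> y i - \<phi> x i else 0)"
        by (intro sum.cong) (auto simp: pderiv_at_coord)
      then show ?thesis using coord by simp
    qed
    then show ?case using square_span_zero[OF xt] by simp
  next
    case (add f g)
    from ideal_span_add[OF square_gens_stalk add.IH]
    show ?case
      by (rule back_subst[where P = "\<lambda>h. h \<in> _"])
         (simp add: fun_eq_iff pderiv_at_add[OF add(1,2)] distrib_right sum.distrib)
  next
    case (mult f g)
    define Lf where "Lf = (\<lambda>y. \<Sum>i<n. pderiv_at i f (\<phi> x) * (\<phi> y i - \<phi> x i))"
    define Lg where "Lg = (\<lambda>y. \<Sum>i<n. pderiv_at i g (\<phi> x) * (\<phi> y i - \<phi> x i))"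
    have fs: "(\<lambda>y. f (\<phi> y)) \<in> stalk X x" and gs: "(\<lambda>y. g (\<phi> y)) \<in> stalk X x"
      using affine_chart_stalk[OF ch x] mult by auto
    have coord: "(\<lambda>y. \<phi> y i - \<phi> x i) \<in> stalk X x" if "i < n" for i
      using affine_chart_stalk[OF ch x polyfun_diff[OF polyfun.coord[OF that] polyfun.const]] .
    have Lgs: "Lg \<in> stalk X x" unfolding Lg_def by (intro stalk_sum stalk_cmult coord xt) auto
    have Lg0: "Lg x = 0" by (simp add: Lg_def)
    \<comment> \<open>The remainder of the product splits into this product of two germs that vanish
      at \<open>x\<close> and into multiples of the remainders of \<open>f\<close> and
      \<open>g\<close>.\<close>
    have "(\<lambda>y. (f (\<phi> y) - f (\<phi> x)) * Lg y) \<in> ideal_span X x (square_gens x)"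
      by (rule square_span_mult[OF stalk_diff[OF fs stalk_const[OF xt]] Lgs]) (simp_all add: Lg0)
    moreover have "(\<lambda>y. f (\<phi> y) * (g (\<phi> y) - g (\<phi> x) - Lg y)) \<in> ideal_span X x (square_gens x)"
      using ideal_span_mult[OF fs mult.IH(2)] by (simp add: Lg_def)
    moreover have "(\<lambda>y. g (\<phi> x) * (f (\<phi> y) - f (\<phi> x) - Lf y)) \<in> ideal_span X x (square_gens x)"
      using ideal_span_mult[OF stalk_const[OF xt] mult.IH(1)] by (simp add: Lf_def)
    ultimately have *: "(\<lambda>y. ((f (\<phi> y) - f (\<phi> x)) * Lg y + f (\<phi> y) * (g (\<phi> y) - g (\<phi> x) - Lg y)) +
        g (\<phi> x) * (f (\<phi> y) - f (\<phi> x) - Lf y)) \<in> ideal_span X x (square_gens x)"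
      by (intro ideal_span_add[OF square_gens_stalk])
    have "(\<Sum>i<n. pderiv_at i (\<lambda>p. f p * g p) (\<phi> x) * (\<phi> y i - \<phi> x i)) = f (\<phi> x) * Lg y + g (\<phi> x) * Lf y" for y
      by (simp add: pderiv_at_mult[OF mult(1,2)] Lf_def Lg_def sum_distrib_left sum.distrib distrib_right mult.assoc)
    then show ?case
      using * by (elim back_subst[where P = "\<lambda>h. h \<in> _"]) (simp add: fun_eq_iff algebra_simps)
  }
qed

text \<open>The equations \<open>F j\<close> of the variety and the numerators of the parameters
  \<open>w i\<close> form one system to which \<open>holomorphic_solution\<close> applies. Its
  hypothesis on the joint Jacobian matrix combines the Jacobian criterion for the \<open>F j\<close>
  with the independence of the parameters modulo the square of the maximal ideal.\<close>

lemma coordinate_arc: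
  assumes ns: "nonsingular X" and x: "x \<in> topspace (zar X)" and w: "regular_parameters X x n w"
    and p: "\<And>i. i < n \<Longrightarrow> p i holomorphic_on UNIV" and p0: "\<And>i. i < n \<Longrightarrow> p i 0 = 0"
  obtains \<gamma> where "holomorphic_arc X \<gamma>" "\<gamma> 0 = x"
    "\<forall>i<n. eventually (\<lambda>t. w i (\<gamma> t) = p i t) (nhds 0)"
proof -
  obtain U N r F \<phi> where U: "openin (zar X) U" "x \<in> U" and F: "\<forall>j<(r::nat). F j \<in> polyfun N"
    and jac: "\<forall>p\<in>zeros N (F ` {..<r}). \<forall>c.
        (\<forall>i<N. (\<Sum>j<r. c j * pderiv_at i (F j) p) = 0) \<longrightarrow> (\<forall>j<r. c j = 0)"
    and iso: "isomorphism (induced X U) (induced (affine_space N) (zeros N (F ` {..<r}))) \<phi>"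
    using ns[unfolded nonsingular_def, rule_format, OF x] by (elim exE conjE)
  obtain \<psi> where ch: "affine_chart X U N (zeros N (F ` {..<r})) \<phi> \<psi>"
    by (rule isomorphism_imp_affine_chart[OF U(1) iso])
  define P where "P = \<phi> x"
  have P: "P \<in> zeros N (F ` {..<r})" using affine_chart_mem(1)[OF ch U(2)] by (simp add: P_def)
  have ws: "w i \<in> stalk X x" and w0: "w i x = 0" if "i < n" for i
  proof -
    have "generates X x (w ` {..<n}) (max_ideal X x)" using w by (simp add: regular_parameters_def)
    from generates_mem[OF this, of "w i"] have "w i \<in> max_ideal X x" using that by simp
    then show "w i \<in> stalk X x" "w i x = 0" by (auto simp: max_ideal_def)
  qed
  define germ where "germ i a b V \<longleftrightarrow> a \<in> polyfun N \<and> b \<in> polyfun N \<and> openin (zar X) V \<and> x \<in> V \<and> V \<subseteq> U \<and>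
      (\<forall>y\<in>V. b (\<phi> y) \<noteq> 0 \<and> w i y = a (\<phi> y) / b (\<phi> y))" for i a b V
  have "\<exists>a b V. i < n \<longrightarrow> germ i a b V" for i
  proof (cases "i < n")
    case True
    obtain W where W: "openin (zar X) W" "x \<in> W" "w i \<in> reg X W" by (rule stalkE[OF ws[OF True]])
    obtain a b V where "a \<in> polyfun N" "b \<in> polyfun N" "openin (zar X) V" "x \<in> V" "V \<subseteq> U \<inter> W"
      "\<forall>y\<in>V. b (\<phi> y) \<noteq> 0 \<and> w i y = a (\<phi> y) / b (\<phi> y)"
      by (rule affine_chart_germ[OF sheaf ch U(2) W(2,1,3)])
    then have "germ i a b V" unfolding germ_def by blast
    then show ?thesis by blast
  qed blast
  then obtain a b V where germ: "\<And>i. i < n \<Longrightarrow> germ i (a i) (b i) (V i)"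
    by metis
  then have ab: "\<And>i. i < n \<Longrightarrow> a i \<in> polyfun N" "\<And>i. i < n \<Longrightarrow> b i \<in> polyfun N"
    and V: "\<And>i. i < n \<Longrightarrow> openin (zar X) (V i)" "\<And>i. i < n \<Longrightarrow> x \<in> V i" "\<And>i. i < n \<Longrightarrow> V i \<subseteq> U"
    and q: "\<And>i y. i < n \<Longrightarrow> y \<in> V i \<Longrightarrow> b i (\<phi> y) \<noteq> 0 \<and> w i y = a i (\<phi> y) / b i (\<phi> y)"
    unfolding germ_def by blast+
  have aP: "a i P = 0" and bP: "b i P \<noteq> 0" if "i < n" for i
    using q[OF that V(2)[OF that]] w0[OF that] by (auto simp: P_def)
  define A where "A = (\<lambda>l. if l < r then F l else a (l - r))"
  \<comment> \<open>The first \<open>r\<close> equations have right-hand side zero and keep the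
    solution on the variety; the others say that the numerator is \<open>p i\<close> times the
    denominator, that is, \<open>w i\<close> takes the value \<open>p i t\<close>.\<close>
  define B where "B = (\<lambda>l. if l < r then (\<lambda>_. 0) else b (l - r))"
  define p' where "p' = (\<lambda>l. if l < r then (\<lambda>_. 0) else p (l - r))"
  have A: "A l \<in> polyfun N" if "l < r + n" for l using that F ab by (auto simp: A_def)
  have indep: "\<forall>l<r + n. d l = 0" if d: "\<forall>i<N. (\<Sum>l<r + n. d l * pderiv_at i (A l) P) = 0" for d
  proof -
    \<comment> \<open>A relation between the Jacobian rows gives a combination \<open>f\<close> of
      the equations with zero differential at \<open>P\<close>, so its restriction lies in the
      square of the maximal ideal; on the variety only the part in the parameters survives.\<close>
    define f where "f = (\<lambda>p. \<Sum>l<r + n. d l * A l p)"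
    have f: "f \<in> polyfun N" unfolding f_def using A by (intro polyfun_sum polyfun.mult polyfun.const) auto
    have fP: "f P = 0" using P aP by (auto simp: f_def A_def zeros_def sum_lessThan_add)
    have "pderiv_at i f P = 0" if "i < N" for i
      unfolding f_def using d that A by (subst pderiv_at_sum[where n = N]) auto
    then have fsq: "(\<lambda>y. f (\<phi> y)) \<in> ideal_span X x (square_gens x)"
      using first_order_taylor[OF ch U(2) f] fP by (simp add: P_def)
    define W where "W = U \<inter> (\<Inter>i<n. V i)"
    have W: "openin (zar X) W" "x \<in> W"
      unfolding W_def using U V by (auto simp: intro: openin_Int_Inter)
    have fw: "f (\<phi> y) = (\<Sum>i<n. d (r + i) * (b i (\<phi> y) * w i y))" if "y \<in> W" for y
    proof -
      have "F l (\<phi> y) = 0" if "l < r" for l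
        using affine_chart_mem(1)[OF ch, of y] \<open>y \<in> W\<close> that by (auto simp: W_def zeros_def)
      moreover have "a i (\<phi> y) = b i (\<phi> y) * w i y" if "i < n" for i
        using q[OF that, of y] \<open>y \<in> W\<close> that by (auto simp: W_def)
      ultimately show ?thesis by (simp add: f_def A_def sum_lessThan_add)
    qed
    \<comment> \<open>Replacing the unit \<open>b i\<close> by its value at \<open>P\<close> changes
      the combination only by elements of the square of the maximal ideal.\<close>
    define c where "c = (\<lambda>i. d (r + i) * b i P)"
    have bs: "(\<lambda>y. b i (\<phi> y)) \<in> stalk X x" if "i < n" for i
      by (rule affine_chart_stalk[OF ch U(2) ab(2)[OF that]])
    have "(\<lambda>y. d (r + i) * ((b i P - b i (\<phi> y)) * w i y)) \<in> ideal_span X x (square_gens x)" if "i < n" for i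
    proof (rule ideal_span_mult[OF stalk_const[OF x] square_span_mult])
      show "(\<lambda>y. b i P - b i (\<phi> y)) \<in> stalk X x" by (rule stalk_diff[OF stalk_const[OF x] bs[OF that]])
    qed (use ws w0 that in \<open>auto simp: P_def\<close>)
    then have "(\<lambda>y. \<Sum>i<n. d (r + i) * ((b i P - b i (\<phi> y)) * w i y)) \<in> ideal_span X x (square_gens x)"
      by (intro ideal_span_sum[OF square_gens_stalk x]) auto
    from ideal_span_add[OF square_gens_stalk fsq this]
    have "(\<lambda>y. \<Sum>i<n. c i * w i y) \<in> ideal_span X x (square_gens x)"
      by (rule ideal_span_eq_near)
         (rule eq_nearI[OF W], simp add: fw c_def sum.distrib[symmetric] algebra_simps)
    then have "\<forall>i<n. c i = 0" using w unfolding regular_parameters_def square_gens_def by blast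
    then have d0: "d (r + i) = 0" if "i < n" for i using bP that by (auto simp: c_def)
    have "\<forall>i<N. (\<Sum>j<r. d j * pderiv_at i (F j) P) = 0"
      using d d0 by (simp add: sum_lessThan_add A_def)
    then have "\<forall>j<r. d j = 0" using jac P by blast
    then show ?thesis using d0 by (metis add_diff_inverse_nat nat_add_left_cancel_less)
  qed
  obtain \<epsilon> z where \<epsilon>: "\<epsilon> > 0" and z: "\<And>i. (\<lambda>t. z t i) holomorphic_on ball 0 \<epsilon>" "z 0 = P"
    "\<And>t. z t \<in> affine_points N"
    and sol: "\<And>t l. t \<in> ball 0 \<epsilon> \<Longrightarrow> l < r + n \<Longrightarrow> A l (z t) = p' l t * B l (z t)"
  proof (rule holomorphic_solution[of "r + n" A N B p' P])
    show "P \<in> affine_points N" using P by (simp add: zeros_def)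
    show "A l P = 0" if "l < r + n" for l using that P aP by (auto simp: A_def zeros_def)
    show "B l \<in> polyfun N" if "l < r + n" for l using that ab by (auto simp: B_def intro: polyfun.const)
    show "p' l holomorphic_on UNIV" "p' l 0 = 0" if "l < r + n" for l
      using that p p0 by (auto simp: p'_def)
    show "A l \<in> polyfun N" if "l < r + n" for l using A that .
    show "\<forall>l<r + n. d l = 0" if "\<forall>i<N. (\<Sum>l<r + n. d l * pderiv_at i (A l) P) = 0" for d
      using indep that .
  qed blast
  have zZ: "z t \<in> zeros N (F ` {..<r})" if "t \<in> ball 0 \<epsilon>" for t
  proof -
    have "F l (z t) = 0" if "l < r" for l
      using sol[OF \<open>t \<in> ball 0 \<epsilon>\<close>, of l] that by (simp add: A_def B_def)
    then show ?thesis using z(3)[of t] by (auto simp: zeros_def)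
  qed
  define \<gamma> where "\<gamma> = (\<lambda>t. \<psi> (z t))"
  have arc: "holomorphic_arc X \<gamma>"
    unfolding \<gamma>_def by (rule holomorphic_arc_chart[OF sheaf ch \<epsilon> z(1) zZ])
  have \<gamma>0: "\<gamma> 0 = x" using ch U(2) by (simp add: \<gamma>_def z(2) P_def affine_chart_def)
  have ev: "eventually (\<lambda>t. w i (\<gamma> t) = p i t) (nhds 0)" if i: "i < n" for i
  proof -
    have "eventually (\<lambda>t. t \<in> ball 0 \<epsilon>) (nhds (0::complex))"
      using \<epsilon> by (intro eventually_nhds_in_open) auto
    moreover have "eventually (\<lambda>t. \<gamma> t \<in> V i) (nhds 0)"
      by (rule holomorphic_arc_near[OF arc V(1)[OF i]]) (use V(2)[OF i] \<gamma>0 in simp)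
    ultimately show ?thesis
    proof eventually_elim
      case (elim t)
      have "\<phi> (\<gamma> t) = z t" using ch zZ[OF elim(1)] by (simp add: \<gamma>_def affine_chart_def)
      then show ?case using q[OF i elim(2)] sol[OF elim(1), of "r + i"] i
        by (simp add: A_def B_def p'_def)
    qed
  qed
  then show ?thesis using that[OF arc \<gamma>0] by blast
qed

end

section \<open>Forms and projective coordinates\<close>

lemma form_mono: "form X V r d F \<Longrightarrow> reg X V \<subseteq> reg Y V' \<Longrightarrow> form Y V' r d F"
  by (induction rule: form.induct) (auto intro: form.intros)

lemma form_homogeneous: "form X V r d F \<Longrightarrow> F x (\<lambda>i. c * \<xi> i) = c ^ d * F x \<xi>"
  by (induction rule: form.induct) (simp_all add: algebra_simps)

lemma form_cong: "form X V r d F \<Longrightarrow> (\<And>i. i \<le> r \<Longrightarrow> \<xi> i = \<eta> i) \<Longrightarrow> F x \<xi> = F x \<eta>"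
  by (induction rule: form.induct) auto

lemma form_tendsto:
  "form X V r d F \<Longrightarrow> (\<And>i. i \<le> r \<Longrightarrow> ((\<lambda>s. \<xi> s i) \<longlongrightarrow> \<eta> i) G) \<Longrightarrow> ((\<lambda>s. F x (\<xi> s)) \<longlongrightarrow> F x \<eta>) G"
  by (induction rule: form.induct) (auto intro: tendsto_intros)

lemma proj_class_self: "\<xi> \<in> proj_class \<xi>"
  unfolding proj_class_def by (rule CollectI, rule exI[of _ 1]) simp

lemma proj_class_memE:
  assumes "\<eta> \<in> proj_class \<xi>"
  obtains c where "c \<noteq> 0" "\<eta> = (\<lambda>i. c * \<xi> i)"
  using assms unfolding proj_class_def by blast

lemma proj_class_scale:
  assumes "c \<noteq> 0"
  shows "proj_class (\<lambda>i. c * \<xi> i) = proj_class \<xi>"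
proof (intro equalityI subsetI)
  fix \<eta> assume "\<eta> \<in> proj_class (\<lambda>i. c * \<xi> i)"
  then obtain b where "b \<noteq> 0" "\<eta> = (\<lambda>i. b * (c * \<xi> i))" by (rule proj_class_memE)
  then show "\<eta> \<in> proj_class \<xi>"
    using assms unfolding proj_class_def
    by (intro CollectI exI[of _ "b * c"]) (simp add: mult.assoc)
next
  fix \<eta> assume "\<eta> \<in> proj_class \<xi>"
  then obtain b where "b \<noteq> 0" "\<eta> = (\<lambda>i. b * \<xi> i)" by (rule proj_class_memE)
  then show "\<eta> \<in> proj_class (\<lambda>i. c * \<xi> i)"
    using assms unfolding proj_class_def
    by (intro CollectI exI[of _ "b / c"]) simp
qed

definition homogeneous_vector :: "nat \<Rightarrow> (nat \<Rightarrow> complex) \<Rightarrow> bool" where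
  "homogeneous_vector r \<xi> \<longleftrightarrow> (\<forall>i>r. \<xi> i = 0) \<and> (\<exists>i\<le>r. \<xi> i \<noteq> 0)"

lemma proj_spaceE:
  assumes "l \<in> proj_space r"
  obtains \<xi> where "homogeneous_vector r \<xi>" "l = proj_class \<xi>"
  using assms unfolding proj_space_def homogeneous_vector_def by blast

lemma proj_class_space: "homogeneous_vector r \<xi> \<Longrightarrow> proj_class \<xi> \<in> proj_space r"
  unfolding proj_space_def homogeneous_vector_def by blast

lemma homogeneous_vector_scale:
  "c \<noteq> 0 \<Longrightarrow> homogeneous_vector r (\<lambda>i. c * \<xi> i) \<longleftrightarrow> homogeneous_vector r \<xi>"
  by (simp add: homogeneous_vector_def)

text \<open>By homogeneity one representative decides for the whole class.\<close>

lemma nonvanishing_proj_class: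
  assumes "form X V' r d F" "homogeneous_vector r \<xi>"
  shows "(y, proj_class \<xi>) \<in> nonvanishing V r F \<longleftrightarrow> y \<in> V \<and> F y \<xi> \<noteq> 0"
proof -
  have "F y \<eta> \<noteq> 0" if "F y \<xi> \<noteq> 0" "\<eta> \<in> proj_class \<xi>" for \<eta>
    using that(2)
  proof (rule proj_class_memE)
    fix c assume "c \<noteq> 0" "\<eta> = (\<lambda>i. c * \<xi> i)"
    then show ?thesis using that(1) form_homogeneous[OF assms(1)] by simp
  qed
  then show ?thesis
    using proj_class_space[OF assms(2)] proj_class_self[of \<xi>] by (auto simp: nonvanishing_def)
qed

section \<open>Forms with regular coefficients\<close>

context regular_functions
begin

lemma form_restrict:
  "form X V r d F \<Longrightarrow> openin (zar X) V \<Longrightarrow> openin (zar X) V' \<Longrightarrow> V' \<subseteq> V \<Longrightarrow> form X V' r d F"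
  by (erule form_mono) (use reg_restrict[of V V'] in auto)

lemma form_coordinate: "openin (zar X) V \<Longrightarrow> i \<le> r \<Longrightarrow> form X V r (Suc 0) (\<lambda>x \<xi>. \<xi> i)"
  using form.coord[OF form.coeff[OF reg_const], of V i r 1] by simp

lemma form_coeff_mult:
  assumes V: "openin (zar X) V" and a: "a \<in> reg X V" and F: "form X V r d F"
  shows "form X V r d (\<lambda>x \<xi>. a x * F x \<xi>)"
  using F
proof induction
  case (coeff b)
  then show ?case by (intro form.coeff reg_mult V a)
next
  case (coord d F i)
  from form.coord[OF coord.IH coord.hyps(2)] show ?case by (simp add: mult.left_commute)
next
  case (add d F G)
  from form.add[OF add.IH] show ?case by (simp add: distrib_left)
qed

lemma form_mult:
  assumes V: "openin (zar X) V" and F: "form X V r d F" and G: "form X V r d' G"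
  shows "form X V r (d + d') (\<lambda>x \<xi>. F x \<xi> * G x \<xi>)"
  using F
proof induction
  case (coeff a)
  then show ?case using form_coeff_mult[OF V _ G] by simp
next
  case (coord d F i)
  from form.coord[OF coord.IH coord.hyps(2)] show ?case by (simp add: mult.assoc)
next
  case (add d F1 F2)
  from form.add[OF add.IH] show ?case by (simp add: distrib_right)
qed

lemma form_arc_holomorphic:
  assumes \<gamma>: "holomorphic_arc X \<gamma>" and V: "openin (zar X) V" "\<gamma> 0 \<in> V"
    and \<xi>: "\<And>i. i \<le> r \<Longrightarrow> (\<lambda>t. \<xi> t i) holomorphic_on UNIV" and F: "form X V r d F"
  shows "\<exists>e>0. (\<lambda>t. F (\<gamma> t) (\<xi> t)) holomorphic_on ball 0 e"
  using F
proof induction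
  case (coeff a)
  then obtain e where "e > 0" "(a \<circ> \<gamma>) holomorphic_on ball 0 e"
    using holomorphic_arc_stalk[OF \<gamma> stalkI[OF V]] by blast
  then show ?case by (auto simp: o_def)
next
  case (coord d F i)
  then obtain e where "e > 0" "(\<lambda>t. F (\<gamma> t) (\<xi> t)) holomorphic_on ball 0 e" by blast
  then show ?case
    by (intro exI[of _ e] conjI holomorphic_intros holomorphic_on_subset[OF \<xi>[OF coord.hyps(2)]]) auto
next
  case (add d F G)
  then obtain e e' where "e > 0" "(\<lambda>t. F (\<gamma> t) (\<xi> t)) holomorphic_on ball 0 e"
    "e' > 0" "(\<lambda>t. G (\<gamma> t) (\<xi> t)) holomorphic_on ball 0 e'" by blast
  then show ?case
    by (intro exI[of _ "min e e'"] conjI holomorphic_intros)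
       (auto elim!: holomorphic_on_subset)
qed

lemma form_arc_nonzero:
  assumes "holomorphic_arc X \<gamma>" "openin (zar X) V" "\<gamma> 0 \<in> V"
    and "\<And>i. i \<le> r \<Longrightarrow> (\<lambda>t. \<xi> t i) holomorphic_on UNIV" "form X V r d F" "F (\<gamma> 0) (\<xi> 0) \<noteq> 0"
  shows "eventually (\<lambda>t. F (\<gamma> t) (\<xi> t) \<noteq> 0) (nhds 0)"
proof -
  obtain e where e: "e > 0" "(\<lambda>t. F (\<gamma> t) (\<xi> t)) holomorphic_on ball 0 e"
    using form_arc_holomorphic[where \<xi> = \<xi>, OF assms(1-3) assms(4) assms(5)] by blast
  then have "isCont (\<lambda>t. F (\<gamma> t) (\<xi> t)) 0"
    using holomorphic_on_imp_continuous_on[OF e(2)] by (simp add: continuous_on_eq_continuous_at)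
  then have "((\<lambda>t. F (\<gamma> t) (\<xi> t)) \<longlongrightarrow> F (\<gamma> 0) (\<xi> 0)) (nhds 0)"
    using tendsto_at_iff_tendsto_nhds[of "\<lambda>t. F (\<gamma> t) (\<xi> t)" 0] by (simp add: isCont_def)
  then show ?thesis using assms(6) by (rule tendsto_imp_eventually_ne)
qed

text \<open>
  With as few terms as possible the \<open>\<mu> i\<close> are linearly independent, so that a form that vanishes for
  all values of the homogeneous coordinates has vanishing coefficients.
\<close>

lemma form_coefficients:
  assumes V: "openin (zar X) V" and F: "form X V r d F"
  obtains m a \<mu> where "\<forall>i<(m::nat). a i \<in> reg X V" "\<forall>i<m. form X V r d (\<lambda>_. \<mu> i)"
    "\<forall>x \<xi>. F x \<xi> = (\<Sum>i<m. a i x * \<mu> i \<xi>)"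
    "\<forall>x. (\<forall>\<xi>. F x \<xi> = 0) \<longrightarrow> (\<forall>i<m. a i x = 0)"
proof -
  define rep where "rep m a \<mu> \<longleftrightarrow> (\<forall>i<(m::nat). a i \<in> reg X V) \<and> (\<forall>i<m. form X V r d (\<lambda>_. \<mu> i)) \<and>
    (\<forall>x \<xi>. F x \<xi> = (\<Sum>i<m. a i x * \<mu> i \<xi>))" for m a \<mu>
  have "\<exists>m a \<mu>. (\<forall>i<(m::nat). a i \<in> reg X V) \<and> (\<forall>i<m. form X V r d (\<lambda>_. \<mu> i)) \<and>
    (\<forall>x \<xi>. F x \<xi> = (\<Sum>i<m. a i x * \<mu> i \<xi>))"
    using F
  proof induction
    case (coeff b)
    then show ?case
      by (intro exI[of _ 1] exI[of _ "\<lambda>_. b"] exI[of _ "\<lambda>_ _. 1"]) (simp add: form.coeff reg_const V)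
  next
    case (coord d F j)
    then obtain m a \<mu> where *: "\<forall>i<(m::nat). a i \<in> reg X V" "\<forall>i<m. form X V r d (\<lambda>_. \<mu> i)"
      "\<forall>x \<xi>. F x \<xi> = (\<Sum>i<m. a i x * \<mu> i \<xi>)" by blast
    have "\<forall>i<m. form X V r (Suc d) (\<lambda>_ \<xi>. \<xi> j * \<mu> i \<xi>)"
      using *(2) coord.hyps(2) by (blast intro: form.coord[where F = "\<lambda>_. \<mu> i" for i])
    then show ?case
      using *(1,3)
      by (intro exI[of _ m] exI[of _ a] exI[of _ "\<lambda>i \<xi>. \<xi> j * \<mu> i \<xi>"])
         (simp add: sum_distrib_left mult.left_commute)
  next
    case (add d F G)
    obtain m a \<mu> where 1: "\<forall>i<(m::nat). a i \<in> reg X V" "\<forall>i<m. form X V r d (\<lambda>_. \<mu> i)"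
      "\<forall>x \<xi>. F x \<xi> = (\<Sum>i<m. a i x * \<mu> i \<xi>)" using add.IH(1) by blast
    obtain m' b \<nu> where 2: "\<forall>i<(m'::nat). b i \<in> reg X V" "\<forall>i<m'. form X V r d (\<lambda>_. \<nu> i)"
      "\<forall>x \<xi>. G x \<xi> = (\<Sum>i<m'. b i x * \<nu> i \<xi>)" using add.IH(2) by blast
    define c where "c = (\<lambda>i. if i < m then a i else b (i - m))"
    define \<kappa> where "\<kappa> = (\<lambda>i. if i < m then \<mu> i else \<nu> (i - m))"
    have "\<forall>i<m + m'. c i \<in> reg X V" "\<forall>i<m + m'. form X V r d (\<lambda>_. \<kappa> i)"
      using 1 2 by (auto simp: c_def \<kappa>_def)
    moreover have "\<forall>x \<xi>. F x \<xi> + G x \<xi> = (\<Sum>i<m + m'. c i x * \<kappa> i \<xi>)"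
      using 1(3) 2(3) by (simp add: sum_lessThan_add c_def \<kappa>_def)
    ultimately show ?case by blast
  qed
  then have ex: "\<exists>m. \<exists>a \<mu>. rep m a \<mu>" unfolding rep_def .
  define m where "m = (LEAST m. \<exists>a \<mu>. rep m a \<mu>)"
  obtain a \<mu> where am: "rep m a \<mu>" using LeastI_ex[OF ex] unfolding m_def by blast
  have least: "m \<le> m'" if "rep m' b \<nu>" for m' b \<nu>
    unfolding m_def using that by (intro Least_le) blast
  have am': "\<forall>i<m. a i \<in> reg X V" "\<forall>i<m. form X V r d (\<lambda>_. \<mu> i)"
    "\<forall>x \<xi>. F x \<xi> = (\<Sum>i<m. a i x * \<mu> i \<xi>)"
    using am unfolding rep_def by auto
  have "a k x = 0" if x: "\<forall>\<xi>. F x \<xi> = 0" and k: "k < m" for x k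
  proof (rule ccontr)
    assume ne: "a k x \<noteq> 0"
    obtain m' where m': "m = Suc m'" using k by (cases m) auto
    define s where "s = (\<lambda>i. if i < k then i else Suc i)"
    have bij: "bij_betw s {..<m'} ({..<m} - {k})"
    proof (rule bij_betwI[where g = "\<lambda>i. if i < k then i else i - 1"])
    qed (use k m' in \<open>auto simp: s_def split: if_splits\<close>)
    define c where "c = (\<lambda>i. a i x / a k x)"
    have split: "(\<Sum>i<m. h i) = h k + (\<Sum>i<m'. h (s i))" for h :: "nat \<Rightarrow> complex"
      using k sum.reindex_bij_betw[OF bij, of h] by (simp add: sum.remove[of "{..<m}" k])
    \<comment> \<open>At a point where the form is identically zero in the homogeneous coordinates
      but \<open>a k\<close> is not zero, the representation becomes a linear relation that
      expresses \<open>\<mu> k\<close> through the others. Substituting it everywhere saves a term,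
      against the choice of \<open>m\<close>.\<close>
    have \<mu>k: "\<mu> k \<xi> = - (\<Sum>i<m'. c (s i) * \<mu> (s i) \<xi>)" for \<xi>
    proof -
      have "a k x * \<mu> k \<xi> + (\<Sum>i<m'. a (s i) x * \<mu> (s i) \<xi>) = 0"
        using x am'(3) split[of "\<lambda>i. a i x * \<mu> i \<xi>"] by simp
      then have "\<mu> k \<xi> = - (\<Sum>i<m'. a (s i) x * \<mu> (s i) \<xi>) / a k x"
        using ne by (simp add: field_simps eq_neg_iff_add_eq_0)
      then show ?thesis by (simp add: c_def sum_divide_distrib)
    qed
    have s: "s i < m" if "i < m'" for i using that m' by (simp add: s_def)
    have "rep m' (\<lambda>i y. a (s i) y + (- c (s i)) * a k y) (\<lambda>i. \<mu> (s i))"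
      unfolding rep_def
    proof (intro conjI allI impI)
      show "(\<lambda>y. a (s i) y + (- c (s i)) * a k y) \<in> reg X V" if "i < m'" for i
        using am'(1) s[OF that] k by (intro reg_add reg_mult reg_const V) auto
      show "form X V r d (\<lambda>_. \<mu> (s i))" if "i < m'" for i using am'(2) s[OF that] by blast
      show "F y \<xi> = (\<Sum>i<m'. (a (s i) y + - c (s i) * a k y) * \<mu> (s i) \<xi>)" for y \<xi>
        unfolding am'(3)[rule_format] split \<mu>k
        by (simp add: left_diff_distrib sum_subtractf sum_distrib_left mult.assoc mult.left_commute)
    qed
    then show False using least m' by fastforce
  qed
  then show ?thesis using that am' by blast
qed

end

section \<open>Charts of the blowing-up\<close>

text \<open>The isomorphism of \<open>blowing_up\<close> over one coordinate neighbourhood, with its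
  inverse named. \<open>idx\<close> picks, without repetition, the coordinates that generate the
  ideal of \<open>C\<close>, so that arcs may prescribe all generators independently.\<close>

locale blowup_chart =
  fixes M :: "'a func_space" and M' :: "'b func_space" and \<sigma> :: "'b \<Rightarrow> 'a" and C U :: "'a set"
    and n r :: nat and u :: "nat \<Rightarrow> 'a \<Rightarrow> complex" and idx :: "nat \<Rightarrow> nat"
    and \<theta> :: "'b \<Rightarrow> 'a \<times> (nat \<Rightarrow> complex) set" and \<theta>' :: "'a \<times> (nat \<Rightarrow> complex) set \<Rightarrow> 'b"
  assumes varM: "variety M" and nsM: "nonsingular M" and varM': "variety M'"
    and \<sigma>: "morphism M' M \<sigma>" and closedC: "closedin (zar M) C"
    and lc: "local_coordinates M U n u"
    and idx: "inj_on idx {..r}" "\<And>i. i \<le> r \<Longrightarrow> idx i < n"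
    and gen: "\<And>y. y \<in> U \<Longrightarrow> generates M y ((\<lambda>i. u (idx i)) ` {..r}) (ideal_at M C y)"
    and \<theta>: "morphism (induced M' {x \<in> topspace (zar M'). \<sigma> x \<in> U})
          (graph_closure (induced M U) C r (\<lambda>i. u (idx i))) \<theta>"
    and \<theta>': "morphism (graph_closure (induced M U) C r (\<lambda>i. u (idx i)))
          (induced M' {x \<in> topspace (zar M'). \<sigma> x \<in> U}) \<theta>'"
    and \<theta>'\<theta>: "\<And>x. x \<in> topspace (zar M') \<Longrightarrow> \<sigma> x \<in> U \<Longrightarrow> \<theta>' (\<theta> x) = x"
    and \<theta>\<theta>': "\<And>p. p \<in> topspace (zar (graph_closure (induced M U) C r (\<lambda>i. u (idx i)))) \<Longrightarrow> \<theta> (\<theta>' p) = p"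
    and fst\<theta>: "\<And>x. x \<in> topspace (zar M') \<Longrightarrow> \<sigma> x \<in> U \<Longrightarrow> fst (\<theta> x) = \<sigma> x"
begin

sublocale M: regular_functions M by (rule variety_regular_functions[OF varM])
sublocale M': regular_functions M' by (rule variety_regular_functions[OF varM'])

definition g :: "nat \<Rightarrow> 'a \<Rightarrow> complex" where "g i = u (idx i)"

definition U' :: "'b set" where "U' = {x \<in> topspace (zar M'). \<sigma> x \<in> U}"

definition TP :: "('a \<times> (nat \<Rightarrow> complex) set) func_space" where "TP = times_proj (induced M U) r"

definition gvec :: "'a \<Rightarrow> nat \<Rightarrow> complex" where "gvec y = (\<lambda>i. if i \<le> r then g i y else 0)"

definition graph :: "('a \<times> (nat \<Rightarrow> complex) set) set" where
  "graph = {(y, proj_class (gvec y)) |y. y \<in> U - C}"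

definition GC :: "('a \<times> (nat \<Rightarrow> complex) set) set" where "GC = zar TP closure_of graph"

lemma openU: "openin (zar M) U"
  using lc by (simp add: local_coordinates_def)

lemma U_topspace: "y \<in> U \<Longrightarrow> y \<in> topspace (zar M)"
  using openU openin_subset by blast

lemma reg_induced_U: "V \<subseteq> U \<Longrightarrow> openin (zar M) V \<Longrightarrow> reg (induced M U) V = reg M V"
  using reg_induced_open[OF M.sheaf openU] .

lemma openin_induced_U: "openin (zar (induced M U)) V \<longleftrightarrow> openin (zar M) V \<and> V \<subseteq> U"
  using openU by (simp add: openin_open_subtopology)

lemma topspace_induced_U: "topspace (zar (induced M U)) = U"
  by (rule topspace_induced_open[OF openU])

lemma form_induced_U: "openin (zar M) V \<Longrightarrow> V \<subseteq> U \<Longrightarrow> form (induced M U) V r d F \<longleftrightarrow> form M V r d F"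
  using form_mono[of "induced M U" V r d F M V] form_mono[of M V r d F "induced M U" V]
  by (auto simp: reg_induced_U)

lemma graph_closure_eq: "graph_closure (induced M U) C r (\<lambda>i. u (idx i)) = induced TP GC"
  unfolding graph_closure_def TP_def GC_def graph_def gvec_def g_def topspace_induced_U ..

lemma g_reg: "i \<le> r \<Longrightarrow> g i \<in> reg M U"
  using lc idx(2) by (simp add: g_def local_coordinates_def)

lemma g_stalk: "i \<le> r \<Longrightarrow> y \<in> U \<Longrightarrow> g i \<in> stalk M y"
  using stalkI[OF openU _ g_reg] .

lemma g_ideal: "i \<le> r \<Longrightarrow> y \<in> U \<Longrightarrow> g i \<in> ideal_at M C y"
  using M.generates_mem[OF gen, of y "u (idx i)"] by (auto simp: g_def)

text \<open>Off the closed set \<open>C\<close> the constant 1 belongs to the ideal of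
  \<open>C\<close>, so the generators cannot all vanish there.\<close>

lemma mem_C_iff:
  assumes y: "y \<in> U"
  shows "y \<in> C \<longleftrightarrow> (\<forall>i\<le>r. g i y = 0)"
proof
  assume "y \<in> C"
  then show "\<forall>i\<le>r. g i y = 0" using g_ideal[OF _ y] ideal_at_zero by metis
next
  assume 0: "\<forall>i\<le>r. g i y = 0"
  show "y \<in> C"
  proof (rule ccontr)
    assume "y \<notin> C"
    then have "openin (zar M) (topspace (zar M) - C)" "y \<in> topspace (zar M) - C"
      using closedC U_topspace[OF y] by auto
    then have one: "(\<lambda>_. 1) \<in> ideal_at M C y"
      using M.stalk_const[OF U_topspace[OF y], of 1] unfolding ideal_at_def by blast
    obtain a where "eq_near M y (\<lambda>_. 1) (\<lambda>z. \<Sum>i\<in>{..r}. a i z * u (idx i) z)"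
      by (rule M.generates_finiteE[OF gen[OF y] finite_atMost one])
    from eq_near_point[OF this] show False using 0 by (simp add: g_def)
  qed
qed

lemma gvec_homogeneous: "y \<in> U \<Longrightarrow> y \<notin> C \<Longrightarrow> homogeneous_vector r (gvec y)"
  using mem_C_iff by (auto simp: homogeneous_vector_def gvec_def)

lemma arc:
  assumes y: "y \<in> U" and p: "\<And>i. i \<le> r \<Longrightarrow> p i holomorphic_on UNIV" "\<And>i. i \<le> r \<Longrightarrow> p i 0 = 0"
  obtains \<gamma> where "holomorphic_arc M \<gamma>" "\<gamma> 0 = y"
    "eventually (\<lambda>t. \<forall>i\<le>r. g i (\<gamma> t) = g i y + p i t) (nhds 0)"
proof -
  have reg: "regular_parameters M y n (\<lambda>i z. u i z - u i y)"
    using lc y by (simp add: local_coordinates_def)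
  \<comment> \<open>Coordinates that are not among the chosen generators stay constant along the
    arc.\<close>
  define p' where "p' = (\<lambda>k. if k \<in> idx ` {..r} then p (inv_into {..r} idx k) else (\<lambda>_. 0))"
  have p': "p' k holomorphic_on UNIV" "p' k 0 = 0" for k
    using p by (auto simp: p'_def idx(1))
  obtain \<gamma> where \<gamma>: "holomorphic_arc M \<gamma>" "\<gamma> 0 = y"
    and ev: "\<forall>i<n. eventually (\<lambda>t. u i (\<gamma> t) - u i y = p' i t) (nhds 0)"
    by (rule M.coordinate_arc[OF nsM U_topspace[OF y] reg p'])
  have "eventually (\<lambda>t. \<forall>i\<in>{..r}. u (idx i) (\<gamma> t) - u (idx i) y = p' (idx i) t) (nhds 0)"
    using ev idx(2) by (intro eventually_ball_finite) auto
  then have "eventually (\<lambda>t. \<forall>i\<le>r. g i (\<gamma> t) = g i y + p i t) (nhds 0)"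
    by eventually_elim (auto simp: g_def p'_def idx(1) algebra_simps)
  then show ?thesis using that \<gamma> by blast
qed

section \<open>The product with projective space and the closure of the graph\<close>

lemma TP_basic_open:
  assumes "openin (zar M) V" "V \<subseteq> U" "form M V r d F"
  shows "openin (zar TP) (nonvanishing V r F)"
proof -
  have "form (induced M U) V r d F" using assms form_induced_U by blast
  moreover have "openin (zar (induced M U)) V" using assms(1,2) openin_induced_U by blast
  ultimately have "nonvanishing V r F \<in>
      {nonvanishing V r F |V F. openin (zar (induced M U)) V \<and> (\<exists>d. form (induced M U) V r d F)}"
    by (intro CollectI exI[of _ V] exI[of _ F] exI[of _ d] conjI refl)
  then have "openin (topology_generated_by
      {nonvanishing V r F |V F. openin (zar (induced M U)) V \<and> (\<exists>d. form (induced M U) V r d F)}) (nonvanishing V r F)"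
    by (rule topology_generated_by_Basis)
  then show ?thesis by (simp only: TP_def times_proj_def func_space.simps)
qed

lemma TP_basis:
  assumes W: "openin (zar TP) W" and p: "p \<in> W"
  obtains V d F where "openin (zar M) V" "V \<subseteq> U" "form M V r d F" "p \<in> nonvanishing V r F"
    "nonvanishing V r F \<subseteq> W"
proof -
  define S where "S = {nonvanishing V r F |V F. openin (zar (induced M U)) V \<and> (\<exists>d. form (induced M U) V r d F)}"
  have SI: "nonvanishing V r F \<in> S" if "openin (zar M) V" "V \<subseteq> U" "form M V r d F" for V d F
  proof -
    have "form (induced M U) V r d F" using that form_induced_U by blast
    moreover have "openin (zar (induced M U)) V" using that openin_induced_U by blast
    ultimately show ?thesis
      unfolding S_def by (intro CollectI exI[of _ V] exI[of _ F] exI[of _ d] conjI refl)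
  qed
  have SE: "\<exists>V d F. A = nonvanishing V r F \<and> openin (zar M) V \<and> V \<subseteq> U \<and> form M V r d F" if "A \<in> S" for A
  proof -
    obtain V F d where A: "A = nonvanishing V r F" "openin (zar (induced M U)) V" "form (induced M U) V r d F"
      using \<open>A \<in> S\<close> unfolding S_def by (elim CollectE exE conjE)
    have V: "openin (zar M) V" "V \<subseteq> U" using A(2) openin_induced_U by blast+
    have "form M V r d F" using A(3) form_induced_U[OF V] by blast
    then show ?thesis using A(1) V by blast
  qed
  have "openin (topology_generated_by S) W" using W by (simp add: TP_def times_proj_def S_def)
  then have "\<exists>A\<in>S. p \<in> A \<and> A \<subseteq> W"
  proof (rule generated_topology_basis[rotated])
    fix A B q assume "A \<in> S" "B \<in> S" and q: "q \<in> A" "q \<in> B"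
    then obtain V d F V' d' F' where A: "A = nonvanishing V r F" "openin (zar M) V" "V \<subseteq> U" "form M V r d F"
      and B: "B = nonvanishing V' r F'" "openin (zar M) V'" "V' \<subseteq> U" "form M V' r d' F'"
      by (metis SE)
    have o: "openin (zar M) (V \<inter> V')" "V \<inter> V' \<subseteq> U" using A B by auto
    have "form M (V \<inter> V') r (d + d') (\<lambda>x \<xi>. F x \<xi> * F' x \<xi>)"
      by (intro M.form_mult o M.form_restrict[OF A(4,2)] M.form_restrict[OF B(4,2)]) auto
    from SI[OF o this] show "\<exists>D\<in>S. q \<in> D \<and> D \<subseteq> A \<inter> B"
      using q A(1) B(1)
      by (intro bexI[of _ "nonvanishing (V \<inter> V') r (\<lambda>x \<xi>. F x \<xi> * F' x \<xi>)"])
         (auto simp: nonvanishing_def)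
  qed (rule p)
  then show ?thesis using SE that by metis
qed

lemma topspace_TP: "topspace (zar TP) = U \<times> proj_space r"
proof (intro equalityI subsetI)
  fix p assume "p \<in> topspace (zar TP)"
  then obtain V d F where "V \<subseteq> U" "p \<in> nonvanishing V r F" by (metis TP_basis openin_topspace)
  then show "p \<in> U \<times> proj_space r" by (auto simp: nonvanishing_def)
next
  fix p assume "p \<in> U \<times> proj_space r"
  then obtain y l where p: "p = (y, l)" "y \<in> U" "l \<in> proj_space r" by blast
  obtain \<xi> where \<xi>: "homogeneous_vector r \<xi>" "l = proj_class \<xi>" using proj_spaceE[OF p(3)] .
  then obtain j where j: "j \<le> r" "\<xi> j \<noteq> 0" by (auto simp: homogeneous_vector_def)
  have F: "form M U r (Suc 0) (\<lambda>x \<xi>. \<xi> j)" by (rule M.form_coordinate[OF openU j(1)])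
  have "p \<in> nonvanishing U r (\<lambda>x \<xi>. \<xi> j)"
    unfolding p \<xi>(2) nonvanishing_proj_class[OF F \<xi>(1)] using p j by simp
  then show "p \<in> topspace (zar TP)" using TP_basic_open[OF openU order_refl F] openin_subset by blast
qed

lemma graph_subset: "graph \<subseteq> topspace (zar TP)"
  unfolding topspace_TP graph_def using gvec_homogeneous proj_class_space by blast

lemma graph_subset_GC: "graph \<subseteq> GC"
  unfolding GC_def by (rule closure_of_subset[OF graph_subset])

lemma GC_subset: "GC \<subseteq> U \<times> proj_space r"
  unfolding GC_def using closure_of_subset_topspace[of "zar TP" graph] topspace_TP by simp

lemma topspace_GC: "topspace (zar (induced TP GC)) = GC"
  using GC_subset topspace_TP by auto

text \<open>The difference of the two sides is a form of degree 1 that vanishes on the graph; if it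
  did not vanish at the given point, its nonvanishing locus would be a neighbourhood that misses the
  graph.\<close>

lemma GC_relation:
  assumes p: "(y, proj_class \<xi>) \<in> GC" and \<xi>: "homogeneous_vector r \<xi>" and ij: "i \<le> r" "j \<le> r"
  shows "g i y * \<xi> j = g j y * \<xi> i"
proof (rule ccontr)
  assume ne: "\<not> ?thesis"
  \<comment> \<open>Forms are built by sums, so the sign goes into the coefficient.\<close>
  define F where "F = (\<lambda>y \<xi>. \<xi> j * g i y + \<xi> i * (- 1 * g j y))"
  have F: "form M U r (Suc 0) F"
    unfolding F_def using ij by (intro form.add form.coord form.coeff M.reg_mult M.reg_const openU g_reg)
  have y: "y \<in> U" using p GC_subset by blast
  have "(y, proj_class \<xi>) \<in> nonvanishing U r F"
    unfolding nonvanishing_proj_class[OF F \<xi>] using y ne by (simp add: F_def mult.commute)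
  then obtain q where "q \<in> graph" "q \<in> nonvanishing U r F"
    using p TP_basic_open[OF openU order_refl F] unfolding GC_def in_closure_of by blast
  then obtain z where z: "z \<in> U - C" "(z, proj_class (gvec z)) \<in> nonvanishing U r F"
    by (auto simp: graph_def)
  then have "F z (gvec z) \<noteq> 0" using nonvanishing_proj_class[OF F gvec_homogeneous] by blast
  then show False using ij by (simp add: F_def gvec_def)
qed

text \<open>Together with \<open>GC_relation\<close> this describes the closure by the relations
  alone, so that points of the blowing-up can be exhibited by checking equations. Off
  \<open>C\<close> the relations force the point onto the graph; over \<open>C\<close> they are
  void, and arcs are needed.\<close>

lemma GC_I:
  assumes y: "y \<in> U" and \<xi>: "homogeneous_vector r \<xi>"
    and rel: "\<And>i j. i \<le> r \<Longrightarrow> j \<le> r \<Longrightarrow> g i y * \<xi> j = g j y * \<xi> i"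
  shows "(y, proj_class \<xi>) \<in> GC"
proof (cases "y \<in> C")
  case False
  obtain j where j: "j \<le> r" "\<xi> j \<noteq> 0" using \<xi> by (auto simp: homogeneous_vector_def)
  have eq: "gvec y = (\<lambda>i. (g j y / \<xi> j) * \<xi> i)"
    using rel[OF _ j(1)] \<xi> j(2) by (auto simp: gvec_def homogeneous_vector_def fun_eq_iff field_simps)
  have "g j y / \<xi> j \<noteq> 0"
    using gvec_homogeneous[OF y False] eq by (auto simp: homogeneous_vector_def)
  then have "proj_class (gvec y) = proj_class \<xi>" unfolding eq by (rule proj_class_scale)
  then have "(y, proj_class \<xi>) \<in> graph" using y False by (auto simp: graph_def)
  then show ?thesis using graph_subset_GC by blast
next
  case True
  have gy: "g i y = 0" if "i \<le> r" for i using mem_C_iff[OF y] True that by blast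
  obtain \<gamma> where \<gamma>: "holomorphic_arc M \<gamma>" "\<gamma> 0 = y"
    and ev: "eventually (\<lambda>t. \<forall>i\<le>r. g i (\<gamma> t) = g i y + \<xi> i * t) (nhds 0)"
    by (rule arc[OF y, of "\<lambda>i t. \<xi> i * t"]) (auto intro: holomorphic_intros)
  show ?thesis
    unfolding GC_def in_closure_of
  proof (intro conjI allI impI)
    show "(y, proj_class \<xi>) \<in> topspace (zar TP)"
      using y proj_class_space[OF \<xi>] by (simp add: topspace_TP)
    fix T assume T: "(y, proj_class \<xi>) \<in> T \<and> openin (zar TP) T"
    then have T': "openin (zar TP) T" "(y, proj_class \<xi>) \<in> T" by auto
    obtain V d F where V: "openin (zar M) V" "V \<subseteq> U" and F: "form M V r d F"
      and p: "(y, proj_class \<xi>) \<in> nonvanishing V r F" and sub: "nonvanishing V r F \<subseteq> T"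
      by (rule TP_basis[OF T'])
    have yV: "\<gamma> 0 \<in> V" "F (\<gamma> 0) \<xi> \<noteq> 0" using p nonvanishing_proj_class[OF F \<xi>] \<gamma>(2) by auto
    have "eventually (\<lambda>t. \<gamma> t \<in> V) (nhds 0)" by (rule M.holomorphic_arc_near[OF \<gamma>(1) V(1) yV(1)])
    moreover have "eventually (\<lambda>t. F (\<gamma> t) \<xi> \<noteq> 0) (nhds 0)"
      by (rule M.form_arc_nonzero[where \<xi> = "\<lambda>_. \<xi>", OF \<gamma>(1) V(1) yV(1) _ F yV(2)])
         (auto intro: holomorphic_intros)
    ultimately have "eventually (\<lambda>t. \<gamma> t \<in> V \<and> F (\<gamma> t) \<xi> \<noteq> 0 \<and>
        (\<forall>i\<le>r. g i (\<gamma> t) = g i y + \<xi> i * t)) (nhds 0)"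
      using ev by eventually_elim auto
    then have "eventually (\<lambda>t. t \<noteq> 0 \<longrightarrow> \<gamma> t \<in> V \<and> F (\<gamma> t) \<xi> \<noteq> 0 \<and>
        (\<forall>i\<le>r. g i (\<gamma> t) = g i y + \<xi> i * t)) (nhds 0)"
      by eventually_elim auto
    then have "eventually (\<lambda>t. \<gamma> t \<in> V \<and> F (\<gamma> t) \<xi> \<noteq> 0 \<and>
        (\<forall>i\<le>r. g i (\<gamma> t) = g i y + \<xi> i * t)) (at 0)"
      by (simp add: eventually_at_filter)
    then have "eventually (\<lambda>t. t \<noteq> 0 \<and> \<gamma> t \<in> V \<and> F (\<gamma> t) \<xi> \<noteq> 0 \<and>
        (\<forall>i\<le>r. g i (\<gamma> t) = g i y + \<xi> i * t)) (at 0)"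
      by (simp add: eventually_conj_iff eventually_neq_at_within)
    from eventually_happens[OF this] obtain t where t: "t \<noteq> 0" "\<gamma> t \<in> V" "F (\<gamma> t) \<xi> \<noteq> 0"
      "\<forall>i\<le>r. g i (\<gamma> t) = g i y + \<xi> i * t" by auto
    have "gvec (\<gamma> t) = (\<lambda>i. t * \<xi> i)"
      using t(4) gy \<xi> by (auto simp: gvec_def homogeneous_vector_def)
    then have cl: "proj_class (gvec (\<gamma> t)) = proj_class \<xi>" using proj_class_scale[OF t(1)] by simp
    obtain i where "i \<le> r" "\<xi> i \<noteq> 0" using \<xi> by (auto simp: homogeneous_vector_def)
    then have "\<gamma> t \<notin> C" using mem_C_iff[of "\<gamma> t"] t V(2) gy by auto
    then have "(\<gamma> t, proj_class \<xi>) \<in> graph" using cl t(2) V(2) by (auto simp: graph_def)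
    moreover have "(\<gamma> t, proj_class \<xi>) \<in> nonvanishing V r F"
      unfolding nonvanishing_proj_class[OF F \<xi>] using t by simp
    ultimately show "\<exists>y. y \<in> graph \<and> y \<in> T" using sub by blast
  qed
qed

section \<open>Homogeneous coordinates on the blowing-up\<close>

lemma openU': "openin (zar M') U'"
  unfolding U'_def using \<sigma> openU unfolding morphism_def by (blast intro: openin_continuous_map_preimage)

lemma \<theta>_morphism: "morphism (induced M' U') (induced TP GC) \<theta>"
  using \<theta> by (simp only: graph_closure_eq U'_def)

lemma \<theta>'_morphism: "morphism (induced TP GC) (induced M' U') \<theta>'"
  using \<theta>' by (simp only: graph_closure_eq U'_def)

lemma topspace_induced_U': "topspace (zar (induced M' U')) = U'"
  by (rule topspace_induced_open[OF openU'])

lemma \<theta>_continuous: "continuous_map (zar (induced M' U')) (zar (induced TP GC)) \<theta>"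
  using \<theta>_morphism by (simp only: morphism_def)

lemma \<theta>'_continuous: "continuous_map (zar (induced TP GC)) (zar (induced M' U')) \<theta>'"
  using \<theta>'_morphism by (simp only: morphism_def)

lemma \<theta>_mem: "x \<in> U' \<Longrightarrow> \<theta> x \<in> GC"
  using continuous_map_image_subset_topspace[OF \<theta>_continuous]
  unfolding topspace_GC topspace_induced_U' by blast

lemma \<theta>'_mem: "p \<in> GC \<Longrightarrow> \<theta>' p \<in> U'"
  using continuous_map_image_subset_topspace[OF \<theta>'_continuous]
  unfolding topspace_GC topspace_induced_U' by blast

lemma \<theta>'_\<theta>: "x \<in> U' \<Longrightarrow> \<theta>' (\<theta> x) = x"
  using \<theta>'\<theta> by (simp add: U'_def)

lemma \<theta>_\<theta>': "p \<in> GC \<Longrightarrow> \<theta> (\<theta>' p) = p"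
  using \<theta>\<theta>'[unfolded graph_closure_eq topspace_GC] .

lemma fst_\<theta>: "x \<in> U' \<Longrightarrow> fst (\<theta> x) = \<sigma> x"
  using fst\<theta> by (simp add: U'_def)

lemma \<sigma>_U: "x \<in> U' \<Longrightarrow> \<sigma> x \<in> U"
  by (simp add: U'_def)

lemma U'_topspace: "x \<in> U' \<Longrightarrow> x \<in> topspace (zar M')"
  by (simp add: U'_def)

definition hom :: "'b \<Rightarrow> nat \<Rightarrow> complex" where "hom x = (SOME \<xi>. \<xi> \<in> snd (\<theta> x))"

lemma hom:
  assumes "x \<in> U'"
  shows "homogeneous_vector r (hom x)" "\<theta> x = (\<sigma> x, proj_class (hom x))"
proof -
  have "snd (\<theta> x) \<in> proj_space r" using \<theta>_mem[OF assms] GC_subset by auto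
  then obtain \<xi> where \<xi>: "homogeneous_vector r \<xi>" "snd (\<theta> x) = proj_class \<xi>" by (rule proj_spaceE)
  have "hom x \<in> snd (\<theta> x)" unfolding hom_def using \<xi>(2) proj_class_self by (metis someI)
  then obtain c where c: "c \<noteq> 0" "hom x = (\<lambda>i. c * \<xi> i)" unfolding \<xi>(2) by (rule proj_class_memE)
  then show "homogeneous_vector r (hom x)" using \<xi>(1) homogeneous_vector_scale by simp
  show "\<theta> x = (\<sigma> x, proj_class (hom x))"
    using proj_class_scale[OF c(1), of \<xi>] c(2) \<xi>(2) fst_\<theta>[OF assms] by (metis prod.collapse)
qed

definition chart :: "nat \<Rightarrow> 'b set" where "chart j = {x \<in> U'. hom x j \<noteq> 0}"

definition q :: "nat \<Rightarrow> 'b \<Rightarrow> nat \<Rightarrow> complex" where "q j x i = hom x i / hom x j"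

lemma chart_exists: "x \<in> U' \<Longrightarrow> \<exists>j\<le>r. x \<in> chart j"
  using hom(1) unfolding homogeneous_vector_def chart_def by blast

lemma chart_U': "x \<in> chart j \<Longrightarrow> x \<in> U'"
  by (simp add: chart_def)

lemma q_homogeneous:
  assumes "x \<in> chart j"
  shows "homogeneous_vector r (q j x)" "\<theta> x = (\<sigma> x, proj_class (q j x))" "q j x j = 1"
proof -
  have eq: "q j x = (\<lambda>i. inverse (hom x j) * hom x i)" by (simp add: q_def fun_eq_iff divide_inverse mult.commute)
  have nz: "inverse (hom x j) \<noteq> 0" using assms by (simp add: chart_def)
  show "homogeneous_vector r (q j x)"
    unfolding eq homogeneous_vector_scale[OF nz] by (rule hom(1)[OF chart_U'[OF assms]])
  show "\<theta> x = (\<sigma> x, proj_class (q j x))"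
    unfolding eq proj_class_scale[OF nz] by (rule hom(2)[OF chart_U'[OF assms]])
  show "q j x j = 1" using assms by (simp add: q_def chart_def)
qed

lemma q_eqI:
  assumes x: "x \<in> U'" and eq: "\<theta> x = (y, proj_class \<xi>)" and j: "\<xi> j \<noteq> 0"
  shows "x \<in> chart j" "q j x i = \<xi> i / \<xi> j"
proof -
  have "hom x \<in> proj_class \<xi>" using hom(2)[OF x] eq proj_class_self by (metis snd_conv)
  then obtain c where "c \<noteq> 0" "hom x = (\<lambda>i. c * \<xi> i)" by (rule proj_class_memE)
  then show "x \<in> chart j" "q j x i = \<xi> i / \<xi> j" using x j by (auto simp: chart_def q_def)
qed

lemma q_relation: "x \<in> chart j \<Longrightarrow> i \<le> r \<Longrightarrow> j \<le> r \<Longrightarrow> g i (\<sigma> x) = q j x i * g j (\<sigma> x)"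
  using GC_relation[of "\<sigma> x" "q j x" i j] q_homogeneous[of x j] \<theta>_mem[OF chart_U'[of x j]]
  by (simp add: mult.commute)

lemma point:
  assumes "y \<in> U" "homogeneous_vector r \<xi>" "\<And>i j. i \<le> r \<Longrightarrow> j \<le> r \<Longrightarrow> g i y * \<xi> j = g j y * \<xi> i"
  shows "\<theta>' (y, proj_class \<xi>) \<in> U'" "\<sigma> (\<theta>' (y, proj_class \<xi>)) = y" "\<theta> (\<theta>' (y, proj_class \<xi>)) = (y, proj_class \<xi>)"
proof -
  have p: "(y, proj_class \<xi>) \<in> GC" by (rule GC_I[OF assms])
  show 1: "\<theta>' (y, proj_class \<xi>) \<in> U'" by (rule \<theta>'_mem[OF p])
  show 2: "\<theta> (\<theta>' (y, proj_class \<xi>)) = (y, proj_class \<xi>)" by (rule \<theta>_\<theta>'[OF p])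
  show "\<sigma> (\<theta>' (y, proj_class \<xi>)) = y" using fst_\<theta>[OF 1] 2 by simp
qed

lemma chart_open: "j \<le> r \<Longrightarrow> openin (zar M') (chart j)"
proof -
  assume j: "j \<le> r"
  have F: "form M U r (Suc 0) (\<lambda>x \<xi>. \<xi> j)" by (rule M.form_coordinate[OF openU j])
  have "openin (zar (induced TP GC)) (nonvanishing U r (\<lambda>x \<xi>. \<xi> j) \<inter> GC)"
    using TP_basic_open[OF openU order_refl F] by (auto simp: openin_subtopology)
  from openin_continuous_map_preimage[OF \<theta>_continuous this]
  have "openin (zar (induced M' U')) {x \<in> U'. \<theta> x \<in> nonvanishing U r (\<lambda>x \<xi>. \<xi> j) \<inter> GC}"
    unfolding topspace_induced_U' .
  then have "openin (zar M') {x \<in> U'. \<theta> x \<in> nonvanishing U r (\<lambda>x \<xi>. \<xi> j) \<inter> GC}"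
    using openU' by (simp add: openin_open_subtopology)
  moreover have "{x \<in> U'. \<theta> x \<in> nonvanishing U r (\<lambda>x \<xi>. \<xi> j) \<inter> GC} = chart j"
    using \<theta>_mem \<sigma>_U hom nonvanishing_proj_class[OF F hom(1)] by (auto simp: chart_def)
  ultimately show ?thesis by simp
qed

text \<open>A quotient of homogeneous coordinates becomes a function on the product by choosing a
  representative of each class, and the choice cancels. Pulling it back along
  \<open>\<theta>\<close> gives the regular function on the chart.\<close>

lemma q_reg:
  assumes j: "j \<le> r" and i: "i \<le> r"
  shows "(\<lambda>x. q j x i) \<in> reg M' (chart j)"
proof -
  define \<Xi> where "\<Xi> = (\<lambda>(y::'a, l). (SOME \<xi>. \<xi> \<in> l) i / (SOME \<xi>. \<xi> \<in> (l :: (nat \<Rightarrow> complex) set)) j :: complex)"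
  define N where "N = nonvanishing U r (\<lambda>(x::'a) \<xi>. \<xi> j)"
  have F: "form M U r (Suc 0) (\<lambda>x \<xi>. \<xi> j)" by (rule M.form_coordinate[OF openU j])
  have G: "form M U r (Suc 0) (\<lambda>x \<xi>. \<xi> i)" by (rule M.form_coordinate[OF openU i])
  have FG: "form (induced M U) U r (Suc 0) (\<lambda>x \<xi>. \<xi> j)" "form (induced M U) U r (Suc 0) (\<lambda>x \<xi>. \<xi> i)"
    using F G form_induced_U[OF openU order_refl] by auto
  have N: "openin (zar TP) N" unfolding N_def by (rule TP_basic_open[OF openU order_refl F])
  have val: "\<Xi> (y, l) = \<xi> i / \<xi> j" if "(y, l) \<in> N" "\<xi> \<in> l" for y l \<xi>
  proof -
    have \<xi>l: "\<xi> \<in> l" by (rule that(2))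
    have "l \<in> proj_space r" using that by (simp add: N_def nonvanishing_def)
    then obtain \<eta> where \<eta>: "l = proj_class \<eta>" by (rule proj_spaceE)
    have "(SOME \<xi>. \<xi> \<in> l) \<in> l" by (rule someI[of "\<lambda>\<xi>. \<xi> \<in> l", OF that(2)])
    then obtain c where c: "c \<noteq> 0" "(SOME \<xi>. \<xi> \<in> l) = (\<lambda>i. c * \<eta> i)"
      unfolding \<eta> by (rule proj_class_memE)
    obtain c' where c': "c' \<noteq> 0" "\<xi> = (\<lambda>i. c' * \<eta> i)" using \<xi>l unfolding \<eta> by (rule proj_class_memE)
    show ?thesis using c c' by (simp add: \<Xi>_def)
  qed
  have "\<Xi> \<in> reg TP N"
    unfolding TP_def times_proj_def
  proof (simp, intro ballI)
    fix p assume p: "p \<in> N"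
    have "\<forall>(y, l) \<in> N \<inter> nonvanishing U r (\<lambda>x \<xi>. \<xi> j). \<forall>\<xi>\<in>l. \<Xi> (y, l) = \<xi> i / \<xi> j"
      using val by auto
    then show "\<exists>V. openin (subtopology (zar M) U) V \<and> (\<exists>d F. form (induced M U) V r d F \<and> (\<exists>G. form (induced M U) V r d G \<and>
           p \<in> nonvanishing V r G \<and> (\<forall>x\<in>N \<inter> nonvanishing V r G. case x of (y, l) \<Rightarrow> \<forall>\<xi>\<in>l. \<Xi> (y, l) = F y \<xi> / G y \<xi>)))"
      using p FG openU
      by (intro exI[of _ U] conjI exI[of _ "Suc 0"] exI[of _ "\<lambda>x \<xi>. \<xi> i"] exI[of _ "\<lambda>x \<xi>. \<xi> j"])
         (auto simp: N_def openin_open_subtopology)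
  qed
  then have "\<Xi> \<in> reg (induced TP GC) (N \<inter> GC)" using N by (intro reg_imp_reg_induced[of _ _ N]) auto
  moreover have "openin (zar (induced TP GC)) (N \<inter> GC)" using N by (auto simp: openin_subtopology)
  ultimately have "\<Xi> \<circ> \<theta> \<in> reg (induced M' U') {x \<in> topspace (zar (induced M' U')). \<theta> x \<in> N \<inter> GC}"
    using \<theta>_morphism unfolding morphism_def by blast
  also have "{x \<in> topspace (zar (induced M' U')). \<theta> x \<in> N \<inter> GC} = chart j"
    unfolding topspace_induced_U' N_def
    using \<theta>_mem \<sigma>_U hom nonvanishing_proj_class[OF F hom(1)] by (auto simp: chart_def)
  also have "reg (induced M' U') (chart j) = reg M' (chart j)"
    by (rule reg_induced_open[OF M'.sheaf openU' chart_open[OF j]])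
  finally have "\<Xi> \<circ> \<theta> \<in> reg M' (chart j)" .
  then show ?thesis
  proof (rule function_sheaf_cong[OF M'.sheaf chart_open[OF j]])
    fix x assume x: "x \<in> chart j"
    have "\<Xi> (\<theta> x) = (SOME \<xi>. \<xi> \<in> snd (\<theta> x)) i / (SOME \<xi>. \<xi> \<in> snd (\<theta> x)) j"
      by (simp add: \<Xi>_def split_beta)
    then show "(\<Xi> \<circ> \<theta>) x = q j x i" by (simp add: q_def hom_def)
  qed
qed

lemma \<sigma>_open: "openin (zar M) V \<Longrightarrow> openin (zar M') {x \<in> chart j. \<sigma> x \<in> V}" if "j \<le> r"
proof -
  assume "openin (zar M) V"
  then have "openin (zar M') {x \<in> topspace (zar M'). \<sigma> x \<in> V}"
    using \<sigma> unfolding morphism_def by (blast intro: openin_continuous_map_preimage)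
  then have "openin (zar M') ({x \<in> topspace (zar M'). \<sigma> x \<in> V} \<inter> chart j)" using chart_open[OF that] by blast
  moreover have "{x \<in> topspace (zar M'). \<sigma> x \<in> V} \<inter> chart j = {x \<in> chart j. \<sigma> x \<in> V}"
    using U'_topspace chart_U' by auto
  ultimately show ?thesis by simp
qed

section \<open>Regular functions of a chart as quotients of forms\<close>

lemma form_reg:
  assumes j: "j \<le> r" and V: "openin (zar M) V" and F: "form M V r d F"
  shows "(\<lambda>x. F (\<sigma> x) (q j x)) \<in> reg M' {x \<in> chart j. \<sigma> x \<in> V}"
  using F
proof induction
  case (coeff a)
  then have a: "a \<circ> \<sigma> \<in> reg M' {x \<in> topspace (zar M'). \<sigma> x \<in> V}"
    using \<sigma> V unfolding morphism_def by blast
  have "openin (zar M') {x \<in> topspace (zar M'). \<sigma> x \<in> V}"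
    using \<sigma> V unfolding morphism_def by (blast intro: openin_continuous_map_preimage)
  from M'.reg_restrict[OF this \<sigma>_open[OF j V] _ a] show ?case
    using U'_topspace chart_U' by (auto simp: o_def)
next
  case (coord d F i)
  have "(\<lambda>x. q j x i) \<in> reg M' {x \<in> chart j. \<sigma> x \<in> V}"
    by (rule M'.reg_restrict[OF chart_open[OF j] \<sigma>_open[OF j V] _ q_reg[OF j coord.hyps(2)]]) auto
  from M'.reg_mult[OF \<sigma>_open[OF j V] this coord.IH] show ?case .
next
  case (add d F G)
  from M'.reg_add[OF \<sigma>_open[OF j V] add.IH] show ?case .
qed

text \<open>The trace on a chart of a basic open set of the product, with the form evaluated at
  normalised coordinates. These sets are the neighbourhoods on which germs get an explicit
  formula.\<close>

definition box :: "nat \<Rightarrow> 'a set \<Rightarrow> ('a \<Rightarrow> (nat \<Rightarrow> complex) \<Rightarrow> complex) \<Rightarrow> 'b set" where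
  "box j V H = {x \<in> chart j. \<sigma> x \<in> V \<and> H (\<sigma> x) (q j x) \<noteq> 0}"

lemma box_open:
  assumes "j \<le> r" "openin (zar M) V" "form M V r d H"
  shows "openin (zar M') (box j V H)"
proof -
  have "box j V H = {x \<in> {x \<in> chart j. \<sigma> x \<in> V}. H (\<sigma> x) (q j x) \<noteq> 0}" by (auto simp: box_def)
  then show ?thesis using M'.open_nonzero[OF \<sigma>_open[OF assms(1,2)] form_reg[OF assms]] by simp
qed

lemma nonvanishing_q:
  assumes "form M V r d F" "x \<in> chart j"
  shows "\<theta> x \<in> nonvanishing V r F \<longleftrightarrow> \<sigma> x \<in> V \<and> F (\<sigma> x) (q j x) \<noteq> 0"
  using nonvanishing_proj_class[OF assms(1) q_homogeneous(1)[OF assms(2)]] q_homogeneous(2)[OF assms(2)]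
  by simp

text \<open>Transport to the graph closure and the definition of \<open>times_proj\<close> turn a
  regular function into a fraction of two forms of equal degree. The extra form \<open>H\<close>
  cuts out a neighbourhood that lies in \<open>W\<close> and on which this fraction is valid; later
  arguments extend identities by multiplying with \<open>H\<close>.\<close>

lemma local_form:
  assumes j: "j \<le> r" and x: "x \<in> chart j" "x \<in> W" and W: "openin (zar M') W" and f: "f \<in> reg M' W"
  obtains V d F G e H where "openin (zar M) V" "V \<subseteq> U" "form M V r d F" "form M V r d G" "form M V r e H"
    "x \<in> box j V H" "box j V H \<subseteq> W"
    "\<forall>y\<in>box j V H. G (\<sigma> y) (q j y) \<noteq> 0 \<and> f y = F (\<sigma> y) (q j y) / G (\<sigma> y) (q j y)"
proof -
  have WU: "openin (zar M') (W \<inter> U')" using W openU' by blast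
  have "f \<in> reg (induced M' U') (W \<inter> U')" by (rule reg_imp_reg_induced[OF f W]) auto
  moreover have oWU: "openin (zar (induced M' U')) (W \<inter> U')"
    using WU openU' by (simp add: openin_open_subtopology)
  ultimately have "f \<circ> \<theta>' \<in> reg (induced TP GC) {p \<in> topspace (zar (induced TP GC)). \<theta>' p \<in> W \<inter> U'}"
    using \<theta>'_morphism unfolding morphism_def by blast
  then have f': "f \<circ> \<theta>' \<in> reg (induced TP GC) {p \<in> GC. \<theta>' p \<in> W \<inter> U'}" unfolding topspace_GC .
  have xU: "x \<in> U'" using chart_U'[OF x(1)] .
  have \<theta>x: "\<theta> x \<in> {p \<in> GC. \<theta>' p \<in> W \<inter> U'}" using \<theta>_mem[OF xU] \<theta>'_\<theta>[OF xU] x xU by simp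
  obtain T h where T: "openin (zar TP) T" "\<theta> x \<in> T" "h \<in> reg TP T"
    and fh: "\<forall>p\<in>T \<inter> {p \<in> GC. \<theta>' p \<in> W \<inter> U'}. (f \<circ> \<theta>') p = h p"
    using f' \<theta>x unfolding reg_induced_iff by blast
  obtain V1 d F G where V1: "openin (zar (induced M U)) V1" and FG: "form (induced M U) V1 r d F" "form (induced M U) V1 r d G"
    and nv: "\<theta> x \<in> nonvanishing V1 r G"
    and hq: "\<forall>(y, l) \<in> T \<inter> nonvanishing V1 r G. \<forall>\<xi>\<in>l. h (y, l) = F y \<xi> / G y \<xi>"
    using T(2,3) unfolding TP_def times_proj_def by auto
  have V1': "openin (zar M) V1" "V1 \<subseteq> U" using V1 openin_induced_U by auto
  have FG': "form M V1 r d F" "form M V1 r d G" using FG form_induced_U[OF V1'] by auto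
  have "openin (zar (induced TP GC)) {p \<in> topspace (zar (induced TP GC)). \<theta>' p \<in> W \<inter> U'}"
    using \<theta>'_morphism oWU unfolding morphism_def by (blast intro: openin_continuous_map_preimage)
  then obtain T2 where T2: "openin (zar TP) T2" "{p \<in> GC. \<theta>' p \<in> W \<inter> U'} = T2 \<inter> GC"
    unfolding topspace_GC by (auto simp: openin_subtopology)
  have "openin (zar TP) (T \<inter> T2 \<inter> nonvanishing V1 r G)"
    using T T2 TP_basic_open[OF V1' FG'(2)] by blast
  moreover have "\<theta> x \<in> T \<inter> T2 \<inter> nonvanishing V1 r G" using T T2 nv \<theta>x by blast
  ultimately obtain V2 e H where V2: "openin (zar M) V2" "V2 \<subseteq> U" and H: "form M V2 r e H"
    and xH: "\<theta> x \<in> nonvanishing V2 r H" and sub: "nonvanishing V2 r H \<subseteq> T \<inter> T2 \<inter> nonvanishing V1 r G"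
    by (rule TP_basis)
  have V: "openin (zar M) (V1 \<inter> V2)" "V1 \<inter> V2 \<subseteq> U" using V1' V2 by auto
  have nvbox: "\<theta> y \<in> nonvanishing V2 r H" if "y \<in> box j (V1 \<inter> V2) H" for y
    using that nonvanishing_q[OF H] by (auto simp: box_def)
  show ?thesis
  proof (rule that[OF V])
    show "form M (V1 \<inter> V2) r d F" "form M (V1 \<inter> V2) r d G" "form M (V1 \<inter> V2) r e H"
      using M.form_restrict[OF FG'(1) V1'(1) V(1)] M.form_restrict[OF FG'(2) V1'(1) V(1)]
        M.form_restrict[OF H V2(1) V(1)] by auto
    have "\<sigma> x \<in> V1" using nv nonvanishing_q[OF FG'(2) x(1)] by blast
    then show "x \<in> box j (V1 \<inter> V2) H"
      using xH nonvanishing_q[OF H x(1)] x(1) by (simp add: box_def)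
    show "box j (V1 \<inter> V2) H \<subseteq> W"
    proof
      fix y assume y: "y \<in> box j (V1 \<inter> V2) H"
      then have yU: "y \<in> U'" using chart_U'[of y j] by (simp add: box_def)
      then have "\<theta> y \<in> T2 \<inter> GC" using nvbox[OF y] sub \<theta>_mem by blast
      then have "\<theta>' (\<theta> y) \<in> W" using T2(2) by blast
      then show "y \<in> W" using \<theta>'_\<theta>[OF yU] by simp
    qed
    show "\<forall>y\<in>box j (V1 \<inter> V2) H. G (\<sigma> y) (q j y) \<noteq> 0 \<and> f y = F (\<sigma> y) (q j y) / G (\<sigma> y) (q j y)"
    proof
      fix y assume y: "y \<in> box j (V1 \<inter> V2) H"
      then have yc: "y \<in> chart j" by (simp add: box_def)
      then have yU: "y \<in> U'" using chart_U' by blast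
      have mem: "\<theta> y \<in> T \<inter> T2 \<inter> nonvanishing V1 r G" using nvbox[OF y] sub by blast
      have ty: "\<theta> y = (\<sigma> y, proj_class (q j y))" by (rule q_homogeneous(2)[OF yc])
      have "G (\<sigma> y) (q j y) \<noteq> 0" using mem nonvanishing_q[OF FG'(2) yc] by blast
      moreover have "\<theta> y \<in> T \<inter> {p \<in> GC. \<theta>' p \<in> W \<inter> U'}" using mem T2(2) \<theta>_mem[OF yU] by blast
      then have "f y = h (\<theta> y)" using fh \<theta>'_\<theta>[OF yU] by force
      moreover have "h (\<theta> y) = F (\<sigma> y) (q j y) / G (\<sigma> y) (q j y)"
        using hq mem proj_class_self[of "q j y"] unfolding ty by blast
      ultimately show "G (\<sigma> y) (q j y) \<noteq> 0 \<and> f y = F (\<sigma> y) (q j y) / G (\<sigma> y) (q j y)" by simp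
    qed
  qed
qed

text \<open>The lift is the arc of pairs of \<open>\<gamma> t\<close> and the class of
  \<open>\<xi> t\<close>, carried over by \<open>\<theta>'\<close>. Regular functions are fractions
  of forms of equal degree, so they may be evaluated at \<open>\<xi> t\<close> instead of the
  normalised coordinates, and the values are quotients of holomorphic functions of
  \<open>t\<close>.\<close>

lemma lift_arc:
  assumes \<gamma>: "holomorphic_arc M \<gamma>" "\<gamma> 0 \<in> U"
    and \<xi>: "\<And>i. i \<le> r \<Longrightarrow> (\<lambda>t. \<xi> t i) holomorphic_on UNIV" "\<And>t i. i > r \<Longrightarrow> \<xi> t i = 0"
      "homogeneous_vector r (\<xi> 0)"
    and rel: "eventually (\<lambda>t. \<forall>i\<le>r. \<forall>k\<le>r. g i (\<gamma> t) * \<xi> t k = g k (\<gamma> t) * \<xi> t i) (nhds 0)"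
  obtains \<gamma>' where "arc_lift M M' \<sigma> \<gamma> \<gamma>'" "\<gamma>' 0 \<in> U'"
    "eventually (\<lambda>t. \<gamma>' t \<in> U' \<and> \<theta> (\<gamma>' t) = (\<gamma> t, proj_class (\<xi> t))) (nhds 0)"
proof -
  define \<gamma>' where "\<gamma>' = (\<lambda>t. \<theta>' (\<gamma> t, proj_class (\<xi> t)))"
  have isC: "isCont (\<lambda>t. \<xi> t i) 0" if "i \<le> r" for i
    using holomorphic_on_imp_continuous_on[OF \<xi>(1)[OF that]] by (simp add: continuous_on_eq_continuous_at)
  have evnz: "eventually (\<lambda>t. \<xi> t i \<noteq> 0) (nhds 0)" if "i \<le> r" "\<xi> 0 i \<noteq> 0" for i
    using tendsto_at_iff_tendsto_nhds[of "\<lambda>t. \<xi> t i" 0] isC[OF that(1)] that(2)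
    by (simp add: isCont_def tendsto_imp_eventually_ne)
  have pt: "\<gamma>' t \<in> U' \<and> \<theta> (\<gamma>' t) = (\<gamma> t, proj_class (\<xi> t)) \<and> \<sigma> (\<gamma>' t) = \<gamma> t"
    if "\<gamma> t \<in> U" "homogeneous_vector r (\<xi> t)" "\<forall>i\<le>r. \<forall>k\<le>r. g i (\<gamma> t) * \<xi> t k = g k (\<gamma> t) * \<xi> t i" for t
    using point[OF that(1,2)] that(3) by (simp add: \<gamma>'_def)
  obtain j where j: "j \<le> r" "\<xi> 0 j \<noteq> 0" using \<xi>(3) by (auto simp: homogeneous_vector_def)
  have "eventually (\<lambda>t. \<gamma> t \<in> U) (nhds 0)" by (rule M.holomorphic_arc_near[OF \<gamma>(1) openU \<gamma>(2)])
  with evnz[OF j] rel have ev: "eventually (\<lambda>t. \<xi> t j \<noteq> 0 \<and> \<gamma>' t \<in> U' \<and> \<theta> (\<gamma>' t) = (\<gamma> t, proj_class (\<xi> t)) \<and> \<sigma> (\<gamma>' t) = \<gamma> t) (nhds 0)"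
  proof eventually_elim
    case (elim t)
    have "homogeneous_vector r (\<xi> t)"
      using \<xi>(2) elim(1) j(1) by (auto simp: homogeneous_vector_def)
    then show ?case using pt[OF elim(3)] elim by blast
  qed
  have at0: "\<gamma>' 0 \<in> U'" "\<theta> (\<gamma>' 0) = (\<gamma> 0, proj_class (\<xi> 0))" "\<sigma> (\<gamma>' 0) = \<gamma> 0"
    using eventually_nhds_x_imp_x[OF ev] by auto
  have c0: "\<gamma>' 0 \<in> chart j" by (rule q_eqI(1)[OF at0(1,2) j(2)])
  have arc': "holomorphic_arc M' \<gamma>'"
    unfolding holomorphic_arc_def
  proof (intro conjI allI impI)
    show "\<gamma>' 0 \<in> topspace (zar M')" using at0(1) U'_topspace by blast
    fix W f assume "openin (zar M') W \<and> \<gamma>' 0 \<in> W \<and> f \<in> reg M' W"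
    then have W: "openin (zar M') W" "\<gamma>' 0 \<in> W" "f \<in> reg M' W" by auto
    obtain V d F G e H where V: "openin (zar M) V" "V \<subseteq> U" and F: "form M V r d F" and G: "form M V r d G"
      and H: "form M V r e H" and inb: "\<gamma>' 0 \<in> box j V H" and sub: "box j V H \<subseteq> W"
      and val: "\<forall>y\<in>box j V H. G (\<sigma> y) (q j y) \<noteq> 0 \<and> f y = F (\<sigma> y) (q j y) / G (\<sigma> y) (q j y)"
      by (rule local_form[OF j(1) c0 W(2,1,3)])
    have \<gamma>V: "\<gamma> 0 \<in> V" using inb at0(3) by (simp add: box_def)
    have scale: "A (\<gamma> t) (\<xi> t) = \<xi> t j ^ b * A (\<gamma> t) (q j (\<gamma>' t))"
      if "form M V r b A" "\<xi> t j \<noteq> 0" "\<gamma>' t \<in> U'" "\<theta> (\<gamma>' t) = (\<gamma> t, proj_class (\<xi> t))" for A b t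
    proof -
      have "q j (\<gamma>' t) i = \<xi> t i / \<xi> t j" for i using q_eqI(2)[OF that(3,4,2)] .
      then have "\<xi> t = (\<lambda>i. \<xi> t j * q j (\<gamma>' t) i)" using that(2) by (simp add: fun_eq_iff)
      then have "A (\<gamma> t) (\<xi> t) = A (\<gamma> t) (\<lambda>i. \<xi> t j * q j (\<gamma>' t) i)" by simp
      then show ?thesis using form_homogeneous[OF that(1)] by simp
    qed
    have "H (\<gamma> 0) (\<xi> 0) \<noteq> 0"
      using scale[OF H j(2) at0(1,2)] inb at0(3) j(2) by (simp add: box_def)
    then have "eventually (\<lambda>t. H (\<gamma> t) (\<xi> t) \<noteq> 0) (nhds 0)"
      using M.form_arc_nonzero[where \<xi> = \<xi>, OF \<gamma>(1) V(1) \<gamma>V \<xi>(1) H] by blast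
    moreover have "eventually (\<lambda>t. \<gamma> t \<in> V) (nhds 0)" by (rule M.holomorphic_arc_near[OF \<gamma>(1) V(1) \<gamma>V])
    ultimately have "eventually (\<lambda>t. \<gamma>' t \<in> W \<and> G (\<gamma> t) (\<xi> t) \<noteq> 0 \<and> f (\<gamma>' t) = F (\<gamma> t) (\<xi> t) / G (\<gamma> t) (\<xi> t)) (nhds 0)"
      using ev
    proof eventually_elim
      case (elim t)
      then have t: "\<xi> t j \<noteq> 0" "\<gamma>' t \<in> U'" "\<theta> (\<gamma>' t) = (\<gamma> t, proj_class (\<xi> t))" "\<sigma> (\<gamma>' t) = \<gamma> t" by auto
      have "\<gamma>' t \<in> box j V H"
        using elim scale[OF H t(1-3)] q_eqI(1)[OF t(2,3,1)] t(4) by (simp add: box_def)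
      then show ?case
        using val sub scale[OF F t(1-3)] scale[OF G t(1-3)] t by auto
    qed
    then obtain e0 where e0: "e0 > 0" "\<And>t. cmod t < e0 \<Longrightarrow> \<gamma>' t \<in> W \<and> G (\<gamma> t) (\<xi> t) \<noteq> 0 \<and> f (\<gamma>' t) = F (\<gamma> t) (\<xi> t) / G (\<gamma> t) (\<xi> t)"
      unfolding eventually_nhds_metric by (auto simp: dist_norm)
    obtain e1 where e1: "e1 > 0" "(\<lambda>t. F (\<gamma> t) (\<xi> t)) holomorphic_on ball 0 e1"
      using M.form_arc_holomorphic[where \<xi> = \<xi>, OF \<gamma>(1) V(1) \<gamma>V \<xi>(1) F] by blast
    obtain e2 where e2: "e2 > 0" "(\<lambda>t. G (\<gamma> t) (\<xi> t)) holomorphic_on ball 0 e2"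
      using M.form_arc_holomorphic[where \<xi> = \<xi>, OF \<gamma>(1) V(1) \<gamma>V \<xi>(1) G] by blast
    define \<epsilon> where "\<epsilon> = min e0 (min e1 e2)"
    have \<epsilon>: "\<epsilon> > 0" "ball 0 \<epsilon> \<subseteq> ball (0::complex) e1" "ball 0 \<epsilon> \<subseteq> ball (0::complex) e2" "\<epsilon> \<le> e0"
      using e0 e1 e2 by (auto simp: \<epsilon>_def)
    have "(\<lambda>t. F (\<gamma> t) (\<xi> t) / G (\<gamma> t) (\<xi> t)) holomorphic_on ball 0 \<epsilon>"
      by (intro holomorphic_on_divide holomorphic_on_subset[OF e1(2) \<epsilon>(2)] holomorphic_on_subset[OF e2(2) \<epsilon>(3)])
         (use e0 \<epsilon> in auto)
    then have "(f \<circ> \<gamma>') holomorphic_on ball 0 \<epsilon>"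
      by (rule holomorphic_transform) (use e0 \<epsilon> in auto)
    then show "\<exists>e>0. \<gamma>' ` ball 0 e \<subseteq> W \<and> (f \<circ> \<gamma>') holomorphic_on ball 0 e"
      using \<epsilon> e0 by (intro exI[of _ \<epsilon>]) auto
  qed
  have "eventually (\<lambda>t. \<sigma> (\<gamma>' t) = \<gamma> t) (nhds 0)" using ev by eventually_elim auto
  then have "\<exists>e>0. \<forall>t\<in>ball 0 e. \<sigma> (\<gamma>' t) = \<gamma> t"
    unfolding eventually_nhds_metric by (auto simp: dist_norm)
  then have "arc_lift M M' \<sigma> \<gamma> \<gamma>'" using \<gamma>(1) arc' by (simp add: arc_lift_def)
  moreover have "eventually (\<lambda>t. \<gamma>' t \<in> U' \<and> \<theta> (\<gamma>' t) = (\<gamma> t, proj_class (\<xi> t))) (nhds 0)"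
    using ev by eventually_elim auto
  ultimately show ?thesis using that at0(1) by blast
qed

text \<open>The common factor \<open>a * t\<close> of the generators cancels in the homogeneous
  coordinates, so \<open>b\<close> governs the homogeneous coordinates of the lifted arc and
  \<open>a\<close> its speed across the exceptional divisor.\<close>

lemma special_arc:
  assumes y: "y \<in> C" "y \<in> U" and \<xi>: "homogeneous_vector r \<xi>"
  obtains \<gamma> \<gamma>' where "arc_lift M M' \<sigma> \<gamma> \<gamma>'" "\<gamma> 0 = y" "\<gamma>' 0 \<in> U'"
    "\<theta> (\<gamma>' 0) = (y, proj_class \<xi>)"
    "eventually (\<lambda>t. (\<forall>i\<le>r. g i (\<gamma> t) = a * t * (\<xi> i + b i * t)) \<and>
       \<gamma>' t \<in> U' \<and> \<theta> (\<gamma>' t) = (\<gamma> t, proj_class (\<lambda>i. if i \<le> r then \<xi> i + b i * t else 0))) (nhds 0)"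
proof -
  obtain \<gamma> where \<gamma>: "holomorphic_arc M \<gamma>" "\<gamma> 0 = y"
    and ev: "eventually (\<lambda>t. \<forall>i\<le>r. g i (\<gamma> t) = g i y + a * t * (\<xi> i + b i * t)) (nhds 0)"
    by (rule arc[OF y(2), of "\<lambda>i t. a * t * (\<xi> i + b i * t)"]) (auto intro!: holomorphic_intros)
  define \<eta> where "\<eta> = (\<lambda>t i. if i \<le> r then \<xi> i + b i * t else 0)"
  have \<eta>0: "\<eta> 0 = \<xi>" using \<xi> by (auto simp: \<eta>_def homogeneous_vector_def fun_eq_iff)
  have ev': "eventually (\<lambda>t. \<forall>i\<le>r. g i (\<gamma> t) = a * t * (\<xi> i + b i * t)) (nhds 0)"
    using ev by eventually_elim (use mem_C_iff[OF y(2)] y(1) in auto)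
  have \<gamma>U: "\<gamma> 0 \<in> U" using \<gamma> y by simp
  have rel: "eventually (\<lambda>t. \<forall>i\<le>r. \<forall>k\<le>r. g i (\<gamma> t) * \<eta> t k = g k (\<gamma> t) * \<eta> t i) (nhds 0)"
    using ev' by eventually_elim (auto simp: \<eta>_def)
  obtain \<gamma>' where \<gamma>': "arc_lift M M' \<sigma> \<gamma> \<gamma>'" "\<gamma>' 0 \<in> U'"
    "eventually (\<lambda>t. \<gamma>' t \<in> U' \<and> \<theta> (\<gamma>' t) = (\<gamma> t, proj_class (\<eta> t))) (nhds 0)"
  proof (rule lift_arc[of \<gamma> \<eta>])
    show "(\<lambda>t. \<eta> t i) holomorphic_on UNIV" if "i \<le> r" for i
      using that by (auto simp: \<eta>_def intro!: holomorphic_intros)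
    show "homogeneous_vector r (\<eta> 0)" using \<xi> \<eta>0 by simp
    show "\<eta> t i = 0" if "r < i" for t i using that by (simp add: \<eta>_def)
  qed (use \<gamma> \<gamma>U rel in auto)
  have "\<theta> (\<gamma>' 0) = (y, proj_class \<xi>)" using eventually_nhds_x_imp_x[OF \<gamma>'(3)] \<gamma>(2) \<eta>0 by simp
  moreover have "eventually (\<lambda>t. (\<forall>i\<le>r. g i (\<gamma> t) = a * t * (\<xi> i + b i * t)) \<and>
       \<gamma>' t \<in> U' \<and> \<theta> (\<gamma>' t) = (\<gamma> t, proj_class (\<lambda>i. if i \<le> r then \<xi> i + b i * t else 0))) (nhds 0)"
    using ev' \<gamma>'(3) by eventually_elim (simp add: \<eta>_def)
  ultimately show ?thesis using that \<gamma>' \<gamma>(2) by blast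
qed

end

section \<open>The exceptional divisor and the strict transforms in a chart\<close>

context blowup_chart
begin

lemma pullback_stalk:
  assumes a: "a \<in> stalk M (\<sigma> x)" and x: "x \<in> topspace (zar M')"
  shows "(\<lambda>y. a (\<sigma> y)) \<in> stalk M' x"
proof -
  obtain V where V: "openin (zar M) V" "\<sigma> x \<in> V" "a \<in> reg M V" by (rule stalkE[OF a])
  have o: "openin (zar M') {y \<in> topspace (zar M'). \<sigma> y \<in> V}"
    using \<sigma> V(1) unfolding morphism_def by (blast intro: openin_continuous_map_preimage)
  have "a \<circ> \<sigma> \<in> reg M' {y \<in> topspace (zar M'). \<sigma> y \<in> V}"
    using \<sigma> V unfolding morphism_def by blast
  then have "a \<circ> \<sigma> \<in> stalk M' x" using stalkI[OF o] x V(2) by blast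
  then show ?thesis by (simp add: o_def)
qed

lemma pullback_eq_near:
  assumes a: "eq_near M (\<sigma> x) a b" and x: "x \<in> topspace (zar M')"
  shows "eq_near M' x (\<lambda>y. a (\<sigma> y)) (\<lambda>y. b (\<sigma> y))"
proof -
  obtain V where V: "openin (zar M) V" "\<sigma> x \<in> V" "\<forall>y\<in>V. a y = b y"
    using a unfolding eq_near_def by blast
  have o: "openin (zar M') {y \<in> topspace (zar M'). \<sigma> y \<in> V}"
    using \<sigma> V(1) unfolding morphism_def by (blast intro: openin_continuous_map_preimage)
  show ?thesis by (rule eq_nearI[OF o]) (use x V in auto)
qed

definition E :: "'b set" where "E = inverse_image M' \<sigma> C"

lemma E_iff: "x \<in> U' \<Longrightarrow> x \<in> E \<longleftrightarrow> \<sigma> x \<in> C"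
  using U'_topspace by (simp add: E_def inverse_image_def)

context
  fixes j x
  assumes j: "j \<le> r" and x: "x \<in> chart j"
begin

lemma chart_nbhd: "openin (zar M') (chart j)" "x \<in> chart j" "x \<in> topspace (zar M')" "x \<in> U'" "\<sigma> x \<in> U"
  using chart_open[OF j] x chart_U' U'_topspace \<sigma>_U by blast+

lemma q_stalk: "i \<le> r \<Longrightarrow> (\<lambda>y. q j y i) \<in> stalk M' x"
  by (rule stalkI[OF chart_nbhd(1,2) q_reg[OF j]])

lemma e_stalk: "i \<le> r \<Longrightarrow> (\<lambda>y. g i (\<sigma> y)) \<in> stalk M' x"
  by (rule pullback_stalk[OF g_stalk[OF _ chart_nbhd(5)] chart_nbhd(3)])

lemma form_stalk:
  assumes "openin (zar M) V" "form M V r d F" "\<sigma> x \<in> V"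
  shows "(\<lambda>y. F (\<sigma> y) (q j y)) \<in> stalk M' x"
  by (rule stalkI[OF \<sigma>_open[OF j assms(1)] _ form_reg[OF j assms(1,2)]]) (use x assms in auto)

lemma q_e_near: "i \<le> r \<Longrightarrow> eq_near M' x (\<lambda>y. g i (\<sigma> y)) (\<lambda>y. q j y i * g j (\<sigma> y))"
  by (rule eq_nearI[OF chart_nbhd(1,2)]) (rule q_relation[OF _ _ j])

lemma e_zero_iff: "\<sigma> x \<in> C \<longleftrightarrow> g j (\<sigma> x) = 0"
proof
  assume "\<sigma> x \<in> C"
  then show "g j (\<sigma> x) = 0" using mem_C_iff[OF chart_nbhd(5)] j by blast
next
  assume 0: "g j (\<sigma> x) = 0"
  have "g i (\<sigma> x) = 0" if "i \<le> r" for i using q_relation[OF x that j] 0 by simp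
  then show "\<sigma> x \<in> C" using mem_C_iff[OF chart_nbhd(5)] by blast
qed

text \<open>The blowing-up is by definition the closure of a graph over the complement of
  \<open>C\<close>, so no nonempty open subset of a chart lies in the exceptional divisor.\<close>

lemma complement_dense:
  assumes W: "openin (zar M') W" "x \<in> W"
  shows "\<exists>y\<in>W \<inter> chart j. \<sigma> y \<notin> C"
proof -
  obtain V d F G e H where V: "openin (zar M) V" "V \<subseteq> U" and "form M V r d F" "form M V r d G"
    and H: "form M V r e H" and xb: "x \<in> box j V H" and sub: "box j V H \<subseteq> W"
    and "\<forall>y\<in>box j V H. G (\<sigma> y) (q j y) \<noteq> 0 \<and> 0 = F (\<sigma> y) (q j y) / G (\<sigma> y) (q j y)"
    by (rule local_form[OF j x W(2,1) M'.reg_const[OF W(1)]])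
  \<comment> \<open>The factor \<open>\<xi> j\<close> forces the graph point that is found into the
    chart \<open>j\<close>.\<close>
  define H' where "H' = (\<lambda>y \<xi>. \<xi> j * H y \<xi>)"
  have H': "form M V r (Suc e) H'" unfolding H'_def by (rule form.coord[OF H j])
  have "\<theta> x \<in> nonvanishing V r H'"
    using xb nonvanishing_q[OF H' x] q_homogeneous(3)[OF x] by (simp add: box_def H'_def)
  then obtain p where "p \<in> graph" and pn: "p \<in> nonvanishing V r H'"
    using \<theta>_mem[OF chart_nbhd(4)] TP_basic_open[OF V H'] unfolding GC_def in_closure_of by blast
  then obtain z where z: "p = (z, proj_class (gvec z))" "z \<in> U" "z \<notin> C" by (auto simp: graph_def)
  have hz: "homogeneous_vector r (gvec z)" by (rule gvec_homogeneous[OF z(2,3)])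
  define y where "y = \<theta>' (z, proj_class (gvec z))"
  have y: "y \<in> U'" "\<sigma> y = z" "\<theta> y = (z, proj_class (gvec z))"
    unfolding y_def by (rule point[OF z(2) hz]; simp add: gvec_def)+
  have Hz: "z \<in> V" "gvec z j \<noteq> 0" "H z (gvec z) \<noteq> 0"
    using pn unfolding z(1) nonvanishing_proj_class[OF H' hz] by (auto simp: H'_def)
  have yc: "y \<in> chart j" by (rule q_eqI(1)[OF y(1,3) Hz(2)])
  have "\<theta> y \<in> nonvanishing V r H"
    unfolding y(3) nonvanishing_proj_class[OF H hz] using Hz by simp
  then have "y \<in> box j V H" using nonvanishing_q[OF H yc] yc by (simp add: box_def)
  then show ?thesis using sub yc y(2) z(3) by blast
qed

end

text \<open>The locus where \<open>f\<close> does not vanish is open, and near \<open>x\<close> it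
  lies in the zero set of \<open>g j \<circ> \<sigma>\<close>, which is the exceptional divisor; by
  density of the complement it is empty there.\<close>

lemma e_cancel:
  assumes j: "j \<le> r" and x: "x \<in> chart j" and f: "f \<in> stalk M' x"
    and ef: "eq_near M' x (\<lambda>y. g j (\<sigma> y) * f y) (\<lambda>y. 0)"
  shows "eq_near M' x f (\<lambda>y. 0)"
proof -
  obtain W where W: "openin (zar M') W" "x \<in> W" "f \<in> reg M' W" by (rule stalkE[OF f])
  obtain W' where W': "openin (zar M') W'" "x \<in> W'" "\<forall>y\<in>W'. g j (\<sigma> y) * f y = 0"
    using ef unfolding eq_near_def by blast
  define T where "T = W' \<inter> (chart j \<inter> {y \<in> W. f y \<noteq> 0})"
  have T: "openin (zar M') T"
    unfolding T_def using W'(1) chart_open[OF j] M'.open_nonzero[OF W(1,3)] by blast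
  have "T = {}"
  proof (rule ccontr)
    assume "T \<noteq> {}"
    then obtain y where y: "y \<in> T" by blast
    then have "y \<in> chart j" by (simp add: T_def)
    from complement_dense[OF j this T y] obtain z where z: "z \<in> T" "z \<in> chart j" "\<sigma> z \<notin> C" by blast
    then show False using e_zero_iff[OF j z(2)] W'(3) by (auto simp: T_def)
  qed
  then show ?thesis
    using W W' x chart_open[OF j]
    by (intro eq_nearI[of M' "W' \<inter> (chart j \<inter> W)"]) (auto simp: T_def)
qed

text \<open>Supplies a point of the blowing-up for arbitrary homogeneous coordinates that satisfy
  the relations; over \<open>C\<close>, where the relations are void, every vector with a nonzero
  coordinate \<open>j\<close> and a nonzero value of \<open>H\<close> qualifies.\<close>

lemma box_point:
  assumes j: "j \<le> r" and V: "V \<subseteq> U" and H: "form M V r e H" and z: "z \<in> V" and \<xi>: "homogeneous_vector r \<xi>" "\<xi> j \<noteq> 0"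
    and rel: "\<And>i k. i \<le> r \<Longrightarrow> k \<le> r \<Longrightarrow> g i z * \<xi> k = g k z * \<xi> i" and Hz: "H z \<xi> \<noteq> 0"
  obtains y where "y \<in> box j V H" "\<sigma> y = z" "q j y = (\<lambda>i. \<xi> i / \<xi> j)"
proof -
  define y where "y = \<theta>' (z, proj_class \<xi>)"
  have y: "y \<in> U'" "\<sigma> y = z" "\<theta> y = (z, proj_class \<xi>)"
    unfolding y_def using point[OF _ \<xi>(1) rel] z V by auto
  have q: "q j y = (\<lambda>i. \<xi> i / \<xi> j)" using q_eqI(2)[OF y(1,3) \<xi>(2)] by blast
  have "(\<lambda>i. \<xi> i / \<xi> j) = (\<lambda>i. (1 / \<xi> j) * \<xi> i)" by simp
  then have "H z (q j y) = (1 / \<xi> j) ^ e * H z \<xi>" using form_homogeneous[OF H] q by metis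
  then have "y \<in> box j V H"
    using q_eqI(1)[OF y(1,3) \<xi>(2)] y(2) z Hz \<xi>(2) by (simp add: box_def)
  then show ?thesis using that y(2) q by blast
qed

section \<open>Divisibility by the exceptional equation\<close>

lemma form_quotient_zero:
  assumes "form M V r d F" "c \<noteq> 0"
  shows "F z (\<lambda>i. \<xi> i / c) = 0 \<longleftrightarrow> F z \<xi> = 0"
proof -
  have "(\<lambda>i. \<xi> i / c) = (\<lambda>i. (1 / c) * \<xi> i)" by simp
  then have "F z (\<lambda>i. \<xi> i / c) = (1 / c) ^ d * F z \<xi>" using form_homogeneous[OF assms(1)] by metis
  then show ?thesis using assms(2) by simp
qed

text \<open>In a chart the ideal of \<open>C\<close> becomes principal: by \<open>q_relation\<close>
  each generator \<open>g i\<close> pulls back to a multiple of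
  \<open>g j \<circ> \<sigma>\<close>.\<close>

lemma ideal_C_pullback:
  assumes j: "j \<le> r" and x: "x \<in> chart j" and h: "h \<in> ideal_at M C (\<sigma> x)"
  obtains b where "b \<in> stalk M' x" "eq_near M' x (\<lambda>y. h (\<sigma> y)) (\<lambda>y. b y * g j (\<sigma> y))"
proof -
  have xt: "x \<in> topspace (zar M')" and \<sigma>x: "\<sigma> x \<in> U" using chart_nbhd[OF j x] by auto
  obtain a where a: "\<forall>i\<in>{..r}. a i \<in> stalk M (\<sigma> x)"
    "eq_near M (\<sigma> x) h (\<lambda>y. \<Sum>i\<in>{..r}. a i y * u (idx i) y)"
    by (rule M.generates_finiteE[OF gen[OF \<sigma>x] finite_atMost h])
  define b where "b = (\<lambda>y. \<Sum>i\<in>{..r}. a i (\<sigma> y) * q j y i)"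
  have b: "b \<in> stalk M' x"
    unfolding b_def using a(1)
    by (intro M'.stalk_sum[OF xt] M'.stalk_mult pullback_stalk[OF _ xt] q_stalk[OF j x]) auto
  have "eq_near M' x (\<lambda>y. h (\<sigma> y)) (\<lambda>y. \<Sum>i\<in>{..r}. a i (\<sigma> y) * g i (\<sigma> y))"
    using pullback_eq_near[OF a(2) xt] by (simp add: g_def)
  moreover have "eq_near M' x (\<lambda>y. \<Sum>i\<in>{..r}. a i (\<sigma> y) * g i (\<sigma> y)) (\<lambda>y. b y * g j (\<sigma> y))"
  proof (rule eq_nearI[OF chart_nbhd(1,2)[OF j x]])
    fix y assume "y \<in> chart j"
    then have "a i (\<sigma> y) * g i (\<sigma> y) = a i (\<sigma> y) * q j y i * g j (\<sigma> y)" if "i \<le> r" for i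
      using q_relation[OF _ that j] by (simp only: mult.assoc)
    then show "(\<Sum>i\<in>{..r}. a i (\<sigma> y) * g i (\<sigma> y)) = b y * g j (\<sigma> y)"
      unfolding b_def sum_distrib_right by (intro sum.cong) auto
  qed
  ultimately show ?thesis by (rule that[OF b eq_near_trans])
qed

text \<open>\<open>form_coefficients\<close> reduces the claim to functions on \<open>M\<close> in
  the ideal of \<open>C\<close>, to which \<open>ideal_C_pullback\<close> applies.\<close>

lemma vanishing_form_pullback:
  assumes j: "j \<le> r" and x: "x \<in> chart j" and V: "openin (zar M) V" "\<sigma> x \<in> V" and P: "form M V r d P"
    and zero: "\<And>z \<xi>. z \<in> C \<inter> V \<Longrightarrow> P z \<xi> = 0"
  obtains a where "a \<in> stalk M' x" "eq_near M' x (\<lambda>y. P (\<sigma> y) (q j y)) (\<lambda>y. a y * g j (\<sigma> y))"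
proof -
  have xt: "x \<in> topspace (zar M')" using chart_nbhd[OF j x] by auto
  obtain m c \<mu> where c: "\<forall>i<(m::nat). c i \<in> reg M V" and \<mu>: "\<forall>i<m. form M V r d (\<lambda>_. \<mu> i)"
    and P_eq: "\<forall>x \<xi>. P x \<xi> = (\<Sum>i<m. c i x * \<mu> i \<xi>)" and c0: "\<forall>x. (\<forall>\<xi>. P x \<xi> = 0) \<longrightarrow> (\<forall>i<m. c i x = 0)"
    by (rule M.form_coefficients[OF V(1) P])
  have "\<exists>b. i < m \<longrightarrow> b \<in> stalk M' x \<and> eq_near M' x (\<lambda>y. c i (\<sigma> y)) (\<lambda>y. b y * g j (\<sigma> y))" for i
  proof (cases "i < m")
    case True
    have "\<forall>z\<in>V \<inter> C. c i z = 0" using c0 zero True by blast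
    then have "c i \<in> ideal_at M C (\<sigma> x)"
      using stalkI[OF V, of "c i"] c True V unfolding ideal_at_def by blast
    from ideal_C_pullback[OF j x this] show ?thesis by metis
  qed blast
  then obtain b where b: "\<And>i. i < m \<Longrightarrow> b i \<in> stalk M' x \<and> eq_near M' x (\<lambda>y. c i (\<sigma> y)) (\<lambda>y. b i y * g j (\<sigma> y))"
    by metis
  define a where "a = (\<lambda>y. \<Sum>i<m. b i y * \<mu> i (q j y))"
  have "(\<lambda>y. \<mu> i (q j y)) \<in> stalk M' x" if "i < m" for i
    using form_stalk[OF j x V(1) \<mu>[rule_format, OF that] V(2)] .
  then have a: "a \<in> stalk M' x"
    unfolding a_def using b by (intro M'.stalk_sum[OF xt] M'.stalk_mult) auto
  have "eq_near M' x (\<lambda>y. \<Sum>i<m. c i (\<sigma> y) * \<mu> i (q j y)) (\<lambda>y. \<Sum>i<m. (b i y * g j (\<sigma> y)) * \<mu> i (q j y))"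
    using b by (intro eq_near_sum[OF xt] eq_near_mult eq_near_refl xt) auto
  then have "eq_near M' x (\<lambda>y. P (\<sigma> y) (q j y)) (\<lambda>y. a y * g j (\<sigma> y))"
    by (simp add: P_eq a_def sum_distrib_right sum_distrib_left mult_ac)
  then show ?thesis by (rule that[OF a])
qed

lemma E_divisible:
  assumes j: "j \<le> r" and x: "x \<in> chart j" and f: "f \<in> ideal_at M' E x"
  obtains a where "a \<in> stalk M' x" "eq_near M' x f (\<lambda>y. a y * g j (\<sigma> y))"
proof -
  have xt: "x \<in> topspace (zar M')" using chart_nbhd[OF j x] by auto
  obtain W1 where W1: "openin (zar M') W1" "x \<in> W1" "\<forall>y\<in>W1 \<inter> E. f y = 0"
    using f unfolding ideal_at_def by blast
  obtain W2 where W2: "openin (zar M') W2" "x \<in> W2" "f \<in> reg M' W2"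
    by (rule stalkE[OF ideal_at_stalk[OF f]])
  define W where "W = W1 \<inter> W2"
  have W: "openin (zar M') W" "x \<in> W" using W1 W2 by (auto simp: W_def)
  have fW: "f \<in> reg M' W" by (rule M'.reg_restrict[OF W2(1) W(1) _ W2(3)]) (simp add: W_def)
  obtain V d F G e H where V: "openin (zar M) V" "V \<subseteq> U" and F: "form M V r d F" and G: "form M V r d G"
    and H: "form M V r e H" and xb: "x \<in> box j V H" and sub: "box j V H \<subseteq> W"
    and val: "\<forall>y\<in>box j V H. G (\<sigma> y) (q j y) \<noteq> 0 \<and> f y = F (\<sigma> y) (q j y) / G (\<sigma> y) (q j y)"
    by (rule local_form[OF j x W(2,1) fW])
  have \<sigma>V: "\<sigma> x \<in> V" using xb by (simp add: box_def)
  \<comment> \<open>The numerator \<open>F\<close> is known to vanish only at points of the box over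
    \<open>C\<close>. The factors \<open>\<xi> j\<close> and \<open>H\<close> extend this to all
    vectors over \<open>C \<inter> V\<close>, as \<open>vanishing_form_pullback\<close>
    requires.\<close>
  define P where "P = (\<lambda>z \<xi>. \<xi> j * (H z \<xi> * F z \<xi>))"
  have P: "form M V r (Suc (e + d)) P"
    unfolding P_def by (rule form.coord[OF M.form_mult[OF V(1) H F] j])
  have zero: "P z \<xi> = 0" if z: "z \<in> C \<inter> V" for z \<xi>
  proof -
    \<comment> \<open>Points of projective space have no coordinates beyond \<open>r\<close>, and
      forms do not depend on such coordinates.\<close>
    define \<eta> where "\<eta> = (\<lambda>i. if i \<le> r then \<xi> i else 0)"
    have "P z \<eta> = 0"
    proof (cases "\<eta> j = 0 \<or> H z \<eta> = 0")
      case False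
      have gz: "g i z = 0" if "i \<le> r" for i using mem_C_iff[of z] z V(2) that by blast
      have h\<eta>: "homogeneous_vector r \<eta>" using False j by (auto simp: homogeneous_vector_def \<eta>_def)
      have zV: "z \<in> V" using z by blast
      obtain y where y: "y \<in> box j V H" "\<sigma> y = z" "q j y = (\<lambda>i. \<eta> i / \<eta> j)"
        by (rule box_point[OF j V(2) H zV h\<eta>]) (use False gz in auto)
      have "y \<in> U'" using y(1) chart_U'[of y j] by (simp add: box_def)
      then have "f y = 0" using W1(3) sub y z E_iff by (auto simp: W_def)
      then have "F z (\<lambda>i. \<eta> i / \<eta> j) = 0" using val y by force
      then show ?thesis using form_quotient_zero[OF F, of "\<eta> j" z \<eta>] False by (simp add: P_def)
    qed (auto simp: P_def)
    then show ?thesis using form_cong[OF P, of \<xi> \<eta> z] by (simp add: \<eta>_def)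
  qed
  obtain a where a: "a \<in> stalk M' x" "eq_near M' x (\<lambda>y. P (\<sigma> y) (q j y)) (\<lambda>y. a y * g j (\<sigma> y))"
    by (rule vanishing_form_pullback[OF j x V(1) \<sigma>V P zero])
  define s where "s = (\<lambda>y. H (\<sigma> y) (q j y) * G (\<sigma> y) (q j y))"
  have s: "s \<in> stalk M' x" "s x \<noteq> 0"
    unfolding s_def using M'.stalk_mult[OF form_stalk[OF j x V(1) H \<sigma>V] form_stalk[OF j x V(1) G \<sigma>V]]
      val xb by (auto simp: box_def)
  have P_s: "P (\<sigma> y) (q j y) = s y * f y" "s y \<noteq> 0" if "y \<in> box j V H" for y
    using val that q_homogeneous(3)[of y j] by (auto simp: box_def P_def s_def)
  have "eq_near M' x (\<lambda>y. P (\<sigma> y) (q j y)) (\<lambda>y. s y * f y)"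
    by (rule eq_nearI[OF box_open[OF j V(1) H] xb P_s(1)])
  from eq_near_trans[OF eq_near_sym[OF this] a(2)]
  have "eq_near M' x (\<lambda>y. s y * f y) (\<lambda>y. a y * g j (\<sigma> y))" .
  moreover have "eq_near M' x (\<lambda>y. inverse (s y) * s y) (\<lambda>y. 1)"
    by (rule eq_nearI[OF box_open[OF j V(1) H] xb]) (simp add: P_s(2))
  ultimately have "eq_near M' x f (\<lambda>y. (inverse (s y) * a y) * g j (\<sigma> y))"
  proof (rule eq_near_combine)
    fix y assume "s y * f y = a y * g j (\<sigma> y)" "inverse (s y) * s y = 1"
    then show "f y = inverse (s y) * a y * g j (\<sigma> y)" by (metis mult.assoc mult.left_neutral)
  qed
  then show ?thesis by (rule that[OF M'.stalk_mult[OF M'.stalk_inverse[OF s] a(1)]])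
qed

lemma E_local_equation:
  assumes j: "j \<le> r" and x: "x \<in> chart j"
  shows "local_equation M' E x (\<lambda>y. g j (\<sigma> y))"
  unfolding M'.local_equation_iff
proof (intro conjI ballI)
  have "\<forall>y\<in>chart j \<inter> E. g j (\<sigma> y) = 0"
    using e_zero_iff[OF j] E_iff chart_U' by blast
  then show "(\<lambda>y. g j (\<sigma> y)) \<in> ideal_at M' E x"
    using e_stalk[OF j x j] chart_nbhd(1,2)[OF j x] unfolding ideal_at_def by blast
  fix f assume "f \<in> ideal_at M' E x"
  from E_divisible[OF j x this] show "\<exists>a\<in>stalk M' x. eq_near M' x f (\<lambda>y. a y * g j (\<sigma> y))" by metis
qed

text \<open>On a fibre of the exceptional divisor \<open>q j y k\<close> is a coordinate function, hence no zero divisor.\<close>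

lemma E_ideal_cancel:
  assumes j: "j \<le> r" and k: "k \<le> r" "k \<noteq> j" and x: "x \<in> chart j" and b: "b \<in> stalk M' x"
    and qb: "(\<lambda>y. q j y k * b y) \<in> ideal_at M' E x"
  shows "b \<in> ideal_at M' E x"
proof -
  obtain W1 where W1: "openin (zar M') W1" "x \<in> W1" "\<forall>y\<in>W1 \<inter> E. q j y k * b y = 0"
    using qb unfolding ideal_at_def by blast
  obtain W2 where W2: "openin (zar M') W2" "x \<in> W2" "b \<in> reg M' W2" by (rule stalkE[OF b])
  define W where "W = W1 \<inter> W2"
  have W: "openin (zar M') W" "x \<in> W" using W1 W2 by (auto simp: W_def)
  have bW: "b \<in> reg M' W" by (rule M'.reg_restrict[OF W2(1) W(1) _ W2(3)]) (simp add: W_def)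
  obtain V d F G e H where V: "openin (zar M) V" "V \<subseteq> U" and F: "form M V r d F" and G: "form M V r d G"
    and H: "form M V r e H" and xb: "x \<in> box j V H" and sub: "box j V H \<subseteq> W"
    and val: "\<forall>y\<in>box j V H. G (\<sigma> y) (q j y) \<noteq> 0 \<and> b y = F (\<sigma> y) (q j y) / G (\<sigma> y) (q j y)"
    by (rule local_form[OF j x W(2,1) bW])
  have "b y = 0" if y: "y \<in> box j V H" "y \<in> E" for y
  proof -
    define z where "z = \<sigma> y"
    \<comment> \<open>Only the coordinate \<open>k\<close> is moved, and \<open>k \<noteq> j\<close>
      keeps the coordinate \<open>j\<close> equal to 1. For small \<open>s \<noteq> 0\<close> the
      coordinate \<open>k\<close> is nonzero, so \<open>b\<close> vanishes at the perturbed point;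
      the value at \<open>s = 0\<close> follows by continuity of the numerator.\<close>
    define \<xi> where "\<xi> = (\<lambda>s i. if i = k then q j y k + s else q j y i)"
    have yc: "y \<in> chart j" and z: "z \<in> V" and Hz: "H z (q j y) \<noteq> 0" using y by (auto simp: box_def z_def)
    have zC: "z \<in> C" using y(2) by (simp add: E_def inverse_image_def z_def)
    have gz: "g i z = 0" if "i \<le> r" for i using mem_C_iff[of z] z zC V(2) that by blast
    have \<xi>0: "((\<lambda>s. \<xi> s i) \<longlongrightarrow> q j y i) (at 0)" for i
      unfolding \<xi>_def by (cases "i = k") (auto intro!: tendsto_eq_intros)
    have "((\<lambda>s. H z (\<xi> s)) \<longlongrightarrow> H z (q j y)) (at 0)" by (rule form_tendsto[OF H \<xi>0])
    then have "eventually (\<lambda>s. H z (\<xi> s) \<noteq> 0) (at 0)" using Hz by (rule tendsto_imp_eventually_ne)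
    moreover have "eventually (\<lambda>s. q j y k + s \<noteq> 0) (at 0)"
    proof (cases "q j y k = 0")
      case False
      then have "((\<lambda>s. q j y k + s) \<longlongrightarrow> q j y k) (at 0)" by (auto intro!: tendsto_eq_intros)
      then show ?thesis using False by (rule tendsto_imp_eventually_ne)
    qed (simp add: eventually_neq_at_within)
    ultimately have "eventually (\<lambda>s. F z (\<xi> s) = 0) (at 0)"
    proof eventually_elim
      case (elim s)
      have \<xi>j: "\<xi> s j = 1" using k(2) q_homogeneous(3)[OF yc] by (simp add: \<xi>_def)
      have "homogeneous_vector r (\<xi> s)"
        unfolding homogeneous_vector_def
      proof
        show "\<forall>i>r. \<xi> s i = 0"
          using q_homogeneous(1)[OF yc] k(1) by (auto simp: homogeneous_vector_def \<xi>_def)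
        show "\<exists>i\<le>r. \<xi> s i \<noteq> 0" using \<xi>j j by (intro exI[of _ j]) simp
      qed
      then obtain w where w: "w \<in> box j V H" "\<sigma> w = z" "q j w = (\<lambda>i. \<xi> s i / \<xi> s j)"
        by (rule box_point[OF j V(2) H z]) (use elim \<xi>j gz in auto)
      have qw: "q j w = \<xi> s" using w(3) \<xi>j by simp
      have "w \<in> U'" using w(1) chart_U'[of w j] by (simp add: box_def)
      then have "w \<in> W1 \<inter> E" using sub w(1,2) zC E_iff by (auto simp: W_def)
      then have "q j w k * b w = 0" using W1(3) by blast
      then have "b w = 0" using elim(2) qw by (simp add: \<xi>_def)
      then show ?case using val w(1,2) qw by force
    qed
    then have "((\<lambda>s. F z (\<xi> s)) \<longlongrightarrow> 0) (at 0)" by (rule tendsto_eventually)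
    moreover have "((\<lambda>s. F z (\<xi> s)) \<longlongrightarrow> F z (q j y)) (at 0)" by (rule form_tendsto[OF F \<xi>0])
    ultimately have "F z (q j y) = 0" using tendsto_unique[OF at_neq_bot] by blast
    then show ?thesis using val y(1) by (simp add: z_def)
  qed
  then show ?thesis
    using b box_open[OF j V(1) H] xb unfolding ideal_at_def by blast
qed

lemma q_divides_power:
  assumes j: "j \<le> r" and k: "k \<le> r" "k \<noteq> j" and x: "x \<in> chart j" and f: "f \<in> stalk M' x"
    and "b \<in> stalk M' x" "eq_near M' x (\<lambda>y. g j (\<sigma> y) ^ N * f y) (\<lambda>y. q j y k * b y)"
  shows "\<exists>c\<in>stalk M' x. eq_near M' x f (\<lambda>y. c y * q j y k)"
  using assms(6,7)
proof (induction N arbitrary: b)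
  case 0
  then show ?case by (intro bexI[of _ b]) (simp_all add: mult.commute)
next
  case (Suc N)
  have qs: "(\<lambda>y. q j y k) \<in> stalk M' x" and es: "(\<lambda>y. g j (\<sigma> y)) \<in> stalk M' x"
    using q_stalk[OF j x k(1)] e_stalk[OF j x j] by auto
  have e: "(\<lambda>y. g j (\<sigma> y)) \<in> ideal_at M' E x"
    using E_local_equation[OF j x] by (simp add: M'.local_equation_iff)
  have Nf: "(\<lambda>y. g j (\<sigma> y) ^ N * f y) \<in> stalk M' x" by (intro M'.stalk_mult M'.stalk_power es f)
  have "(\<lambda>y. q j y k * b y) \<in> ideal_at M' E x"
    by (rule M'.ideal_at_eq_near[OF M'.ideal_at_mult[OF e Nf]])
       (use Suc.prems(2) in \<open>simp add: mult_ac\<close>)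
  then have "b \<in> ideal_at M' E x" by (rule E_ideal_cancel[OF j k x Suc.prems(1)])
  then obtain a where a: "a \<in> stalk M' x" "eq_near M' x b (\<lambda>y. a y * g j (\<sigma> y))"
    by (rule E_divisible[OF j x])
  \<comment> \<open>Both sides now contain the factor \<open>g j \<circ> \<sigma>\<close>;
    cancelling it lowers the exponent by one.\<close>
  have "eq_near M' x (\<lambda>y. g j (\<sigma> y) * (g j (\<sigma> y) ^ N * f y - q j y k * a y)) (\<lambda>y. 0)"
    using Suc.prems(2) a(2) by (rule eq_near_combine) (simp add: algebra_simps)
  then have "eq_near M' x (\<lambda>y. g j (\<sigma> y) ^ N * f y - q j y k * a y) (\<lambda>y. 0)"
    by (rule e_cancel[OF j x M'.stalk_diff[OF Nf M'.stalk_mult[OF qs a(1)]]])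
  then have "eq_near M' x (\<lambda>y. g j (\<sigma> y) ^ N * f y) (\<lambda>y. q j y k * a y)"
    by (rule eq_near_mono) simp
  then show ?case by (rule Suc.IH[OF a(1)])
qed

text \<open>Substituting the generators for the homogeneous coordinates pushes a form down to a
  regular function on \<open>M\<close>, where the equation of a divisor can be applied. By
  \<open>gvec_form\<close> this costs a power of \<open>g j \<circ> \<sigma>\<close> on the
  blowing-up.\<close>

lemma gvec_form_reg:
  assumes V: "openin (zar M) V" "V \<subseteq> U" and F: "form M V r d F"
  shows "(\<lambda>z. F z (gvec z)) \<in> reg M V"
  using F
proof induction
  case (coeff a)
  then show ?case .
next
  case (coord d F i)
  have "g i \<in> reg M V" by (rule M.reg_restrict[OF openU V g_reg[OF coord.hyps(2)]])
  from M.reg_mult[OF V(1) this coord.IH] show ?case using coord.hyps(2) by (simp add: gvec_def)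
next
  case (add d F G)
  from M.reg_add[OF V(1) add.IH] show ?case .
qed

lemma gvec_form:
  assumes "j \<le> r" "y \<in> chart j" "form M V r d F"
  shows "F (\<sigma> y) (gvec (\<sigma> y)) = g j (\<sigma> y) ^ d * F (\<sigma> y) (q j y)"
proof -
  have "F (\<sigma> y) (gvec (\<sigma> y)) = F (\<sigma> y) (\<lambda>i. g j (\<sigma> y) * q j y i)"
    by (rule form_cong[OF assms(3)]) (use q_relation[OF assms(2) _ assms(1)] in \<open>simp only: gvec_def mult.commute if_True\<close>)
  then show ?thesis using form_homogeneous[OF assms(3)] by simp
qed

text \<open>With \<open>b j = 0\<close> the coordinate \<open>j\<close> stays equal to 1 along the
  arc, so the normalised coordinates are polynomials of degree at most 1 in \<open>t\<close> rather
  than quotients.\<close>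

lemma chart_arc:
  assumes j: "j \<le> r" and x: "x \<in> chart j" and xC: "\<sigma> x \<in> C" and b: "b j = 0"
  obtains \<gamma> \<gamma>' where "arc_lift M M' \<sigma> \<gamma> \<gamma>'" "\<gamma> 0 = \<sigma> x" "\<gamma>' 0 = x"
    "eventually (\<lambda>t. \<gamma>' t \<in> chart j \<and> \<sigma> (\<gamma>' t) = \<gamma> t \<and>
       (\<forall>i\<le>r. g i (\<gamma> t) = a * t * (q j x i + b i * t) \<and> q j (\<gamma>' t) i = q j x i + b i * t)) (nhds 0)"
proof -
  have xU: "x \<in> U'" "\<sigma> x \<in> U" using chart_nbhd[OF j x] by auto
  obtain \<gamma> \<gamma>' where *: "arc_lift M M' \<sigma> \<gamma> \<gamma>'" "\<gamma> 0 = \<sigma> x" "\<gamma>' 0 \<in> U'"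
    "\<theta> (\<gamma>' 0) = (\<sigma> x, proj_class (q j x))"
    and ev: "eventually (\<lambda>t. (\<forall>i\<le>r. g i (\<gamma> t) = a * t * (q j x i + b i * t)) \<and>
       \<gamma>' t \<in> U' \<and> \<theta> (\<gamma>' t) = (\<gamma> t, proj_class (\<lambda>i. if i \<le> r then q j x i + b i * t else 0))) (nhds 0)"
    by (rule special_arc[OF xC xU(2) q_homogeneous(1)[OF x]])
  have "\<gamma>' 0 = x" using \<theta>'_\<theta>[OF *(3)] \<theta>'_\<theta>[OF xU(1)] *(4) q_homogeneous(2)[OF x] by metis
  moreover have "eventually (\<lambda>t. \<gamma>' t \<in> chart j \<and> \<sigma> (\<gamma>' t) = \<gamma> t \<and>
       (\<forall>i\<le>r. g i (\<gamma> t) = a * t * (q j x i + b i * t) \<and> q j (\<gamma>' t) i = q j x i + b i * t)) (nhds 0)"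
    using ev
  proof eventually_elim
    case (elim t)
    define \<eta> where "\<eta> = (\<lambda>i. if i \<le> r then q j x i + b i * t else 0)"
    have \<eta>: "\<theta> (\<gamma>' t) = (\<gamma> t, proj_class \<eta>)" "\<eta> j = 1" "\<gamma>' t \<in> U'"
      using elim b j q_homogeneous(3)[OF x] by (auto simp: \<eta>_def)
    have "\<eta> j \<noteq> 0" using \<eta>(2) by simp
    from q_eqI[OF \<eta>(3,1) this] fst_\<theta>[OF \<eta>(3)] show ?case
      using elim \<eta>(1,2) by (auto simp: \<eta>_def)
  qed
  ultimately show ?thesis using that *(1,2) by blast
qed

section \<open>The strict transform of a divisor that contains the centre\<close>

context
  fixes Z k
  assumes CZ: "C \<subseteq> Z" and closedZ: "closedin (zar M) Z" and k: "k \<le> r"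
    and eqZ: "\<And>y. y \<in> U \<Longrightarrow> local_equation M Z y (g k)"
begin

definition ST :: "'b set" where "ST = strict_transform M' \<sigma> C Z"

lemma mem_Z_iff:
  assumes y: "y \<in> U"
  shows "y \<in> Z \<longleftrightarrow> g k y = 0"
proof
  assume "y \<in> Z"
  then show "g k y = 0" using eqZ[OF y] ideal_at_zero by (metis M.local_equation_iff)
next
  assume 0: "g k y = 0"
  show "y \<in> Z"
  proof (rule ccontr)
    assume "y \<notin> Z"
    then have "openin (zar M) (topspace (zar M) - Z)" "y \<in> topspace (zar M) - Z"
      using closedZ U_topspace[OF y] by auto
    then have "(\<lambda>_. 1) \<in> ideal_at M Z y"
      using M.stalk_const[OF U_topspace[OF y], of 1] unfolding ideal_at_def by blast
    then obtain a where "eq_near M y (\<lambda>_. 1) (\<lambda>z. a z * g k z)"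
      using eqZ[OF y] unfolding M.local_equation_iff by blast
    from eq_near_point[OF this] show False using 0 by simp
  qed
qed

text \<open>Over \<open>Z - C\<close> the equation \<open>g k\<close> vanishes while
  \<open>g j \<circ> \<sigma>\<close> does not, so the coordinate \<open>k\<close> vanishes there,
  and since its nonvanishing locus is open also on the closure.\<close>

lemma ST_zero:
  assumes j: "j \<le> r" and x: "x \<in> chart j" "x \<in> ST"
  shows "q j x k = 0"
proof (rule ccontr)
  assume nz: "q j x k \<noteq> 0"
  have o: "openin (zar M') {y \<in> chart j. q j y k \<noteq> 0}"
    by (rule M'.open_nonzero[OF chart_open[OF j] q_reg[OF j k]])
  have "x \<in> {y \<in> chart j. q j y k \<noteq> 0}" using x(1) nz by simp
  moreover have "\<forall>T. x \<in> T \<and> openin (zar M') T \<longrightarrow> (\<exists>y. y \<in> inverse_image M' \<sigma> (Z - C) \<and> y \<in> T)"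
    using x(2) unfolding ST_def strict_transform_def in_closure_of by simp
  ultimately have "\<exists>y. y \<in> inverse_image M' \<sigma> (Z - C) \<and> y \<in> {y \<in> chart j. q j y k \<noteq> 0}" using o by (elim allE impE, intro conjI)
  then obtain z where z: "z \<in> inverse_image M' \<sigma> (Z - C)" "z \<in> chart j" "q j z k \<noteq> 0" by auto
  have "\<sigma> z \<in> Z" "\<sigma> z \<notin> C" using z(1) by (auto simp: inverse_image_def)
  then show False
    using mem_Z_iff[OF chart_nbhd(5)[OF j z(2)]] q_relation[OF z(2) k j] e_zero_iff[OF j z(2)] z(3) by simp
qed

text \<open>The arc with constant normalised coordinates, \<open>g i = t * q j x i\<close>, stays in
  \<open>Z\<close> and leaves \<open>C\<close> at once, so its lift approaches \<open>x\<close>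
  through the preimage of \<open>Z - C\<close>.\<close>

lemma ST_I:
  assumes j: "j \<le> r" and x: "x \<in> chart j" "\<sigma> x \<in> C" and zero: "q j x k = 0"
  shows "x \<in> ST"
proof -
  obtain \<gamma> \<gamma>' where arc: "arc_lift M M' \<sigma> \<gamma> \<gamma>'" "\<gamma> 0 = \<sigma> x" "\<gamma>' 0 = x"
    and ev: "eventually (\<lambda>t. \<gamma>' t \<in> chart j \<and> \<sigma> (\<gamma>' t) = \<gamma> t \<and>
       (\<forall>i\<le>r. g i (\<gamma> t) = 1 * t * (q j x i + (\<lambda>_. 0) i * t) \<and> q j (\<gamma>' t) i = q j x i + (\<lambda>_. 0) i * t)) (nhds 0)"
    by (rule chart_arc[OF j x, of "\<lambda>_. 0"]) simp
  show ?thesis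
    unfolding ST_def strict_transform_def in_closure_of
  proof (intro conjI allI impI)
    show "x \<in> topspace (zar M')" using chart_nbhd[OF j x(1)] by auto
    fix T assume T: "x \<in> T \<and> openin (zar M') T"
    have "holomorphic_arc M' \<gamma>'" using arc(1) by (simp add: arc_lift_def)
    then have "eventually (\<lambda>t. \<gamma>' t \<in> T) (nhds 0)"
      by (rule M'.holomorphic_arc_near) (use T arc(3) in auto)
    with ev have "eventually (\<lambda>t. \<gamma>' t \<in> T \<and> \<gamma>' t \<in> chart j \<and> \<sigma> (\<gamma>' t) = \<gamma> t \<and> (\<forall>i\<le>r. g i (\<gamma> t) = t * q j x i)) (at 0)"
      unfolding eventually_at_filter by eventually_elim auto
    moreover have "eventually (\<lambda>t. t \<noteq> (0::complex)) (at 0)" by (simp add: eventually_neq_at_within)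
    ultimately have "eventually (\<lambda>t. t \<noteq> 0 \<and> \<gamma>' t \<in> T \<and> \<gamma>' t \<in> chart j \<and> \<sigma> (\<gamma>' t) = \<gamma> t \<and> (\<forall>i\<le>r. g i (\<gamma> t) = t * q j x i)) (at 0)"
      by eventually_elim auto
    from eventually_happens[OF this] obtain t where t: "t \<noteq> 0" "\<gamma>' t \<in> T" "\<gamma>' t \<in> chart j" "\<sigma> (\<gamma>' t) = \<gamma> t"
      "\<forall>i\<le>r. g i (\<gamma> t) = t * q j x i" by auto
    have \<gamma>U: "\<gamma> t \<in> U" using chart_nbhd(5)[OF j t(3)] t(4) by simp
    have "\<gamma> t \<in> Z" using mem_Z_iff[OF \<gamma>U] t(5) k zero by simp
    moreover have "\<gamma> t \<notin> C" using e_zero_iff[OF j t(3)] t(1,4,5) j q_homogeneous(3)[OF x(1)] by simp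
    ultimately have "\<gamma>' t \<in> inverse_image M' \<sigma> (Z - C)"
      using chart_nbhd(3)[OF j t(3)] t(4) by (simp add: inverse_image_def)
    then show "\<exists>y. y \<in> inverse_image M' \<sigma> (Z - C) \<and> y \<in> T" using t(2) by blast
  qed
qed

lemma ST_mem_iff: "j \<le> r \<Longrightarrow> x \<in> chart j \<Longrightarrow> \<sigma> x \<in> C \<Longrightarrow> x \<in> ST \<longleftrightarrow> q j x k = 0"
  using ST_I ST_zero by blast

lemma ST_divisible:
  assumes j: "j \<le> r" "k \<noteq> j" and x: "x \<in> chart j" and f: "f \<in> ideal_at M' ST x"
  shows "\<exists>a\<in>stalk M' x. eq_near M' x f (\<lambda>y. a y * q j y k)"
proof -
  have xt: "x \<in> topspace (zar M')" and \<sigma>U: "\<sigma> x \<in> U" using chart_nbhd[OF j(1) x] by auto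
  obtain W1 where W1: "openin (zar M') W1" "x \<in> W1" "\<forall>y\<in>W1 \<inter> ST. f y = 0"
    using f unfolding ideal_at_def by blast
  obtain W2 where W2: "openin (zar M') W2" "x \<in> W2" "f \<in> reg M' W2"
    by (rule stalkE[OF ideal_at_stalk[OF f]])
  define W where "W = W1 \<inter> W2"
  have W: "openin (zar M') W" "x \<in> W" using W1 W2 by (auto simp: W_def)
  have fW: "f \<in> reg M' W" by (rule M'.reg_restrict[OF W2(1) W(1) _ W2(3)]) (simp add: W_def)
  obtain V d F G e H where V: "openin (zar M) V" "V \<subseteq> U" and F: "form M V r d F" and G: "form M V r d G"
    and H: "form M V r e H" and xb: "x \<in> box j V H" and sub: "box j V H \<subseteq> W"
    and val: "\<forall>y\<in>box j V H. G (\<sigma> y) (q j y) \<noteq> 0 \<and> f y = F (\<sigma> y) (q j y) / G (\<sigma> y) (q j y)"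
    by (rule local_form[OF j(1) x W(2,1) fW])
  have \<sigma>V: "\<sigma> x \<in> V" using xb by (simp add: box_def)
  \<comment> \<open>The numerator of \<open>f\<close>, pulled back along the graph of \<open>[g 0 : \<dots> : g r]\<close>; the factors \<open>g j\<close> and \<open>H\<close> make
    it vanish on all of \<open>Z \<inter> V\<close>.\<close>
  define \<phi> where "\<phi> = (\<lambda>z. g j z * (H z (gvec z) * F z (gvec z)))"
  have \<phi>V: "\<phi> \<in> reg M V"
    unfolding \<phi>_def
    by (intro M.reg_mult V gvec_form_reg[OF V H] gvec_form_reg[OF V F] M.reg_restrict[OF openU V g_reg[OF j(1)]])
  have "\<phi> z = 0" if z: "z \<in> V" "z \<in> Z" for z
  proof (cases "z \<in> C \<or> g j z = 0 \<or> H z (gvec z) = 0")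
    case True
    then show ?thesis using mem_C_iff[of z] z(1) V(2) j(1) by (auto simp: \<phi>_def)
  next
    case False
    have "homogeneous_vector r (gvec z)" using gvec_homogeneous z(1) V(2) False by blast
    moreover have gj: "gvec z j \<noteq> 0" using False j(1) by (simp add: gvec_def)
    ultimately obtain y where y: "y \<in> box j V H" "\<sigma> y = z" "q j y = (\<lambda>i. gvec z i / gvec z j)"
      by (rule box_point[OF j(1) V(2) H z(1)]) (use False in \<open>auto simp: gvec_def\<close>)
    have yt: "y \<in> topspace (zar M')" using y(1) chart_nbhd(3)[OF j(1), of y] by (simp add: box_def)
    then have "y \<in> inverse_image M' \<sigma> (Z - C)" using y(2) z(2) False by (simp add: inverse_image_def)
    moreover have "inverse_image M' \<sigma> (Z - C) \<subseteq> ST"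
      unfolding ST_def strict_transform_def by (rule closure_of_subset) (auto simp: inverse_image_def)
    ultimately have "f y = 0" using W1(3) sub y(1) by (auto simp: W_def)
    then have "F z (\<lambda>i. gvec z i / gvec z j) = 0" using val y by force
    then show ?thesis using form_quotient_zero[OF F gj] by (simp add: \<phi>_def)
  qed
  then have "\<phi> \<in> ideal_at M Z (\<sigma> x)"
    using stalkI[OF V(1) \<sigma>V \<phi>V] V(1) \<sigma>V unfolding ideal_at_def by blast
  then obtain b where b: "b \<in> stalk M (\<sigma> x)" "eq_near M (\<sigma> x) \<phi> (\<lambda>y. b y * g k y)"
    using eqZ[OF \<sigma>U] unfolding M.local_equation_iff by blast
  define s where "s = (\<lambda>y. H (\<sigma> y) (q j y) * G (\<sigma> y) (q j y))"
  have s: "s \<in> stalk M' x" "s x \<noteq> 0"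
    unfolding s_def using M'.stalk_mult[OF form_stalk[OF j(1) x V(1) H \<sigma>V] form_stalk[OF j(1) x V(1) G \<sigma>V]]
      val xb by (auto simp: box_def)
  have fs: "f \<in> stalk M' x" by (rule ideal_at_stalk[OF f])
  \<comment> \<open>The exponent counts the factor \<open>g j\<close> of \<open>\<phi>\<close> and
    the degrees \<open>e\<close> and \<open>d\<close> of \<open>H\<close> and \<open>F\<close>,
    which \<open>gvec_form\<close> turns into powers.\<close>
  have "eq_near M' x (\<lambda>y. \<phi> (\<sigma> y)) (\<lambda>y. g j (\<sigma> y) ^ Suc (e + d) * (s y * f y))"
  proof (rule eq_nearI[OF box_open[OF j(1) V(1) H] xb])
    fix y assume y: "y \<in> box j V H"
    then have yc: "y \<in> chart j" by (simp add: box_def)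
    have "F (\<sigma> y) (q j y) = G (\<sigma> y) (q j y) * f y" using val y by simp
    then show "\<phi> (\<sigma> y) = g j (\<sigma> y) ^ Suc (e + d) * (s y * f y)"
      by (simp add: \<phi>_def gvec_form[OF j(1) yc H] gvec_form[OF j(1) yc F] s_def power_add)
  qed
  from eq_near_trans[OF eq_near_sym[OF this] pullback_eq_near[OF b(2) xt]]
  have "eq_near M' x (\<lambda>y. g j (\<sigma> y) ^ Suc (e + d) * (s y * f y)) (\<lambda>y. b (\<sigma> y) * g k (\<sigma> y))" .
  then have "eq_near M' x (\<lambda>y. g j (\<sigma> y) ^ Suc (e + d) * (s y * f y)) (\<lambda>y. q j y k * (b (\<sigma> y) * g j (\<sigma> y)))"
    using q_e_near[OF j(1) x k] by (rule eq_near_combine) (simp add: mult_ac)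
  moreover have "(\<lambda>y. b (\<sigma> y) * g j (\<sigma> y)) \<in> stalk M' x"
    by (intro M'.stalk_mult pullback_stalk[OF b(1) xt] e_stalk[OF j(1) x j(1)])
  ultimately obtain c where c: "c \<in> stalk M' x" "eq_near M' x (\<lambda>y. s y * f y) (\<lambda>y. c y * q j y k)"
    using q_divides_power[OF j(1) k j(2) x M'.stalk_mult[OF s(1) fs]] by blast
  have "eq_near M' x (\<lambda>y. inverse (s y) * s y) (\<lambda>y. 1)"
    by (rule M'.eq_near_nonzero[OF s]) simp
  with c(2) have "eq_near M' x f (\<lambda>y. (inverse (s y) * c y) * q j y k)"
  proof (rule eq_near_combine)
    fix y assume "s y * f y = c y * q j y k" "inverse (s y) * s y = 1"
    then show "f y = inverse (s y) * c y * q j y k" by (metis mult.assoc mult.left_neutral)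
  qed
  then show ?thesis by (rule bexI[OF _ M'.stalk_mult[OF M'.stalk_inverse[OF s] c(1)]])
qed

lemma ST_local_equation:
  assumes j: "j \<le> r" and x: "x \<in> chart j" and zero: "q j x k = 0"
  shows "local_equation M' ST x (\<lambda>y. q j y k)"
  unfolding M'.local_equation_iff
proof (intro conjI ballI)
  have "\<forall>y\<in>chart j \<inter> ST. q j y k = 0" using ST_zero[OF j] by blast
  then show "(\<lambda>y. q j y k) \<in> ideal_at M' ST x"
    using q_stalk[OF j x k] chart_nbhd(1,2)[OF j x] unfolding ideal_at_def by blast
  have "k \<noteq> j" using zero q_homogeneous(3)[OF x] by auto
  then show "\<exists>a\<in>stalk M' x. eq_near M' x f (\<lambda>y. a y * q j y k)" if "f \<in> ideal_at M' ST x" for f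
    using ST_divisible[OF j _ x that] by blast
qed

end

end

section \<open>Points of the log-space from arcs\<close>

text \<open>The order \<open>m\<close> is not recorded: at most one order gives a nonzero
  limit.\<close>

definition leading_coeff :: "(complex \<Rightarrow> complex) \<Rightarrow> complex" where
  "leading_coeff \<phi> = (THE c. c \<noteq> 0 \<and> (\<exists>m. ((\<lambda>t. \<phi> t / t ^ m) \<longlongrightarrow> c) (at 0)))"

lemma leading_coeff_order_aux:
  assumes "((\<lambda>t. \<phi> t / t ^ m) \<longlongrightarrow> c) (at (0::complex))" "((\<lambda>t. \<phi> t / t ^ m') \<longlongrightarrow> c') (at 0)"
    "m < m'" 
  shows "c = 0"
proof -
  have "((\<lambda>t. t ^ (m' - m) * (\<phi> t / t ^ m')) \<longlongrightarrow> 0 ^ (m' - m) * c') (at 0)"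
    by (intro tendsto_intros assms(2))
  moreover have "eventually (\<lambda>t. t ^ (m' - m) * (\<phi> t / t ^ m') = \<phi> t / t ^ m) (at 0)"
    unfolding eventually_at_filter
  proof (intro always_eventually allI impI)
    fix t :: complex assume "t \<noteq> 0"
    moreover have "t ^ m' = t ^ (m' - m) * t ^ m" using assms(3) by (simp add: power_add[symmetric])
    ultimately show "t ^ (m' - m) * (\<phi> t / t ^ m') = \<phi> t / t ^ m" by simp
  qed
  ultimately have "((\<lambda>t. \<phi> t / t ^ m) \<longlongrightarrow> 0 ^ (m' - m) * c') (at 0)"
    by (rule Lim_transform_eventually)
  then have "c = 0 ^ (m' - m) * c'" using tendsto_unique[OF at_neq_bot assms(1)] by blast
  then show ?thesis using assms(3) by simp
qed

lemma leading_coeff_eqI: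
  assumes "c \<noteq> 0" "((\<lambda>t. \<phi> t / t ^ m) \<longlongrightarrow> c) (at 0)"
  shows "leading_coeff \<phi> = c"
  unfolding leading_coeff_def
proof (rule the_equality)
  show "c \<noteq> 0 \<and> (\<exists>m. ((\<lambda>t. \<phi> t / t ^ m) \<longlongrightarrow> c) (at 0))" using assms by blast
  fix c' assume "c' \<noteq> 0 \<and> (\<exists>m. ((\<lambda>t. \<phi> t / t ^ m) \<longlongrightarrow> c') (at 0))"
  then obtain m' where c': "c' \<noteq> 0" "((\<lambda>t. \<phi> t / t ^ m') \<longlongrightarrow> c') (at 0)" by blast
  have "m = m'"
    using leading_coeff_order_aux[OF assms(2) c'(2)] leading_coeff_order_aux[OF c'(2) assms(2)]
      assms(1) c'(1) by (meson linorder_neqE_nat)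
  then show "c' = c" using tendsto_unique[OF at_neq_bot c'(2)] assms(2) by blast
qed

text \<open>If the function vanishes at \<open>0\<close> it is not constant, as it has no other
  zeros nearby, and it splits into a power of \<open>t\<close> and a nonvanishing factor.\<close>

lemma leading_coeff_exists:
  assumes e: "e > 0" and hol: "\<phi> holomorphic_on ball 0 e" and nz: "eventually (\<lambda>t. \<phi> t \<noteq> 0) (at 0)"
  shows "\<exists>c m. c \<noteq> 0 \<and> ((\<lambda>t. \<phi> t / t ^ m) \<longlongrightarrow> c) (at 0)"
proof (cases "\<phi> 0 = 0")
  case False
  have "isCont \<phi> 0"
    using holomorphic_on_imp_continuous_on[OF hol] e by (simp add: continuous_on_eq_continuous_at)
  then have "((\<lambda>t. \<phi> t / t ^ 0) \<longlongrightarrow> \<phi> 0) (at 0)" by (simp add: isCont_def)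
  then show ?thesis using False by blast
next
  case True
  have "\<not> \<phi> constant_on ball 0 e"
  proof
    assume "\<phi> constant_on ball 0 e"
    then have z: "\<forall>t\<in>ball 0 e. \<phi> t = 0" using True e unfolding constant_on_def by (metis centre_in_ball)
    have "eventually (\<lambda>t. t \<in> ball 0 e) (at (0::complex))"
      using e by (intro eventually_at_in_open') auto
    with nz have "eventually (\<lambda>t::complex. False) (at 0)" by eventually_elim (use z in blast)
    then show False by simp
  qed
  moreover have "0 \<in> ball (0::complex) e" using e by simp
  ultimately obtain h d m where h: "0 < d" "h holomorphic_on ball 0 d" "\<And>w. w \<in> ball 0 d \<Longrightarrow> \<phi> w = (w - 0) ^ m * h w"
    "\<And>w. w \<in> ball 0 d \<Longrightarrow> h w \<noteq> 0"
    using holomorphic_factor_zero_nonconstant[OF hol open_ball connected_ball _ True] by metis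
  have "isCont h 0"
    using holomorphic_on_imp_continuous_on[OF h(2)] h(1) by (simp add: continuous_on_eq_continuous_at)
  then have lim: "(h \<longlongrightarrow> h 0) (at 0)" by (simp add: isCont_def)
  have ev1: "eventually (\<lambda>t. t \<in> ball 0 d) (at (0::complex))"
    using h(1) by (intro eventually_at_in_open') auto
  have ev2: "eventually (\<lambda>t. t \<noteq> 0) (at (0::complex))" by (simp add: eventually_neq_at_within)
  have "eventually (\<lambda>t. h t = \<phi> t / t ^ m) (at 0)"
    using ev1 ev2 by eventually_elim (simp add: h(3))
  then have "((\<lambda>t. \<phi> t / t ^ m) \<longlongrightarrow> h 0) (at 0)" by (rule Lim_transform_eventually[OF lim])
  then show ?thesis using h(4)[of 0] h(1) by auto
qed

lemma alog_mult:
  "(x, \<Phi>) \<in> alog X Z \<Longrightarrow> f \<in> log_stalk X Z x \<Longrightarrow> g \<in> log_stalk X Z x \<Longrightarrow>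
     \<Phi> (\<lambda>y. f y * g y) = \<Phi> f * \<Phi> g"
  unfolding alog_def by blast

section \<open>Germs that are invertible off a divisor\<close>

context regular_functions
begin

text \<open>The inverse required by \<open>log_stalk\<close> exists as soon as the function has no
  zeros off \<open>Z\<close>, since inverses of nowhere vanishing regular functions are
  regular.\<close>

lemma log_stalk_iff:
  assumes Z: "closedin (zar X) Z"
  shows "f \<in> log_stalk X Z x \<longleftrightarrow> (\<exists>U. openin (zar X) U \<and> x \<in> U \<and> f \<in> reg X U \<and> (\<forall>y\<in>U - Z. f y \<noteq> 0))"
    (is "?L \<longleftrightarrow> ?R")
proof
  assume ?L
  then obtain U h where U: "openin (zar X) U" "x \<in> U" "f \<in> reg X U" "\<forall>y\<in>U - Z. f y * h y = 1"
    unfolding log_stalk_def by blast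
  have "f y \<noteq> 0" if "y \<in> U - Z" for y
  proof -
    have "f y * h y = 1" using U(4) that by blast
    then show ?thesis by auto
  qed
  then show ?R using U by blast
next
  assume ?R
  then obtain U where U: "openin (zar X) U" "x \<in> U" "f \<in> reg X U" "\<forall>y\<in>U - Z. f y \<noteq> 0" by blast
  have o: "openin (zar X) (U - Z)" using U(1) Z by blast
  have "f \<in> reg X (U - Z)" by (rule reg_restrict[OF U(1) o _ U(3)]) blast
  then have "(\<lambda>y. inverse (f y)) \<in> reg X (U - Z)" by (rule reg_inverse[OF o]) (use U(4) in blast)
  then have "\<exists>h\<in>reg X (U - Z). \<forall>y\<in>U - Z. f y * h y = 1"
    by (rule bexI[rotated]) (use U(4) in simp)
  then show ?L unfolding log_stalk_def using U by blast
qed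

lemma log_stalkI:
  assumes Z: "closedin (zar X) Z" and f: "f \<in> stalk X x" and W: "openin (zar X) W" "x \<in> W"
    and nz: "\<And>y. y \<in> W \<Longrightarrow> y \<notin> Z \<Longrightarrow> f y \<noteq> 0"
  shows "f \<in> log_stalk X Z x"
proof -
  obtain V where V: "openin (zar X) V" "x \<in> V" "f \<in> reg X V" by (rule stalkE[OF f])
  have o: "openin (zar X) (V \<inter> W)" using V W by blast
  have "f \<in> reg X (V \<inter> W)" by (rule reg_restrict[OF V(1) o _ V(3)]) blast
  moreover have "\<forall>y\<in>V \<inter> W - Z. f y \<noteq> 0" using nz by blast
  ultimately show ?thesis unfolding log_stalk_iff[OF Z] using o V(2) W(2) by blast
qed

lemma log_stalk_stalk: "f \<in> log_stalk X Z x \<Longrightarrow> f \<in> stalk X x"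
  unfolding log_stalk_def stalk_def by blast

lemma log_stalk_eq_near:
  assumes Z: "closedin (zar X) Z" and f: "f \<in> log_stalk X Z x" and fg: "eq_near X x f g"
  shows "g \<in> log_stalk X Z x"
proof -
  obtain U where U: "openin (zar X) U" "x \<in> U" "\<forall>y\<in>U - Z. f y \<noteq> 0"
    using f log_stalk_iff[OF Z] by blast
  obtain V where V: "openin (zar X) V" "x \<in> V" "\<forall>y\<in>V. f y = g y" using fg unfolding eq_near_def by blast
  obtain W where W: "openin (zar X) W" "x \<in> W" "g \<in> reg X W"
    by (rule stalkE[OF stalk_eq_near[OF log_stalk_stalk[OF f] fg]])
  have o: "openin (zar X) (U \<inter> V \<inter> W)" using U V W by blast
  have "g \<in> reg X (U \<inter> V \<inter> W)" by (rule reg_restrict[OF W(1) o _ W(3)]) blast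
  moreover have "\<forall>y\<in>U \<inter> V \<inter> W - Z. g y \<noteq> 0" using U(3) V(3) by auto
  ultimately show ?thesis unfolding log_stalk_iff[OF Z] using o U(2) V(2) W(2) by blast
qed

lemma log_stalk_mult:
  assumes Z: "closedin (zar X) Z" and f: "f \<in> log_stalk X Z x" and g: "g \<in> log_stalk X Z x"
  shows "(\<lambda>y. f y * g y) \<in> log_stalk X Z x"
proof -
  obtain U where U: "openin (zar X) U" "x \<in> U" "f \<in> reg X U" "\<forall>y\<in>U - Z. f y \<noteq> 0"
    using f log_stalk_iff[OF Z] by blast
  obtain V where V: "openin (zar X) V" "x \<in> V" "g \<in> reg X V" "\<forall>y\<in>V - Z. g y \<noteq> 0"
    using g log_stalk_iff[OF Z] by blast
  have o: "openin (zar X) (U \<inter> V)" using U V by blast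
  have "(\<lambda>y. f y * g y) \<in> reg X (U \<inter> V)"
    by (rule reg_mult[OF o reg_restrict[OF U(1) o _ U(3)] reg_restrict[OF V(1) o _ V(3)]]) auto
  moreover have "\<forall>y\<in>U \<inter> V - Z. f y * g y \<noteq> 0" using U(4) V(4) by auto
  ultimately show ?thesis unfolding log_stalk_iff[OF Z] using o U(2) V(2) by blast
qed

lemma log_stalk_unit:
  assumes Z: "closedin (zar X) Z" and f: "f \<in> stalk X x" "f x \<noteq> 0"
  shows "f \<in> log_stalk X Z x"
proof -
  obtain U where "openin (zar X) U" "x \<in> U" "f \<in> reg X U" "\<forall>y\<in>U. f y \<noteq> 0"
    using f by (rule stalk_nonzero_nbhd) blast
  then show ?thesis unfolding log_stalk_iff[OF Z] by blast
qed

text \<open>Two equations of the same set divide each other. That the cofactor is a unit is seen by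
  testing both divisibilities on one normal vector along which \<open>g\<close> has nonzero
  derivative.\<close>

lemma local_equation_unit:
  assumes g: "local_equation X Z x g" and h: "local_equation X Z x h" and x: "x \<in> Z"
    and \<nu>: "\<nu> \<in> normal_space X Z x" "normal_deriv \<nu> g \<noteq> 0"
  obtains a where "a \<in> stalk X x" "a x \<noteq> 0" "eq_near X x h (\<lambda>y. a y * g y)"
proof -
  have gI: "g \<in> ideal_at X Z x" and hI: "h \<in> ideal_at X Z x"
    using g h by (auto simp: local_equation_iff)
  obtain a where a: "a \<in> stalk X x" "eq_near X x h (\<lambda>y. a y * g y)"
    using g hI unfolding local_equation_iff by blast
  obtain b where b: "b \<in> stalk X x" "eq_near X x g (\<lambda>y. b y * h y)"
    using h gI unfolding local_equation_iff by blast
  have "normal_deriv \<nu> h = a x * normal_deriv \<nu> g" "normal_deriv \<nu> g = b x * normal_deriv \<nu> h"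
    using normal_deriv_mult[OF \<nu>(1) x a(1) gI a(2)] normal_deriv_mult[OF \<nu>(1) x b(1) hI b(2)] by auto
  then have "a x \<noteq> 0" using \<nu>(2) by auto
  then show ?thesis using that a by blast
qed

lemma log_normal_eqI:
  assumes x: "x \<in> Z" "x \<in> topspace (zar X)" and g: "local_equation X Z x g"
    and \<nu>: "\<nu> \<in> nonzero_normals X Z x" and \<Phi>: "\<And>h. local_equation X Z x h \<Longrightarrow> \<Phi> h = normal_deriv \<nu> h"
  shows "log_normal X Z x \<Phi> = \<nu>"
  unfolding log_normal_def
proof (rule the_equality)
  show "\<nu> \<in> nonzero_normals X Z x \<and> (\<forall>g. local_equation X Z x g \<longrightarrow> \<Phi> g = normal_deriv \<nu> g)"
    using \<nu> \<Phi> by blast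
  fix \<mu> assume \<mu>: "\<mu> \<in> nonzero_normals X Z x \<and> (\<forall>g. local_equation X Z x g \<longrightarrow> \<Phi> g = normal_deriv \<mu> g)"
  then have "normal_deriv \<mu> g = normal_deriv \<nu> g" using g \<Phi>[OF g] by simp
  then show "\<mu> = \<nu>"
    using normal_eq_local_equation[OF _ _ x g, of \<mu> \<nu>] \<mu> \<nu> by (simp add: nonzero_normals_def)
qed

lemma alog_unit_mult:
  assumes Z0: "closedin (zar X) Z0" and \<Phi>: "(x, \<Phi>) \<in> alog X Z0" and a: "a \<in> stalk X x" "a x \<noteq> 0"
    and g: "g \<in> log_stalk X Z0 x" and h: "eq_near X x h (\<lambda>y. a y * g y)"
  shows "\<Phi> h = a x * \<Phi> g"
proof -
  have al: "a \<in> log_stalk X Z0 x" by (rule log_stalk_unit[OF Z0 a])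
  have ag: "(\<lambda>y. a y * g y) \<in> log_stalk X Z0 x" by (rule log_stalk_mult[OF Z0 al g])
  have hl: "h \<in> log_stalk X Z0 x" by (rule log_stalk_eq_near[OF Z0 ag eq_near_sym[OF h]])
  have "\<Phi> h = \<Phi> (\<lambda>y. a y * g y)" using \<Phi> hl ag h unfolding alog_def by blast
  also have "\<dots> = \<Phi> a * \<Phi> g" using \<Phi> al g unfolding alog_def by blast
  also have "\<Phi> a = a x" using \<Phi> a stalk_units_iff[of a x] unfolding alog_def by blast
  finally show ?thesis .
qed

text \<open>A point \<Phi> of the log-space and the derivative along a normal vector both multiply
  by \<open>a x\<close> when an equation is multiplied by a unit \<open>a\<close>, so the condition
  on all local equations in \<open>log_normal\<close> need only be checked for one.\<close>

lemma log_normal_alog: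
  assumes Z0: "closedin (zar X) Z0" and \<Phi>: "(x, \<Phi>) \<in> alog X Z0" and x: "x \<in> Z"
    and g: "local_equation X Z x g" "g \<in> log_stalk X Z0 x"
    and \<nu>: "\<nu> \<in> normal_space X Z x" "normal_deriv \<nu> g = \<Phi> g"
  shows "log_normal X Z x \<Phi> = \<nu>"
proof -
  have xt: "x \<in> topspace (zar X)" by (rule stalk_topspace[OF log_stalk_stalk[OF g(2)]])
  have nz: "\<Phi> g \<noteq> 0" using \<Phi> g(2) unfolding alog_def by blast
  have gI: "g \<in> ideal_at X Z x" using g(1) by (simp add: local_equation_iff)
  show ?thesis
  proof (rule log_normal_eqI[OF x xt g(1)])
    show "\<nu> \<in> nonzero_normals X Z x" using nonzero_normals_iff[OF x xt g(1)] \<nu> nz by simp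
    fix h assume h: "local_equation X Z x h"
    obtain a where a: "a \<in> stalk X x" "a x \<noteq> 0" "eq_near X x h (\<lambda>y. a y * g y)"
      by (rule local_equation_unit[OF g(1) h x \<nu>(1)]) (use \<nu>(2) nz in simp)
    show "\<Phi> h = normal_deriv \<nu> h"
      using alog_unit_mult[OF Z0 \<Phi> a(1,2) g(2) a(3)] normal_deriv_mult[OF \<nu>(1) x a(1) gI a(3)] \<nu>(2) by simp
  qed
qed

text \<open>
  An arc that meets the divisor only at \<open>t = 0\<close> defines a point of the log-space: \<open>\<Phi> f\<close> is the leading
  coefficient of \<open>f\<close> along the arc.
\<close>

definition arc_log :: "'a set \<Rightarrow> (complex \<Rightarrow> 'a) \<Rightarrow> ('a \<Rightarrow> complex) \<Rightarrow> complex" where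
  "arc_log Z \<gamma> = restrict (\<lambda>f. leading_coeff (\<lambda>t. f (\<gamma> t))) (log_stalk X Z (\<gamma> 0))"

context
  fixes Z \<gamma>
  assumes Z: "closedin (zar X) Z" and \<gamma>: "holomorphic_arc X \<gamma>"
    and off: "eventually (\<lambda>t. \<gamma> t \<notin> Z) (at 0)"
begin

lemma log_stalk_leading:
  assumes f: "f \<in> log_stalk X Z (\<gamma> 0)"
  shows "\<exists>m. arc_log Z \<gamma> f \<noteq> 0 \<and> ((\<lambda>t. f (\<gamma> t) / t ^ m) \<longlongrightarrow> arc_log Z \<gamma> f) (at 0)"
proof -
  obtain U where U: "openin (zar X) U" "\<gamma> 0 \<in> U" "\<forall>y\<in>U - Z. f y \<noteq> 0"
    using f log_stalk_iff[OF Z] by blast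
  obtain e where e: "e > 0" "(f \<circ> \<gamma>) holomorphic_on ball 0 e"
    by (rule holomorphic_arc_stalk[OF \<gamma> log_stalk_stalk[OF f]])
  have "eventually (\<lambda>t. \<gamma> t \<in> U) (nhds 0)" by (rule holomorphic_arc_near[OF \<gamma> U(1,2)])
  then have "eventually (\<lambda>t. \<gamma> t \<in> U) (at 0)"
    unfolding eventually_at_filter by eventually_elim auto
  with off have "eventually (\<lambda>t. (f \<circ> \<gamma>) t \<noteq> 0) (at 0)"
    by eventually_elim (use U(3) in auto)
  from leading_coeff_exists[OF e this] obtain c m where c: "c \<noteq> 0" "((\<lambda>t. f (\<gamma> t) / t ^ m) \<longlongrightarrow> c) (at 0)"
    by (auto simp: o_def)
  have "arc_log Z \<gamma> f = c" using leading_coeff_eqI[OF c] f by (simp add: arc_log_def)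
  then show ?thesis using c by blast
qed

lemma arc_log_eqI:
  assumes "f \<in> log_stalk X Z (\<gamma> 0)" "c \<noteq> 0" "((\<lambda>t. f (\<gamma> t) / t ^ m) \<longlongrightarrow> c) (at 0)"
  shows "arc_log Z \<gamma> f = c"
  using leading_coeff_eqI[OF assms(2,3)] assms(1) by (simp add: arc_log_def)

lemma arc_log_alog: "(\<gamma> 0, arc_log Z \<gamma>) \<in> alog X Z"
proof -
  have x: "\<gamma> 0 \<in> topspace (zar X)" using \<gamma> by (simp add: holomorphic_arc_def)
  have unit: "arc_log Z \<gamma> f = f (\<gamma> 0)" if f: "f \<in> stalk_units X (\<gamma> 0)" for f
  proof -
    have f': "f \<in> stalk X (\<gamma> 0)" "f (\<gamma> 0) \<noteq> 0" using f stalk_units_iff by auto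
    have "isCont (\<lambda>t. f (\<gamma> t)) 0" by (rule DERIV_isCont[OF holomorphic_arc_deriv[OF \<gamma> f'(1)]])
    then have "((\<lambda>t. f (\<gamma> t) / t ^ 0) \<longlongrightarrow> f (\<gamma> 0)) (at 0)" by (simp add: isCont_def)
    from arc_log_eqI[OF log_stalk_unit[OF Z f'] f'(2) this] show ?thesis .
  qed
  have "(\<lambda>_. 1) \<in> stalk_units X (\<gamma> 0)" using stalk_const[OF x, of 1] by (simp add: stalk_units_iff)
  from unit[OF this] have one: "arc_log Z \<gamma> (\<lambda>_. 1) = 1" by simp
  have cong: "arc_log Z \<gamma> f = arc_log Z \<gamma> h"
    if f: "f \<in> log_stalk X Z (\<gamma> 0)" and h: "h \<in> log_stalk X Z (\<gamma> 0)" and fh: "eq_near X (\<gamma> 0) f h" for f h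
  proof -
    obtain m where m: "arc_log Z \<gamma> h \<noteq> 0" "((\<lambda>t. h (\<gamma> t) / t ^ m) \<longlongrightarrow> arc_log Z \<gamma> h) (at 0)"
      using log_stalk_leading[OF h] by blast
    have "eventually (\<lambda>t. h (\<gamma> t) / t ^ m = f (\<gamma> t) / t ^ m) (at 0)"
      using holomorphic_arc_eq_near[OF \<gamma> fh] unfolding eventually_at_filter by eventually_elim simp
    then have "((\<lambda>t. f (\<gamma> t) / t ^ m) \<longlongrightarrow> arc_log Z \<gamma> h) (at 0)"
      by (rule Lim_transform_eventually[OF m(2)])
    from arc_log_eqI[OF f m(1) this] show ?thesis .
  qed
  have mult: "arc_log Z \<gamma> (\<lambda>y. f y * h y) = arc_log Z \<gamma> f * arc_log Z \<gamma> h"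
    if f: "f \<in> log_stalk X Z (\<gamma> 0)" and h: "h \<in> log_stalk X Z (\<gamma> 0)" for f h
  proof -
    obtain m where m: "arc_log Z \<gamma> f \<noteq> 0" "((\<lambda>t. f (\<gamma> t) / t ^ m) \<longlongrightarrow> arc_log Z \<gamma> f) (at 0)"
      using log_stalk_leading[OF f] by blast
    obtain m' where m': "arc_log Z \<gamma> h \<noteq> 0" "((\<lambda>t. h (\<gamma> t) / t ^ m') \<longlongrightarrow> arc_log Z \<gamma> h) (at 0)"
      using log_stalk_leading[OF h] by blast
    have "((\<lambda>t. f (\<gamma> t) / t ^ m * (h (\<gamma> t) / t ^ m')) \<longlongrightarrow> arc_log Z \<gamma> f * arc_log Z \<gamma> h) (at 0)"
      by (rule tendsto_mult[OF m(2) m'(2)])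
    then have "((\<lambda>t. f (\<gamma> t) * h (\<gamma> t) / t ^ (m + m')) \<longlongrightarrow> arc_log Z \<gamma> f * arc_log Z \<gamma> h) (at 0)"
      by (simp add: power_add)
    then show ?thesis
      using m(1) m'(1) by (intro arc_log_eqI[OF log_stalk_mult[OF Z f h]]) auto
  qed
  have ext: "arc_log Z \<gamma> \<in> extensional (log_stalk X Z (\<gamma> 0))" by (simp add: arc_log_def)
  have nz: "\<forall>f\<in>log_stalk X Z (\<gamma> 0). arc_log Z \<gamma> f \<noteq> 0" using log_stalk_leading by blast
  show ?thesis
    unfolding alog_def using x ext nz cong one mult unit by blast
qed

text \<open>With nonzero velocity the zero is simple, so the leading coefficient is the limit of the
  difference quotient.\<close>

lemma arc_log_velocity:
  assumes f: "f \<in> log_stalk X Z (\<gamma> 0)" "f (\<gamma> 0) = 0" "velocity X \<gamma> f \<noteq> 0"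
  shows "arc_log Z \<gamma> f = velocity X \<gamma> f"
proof (rule arc_log_eqI[OF f(1,3)])
  have "((\<lambda>t. f (\<gamma> t)) has_field_derivative velocity X \<gamma> f) (at 0)"
    by (rule holomorphic_arc_deriv[OF \<gamma> log_stalk_stalk[OF f(1)]])
  then show "((\<lambda>t. f (\<gamma> t) / t ^ 1) \<longlongrightarrow> velocity X \<gamma> f) (at 0)"
    by (simp add: has_field_derivative_iff f(2))
qed

end

end

section \<open>Normal vectors in a chart\<close>

text \<open>\<open>\<kappa> k\<close> is the position of the equation of \<open>D k\<close> among
  the generators of the ideal of \<open>C\<close>; its injectivity lets the velocities across
  different components be prescribed independently.\<close>

locale blowup_point = blowup_chart +
  fixes K :: "'k set" and D :: "'k \<Rightarrow> 'a set" and \<kappa> :: "'k \<Rightarrow> nat"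
  assumes finK: "finite K" and neK: "K \<noteq> {}" and closedD: "\<And>k. k \<in> K \<Longrightarrow> closedin (zar M) (D k)"
    and CD: "\<And>k. k \<in> K \<Longrightarrow> C \<subseteq> D k" and \<kappa>: "\<And>k. k \<in> K \<Longrightarrow> \<kappa> k \<le> r" "inj_on \<kappa> K"
    and eqD: "\<And>k y. k \<in> K \<Longrightarrow> y \<in> U \<Longrightarrow> local_equation M (D k) y (g (\<kappa> k))"
begin

definition S :: "'k \<Rightarrow> 'b set" where "S k = strict_transform M' \<sigma> C (D k)"

context
  fixes k
  assumes k: "k \<in> K"
begin

lemma S_ST: "S k = ST (D k)"
  by (simp add: S_def ST_def[OF CD[OF k] closedD[OF k] \<kappa>(1)[OF k] eqD[OF k]])

lemma S_mem_iff: "j \<le> r \<Longrightarrow> x \<in> chart j \<Longrightarrow> \<sigma> x \<in> C \<Longrightarrow> x \<in> S k \<longleftrightarrow> q j x (\<kappa> k) = 0"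
  unfolding S_ST by (rule ST_mem_iff[OF CD[OF k] closedD[OF k] \<kappa>(1)[OF k] eqD[OF k]])

lemma S_local_equation:
  "j \<le> r \<Longrightarrow> x \<in> chart j \<Longrightarrow> q j x (\<kappa> k) = 0 \<Longrightarrow> local_equation M' (S k) x (\<lambda>y. q j y (\<kappa> k))"
  unfolding S_ST by (rule ST_local_equation[OF CD[OF k] closedD[OF k] \<kappa>(1)[OF k] eqD[OF k]])

lemma D_mem_iff: "y \<in> U \<Longrightarrow> y \<in> D k \<longleftrightarrow> g (\<kappa> k) y = 0"
  by (rule mem_Z_iff[OF CD[OF k] closedD[OF k] \<kappa>(1)[OF k] eqD[OF k]])

end

lemma E_chart: "x \<in> E \<Longrightarrow> \<sigma> x \<in> U \<Longrightarrow> \<exists>j\<le>r. x \<in> chart j"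
  using chart_exists[of x] by (simp add: E_def inverse_image_def U'_def)

lemma E_\<sigma>: "x \<in> E \<Longrightarrow> \<sigma> x \<in> C"
  by (simp add: E_def inverse_image_def)

lemma E_topspace: "x \<in> E \<Longrightarrow> x \<in> topspace (zar M')"
  by (simp add: E_def inverse_image_def)

text \<open>Differentiating the product of \<open>q j y i\<close> and the exceptional equation along
  the lifted arc leaves one term, because the exceptional equation vanishes at the starting
  point.\<close>

lemma lift_velocity:
  assumes arc: "arc_lift M M' \<sigma> \<gamma> \<gamma>'" and j: "j \<le> r" and x: "\<gamma>' 0 \<in> chart j" "\<gamma>' 0 \<in> E" and i: "i \<le> r"
  shows "velocity M \<gamma> (g i) = q j (\<gamma>' 0) i * velocity M' \<gamma>' (\<lambda>y. g j (\<sigma> y))"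
proof -
  have \<gamma>: "holomorphic_arc M \<gamma>" and \<gamma>': "holomorphic_arc M' \<gamma>'"
    and lift: "eventually (\<lambda>t. \<sigma> (\<gamma>' t) = \<gamma> t) (nhds 0)"
    using arc unfolding arc_lift_def eventually_nhds_metric by (auto simp: dist_norm)
  have \<gamma>0: "\<gamma> 0 = \<sigma> (\<gamma>' 0)" using eventually_nhds_x_imp_x[OF lift] by simp
  have \<gamma>U: "\<gamma> 0 \<in> U" using chart_nbhd(5)[OF j x(1)] \<gamma>0 by simp
  have ch: "eventually (\<lambda>t. \<gamma>' t \<in> chart j) (nhds 0)"
    by (rule M'.holomorphic_arc_near[OF \<gamma>' chart_open[OF j] x(1)])
  have ev: "eventually (\<lambda>t. g i (\<gamma> t) = q j (\<gamma>' t) i * g j (\<sigma> (\<gamma>' t))) (nhds 0)"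
    using lift ch
  proof eventually_elim
    case (elim t)
    show ?case using q_relation[OF elim(2) i j] unfolding elim(1) .
  qed
  have e0: "g j (\<sigma> (\<gamma>' 0)) = 0" using e_zero_iff[OF j x(1)] E_\<sigma>[OF x(2)] by blast
  have "((\<lambda>t. q j (\<gamma>' t) i * g j (\<sigma> (\<gamma>' t))) has_field_derivative
      velocity M' \<gamma>' (\<lambda>y. q j y i) * g j (\<sigma> (\<gamma>' 0)) + velocity M' \<gamma>' (\<lambda>y. g j (\<sigma> y)) * q j (\<gamma>' 0) i) (at 0)"
    by (rule DERIV_mult[OF M'.holomorphic_arc_deriv[OF \<gamma>' q_stalk[OF j x(1) i]]
          M'.holomorphic_arc_deriv[OF \<gamma>' e_stalk[OF j x(1) j]]])
  from M.velocity_eventuallyI[where \<gamma> = \<gamma>, OF g_stalk[OF i \<gamma>U] ev this] show ?thesis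
    by (simp add: e0)
qed

text \<open>Required in every chart through \<open>x\<close>, so that vectors constructed in
  different charts can be compared.\<close>

definition compatible :: "'b \<Rightarrow> 'a normal \<Rightarrow> 'b normal \<Rightarrow> bool" where
  "compatible x \<nu> \<nu>' \<longleftrightarrow> (\<forall>j\<le>r. x \<in> chart j \<longrightarrow>
     (\<forall>i\<le>r. normal_deriv \<nu> (g i) = q j x i * normal_deriv \<nu>' (\<lambda>y. g j (\<sigma> y))))"

lemma compatibleD:
  "compatible x \<nu> \<nu>' \<Longrightarrow> j \<le> r \<Longrightarrow> x \<in> chart j \<Longrightarrow> i \<le> r \<Longrightarrow>
     normal_deriv \<nu> (g i) = q j x i * normal_deriv \<nu>' (\<lambda>y. g j (\<sigma> y))"
  by (simp add: compatible_def)

lemma arc_compatible: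
  assumes arc: "arc_lift M M' \<sigma> \<gamma> \<gamma>'" and x: "\<gamma>' 0 \<in> E" "\<sigma> (\<gamma>' 0) \<in> U"
  shows "compatible (\<gamma>' 0) (normal_class M C (\<gamma> 0) (velocity M \<gamma>)) (normal_class M' E (\<gamma>' 0) (velocity M' \<gamma>'))"
  unfolding compatible_def
proof (intro allI impI)
  fix j i assume j: "j \<le> r" and c: "\<gamma>' 0 \<in> chart j" and i: "i \<le> r"
  have \<gamma>: "holomorphic_arc M \<gamma>" and \<gamma>': "holomorphic_arc M' \<gamma>'" and \<gamma>0: "\<gamma> 0 = \<sigma> (\<gamma>' 0)"
    using arc unfolding arc_lift_def by auto
  have e: "(\<lambda>y. g j (\<sigma> y)) \<in> ideal_at M' E (\<gamma>' 0)"
    using E_local_equation[OF j c] by (simp add: M'.local_equation_iff)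
  have gi: "g i \<in> ideal_at M C (\<gamma> 0)" using g_ideal[OF i] x(2) \<gamma>0 by simp
  show "normal_deriv (normal_class M C (\<gamma> 0) (velocity M \<gamma>)) (g i) =
      q j (\<gamma>' 0) i * normal_deriv (normal_class M' E (\<gamma>' 0) (velocity M' \<gamma>')) (\<lambda>y. g j (\<sigma> y))"
    using M.normal_deriv_class[OF M.velocity_tangent[OF \<gamma>] gi] M'.normal_deriv_class[OF M'.velocity_tangent[OF \<gamma>'] e]
      lift_velocity[OF arc j c x(1) i] by simp
qed

lemma normal_C_eqI:
  assumes "\<nu> \<in> normal_space M C y" "\<mu> \<in> normal_space M C y" "y \<in> C" "y \<in> U"
    "\<And>i. i \<le> r \<Longrightarrow> normal_deriv \<nu> (g i) = normal_deriv \<mu> (g i)"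
  shows "\<nu> = \<mu>"
  using M.normal_eq_generators[OF assms(1-3) U_topspace[OF assms(4)] finite_atMost gen[OF assms(4)]] assms(5)
  by (simp add: g_def)

lemma normal_C_nonzero_iff:
  assumes "\<nu> \<in> normal_space M C y" "y \<in> C" "y \<in> U"
  shows "\<nu> \<in> nonzero_normals M C y \<longleftrightarrow> (\<exists>i\<le>r. normal_deriv \<nu> (g i) \<noteq> 0)"
proof -
  have "\<nu> = zero_normal M C y \<longleftrightarrow> (\<forall>i\<le>r. normal_deriv \<nu> (g i) = 0)"
    using normal_C_eqI[OF assms(1) M.zero_normal_space assms(2,3)] M.normal_deriv_zero[OF g_ideal[OF _ assms(3)]]
    by metis
  then show ?thesis using assms(1) by (auto simp: nonzero_normals_def)
qed

lemma compatible_unique: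
  assumes "compatible x \<nu> \<nu>'" "compatible x \<mu> \<nu>'" "x \<in> E" "\<sigma> x \<in> U"
    "\<nu> \<in> normal_space M C (\<sigma> x)" "\<mu> \<in> normal_space M C (\<sigma> x)"
  shows "\<nu> = \<mu>"
proof -
  obtain j where j: "j \<le> r" "x \<in> chart j" using E_chart assms by blast
  show ?thesis
    by (rule normal_C_eqI[OF assms(5,6) E_\<sigma>[OF assms(3)] assms(4)])
       (simp add: compatibleD[OF assms(1) j] compatibleD[OF assms(2) j])
qed

lemma E_normal_eqI:
  assumes "j \<le> r" "x \<in> chart j" "x \<in> E" "\<nu> \<in> normal_space M' E x" "\<mu> \<in> normal_space M' E x"
    "normal_deriv \<nu> (\<lambda>y. g j (\<sigma> y)) = normal_deriv \<mu> (\<lambda>y. g j (\<sigma> y))"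
  shows "\<nu> = \<mu>"
  by (rule M'.normal_eq_local_equation[OF assms(4,5,3) E_topspace[OF assms(3)] E_local_equation[OF assms(1,2)] assms(6)])

lemma E_nonzero_iff:
  assumes "j \<le> r" "x \<in> chart j" "x \<in> E"
  shows "\<nu> \<in> nonzero_normals M' E x \<longleftrightarrow> \<nu> \<in> normal_space M' E x \<and> normal_deriv \<nu> (\<lambda>y. g j (\<sigma> y)) \<noteq> 0"
  by (rule M'.nonzero_normals_iff[OF assms(3) E_topspace[OF assms(3)] E_local_equation[OF assms(1,2)]])

lemma velocity_arc:
  assumes j: "j \<le> r" and x: "x \<in> chart j" "x \<in> E" and b: "b j = 0"
  obtains \<gamma> \<gamma>' where "arc_lift M M' \<sigma> \<gamma> \<gamma>'" "\<gamma> 0 = \<sigma> x" "\<gamma>' 0 = x"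
    "velocity M' \<gamma>' (\<lambda>y. g j (\<sigma> y)) = a" "\<forall>i\<le>r. velocity M' \<gamma>' (\<lambda>y. q j y i) = b i"
    "eventually (\<lambda>t. \<gamma>' t \<in> chart j \<and> (\<forall>i\<le>r. g i (\<sigma> (\<gamma>' t)) = a * t * (q j x i + b i * t))) (nhds 0)"
proof -
  obtain \<gamma> \<gamma>' where arc: "arc_lift M M' \<sigma> \<gamma> \<gamma>'" "\<gamma> 0 = \<sigma> x" "\<gamma>' 0 = x"
    and ev: "eventually (\<lambda>t. \<gamma>' t \<in> chart j \<and> \<sigma> (\<gamma>' t) = \<gamma> t \<and>
       (\<forall>i\<le>r. g i (\<gamma> t) = a * t * (q j x i + b i * t) \<and> q j (\<gamma>' t) i = q j x i + b i * t)) (nhds 0)"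
    by (rule chart_arc[where a = a and b = b, OF j x(1) E_\<sigma>[OF x(2)] b])
  have ev': "eventually (\<lambda>t. g j (\<sigma> (\<gamma>' t)) = a * t) (nhds 0)"
    using ev by eventually_elim (use j b q_homogeneous(3)[OF x(1)] in auto)
  have e: "velocity M' \<gamma>' (\<lambda>y. g j (\<sigma> y)) = a"
    by (rule M'.velocity_eventuallyI[where \<gamma> = \<gamma>', OF _ ev'])
       (use e_stalk[OF j x(1) j] arc(3) in \<open>auto intro!: derivative_eq_intros\<close>)
  have "velocity M' \<gamma>' (\<lambda>y. q j y i) = b i" if i: "i \<le> r" for i
  proof -
    have "eventually (\<lambda>t. q j (\<gamma>' t) i = q j x i + b i * t) (nhds 0)"
      using ev by eventually_elim (use i in auto)
    then show ?thesis
      by (rule M'.velocity_eventuallyI[where \<gamma> = \<gamma>', rotated])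
         (use q_stalk[OF j x(1) i] arc(3) in \<open>auto intro!: derivative_eq_intros\<close>)
  qed
  moreover have "eventually (\<lambda>t. \<gamma>' t \<in> chart j \<and> (\<forall>i\<le>r. g i (\<sigma> (\<gamma>' t)) = a * t * (q j x i + b i * t))) (nhds 0)"
    using ev by eventually_elim auto
  ultimately show ?thesis using that arc e by blast
qed

text \<open>\<open>lift_normal\<close> is a definite description over all arcs with the given class,
  so any two candidates must agree. The coordinate vectors of their starting points are both
  proportional to the values of the common class on the \<open>g i\<close>, hence the points
  coincide; there the class also determines the value on the exceptional equation.\<close>

lemma lift_normal_eq:
  assumes arc: "arc_lift M M' \<sigma> \<gamma> \<gamma>'" and x: "\<gamma>' 0 \<in> E" "\<sigma> (\<gamma>' 0) \<in> U"
    and nz: "normal_class M' E (\<gamma>' 0) (velocity M' \<gamma>') \<in> nonzero_normals M' E (\<gamma>' 0)"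
  shows "lift_normal M C M' \<sigma> (\<gamma> 0, normal_class M C (\<gamma> 0) (velocity M \<gamma>)) =
     (\<gamma>' 0, normal_class M' E (\<gamma>' 0) (velocity M' \<gamma>'))"
  unfolding lift_normal_def prod.case
proof (rule the_equality)
  show "\<exists>\<gamma>1 \<gamma>1'. arc_lift M M' \<sigma> \<gamma>1 \<gamma>1' \<and> \<gamma>1 0 = \<gamma> 0 \<and>
      normal_class M C (\<gamma> 0) (velocity M \<gamma>1) = normal_class M C (\<gamma> 0) (velocity M \<gamma>) \<and>
      (\<gamma>' 0, normal_class M' E (\<gamma>' 0) (velocity M' \<gamma>')) =
      (\<gamma>1' 0, normal_class M' (inverse_image M' \<sigma> C) (\<gamma>1' 0) (velocity M' \<gamma>1'))"
    using arc by (intro exI[of _ \<gamma>] exI[of _ \<gamma>']) (simp add: E_def)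
  fix p assume "\<exists>\<gamma>1 \<gamma>1'. arc_lift M M' \<sigma> \<gamma>1 \<gamma>1' \<and> \<gamma>1 0 = \<gamma> 0 \<and>
      normal_class M C (\<gamma> 0) (velocity M \<gamma>1) = normal_class M C (\<gamma> 0) (velocity M \<gamma>) \<and>
      p = (\<gamma>1' 0, normal_class M' (inverse_image M' \<sigma> C) (\<gamma>1' 0) (velocity M' \<gamma>1'))"
  then obtain \<gamma>1 \<gamma>1' where arc1: "arc_lift M M' \<sigma> \<gamma>1 \<gamma>1'" and g1: "\<gamma>1 0 = \<gamma> 0"
    and cl: "normal_class M C (\<gamma> 0) (velocity M \<gamma>1) = normal_class M C (\<gamma> 0) (velocity M \<gamma>)"
    and p: "p = (\<gamma>1' 0, normal_class M' E (\<gamma>1' 0) (velocity M' \<gamma>1'))" unfolding E_def by blast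
  define \<nu> where "\<nu> = normal_class M C (\<gamma> 0) (velocity M \<gamma>)"
  define \<nu>' where "\<nu>' = normal_class M' E (\<gamma>' 0) (velocity M' \<gamma>')"
  define \<nu>1' where "\<nu>1' = normal_class M' E (\<gamma>1' 0) (velocity M' \<gamma>1')"
  have pts: "\<gamma>' 0 \<in> topspace (zar M')" "\<gamma>1' 0 \<in> topspace (zar M')" "\<gamma> 0 = \<sigma> (\<gamma>' 0)" "\<gamma> 0 = \<sigma> (\<gamma>1' 0)"
    using arc arc1 g1 unfolding arc_lift_def holomorphic_arc_def by auto
  have x1: "\<gamma>1' 0 \<in> E" "\<sigma> (\<gamma>1' 0) \<in> U"
    using pts x E_\<sigma>[OF x(1)] by (auto simp: E_def inverse_image_def)
  have comp: "compatible (\<gamma>' 0) \<nu> \<nu>'" unfolding \<nu>_def \<nu>'_def by (rule arc_compatible[OF arc x])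
  have comp1: "compatible (\<gamma>1' 0) \<nu> \<nu>1'"
    using arc_compatible[OF arc1 x1] cl g1 unfolding \<nu>_def \<nu>1'_def by simp
  obtain j where j: "j \<le> r" "\<gamma>' 0 \<in> chart j" using E_chart[OF x] by blast
  obtain j1 where j1: "j1 \<le> r" "\<gamma>1' 0 \<in> chart j1" using E_chart[OF x1] by blast
  define c where "c = normal_deriv \<nu>' (\<lambda>y. g j (\<sigma> y))"
  define c1 where "c1 = normal_deriv \<nu>1' (\<lambda>y. g j1 (\<sigma> y))"
  have c: "c \<noteq> 0" using nz E_nonzero_iff[OF j x(1)] by (simp add: c_def \<nu>'_def)
  have rel: "q j (\<gamma>' 0) i * c = q j1 (\<gamma>1' 0) i * c1" if "i \<le> r" for i
    using compatibleD[OF comp j that] compatibleD[OF comp1 j1 that] by (simp add: c_def c1_def)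
  \<comment> \<open>At the index \<open>j\<close> the left side of \<open>rel\<close> is
    \<open>c\<close>, since the normalised coordinate is 1.\<close>
  have c1: "c1 \<noteq> 0" using rel[OF j(1)] q_homogeneous(3)[OF j(2)] c by auto
  have "q j (\<gamma>' 0) i = (c1 / c) * q j1 (\<gamma>1' 0) i" for i
  proof (cases "i \<le> r")
    case True
    then show ?thesis using rel[OF True] c by (simp add: field_simps)
  next
    case False
    then show ?thesis
      using q_homogeneous(1)[OF j(2)] q_homogeneous(1)[OF j1(2)] by (simp add: homogeneous_vector_def)
  qed
  then have "q j (\<gamma>' 0) = (\<lambda>i. (c1 / c) * q j1 (\<gamma>1' 0) i)" by blast
  moreover have "c1 / c \<noteq> 0" using c c1 by simp
  ultimately have "proj_class (q j (\<gamma>' 0)) = proj_class (q j1 (\<gamma>1' 0))" using proj_class_scale by metis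
  then have "\<theta> (\<gamma>' 0) = \<theta> (\<gamma>1' 0)"
    using q_homogeneous(2)[OF j(2)] q_homogeneous(2)[OF j1(2)] pts by simp
  then have eq: "\<gamma>1' 0 = \<gamma>' 0" using \<theta>'_\<theta> chart_U'[OF j(2)] chart_U'[OF j1(2)] by metis
  have v: "\<nu>' \<in> normal_space M' E (\<gamma>' 0)" "\<nu>1' \<in> normal_space M' E (\<gamma>' 0)"
    using M'.velocity_tangent[of \<gamma>'] M'.velocity_tangent[of \<gamma>1'] arc arc1 eq
    unfolding \<nu>'_def \<nu>1'_def normal_space_def arc_lift_def by auto
  have "normal_deriv \<nu>' (\<lambda>y. g j (\<sigma> y)) = normal_deriv \<nu>1' (\<lambda>y. g j (\<sigma> y))"
    using compatibleD[OF comp j j(1)] compatibleD[OF comp1 j(1) _ j(1)] j(2) eq q_homogeneous(3)[OF j(2)] by simp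
  then have "\<nu>' = \<nu>1'" by (rule E_normal_eqI[OF j x(1) v])
  then show "p = (\<gamma>' 0, normal_class M' E (\<gamma>' 0) (velocity M' \<gamma>'))"
    using p eq by (simp add: \<nu>'_def \<nu>1'_def)
qed

text \<open>An arc with constant homogeneous coordinates and with the value of \<open>\<nu>'\<close>
  on the exceptional equation as speed realises \<open>\<nu>'\<close>; the class of its image in
  \<open>M\<close> is the preimage.\<close>

lemma lift_normal_at:
  assumes x: "x \<in> E" "\<sigma> x \<in> U" and \<nu>': "\<nu>' \<in> nonzero_normals M' E x"
  obtains \<nu> where "\<nu> \<in> nonzero_normals M C (\<sigma> x)" "compatible x \<nu> \<nu>'" "lift_normal M C M' \<sigma> (\<sigma> x, \<nu>) = (x, \<nu>')"
proof -
  obtain j where j: "j \<le> r" "x \<in> chart j" using E_chart[OF x] by blast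
  define a where "a = normal_deriv \<nu>' (\<lambda>y. g j (\<sigma> y))"
  have a: "a \<noteq> 0" "\<nu>' \<in> normal_space M' E x" using \<nu>' E_nonzero_iff[OF j x(1)] by (auto simp: a_def)
  obtain \<gamma> \<gamma>' where arc: "arc_lift M M' \<sigma> \<gamma> \<gamma>'" "\<gamma> 0 = \<sigma> x" "\<gamma>' 0 = x"
    and vel: "velocity M' \<gamma>' (\<lambda>y. g j (\<sigma> y)) = a"
    by (rule velocity_arc[OF j x(1), of "\<lambda>_. 0"]) auto
  have vt: "velocity M' \<gamma>' \<in> tangent_space M' x" "velocity M \<gamma> \<in> tangent_space M (\<sigma> x)"
    using M'.velocity_tangent[of \<gamma>'] M.velocity_tangent[of \<gamma>] arc by (auto simp: arc_lift_def)
  have e: "(\<lambda>y. g j (\<sigma> y)) \<in> ideal_at M' E x"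
    using E_local_equation[OF j] by (simp add: M'.local_equation_iff)
  have cl: "normal_class M' E x (velocity M' \<gamma>') = \<nu>'"
    by (rule E_normal_eqI[OF j x(1) _ a(2)])
       (use vt M'.normal_deriv_class[OF vt(1) e] vel in \<open>auto simp: normal_space_def a_def\<close>)
  define \<nu> where "\<nu> = normal_class M C (\<sigma> x) (velocity M \<gamma>)"
  have comp: "compatible x \<nu> \<nu>'"
    using arc_compatible[OF arc(1)] x arc(2,3) cl by (simp add: \<nu>_def)
  have \<nu>: "\<nu> \<in> normal_space M C (\<sigma> x)" using vt(2) by (simp add: \<nu>_def normal_space_def)
  have "normal_deriv \<nu> (g j) \<noteq> 0"
    using compatibleD[OF comp j j(1)] q_homogeneous(3)[OF j(2)] a(1) by (simp add: a_def)
  then have "\<nu> \<in> nonzero_normals M C (\<sigma> x)"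
    using normal_C_nonzero_iff[OF \<nu> E_\<sigma>[OF x(1)] x(2)] j(1) by blast
  moreover have "lift_normal M C M' \<sigma> (\<sigma> x, \<nu>) = (x, \<nu>')"
    using lift_normal_eq[OF arc(1)] x arc(2,3) cl \<nu>' by (simp add: \<nu>_def)
  ultimately show ?thesis using that comp by blast
qed

lemma lift_normal_exists:
  assumes y: "y \<in> C" "y \<in> U" and \<nu>: "\<nu> \<in> nonzero_normals M C y"
  obtains x \<nu>' where "x \<in> E" "\<sigma> x = y" "\<nu>' \<in> nonzero_normals M' E x" "compatible x \<nu> \<nu>'"
    "lift_normal M C M' \<sigma> (y, \<nu>) = (x, \<nu>')"
proof -
  have \<nu>s: "\<nu> \<in> normal_space M C y" using \<nu> by (simp add: nonzero_normals_def)
  \<comment> \<open>The point of the projective fibre determined by \<open>\<nu>\<close> has the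
    derivatives of the generators as homogeneous coordinates.\<close>
  define \<xi> where "\<xi> = (\<lambda>i. if i \<le> r then normal_deriv \<nu> (g i) else 0)"
  have \<xi>: "homogeneous_vector r \<xi>"
    using \<nu> normal_C_nonzero_iff[OF \<nu>s y] by (auto simp: homogeneous_vector_def \<xi>_def)
  then obtain j where j: "j \<le> r" "\<xi> j \<noteq> 0" by (auto simp: homogeneous_vector_def)
  have gy: "g i y = 0" if "i \<le> r" for i using mem_C_iff[OF y(2)] y(1) that by blast
  define x where "x = \<theta>' (y, proj_class \<xi>)"
  have x: "x \<in> U'" "\<sigma> x = y" "\<theta> x = (y, proj_class \<xi>)"
    unfolding x_def by (rule point[OF y(2) \<xi>]; simp add: gy)+
  have xE: "x \<in> E" using E_iff[OF x(1)] x(2) y(1) by simp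
  have xj: "x \<in> chart j" and qx: "\<And>i. q j x i = \<xi> i / \<xi> j" using q_eqI[OF x(1,3) j(2)] by auto
  obtain \<gamma> \<gamma>' where arc: "arc_lift M M' \<sigma> \<gamma> \<gamma>'" "\<gamma> 0 = \<sigma> x" "\<gamma>' 0 = x"
    and vel: "velocity M' \<gamma>' (\<lambda>y. g j (\<sigma> y)) = \<xi> j"
    by (rule velocity_arc[OF j(1) xj xE, of "\<lambda>_. 0"]) auto
  have vt: "velocity M' \<gamma>' \<in> tangent_space M' x" "velocity M \<gamma> \<in> tangent_space M y"
    using M'.velocity_tangent[of \<gamma>'] M.velocity_tangent[of \<gamma>] arc x(2) by (auto simp: arc_lift_def)
  have e: "(\<lambda>y. g j (\<sigma> y)) \<in> ideal_at M' E x"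
    using E_local_equation[OF j(1) xj] by (simp add: M'.local_equation_iff)
  define \<nu>' where "\<nu>' = normal_class M' E x (velocity M' \<gamma>')"
  have \<nu>'e: "normal_deriv \<nu>' (\<lambda>y. g j (\<sigma> y)) = \<xi> j"
    using M'.normal_deriv_class[OF vt(1) e] vel by (simp add: \<nu>'_def)
  have \<nu>': "\<nu>' \<in> nonzero_normals M' E x"
    unfolding E_nonzero_iff[OF j(1) xj xE] using vt(1) \<nu>'e j(2) by (auto simp: \<nu>'_def normal_space_def)
  have comp: "compatible x (normal_class M C y (velocity M \<gamma>)) \<nu>'"
    using arc_compatible[OF arc(1)] xE x y(2) arc(2,3) by (simp add: \<nu>'_def)
  have cl: "normal_class M C y (velocity M \<gamma>) = \<nu>"
  proof (rule normal_C_eqI[OF _ \<nu>s y])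
    show "normal_class M C y (velocity M \<gamma>) \<in> normal_space M C y" using vt(2) by (simp add: normal_space_def)
    show "normal_deriv (normal_class M C y (velocity M \<gamma>)) (g i) = normal_deriv \<nu> (g i)" if "i \<le> r" for i
      using compatibleD[OF comp j(1) xj that] qx \<nu>'e j(2) that by (simp add: \<xi>_def)
  qed
  have "lift_normal M C M' \<sigma> (y, \<nu>) = (x, \<nu>')"
    using lift_normal_eq[OF arc(1)] xE x(2) y(2) arc(2,3) cl \<nu>' by (simp add: \<nu>'_def)
  then show ?thesis using that xE x(2) \<nu>' comp cl by blast
qed

section \<open>Normal vectors with prescribed values and their products\<close>

lemma normal_D_exists:
  assumes k: "k \<in> K" and y: "y \<in> C" "y \<in> U"
  obtains \<omega> where "\<omega> \<in> normal_space M (D k) y" "normal_deriv \<omega> (g (\<kappa> k)) = c"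
proof -
  obtain \<gamma> where \<gamma>: "holomorphic_arc M \<gamma>" "\<gamma> 0 = y"
    and ev: "eventually (\<lambda>t. \<forall>i\<le>r. g i (\<gamma> t) = g i y + c * t) (nhds 0)"
    by (rule arc[OF y(2), of "\<lambda>_ t. c * t"]) (auto intro!: holomorphic_intros)
  have ev': "eventually (\<lambda>t. g (\<kappa> k) (\<gamma> t) = g (\<kappa> k) y + c * t) (nhds 0)"
    using ev by eventually_elim (use \<kappa>(1)[OF k] in auto)
  have "velocity M \<gamma> (g (\<kappa> k)) = c"
    by (rule M.velocity_eventuallyI[where \<gamma> = \<gamma>, OF _ ev'])
       (use g_stalk[OF \<kappa>(1)[OF k] y(2)] \<gamma>(2) in \<open>auto intro!: derivative_eq_intros\<close>)
  moreover have v: "velocity M \<gamma> \<in> tangent_space M y" using M.velocity_tangent[OF \<gamma>(1)] \<gamma>(2) by simp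
  moreover have "g (\<kappa> k) \<in> ideal_at M (D k) y" using eqD[OF k y(2)] by (simp add: M.local_equation_iff)
  ultimately show ?thesis
    using that[of "normal_class M (D k) y (velocity M \<gamma>)"] M.normal_deriv_class[OF v] by (simp add: normal_space_def)
qed

lemma normal_S_exists:
  assumes k: "k \<in> K" and j: "j \<le> r" and x: "x \<in> chart j" "x \<in> E" "x \<in> S k"
  obtains \<mu> where "\<mu> \<in> normal_space M' (S k) x" "normal_deriv \<mu> (\<lambda>y. q j y (\<kappa> k)) = c"
proof -
  have q0: "q j x (\<kappa> k) = 0" using S_mem_iff[OF k j x(1) E_\<sigma>[OF x(2)]] x(3) by blast
  \<comment> \<open>On the strict transform the coordinate \<open>\<kappa> k\<close> vanishes while
    the coordinate \<open>j\<close> is 1, so the former may be moved without disturbing the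
    normalisation.\<close>
  then have kj: "\<kappa> k \<noteq> j" using q_homogeneous(3)[OF x(1)] by auto
  obtain \<gamma> \<gamma>' where arc: "arc_lift M M' \<sigma> \<gamma> \<gamma>'" "\<gamma>' 0 = x"
    and vel: "\<forall>i\<le>r. velocity M' \<gamma>' (\<lambda>y. q j y i) = (\<lambda>i. if i = \<kappa> k then c else 0) i"
    by (rule velocity_arc[OF j x(1,2), of "\<lambda>i. if i = \<kappa> k then c else 0"]) (use kj in auto)
  have v: "velocity M' \<gamma>' \<in> tangent_space M' x" using M'.velocity_tangent[of \<gamma>'] arc by (simp add: arc_lift_def)
  have "(\<lambda>y. q j y (\<kappa> k)) \<in> ideal_at M' (S k) x"
    using S_local_equation[OF k j x(1) q0] by (simp add: M'.local_equation_iff)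
  then show ?thesis
    using that[of "normal_class M' (S k) x (velocity M' \<gamma>')"] M'.normal_deriv_class[OF v] v vel \<kappa>(1)[OF k]
    by (simp add: normal_space_def)
qed

text \<open>The definite description quantifies over all factorisations of all equations. Any of
  them differs from the one in the chart by cofactors \<open>a\<close>, \<open>b\<close>,
  \<open>c\<close>, and the claim reduces to \<open>a (\<sigma> x) = b x * c x\<close>.\<close>

lemma normal_mult_eq:
  assumes k: "k \<in> K" and j: "j \<le> r" and x: "x \<in> chart j" "x \<in> E" "x \<in> S k"
    and \<nu>: "\<nu> \<in> normal_space M' E x" and \<mu>: "\<mu> \<in> normal_space M' (S k) x"
    and \<omega>: "\<omega> \<in> normal_space M (D k) (\<sigma> x)"
      "normal_deriv \<omega> (g (\<kappa> k)) = normal_deriv \<nu> (\<lambda>y. g j (\<sigma> y)) * normal_deriv \<mu> (\<lambda>y. q j y (\<kappa> k))"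
  shows "normal_mult M C M' \<sigma> (D k) x \<nu> \<mu> = \<omega>"
proof -
  have \<sigma>x: "\<sigma> x \<in> C" "\<sigma> x \<in> U" "\<sigma> x \<in> D k" "x \<in> topspace (zar M')"
    using E_\<sigma>[OF x(2)] chart_nbhd(5)[OF j x(1)] CD[OF k] E_topspace[OF x(2)] by auto
  have q0: "q j x (\<kappa> k) = 0" using S_mem_iff[OF k j x(1) \<sigma>x(1)] x(3) by blast
  have kr: "\<kappa> k \<le> r" by (rule \<kappa>(1)[OF k])
  note leg = eqD[OF k \<sigma>x(2)] and lee = E_local_equation[OF j x(1)] and leq = S_local_equation[OF k j x(1) q0]
  have gI: "g (\<kappa> k) \<in> ideal_at M (D k) (\<sigma> x)" and eI: "(\<lambda>y. g j (\<sigma> y)) \<in> ideal_at M' E x"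
    and qI: "(\<lambda>y. q j y (\<kappa> k)) \<in> ideal_at M' (S k) x"
    using leg lee leq by (auto simp: M.local_equation_iff M'.local_equation_iff)
  have fac: "eq_near M' x (g (\<kappa> k) \<circ> \<sigma>) (\<lambda>y. g j (\<sigma> y) * q j y (\<kappa> k))"
    using q_e_near[OF j x(1) kr] by (simp add: o_def mult.commute)
  show ?thesis
    unfolding normal_mult_def E_def[symmetric] S_def[symmetric]
  proof (rule the_equality)
    show "\<omega> \<in> normal_space M (D k) (\<sigma> x) \<and> (\<forall>g e h. local_equation M (D k) (\<sigma> x) g \<and>
        local_equation M' E x e \<and> local_equation M' (S k) x h \<and> eq_near M' x (g \<circ> \<sigma>) (\<lambda>y. e y * h y) \<longrightarrow>
        normal_deriv \<omega> g = normal_deriv \<nu> e * normal_deriv \<mu> h)"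
    proof (intro conjI allI impI \<omega>(1))
      fix g1 e1 h1 assume "local_equation M (D k) (\<sigma> x) g1 \<and> local_equation M' E x e1 \<and>
        local_equation M' (S k) x h1 \<and> eq_near M' x (g1 \<circ> \<sigma>) (\<lambda>y. e1 y * h1 y)"
      then have le: "g1 \<in> ideal_at M (D k) (\<sigma> x)" "e1 \<in> ideal_at M' E x" "h1 \<in> ideal_at M' (S k) x"
        and fac1: "eq_near M' x (\<lambda>y. g1 (\<sigma> y)) (\<lambda>y. e1 y * h1 y)"
        by (auto simp: M.local_equation_iff M'.local_equation_iff o_def)
      obtain a where a: "a \<in> stalk M (\<sigma> x)" "eq_near M (\<sigma> x) g1 (\<lambda>y. a y * g (\<kappa> k) y)"
        using leg le(1) unfolding M.local_equation_iff by blast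
      obtain b where b: "b \<in> stalk M' x" "eq_near M' x e1 (\<lambda>y. b y * g j (\<sigma> y))"
        using lee le(2) unfolding M'.local_equation_iff by blast
      obtain c where c: "c \<in> stalk M' x" "eq_near M' x h1 (\<lambda>y. c y * q j y (\<kappa> k))"
        using leq le(3) unfolding M'.local_equation_iff by blast
      \<comment> \<open>The discrepancy of the cofactors. Comparing the two factorisations shows
        that its product with \<open>q\<close> and the exceptional equation is zero near
        \<open>x\<close>, and the exceptional equation is cancelled by density.\<close>
      define s where "s = (\<lambda>y. a (\<sigma> y) - b y * c y)"
      have s: "s \<in> stalk M' x"
        unfolding s_def by (intro M'.stalk_diff M'.stalk_mult pullback_stalk[OF a(1) \<sigma>x(4)] b(1) c(1))
      have qs: "(\<lambda>y. q j y (\<kappa> k)) \<in> stalk M' x" by (rule q_stalk[OF j x(1) kr])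
      have "eq_near M' x (\<lambda>y. a (\<sigma> y) * g (\<kappa> k) (\<sigma> y)) (\<lambda>y. e1 y * h1 y)"
        by (rule eq_near_trans[OF eq_near_sym[OF pullback_eq_near[OF a(2) \<sigma>x(4)]] fac1])
      moreover have "eq_near M' x (\<lambda>y. e1 y * h1 y) (\<lambda>y. (b y * g j (\<sigma> y)) * (c y * q j y (\<kappa> k)))"
        by (rule eq_near_mult[OF b(2) c(2)])
      ultimately have "eq_near M' x (\<lambda>y. a (\<sigma> y) * g (\<kappa> k) (\<sigma> y)) (\<lambda>y. (b y * g j (\<sigma> y)) * (c y * q j y (\<kappa> k)))"
        by (rule eq_near_trans)
      then have "eq_near M' x (\<lambda>y. g j (\<sigma> y) * (s y * q j y (\<kappa> k))) (\<lambda>y. 0)"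
        using q_e_near[OF j x(1) kr] by (rule eq_near_combine) (simp add: s_def algebra_simps)
      then have sq: "eq_near M' x (\<lambda>y. s y * q j y (\<kappa> k)) (\<lambda>y. 0)"
        by (rule e_cancel[OF j x(1) M'.stalk_mult[OF s qs]])
      \<comment> \<open>Since the product of \<open>s\<close> and \<open>q\<close> is zero near
        \<open>x\<close>, a normal vector of the strict transform with derivative 1 along
        \<open>q\<close> detects \<open>s x\<close>.\<close>
      have "s x = 0"
      proof -
        obtain \<mu>1 where \<mu>1: "\<mu>1 \<in> normal_space M' (S k) x" "normal_deriv \<mu>1 (\<lambda>y. q j y (\<kappa> k)) = 1"
          by (rule normal_S_exists[OF k j x])
        have "normal_deriv \<mu>1 (\<lambda>y. 0) = s x * normal_deriv \<mu>1 (\<lambda>y. q j y (\<kappa> k))"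
          by (rule M'.normal_deriv_mult[OF \<mu>1(1) x(3) s qI eq_near_sym[OF sq]])
        moreover have "normal_deriv \<mu>1 (\<lambda>y. 0) = 0 * normal_deriv \<mu>1 (\<lambda>y. q j y (\<kappa> k))"
          by (rule M'.normal_deriv_mult[OF \<mu>1(1) x(3) M'.stalk_const[OF \<sigma>x(4)] qI])
             (simp add: eq_near_refl[OF \<sigma>x(4)])
        ultimately show ?thesis using \<mu>1(2) by simp
      qed
      then have abc: "a (\<sigma> x) = b x * c x" by (simp add: s_def)
      show "normal_deriv \<omega> g1 = normal_deriv \<nu> e1 * normal_deriv \<mu> h1"
        using M.normal_deriv_mult[OF \<omega>(1) \<sigma>x(3) a(1) gI a(2)] M'.normal_deriv_mult[OF \<nu> x(2) b(1) eI b(2)]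
          M'.normal_deriv_mult[OF \<mu> x(3) c(1) qI c(2)] \<omega>(2) abc by simp
    qed
    fix \<omega>' assume *: "\<omega>' \<in> normal_space M (D k) (\<sigma> x) \<and> (\<forall>g e h. local_equation M (D k) (\<sigma> x) g \<and>
        local_equation M' E x e \<and> local_equation M' (S k) x h \<and> eq_near M' x (g \<circ> \<sigma>) (\<lambda>y. e y * h y) \<longrightarrow>
        normal_deriv \<omega>' g = normal_deriv \<nu> e * normal_deriv \<mu> h)"
    then have "normal_deriv \<omega>' (g (\<kappa> k)) = normal_deriv \<omega> (g (\<kappa> k))"
      using leg lee leq fac \<omega>(2) by metis
    then show "\<omega>' = \<omega>"
      using M.normal_eq_local_equation[OF _ \<omega>(1) \<sigma>x(3) U_topspace[OF \<sigma>x(2)] leg] * by blast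
  qed
qed


section \<open>The divisor and the log-space over the exceptional divisor\<close>

definition DM :: "'a set" where "DM = (\<Union>k\<in>K. D k)"

definition DM' :: "'b set" where "DM' = inverse_image M' \<sigma> DM"

lemma closed_DM: "closedin (zar M) DM"
  unfolding DM_def using finK closedD by (intro closedin_Union) auto

lemma closed_DM': "closedin (zar M') DM'"
  unfolding DM'_def inverse_image_def
  using \<sigma> closed_DM unfolding morphism_def by (blast intro: closedin_continuous_map_preimage)

lemma DM'_iff: "y \<in> topspace (zar M') \<Longrightarrow> y \<in> DM' \<longleftrightarrow> \<sigma> y \<in> DM"
  by (simp add: DM'_def inverse_image_def)

lemma D_log:
  assumes k: "k \<in> K" and y: "y \<in> U"
  shows "g (\<kappa> k) \<in> log_stalk M DM y"
  by (rule M.log_stalkI[OF closed_DM g_stalk[OF \<kappa>(1)[OF k] y] openU y])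
     (use D_mem_iff[OF k] k in \<open>auto simp: DM_def\<close>)

text \<open>The exceptional equation vanishes only over \<open>C\<close>, and \<open>C\<close> lies
  in the divisor because \<open>K\<close> is nonempty.\<close>

lemma E_log:
  assumes j: "j \<le> r" and x: "x \<in> chart j"
  shows "(\<lambda>y. g j (\<sigma> y)) \<in> log_stalk M' DM' x"
proof (rule M'.log_stalkI[OF closed_DM' e_stalk[OF j x j] chart_nbhd(1,2)[OF j x]])
  fix y assume y: "y \<in> chart j" "y \<notin> DM'"
  have "\<sigma> y \<notin> DM" using y DM'_iff chart_nbhd(3)[OF j y(1)] by blast
  moreover have "C \<subseteq> DM" using neK CD by (auto simp: DM_def)
  ultimately show "g j (\<sigma> y) \<noteq> 0" using e_zero_iff[OF j y(1)] by blast
qed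

text \<open>A zero of this coordinate is a zero of the pulled back equation of \<open>D k\<close>.
  The argument covers every \<open>k\<close>, also when the coordinate is a unit at
  \<open>x\<close>.\<close>

lemma S_log:
  assumes j: "j \<le> r" and x: "x \<in> chart j" and k: "k \<in> K"
  shows "(\<lambda>y. q j y (\<kappa> k)) \<in> log_stalk M' DM' x"
proof (rule M'.log_stalkI[OF closed_DM' q_stalk[OF j x \<kappa>(1)[OF k]] chart_nbhd(1,2)[OF j x]])
  fix y assume y: "y \<in> chart j" "y \<notin> DM'"
  have "\<sigma> y \<notin> DM" using y DM'_iff chart_nbhd(3)[OF j y(1)] by blast
  then have "g (\<kappa> k) (\<sigma> y) \<noteq> 0" using D_mem_iff[OF k chart_nbhd(5)[OF j y(1)]] k by (auto simp: DM_def)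
  then show "q j y (\<kappa> k) \<noteq> 0" using q_relation[OF y(1) \<kappa>(1)[OF k] j] by auto
qed

lemma normal_E_exists:
  assumes j: "j \<le> r" and x: "x \<in> chart j" "x \<in> E"
  obtains \<nu> where "\<nu> \<in> normal_space M' E x" "normal_deriv \<nu> (\<lambda>y. g j (\<sigma> y)) = c"
proof -
  obtain \<gamma> \<gamma>' where arc: "arc_lift M M' \<sigma> \<gamma> \<gamma>'" "\<gamma>' 0 = x"
    and vel: "velocity M' \<gamma>' (\<lambda>y. g j (\<sigma> y)) = c"
    by (rule velocity_arc[OF j x, of "\<lambda>_. 0"]) auto
  have v: "velocity M' \<gamma>' \<in> tangent_space M' x" using M'.velocity_tangent[of \<gamma>'] arc by (simp add: arc_lift_def)
  have "(\<lambda>y. g j (\<sigma> y)) \<in> ideal_at M' E x"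
    using E_local_equation[OF j x(1)] by (simp add: M'.local_equation_iff)
  then show ?thesis
    using that[of "normal_class M' E x (velocity M' \<gamma>')"] M'.normal_deriv_class[OF v] v vel
    by (simp add: normal_space_def)
qed

lemma S_nonzero_iff:
  assumes "k \<in> K" "j \<le> r" "x \<in> chart j" "x \<in> E" "x \<in> S k"
  shows "\<mu> \<in> nonzero_normals M' (S k) x \<longleftrightarrow>
    \<mu> \<in> normal_space M' (S k) x \<and> normal_deriv \<mu> (\<lambda>y. q j y (\<kappa> k)) \<noteq> 0"
proof -
  have "q j x (\<kappa> k) = 0" using S_mem_iff[OF assms(1-3) E_\<sigma>[OF assms(4)]] assms(5) by blast
  from S_local_equation[OF assms(1-3) this] show ?thesis
    by (rule M'.nonzero_normals_iff[OF assms(5) E_topspace[OF assms(4)]])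
qed

lemma D_nonzero_iff:
  assumes "k \<in> K" "y \<in> C" "y \<in> U"
  shows "\<omega> \<in> nonzero_normals M (D k) y \<longleftrightarrow>
    \<omega> \<in> normal_space M (D k) y \<and> normal_deriv \<omega> (g (\<kappa> k)) \<noteq> 0"
  by (rule M.nonzero_normals_iff[OF _ U_topspace[OF assms(3)] eqD[OF assms(1,3)]]) (use CD assms in auto)

lemma normal_mult_val:
  assumes "k \<in> K" "j \<le> r" "x \<in> chart j" "x \<in> E" "x \<in> S k"
    and "\<nu> \<in> normal_space M' E x" "\<mu> \<in> normal_space M' (S k) x"
  shows "normal_mult M C M' \<sigma> (D k) x \<nu> \<mu> \<in> normal_space M (D k) (\<sigma> x)"
    "normal_deriv (normal_mult M C M' \<sigma> (D k) x \<nu> \<mu>) (g (\<kappa> k)) =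
       normal_deriv \<nu> (\<lambda>y. g j (\<sigma> y)) * normal_deriv \<mu> (\<lambda>y. q j y (\<kappa> k))"
proof -
  obtain \<omega> where \<omega>: "\<omega> \<in> normal_space M (D k) (\<sigma> x)"
    "normal_deriv \<omega> (g (\<kappa> k)) = normal_deriv \<nu> (\<lambda>y. g j (\<sigma> y)) * normal_deriv \<mu> (\<lambda>y. q j y (\<kappa> k))"
    by (rule normal_D_exists[OF assms(1) E_\<sigma>[OF assms(4)] chart_nbhd(5)[OF assms(2,3)]])
  have "normal_mult M C M' \<sigma> (D k) x \<nu> \<mu> = \<omega>" by (rule normal_mult_eq[OF assms \<omega>])
  then show "normal_mult M C M' \<sigma> (D k) x \<nu> \<mu> \<in> normal_space M (D k) (\<sigma> x)"
    "normal_deriv (normal_mult M C M' \<sigma> (D k) x \<nu> \<mu>) (g (\<kappa> k)) =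
       normal_deriv \<nu> (\<lambda>y. g j (\<sigma> y)) * normal_deriv \<mu> (\<lambda>y. q j y (\<kappa> k))"
    using \<omega> by auto
qed

lemma normal_mult_nonzero:
  assumes k: "k \<in> K" and x: "x \<in> E" "\<sigma> x \<in> U" "x \<in> S k"
    and \<nu>: "\<nu> \<in> nonzero_normals M' E x" and \<mu>: "\<mu> \<in> nonzero_normals M' (S k) x"
  shows "normal_mult M C M' \<sigma> (D k) x \<nu> \<mu> \<in> nonzero_normals M (D k) (\<sigma> x)"
proof -
  obtain j where j: "j \<le> r" "x \<in> chart j" using E_chart[OF x(1,2)] by blast
  show ?thesis
    using \<nu> \<mu> normal_mult_val[OF k j x(1,3)]
    unfolding E_nonzero_iff[OF j x(1)] S_nonzero_iff[OF k j x(1,3)] D_nonzero_iff[OF k E_\<sigma>[OF x(1)] x(2)]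
    by auto
qed

lemma normal_mult_inject:
  assumes k: "k \<in> K" and x: "x \<in> E" "\<sigma> x \<in> U" "x \<in> S k"
    and \<nu>: "\<nu> \<in> nonzero_normals M' E x" and \<mu>: "\<mu> \<in> normal_space M' (S k) x" "\<mu>1 \<in> normal_space M' (S k) x"
    and eq: "normal_mult M C M' \<sigma> (D k) x \<nu> \<mu> = normal_mult M C M' \<sigma> (D k) x \<nu> \<mu>1"
  shows "\<mu> = \<mu>1"
proof -
  obtain j where j: "j \<le> r" "x \<in> chart j" using E_chart[OF x(1,2)] by blast
  have \<nu>': "\<nu> \<in> normal_space M' E x" "normal_deriv \<nu> (\<lambda>y. g j (\<sigma> y)) \<noteq> 0"
    using \<nu> E_nonzero_iff[OF j x(1)] by auto
  have "q j x (\<kappa> k) = 0" using S_mem_iff[OF k j E_\<sigma>[OF x(1)]] x(3) by blast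
  from M'.normal_eq_local_equation[OF \<mu> x(3) E_topspace[OF x(1)] S_local_equation[OF k j this]]
  show ?thesis
    using normal_mult_val(2)[OF k j x(1,3) \<nu>'(1) \<mu>(1)] normal_mult_val(2)[OF k j x(1,3) \<nu>'(1) \<mu>(2)] eq \<nu>'(2)
    by simp
qed

lemma normal_mult_surject:
  assumes k: "k \<in> K" and x: "x \<in> E" "\<sigma> x \<in> U" "x \<in> S k"
    and \<nu>: "\<nu> \<in> nonzero_normals M' E x" and \<omega>: "\<omega> \<in> nonzero_normals M (D k) (\<sigma> x)"
  shows "\<exists>\<mu>\<in>nonzero_normals M' (S k) x. normal_mult M C M' \<sigma> (D k) x \<nu> \<mu> = \<omega>"
proof -
  obtain j where j: "j \<le> r" "x \<in> chart j" using E_chart[OF x(1,2)] by blast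
  have \<nu>': "\<nu> \<in> normal_space M' E x" "normal_deriv \<nu> (\<lambda>y. g j (\<sigma> y)) \<noteq> 0"
    using \<nu> E_nonzero_iff[OF j x(1)] by auto
  have \<omega>': "\<omega> \<in> normal_space M (D k) (\<sigma> x)" "normal_deriv \<omega> (g (\<kappa> k)) \<noteq> 0"
    using \<omega> D_nonzero_iff[OF k E_\<sigma>[OF x(1)] x(2)] by auto
  obtain \<mu> where \<mu>: "\<mu> \<in> normal_space M' (S k) x"
    "normal_deriv \<mu> (\<lambda>y. q j y (\<kappa> k)) = normal_deriv \<omega> (g (\<kappa> k)) / normal_deriv \<nu> (\<lambda>y. g j (\<sigma> y))"
    by (rule normal_S_exists[OF k j x(1,3)])
  have "normal_mult M C M' \<sigma> (D k) x \<nu> \<mu> = \<omega>"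
    by (rule normal_mult_eq[OF k j x(1,3) \<nu>'(1) \<mu>(1) \<omega>'(1)]) (use \<mu>(2) \<nu>'(2) in simp)
  moreover have "\<mu> \<in> nonzero_normals M' (S k) x"
    unfolding S_nonzero_iff[OF k j x(1,3)] using \<mu> \<nu>'(2) \<omega>'(2) by simp
  ultimately show ?thesis by blast
qed

lemma normal_proj_val:
  assumes "k \<in> K" "y \<in> U" "\<nu> \<in> normal_space M C y"
  shows "normal_proj M (D k) y \<nu> \<in> normal_space M (D k) y"
    "normal_deriv (normal_proj M (D k) y \<nu>) (g (\<kappa> k)) = normal_deriv \<nu> (g (\<kappa> k))"
  using M.normal_proj_space[OF assms(3) CD[OF assms(1)]] eqD[OF assms(1,2)]
  by (auto simp: M.local_equation_iff)

text \<open>By compatibility the derivative of \<open>\<nu>\<close> along the equation of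
  \<open>D k\<close> is \<open>q j x (\<kappa> k)\<close> times a nonzero number. This makes the
  strata of the exceptional divisor match the conditions in \<open>normal_part\<close>.\<close>

lemma normal_proj_zero_iff:
  assumes x: "x \<in> E" "\<sigma> x \<in> U" and \<nu>: "\<nu> \<in> normal_space M C (\<sigma> x)" and \<nu>': "\<nu>' \<in> nonzero_normals M' E x"
    and comp: "compatible x \<nu> \<nu>'" and k: "k \<in> K"
  shows "normal_proj M (D k) (\<sigma> x) \<nu> = zero_normal M (D k) (\<sigma> x) \<longleftrightarrow> x \<in> S k"
proof -
  obtain j where j: "j \<le> r" "x \<in> chart j" using E_chart[OF x] by blast
  have "normal_proj M (D k) (\<sigma> x) \<nu> \<in> nonzero_normals M (D k) (\<sigma> x) \<longleftrightarrow> normal_deriv \<nu> (g (\<kappa> k)) \<noteq> 0"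
    unfolding D_nonzero_iff[OF k E_\<sigma>[OF x(1)] x(2)] using normal_proj_val[OF k x(2) \<nu>] by simp
  moreover have "normal_deriv \<nu> (g (\<kappa> k)) = q j x (\<kappa> k) * normal_deriv \<nu>' (\<lambda>y. g j (\<sigma> y))"
    by (rule compatibleD[OF comp j \<kappa>(1)[OF k]])
  moreover have "normal_deriv \<nu>' (\<lambda>y. g j (\<sigma> y)) \<noteq> 0" using \<nu>' E_nonzero_iff[OF j x(1)] by blast
  ultimately show ?thesis
    using S_mem_iff[OF k j E_\<sigma>[OF x(1)]] normal_proj_val(1)[OF k x(2) \<nu>] by (auto simp: nonzero_normals_def)
qed

text \<open>\<open>log_normal\<close> can be evaluated once a normal vector with the value of \<Phi>
  has been exhibited. Consequently the normal vectors determine \<Phi> on the equations, whichever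
  \<Phi> the inverse in \<open>sigma_N_alog\<close> selects.\<close>

lemma exc_alog_values:
  assumes j: "j \<le> r" and x: "x \<in> chart j" "x \<in> E" and QK: "Q \<subseteq> K" and xQ: "\<forall>k\<in>Q. x \<in> S k"
    and \<Phi>: "(x, \<Phi>) \<in> alog M' DM'" and id: "exc_alog_ident D C M' \<sigma> Q (x, \<Phi>) = (x, \<nu>, \<mu>)"
  shows "\<Phi> (\<lambda>y. g j (\<sigma> y)) = normal_deriv \<nu> (\<lambda>y. g j (\<sigma> y))"
    "k \<in> Q \<Longrightarrow> \<Phi> (\<lambda>y. q j y (\<kappa> k)) = normal_deriv (\<mu> k) (\<lambda>y. q j y (\<kappa> k))"
proof -
  have id': "log_normal M' E x \<Phi> = \<nu>" "\<And>k. k \<in> Q \<Longrightarrow> log_normal M' (S k) x \<Phi> = \<mu> k"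
    using id by (auto simp: exc_alog_ident_def E_def S_def)
  obtain \<nu>0 where \<nu>0: "\<nu>0 \<in> normal_space M' E x" "normal_deriv \<nu>0 (\<lambda>y. g j (\<sigma> y)) = \<Phi> (\<lambda>y. g j (\<sigma> y))"
    by (rule normal_E_exists[OF j x])
  have "log_normal M' E x \<Phi> = \<nu>0"
    by (rule M'.log_normal_alog[OF closed_DM' \<Phi> x(2) E_local_equation[OF j x(1)] E_log[OF j x(1)] \<nu>0])
  then show "\<Phi> (\<lambda>y. g j (\<sigma> y)) = normal_deriv \<nu> (\<lambda>y. g j (\<sigma> y))" using id'(1) \<nu>0(2) by simp
  assume kQ: "k \<in> Q"
  then have k: "k \<in> K" using QK by blast
  have xS: "x \<in> S k" using xQ kQ by blast
  obtain \<mu>0 where \<mu>0: "\<mu>0 \<in> normal_space M' (S k) x"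
    "normal_deriv \<mu>0 (\<lambda>y. q j y (\<kappa> k)) = \<Phi> (\<lambda>y. q j y (\<kappa> k))"
    by (rule normal_S_exists[OF k j x xS])
  have q0: "q j x (\<kappa> k) = 0" using S_mem_iff[OF k j x(1) E_\<sigma>[OF x(2)]] xS by blast
  have "log_normal M' (S k) x \<Phi> = \<mu>0"
    by (rule M'.log_normal_alog[OF closed_DM' \<Phi> xS S_local_equation[OF k j x(1) q0] S_log[OF j x(1) k] \<mu>0])
  then show "\<Phi> (\<lambda>y. q j y (\<kappa> k)) = normal_deriv (\<mu> k) (\<lambda>y. q j y (\<kappa> k))"
    using id'(2)[OF kQ] \<mu>0(2) by simp
qed

lemma exc_alog_surject:
  assumes x: "x \<in> E" "\<sigma> x \<in> U" and QK: "Q \<subseteq> K" and xQ: "\<And>k. k \<in> K \<Longrightarrow> x \<in> S k \<longleftrightarrow> k \<in> Q"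
    and \<nu>: "\<nu> \<in> nonzero_normals M' E x" and \<mu>: "\<mu> \<in> (\<Pi>\<^sub>E k\<in>Q. nonzero_normals M' (S k) x)"
  obtains \<Phi> where "(x, \<Phi>) \<in> alog M' DM'" "exc_alog_ident D C M' \<sigma> Q (x, \<Phi>) = (x, \<nu>, \<mu>)"
proof -
  obtain j where j: "j \<le> r" "x \<in> chart j" using E_chart[OF x] by blast
  define a where "a = normal_deriv \<nu> (\<lambda>y. g j (\<sigma> y))"
  have a: "\<nu> \<in> normal_space M' E x" "a \<noteq> 0" using \<nu> E_nonzero_iff[OF j x(1)] by (auto simp: a_def)
  \<comment> \<open>The arc moves the coordinates \<open>\<kappa> k\<close> for
    \<open>k \<in> Q\<close> with the velocities given by \<open>\<mu>\<close> and keeps all others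
    constant; injectivity of \<open>\<kappa>\<close> makes \<open>k\<close> recoverable from
    \<open>\<kappa> k\<close>.\<close>
  define b where "b = (\<lambda>i. if i \<in> \<kappa> ` Q then normal_deriv (\<mu> (inv_into K \<kappa> i)) (\<lambda>y. q j y i) else 0)"
  have q0: "q j x (\<kappa> k) = 0 \<longleftrightarrow> k \<in> Q" if "k \<in> K" for k
    using S_mem_iff[OF that j E_\<sigma>[OF x(1)]] xQ[OF that] by blast
  have bj: "b j = 0" using q0 QK q_homogeneous(3)[OF j(2)] by (fastforce simp: b_def)
  have bk: "b (\<kappa> k) = normal_deriv (\<mu> k) (\<lambda>y. q j y (\<kappa> k))" if "k \<in> Q" for k
    using that QK inv_into_f_f[OF \<kappa>(2), of k] by (auto simp: b_def)
  have \<mu>k: "\<mu> k \<in> normal_space M' (S k) x" "normal_deriv (\<mu> k) (\<lambda>y. q j y (\<kappa> k)) \<noteq> 0" if k: "k \<in> Q" for k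
  proof -
    have "k \<in> K" "x \<in> S k" using that QK xQ by auto
    then show "\<mu> k \<in> normal_space M' (S k) x" "normal_deriv (\<mu> k) (\<lambda>y. q j y (\<kappa> k)) \<noteq> 0"
      using S_nonzero_iff[OF _ j x(1), of k "\<mu> k"] PiE_mem[OF \<mu> k] by auto
  qed
  obtain \<gamma> \<gamma>' where arc: "arc_lift M M' \<sigma> \<gamma> \<gamma>'" and \<gamma>0: "\<gamma>' 0 = x"
    and ve: "velocity M' \<gamma>' (\<lambda>y. g j (\<sigma> y)) = a" and vq: "\<forall>i\<le>r. velocity M' \<gamma>' (\<lambda>y. q j y i) = b i"
    and ev: "eventually (\<lambda>t. \<gamma>' t \<in> chart j \<and> (\<forall>i\<le>r. g i (\<sigma> (\<gamma>' t)) = a * t * (q j x i + b i * t))) (nhds 0)"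
    by (rule velocity_arc[where a = a and b = b, OF j x(1) bj])
  have \<gamma>': "holomorphic_arc M' \<gamma>'" using arc by (simp add: arc_lift_def)
  \<comment> \<open>Along the arc the equation of \<open>D k\<close> is \<open>a * t\<close> times
    this factor: for \<open>k \<in> Q\<close> the factor is a nonzero multiple of \<open>t\<close>,
    for other \<open>k\<close> it is nonzero at \<open>t = 0\<close>. Finiteness of \<open>K\<close>
    gives a common punctured neighbourhood, so the arc leaves the divisor at once.\<close>
  have nz: "eventually (\<lambda>t. \<forall>k\<in>K. q j x (\<kappa> k) + b (\<kappa> k) * t \<noteq> 0) (at 0)"
  proof (rule eventually_ball_finite[OF finK], rule ballI)
    fix k assume k: "k \<in> K"
    show "eventually (\<lambda>t. q j x (\<kappa> k) + b (\<kappa> k) * t \<noteq> 0) (at 0)"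
    proof (cases "k \<in> Q")
      case True
      then have "b (\<kappa> k) \<noteq> 0" "q j x (\<kappa> k) = 0" using bk[OF True] \<mu>k(2)[OF True] q0[OF k] by auto
      then show ?thesis by (simp add: eventually_neq_at_within)
    next
      case False
      then have "q j x (\<kappa> k) \<noteq> 0" using q0[OF k] by blast
      moreover have "((\<lambda>t. q j x (\<kappa> k) + b (\<kappa> k) * t) \<longlongrightarrow> q j x (\<kappa> k)) (at 0)"
        by (auto intro!: tendsto_eq_intros)
      ultimately show ?thesis by (metis tendsto_imp_eventually_ne)
    qed
  qed
  have "eventually (\<lambda>t. t \<noteq> 0 \<longrightarrow> \<gamma>' t \<in> chart j \<and> (\<forall>i\<le>r. g i (\<sigma> (\<gamma>' t)) = a * t * (q j x i + b i * t))) (nhds 0)"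
    using ev by eventually_elim auto
  then have ev': "eventually (\<lambda>t. \<gamma>' t \<in> chart j \<and> (\<forall>i\<le>r. g i (\<sigma> (\<gamma>' t)) = a * t * (q j x i + b i * t))) (at 0)"
    by (simp add: eventually_at_filter)
  have "eventually (\<lambda>t. t \<noteq> (0::complex)) (at 0)" by (simp add: eventually_neq_at_within)
  with ev' nz have off: "eventually (\<lambda>t. \<gamma>' t \<notin> DM') (at 0)"
  proof eventually_elim
    case (elim t)
    have ch: "\<gamma>' t \<in> chart j" using elim(1) by blast
    have "g (\<kappa> k) (\<sigma> (\<gamma>' t)) \<noteq> 0" if "k \<in> K" for k
      using elim \<kappa>(1)[OF that] that a(2) by auto
    then have "\<sigma> (\<gamma>' t) \<notin> DM" using D_mem_iff[OF _ chart_nbhd(5)[OF j(1) ch]] by (auto simp: DM_def)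
    then show ?case using DM'_iff[OF chart_nbhd(3)[OF j(1) ch]] by blast
  qed
  define \<Phi> where "\<Phi> = M'.arc_log DM' \<gamma>'"
  have \<Phi>: "(x, \<Phi>) \<in> alog M' DM'"
    using M'.arc_log_alog[OF closed_DM' \<gamma>' off] \<gamma>0 by (simp add: \<Phi>_def)
  have "\<Phi> (\<lambda>y. g j (\<sigma> y)) = a"
    unfolding \<Phi>_def ve[symmetric]
    by (rule M'.arc_log_velocity[OF closed_DM' \<gamma>' off])
       (use E_log[OF j] \<gamma>0 e_zero_iff[OF j] E_\<sigma>[OF x(1)] ve a(2) in auto)
  then have 1: "log_normal M' E x \<Phi> = \<nu>"
    using M'.log_normal_alog[OF closed_DM' \<Phi> x(1) E_local_equation[OF j] E_log[OF j] a(1)] by (simp add: a_def)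
  have 2: "log_normal M' (S k) x \<Phi> = \<mu> k" if kQ: "k \<in> Q" for k
  proof -
    have k: "k \<in> K" "x \<in> S k" using that QK xQ by auto
    have qx: "q j x (\<kappa> k) = 0" using q0[OF k(1)] kQ by blast
    have v: "velocity M' \<gamma>' (\<lambda>y. q j y (\<kappa> k)) = normal_deriv (\<mu> k) (\<lambda>y. q j y (\<kappa> k))"
      using vq \<kappa>(1)[OF k(1)] bk[OF kQ] by simp
    have "\<Phi> (\<lambda>y. q j y (\<kappa> k)) = velocity M' \<gamma>' (\<lambda>y. q j y (\<kappa> k))"
      unfolding \<Phi>_def
      by (rule M'.arc_log_velocity[OF closed_DM' \<gamma>' off])
         (use S_log[OF j k(1)] \<gamma>0 qx v \<mu>k(2)[OF kQ] in auto)
    then show ?thesis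
      using M'.log_normal_alog[OF closed_DM' \<Phi> k(2) S_local_equation[OF k(1) j qx] S_log[OF j k(1)] \<mu>k(1)[OF kQ]] v
      by simp
  qed
  have "(\<lambda>k\<in>Q. log_normal M' (S k) x \<Phi>) = \<mu>"
    using 2 PiE_arb[OF \<mu>] by (auto simp: fun_eq_iff restrict_def)
  then have "exc_alog_ident D C M' \<sigma> Q (x, \<Phi>) = (x, \<nu>, \<mu>)"
    using 1 by (simp add: exc_alog_ident_def E_def S_def)
  then show ?thesis using that \<Phi> by blast
qed

text \<open>In both cases the normal vector on the right takes on \<open>g (\<kappa> k)\<close> the
  product of the values of \<Phi> on \<open>q\<close> and on the exceptional equation: for
  \<open>k \<in> Q\<close> by the rule for products of normal vectors, for other \<open>k\<close>
  because \<open>q\<close> is a unit at \<open>x\<close>, on which \<Phi> is evaluation, and the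
  projection of \<open>\<nu>\<close> has the value given by compatibility.\<close>

lemma alog_ident_alog_map:
  assumes x: "x \<in> E" "\<sigma> x \<in> U" and QK: "Q \<subseteq> K" and xQ: "\<And>k. k \<in> K \<Longrightarrow> x \<in> S k \<longleftrightarrow> k \<in> Q"
    and \<nu>': "\<nu>' \<in> nonzero_normals M' E x" and \<mu>: "\<And>k. k \<in> Q \<Longrightarrow> \<mu> k \<in> nonzero_normals M' (S k) x"
    and \<nu>: "\<nu> \<in> normal_space M C (\<sigma> x)" "compatible x \<nu> \<nu>'"
    and \<Phi>: "(x, \<Phi>) \<in> alog M' DM'" and id: "exc_alog_ident D C M' \<sigma> Q (x, \<Phi>) = (x, \<nu>', \<mu>)"
  shows "alog_ident M K D (alog_map M DM \<sigma> (x, \<Phi>)) =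
    (\<sigma> x, \<lambda>k\<in>K. if k \<in> Q then normal_mult M C M' \<sigma> (D k) x \<nu>' (\<mu> k) else normal_proj M (D k) (\<sigma> x) \<nu>)"
proof -
  obtain j where j: "j \<le> r" "x \<in> chart j" using E_chart[OF x] by blast
  have \<sigma>x: "\<sigma> x \<in> C" "\<sigma> x \<in> topspace (zar M)" "x \<in> topspace (zar M')"
    using E_\<sigma>[OF x(1)] U_topspace[OF x(2)] E_topspace[OF x(1)] by auto
  have \<nu>'s: "\<nu>' \<in> normal_space M' E x" "normal_deriv \<nu>' (\<lambda>y. g j (\<sigma> y)) \<noteq> 0"
    using \<nu>' E_nonzero_iff[OF j x(1)] by auto
  have xQ': "\<And>k. k \<in> Q \<Longrightarrow> x \<in> S k" using xQ QK by blast
  have "\<forall>k\<in>Q. x \<in> S k" using xQ' by blast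
  note val = exc_alog_values[OF j x(1) QK this \<Phi> id]
  define \<Phi>' where "\<Phi>' = restrict (\<lambda>g. \<Phi> (g \<circ> \<sigma>)) (log_stalk M DM (\<sigma> x))"
  have "log_normal M (D k) (\<sigma> x) \<Phi>' =
      (if k \<in> Q then normal_mult M C M' \<sigma> (D k) x \<nu>' (\<mu> k) else normal_proj M (D k) (\<sigma> x) \<nu>)"
    (is "_ = ?\<omega>") if k: "k \<in> K" for k
  proof -
    have xD: "\<sigma> x \<in> D k" using CD[OF k] \<sigma>x(1) by blast
    have gI: "g (\<kappa> k) \<in> ideal_at M (D k) (\<sigma> x)" using eqD[OF k x(2)] by (simp add: M.local_equation_iff)
    have "?\<omega> \<in> normal_space M (D k) (\<sigma> x) \<and>
        normal_deriv ?\<omega> (g (\<kappa> k)) = \<Phi> (\<lambda>y. q j y (\<kappa> k)) * \<Phi> (\<lambda>y. g j (\<sigma> y)) \<and>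
        \<Phi> (\<lambda>y. q j y (\<kappa> k)) \<noteq> 0"
    proof (cases "k \<in> Q")
      case True
      have m: "\<mu> k \<in> normal_space M' (S k) x" "normal_deriv (\<mu> k) (\<lambda>y. q j y (\<kappa> k)) \<noteq> 0"
        using S_nonzero_iff[OF k j x(1) xQ'[OF True]] \<mu>[OF True] by auto
      show ?thesis
        using normal_mult_val[OF k j x(1) xQ'[OF True] \<nu>'s(1) m(1)] val(1) val(2)[OF True] m(2) True by simp
    next
      case False
      have qx: "q j x (\<kappa> k) \<noteq> 0" using S_mem_iff[OF k j \<sigma>x(1)] xQ[OF k] False by blast
      have "(\<lambda>y. q j y (\<kappa> k)) \<in> stalk_units M' x"
        using q_stalk[OF j \<kappa>(1)[OF k]] qx by (simp add: M'.stalk_units_iff)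
      then have "\<Phi> (\<lambda>y. q j y (\<kappa> k)) = q j x (\<kappa> k)" using \<Phi> unfolding alog_def by blast
      then show ?thesis
        using normal_proj_val[OF k x(2) \<nu>(1)] compatibleD[OF \<nu>(2) j \<kappa>(1)[OF k]] val(1) qx False by simp
    qed
    then have \<omega>: "?\<omega> \<in> normal_space M (D k) (\<sigma> x)"
      "normal_deriv ?\<omega> (g (\<kappa> k)) = \<Phi> (\<lambda>y. q j y (\<kappa> k)) * \<Phi> (\<lambda>y. g j (\<sigma> y))"
      "\<Phi> (\<lambda>y. q j y (\<kappa> k)) \<noteq> 0" by auto
    have \<omega>nz: "?\<omega> \<in> nonzero_normals M (D k) (\<sigma> x)"
      using D_nonzero_iff[OF k \<sigma>x(1) x(2)] \<omega> val(1) \<nu>'s(2) by simp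
    show ?thesis
    proof (rule M.log_normal_eqI[OF xD \<sigma>x(2) eqD[OF k x(2)] \<omega>nz])
      fix h assume h: "local_equation M (D k) (\<sigma> x) h"
      have "normal_deriv ?\<omega> (g (\<kappa> k)) \<noteq> 0" using D_nonzero_iff[OF k \<sigma>x(1) x(2)] \<omega>nz by blast
      then obtain a where a: "a \<in> stalk M (\<sigma> x)" "a (\<sigma> x) \<noteq> 0" "eq_near M (\<sigma> x) h (\<lambda>y. a y * g (\<kappa> k) y)"
        by (rule M.local_equation_unit[OF eqD[OF k x(2)] h xD \<omega>(1)])
      have hl: "h \<in> log_stalk M DM (\<sigma> x)"
        by (rule M.log_stalk_eq_near[OF closed_DM M.log_stalk_mult[OF closed_DM
              M.log_stalk_unit[OF closed_DM a(1,2)] D_log[OF k x(2)]] eq_near_sym[OF a(3)]])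
      have qe: "(\<lambda>y. q j y (\<kappa> k) * g j (\<sigma> y)) \<in> log_stalk M' DM' x"
        by (rule M'.log_stalk_mult[OF closed_DM' S_log[OF j k] E_log[OF j]])
      have near: "eq_near M' x (h \<circ> \<sigma>) (\<lambda>y. a (\<sigma> y) * (q j y (\<kappa> k) * g j (\<sigma> y)))"
        using pullback_eq_near[OF a(3) \<sigma>x(3)] q_e_near[OF j \<kappa>(1)[OF k]]
        by (rule eq_near_combine) simp
      have "\<Phi>' h = \<Phi> (h \<circ> \<sigma>)" using hl by (simp add: \<Phi>'_def)
      also have "\<dots> = a (\<sigma> x) * \<Phi> (\<lambda>y. q j y (\<kappa> k) * g j (\<sigma> y))"
        using M'.alog_unit_mult[OF closed_DM' \<Phi> pullback_stalk[OF a(1) \<sigma>x(3)] a(2) qe near] by simp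
      also have "\<Phi> (\<lambda>y. q j y (\<kappa> k) * g j (\<sigma> y)) = \<Phi> (\<lambda>y. q j y (\<kappa> k)) * \<Phi> (\<lambda>y. g j (\<sigma> y))"
        by (rule alog_mult[OF \<Phi> S_log[OF j k] E_log[OF j]])
      also have "a (\<sigma> x) * \<dots> = normal_deriv ?\<omega> h"
        using M.normal_deriv_mult[OF \<omega>(1) xD a(1) gI a(3)] \<omega>(2) by simp
      finally show "\<Phi>' h = normal_deriv ?\<omega> h" .
    qed
  qed
  then have "(\<lambda>k\<in>K. log_normal M (D k) (\<sigma> x) \<Phi>') =
      (\<lambda>k\<in>K. if k \<in> Q then normal_mult M C M' \<sigma> (D k) x \<nu>' (\<mu> k) else normal_proj M (D k) (\<sigma> x) \<nu>)"
    by (rule restrict_ext)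
  then show ?thesis by (simp only: alog_ident_def alog_map_def prod.case \<Phi>'_def)
qed

lemma exc_stratum_iff:
  "x \<in> exc_stratum K D C M' \<sigma> Q \<longleftrightarrow> x \<in> E \<and> (\<forall>k\<in>Q. x \<in> S k) \<and> (\<forall>k\<in>K - Q. x \<notin> S k)"
  by (auto simp: exc_stratum_def E_def S_def)

text \<open>The inverse in \<open>unlift_normal\<close> is taken on the whole punctured bundle, so
  injectivity is required beyond the chart and enters as a hypothesis.\<close>

lemma unlift_normal_at:
  assumes inj: "inj_on (lift_normal M C M' \<sigma>) (normal_bundle_nz M C)"
    and x: "x \<in> E" "\<sigma> x \<in> U" and \<nu>': "\<nu>' \<in> nonzero_normals M' E x"
  obtains \<nu> where "\<nu> \<in> nonzero_normals M C (\<sigma> x)" "compatible x \<nu> \<nu>'" "unlift_normal M C M' \<sigma> (x, \<nu>') = (\<sigma> x, \<nu>)"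
proof -
  obtain \<nu> where \<nu>: "\<nu> \<in> nonzero_normals M C (\<sigma> x)" "compatible x \<nu> \<nu>'" "lift_normal M C M' \<sigma> (\<sigma> x, \<nu>) = (x, \<nu>')"
    by (rule lift_normal_at[OF x \<nu>'])
  have "(\<sigma> x, \<nu>) \<in> normal_bundle_nz M C" using \<nu>(1) E_\<sigma>[OF x(1)] by (simp add: normal_bundle_nz_def)
  then have "unlift_normal M C M' \<sigma> (x, \<nu>') = (\<sigma> x, \<nu>)"
    unfolding unlift_normal_def using inv_into_f_eq[OF inj _ \<nu>(3)] by blast
  then show ?thesis using that \<nu>(1,2) by blast
qed


lemma lift_normal_inject:
  assumes y: "y \<in> C" "y \<in> U" and \<nu>: "\<nu> \<in> nonzero_normals M C y" "\<mu> \<in> nonzero_normals M C y"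
    and eq: "lift_normal M C M' \<sigma> (y, \<nu>) = lift_normal M C M' \<sigma> (y, \<mu>)"
  shows "\<nu> = \<mu>"
proof -
  obtain x \<nu>' where 1: "x \<in> E" "\<sigma> x = y" "\<nu>' \<in> nonzero_normals M' E x" "compatible x \<nu> \<nu>'"
    "lift_normal M C M' \<sigma> (y, \<nu>) = (x, \<nu>')"
    by (rule lift_normal_exists[OF y \<nu>(1)])
  obtain x1 \<nu>1' where 2: "x1 \<in> E" "\<sigma> x1 = y" "\<nu>1' \<in> nonzero_normals M' E x1" "compatible x1 \<mu> \<nu>1'"
    "lift_normal M C M' \<sigma> (y, \<mu>) = (x1, \<nu>1')"
    by (rule lift_normal_exists[OF y \<nu>(2)])
  have "compatible x \<mu> \<nu>'" using 1(5) 2(4,5) eq by simp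
  from compatible_unique[OF 1(4) this 1(1)] show ?thesis
    using 1(2) y(2) \<nu> by (simp add: nonzero_normals_def)
qed

section \<open>The maps of the diagram over one chart\<close>

context
  fixes Q
  assumes Q: "Q \<subset> K" and inj: "inj_on (lift_normal M C M' \<sigma>) (normal_bundle_nz M C)"
begin

lemma exc_normal_star_iff:
  "(x, \<nu>', \<mu>) \<in> exc_normal_star K D C M' \<sigma> Q \<longleftrightarrow> x \<in> E \<and> (\<forall>k\<in>K. x \<in> S k \<longleftrightarrow> k \<in> Q) \<and>
     \<nu>' \<in> nonzero_normals M' E x \<and> \<mu> \<in> (\<Pi>\<^sub>E k\<in>Q. nonzero_normals M' (S k) x)"
  unfolding exc_normal_star_def mem_Sigma_iff exc_stratum_iff using Q by (auto simp: E_def S_def)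

lemma H_alog_mem:
  assumes p: "(x, \<nu>', \<mu>) \<in> exc_normal_star K D C M' \<sigma> Q" and xU: "\<sigma> x \<in> U"
  shows "H_alog M D C M' \<sigma> Q (x, \<nu>', \<mu>) \<in> mixed_star M K D C Q"
proof -
  have x: "x \<in> E" and xQ: "\<And>k. k \<in> K \<Longrightarrow> x \<in> S k \<longleftrightarrow> k \<in> Q" and \<nu>': "\<nu>' \<in> nonzero_normals M' E x"
    and \<mu>: "\<mu> \<in> (\<Pi>\<^sub>E k\<in>Q. nonzero_normals M' (S k) x)"
    using p by (auto simp: exc_normal_star_iff)
  obtain \<nu> where \<nu>: "\<nu> \<in> nonzero_normals M C (\<sigma> x)" "compatible x \<nu> \<nu>'" "unlift_normal M C M' \<sigma> (x, \<nu>') = (\<sigma> x, \<nu>)"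
    by (rule unlift_normal_at[OF inj x xU \<nu>'])
  have \<nu>s: "\<nu> \<in> normal_space M C (\<sigma> x)" using \<nu>(1) by (simp add: nonzero_normals_def)
  note proj = normal_proj_zero_iff[OF x xU \<nu>s \<nu>' \<nu>(2)]
  have "(\<sigma> x, \<nu>) \<in> normal_part M K D C Q"
    unfolding normal_part_def normal_bundle_def using \<nu>s E_\<sigma>[OF x] proj xQ Q by auto
  moreover have "normal_mult M C M' \<sigma> (D k) x \<nu>' (\<mu> k) \<in> nonzero_normals M (D k) (\<sigma> x)" if "k \<in> Q" for k
    using normal_mult_nonzero[OF _ x xU _ \<nu>' PiE_mem[OF \<mu> that]] that xQ Q by blast
  then have "(\<sigma> x, \<lambda>k\<in>Q. normal_mult M C M' \<sigma> (D k) x \<nu>' (\<mu> k)) \<in> normal_star M D C Q"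
    using E_\<sigma>[OF x] by (simp add: normal_star_def)
  ultimately show ?thesis by (simp add: H_alog_def mixed_star_def \<nu>(3))
qed

lemma H_alog_inject:
  assumes p: "(x, \<nu>', \<mu>) \<in> exc_normal_star K D C M' \<sigma> Q" "(x, \<nu>', \<mu>1) \<in> exc_normal_star K D C M' \<sigma> Q"
    and xU: "\<sigma> x \<in> U"
    and eq: "H_alog M D C M' \<sigma> Q (x, \<nu>', \<mu>) = H_alog M D C M' \<sigma> Q (x, \<nu>', \<mu>1)"
  shows "\<mu> = \<mu>1"
proof (rule PiE_ext)
  have x: "x \<in> E" and xQ: "\<And>k. k \<in> K \<Longrightarrow> x \<in> S k \<longleftrightarrow> k \<in> Q" and \<nu>': "\<nu>' \<in> nonzero_normals M' E x"
    and \<mu>: "\<mu> \<in> (\<Pi>\<^sub>E k\<in>Q. nonzero_normals M' (S k) x)" "\<mu>1 \<in> (\<Pi>\<^sub>E k\<in>Q. nonzero_normals M' (S k) x)"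
    using p by (auto simp: exc_normal_star_iff)
  show "\<mu> \<in> (\<Pi>\<^sub>E k\<in>Q. nonzero_normals M' (S k) x)" "\<mu>1 \<in> (\<Pi>\<^sub>E k\<in>Q. nonzero_normals M' (S k) x)"
    by (rule \<mu>)+
  fix k assume k: "k \<in> Q"
  then have kK: "k \<in> K" "x \<in> S k" using Q xQ by auto
  have "(\<lambda>k\<in>Q. normal_mult M C M' \<sigma> (D k) x \<nu>' (\<mu> k)) k = (\<lambda>k\<in>Q. normal_mult M C M' \<sigma> (D k) x \<nu>' (\<mu>1 k)) k"
    using eq by (simp add: H_alog_def)
  then have "normal_mult M C M' \<sigma> (D k) x \<nu>' (\<mu> k) = normal_mult M C M' \<sigma> (D k) x \<nu>' (\<mu>1 k)" using k by simp
  then show "\<mu> k = \<mu>1 k"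
    using normal_mult_inject[OF kK(1) x xU kK(2) \<nu>'] PiE_mem[OF \<mu>(1) k] PiE_mem[OF \<mu>(2) k]
    by (simp add: nonzero_normals_def)
qed

lemma H_alog_surject:
  assumes p: "((y, \<nu>), (y, \<omega>)) \<in> mixed_star M K D C Q" and yU: "y \<in> U"
  shows "\<exists>x \<nu>' \<mu>. (x, \<nu>', \<mu>) \<in> exc_normal_star K D C M' \<sigma> Q \<and>
     H_alog M D C M' \<sigma> Q (x, \<nu>', \<mu>) = ((y, \<nu>), (y, \<omega>))"
proof -
  have y: "y \<in> C" and \<nu>s: "\<nu> \<in> normal_space M C y"
    and out: "\<And>k. k \<in> K - Q \<Longrightarrow> normal_proj M (D k) y \<nu> \<noteq> zero_normal M (D k) y"
    and ins: "\<And>k. k \<in> Q \<Longrightarrow> normal_proj M (D k) y \<nu> = zero_normal M (D k) y"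
    and \<omega>: "\<omega> \<in> (\<Pi>\<^sub>E k\<in>Q. nonzero_normals M (D k) y)"
    using p by (auto simp: mixed_star_def normal_part_def normal_bundle_def normal_star_def)
  \<comment> \<open>\<open>Q\<close> is a proper subset of \<open>K\<close>: a component outside
    \<open>Q\<close> forces \<open>\<nu>\<close> to be nonzero, so that it has a lift.\<close>
  obtain k0 where k0: "k0 \<in> K" "k0 \<in> K - Q" using Q by blast
  have "normal_proj M (D k0) y \<nu> \<in> nonzero_normals M (D k0) y"
    using normal_proj_val(1)[OF k0(1) yU \<nu>s] out[OF k0(2)] by (simp add: nonzero_normals_def)
  then have "normal_deriv \<nu> (g (\<kappa> k0)) \<noteq> 0"
    using D_nonzero_iff[OF k0(1) y yU] normal_proj_val(2)[OF k0(1) yU \<nu>s] by simp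
  then have \<nu>: "\<nu> \<in> nonzero_normals M C y" using normal_C_nonzero_iff[OF \<nu>s y yU] \<kappa>(1)[OF k0(1)] by blast
  obtain x \<nu>' where x: "x \<in> E" "\<sigma> x = y" and \<nu>': "\<nu>' \<in> nonzero_normals M' E x" and comp: "compatible x \<nu> \<nu>'"
    and lift: "lift_normal M C M' \<sigma> (y, \<nu>) = (x, \<nu>')"
    by (rule lift_normal_exists[OF y yU \<nu>])
  have xU: "\<sigma> x \<in> U" using x(2) yU by simp
  have xQ: "x \<in> S k \<longleftrightarrow> k \<in> Q" if "k \<in> K" for k
    using normal_proj_zero_iff[OF x(1) xU _ \<nu>' comp that] \<nu>s x(2) out ins that by blast
  have "\<exists>\<mu>. k \<in> Q \<longrightarrow> \<mu> \<in> nonzero_normals M' (S k) x \<and> normal_mult M C M' \<sigma> (D k) x \<nu>' \<mu> = \<omega> k" for k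
  proof (cases "k \<in> Q")
    case True
    then have k: "k \<in> K" "x \<in> S k" using Q xQ by auto
    show ?thesis
      using normal_mult_surject[OF k(1) x(1) xU k(2) \<nu>', of "\<omega> k"] PiE_mem[OF \<omega> True] x(2) by auto
  qed blast
  then obtain \<mu> where \<mu>: "\<And>k. k \<in> Q \<Longrightarrow> \<mu> k \<in> nonzero_normals M' (S k) x \<and> normal_mult M C M' \<sigma> (D k) x \<nu>' (\<mu> k) = \<omega> k"
    by metis
  have mem: "(x, \<nu>', restrict \<mu> Q) \<in> exc_normal_star K D C M' \<sigma> Q"
    unfolding exc_normal_star_iff using x(1) xQ \<nu>' \<mu> by auto
  have "(y, \<nu>) \<in> normal_bundle_nz M C" using y \<nu> by (simp add: normal_bundle_nz_def)
  then have "unlift_normal M C M' \<sigma> (x, \<nu>') = (y, \<nu>)"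
    unfolding unlift_normal_def lift[symmetric] by (rule inv_into_f_f[OF inj])
  moreover have "(\<lambda>k\<in>Q. normal_mult M C M' \<sigma> (D k) x \<nu>' (restrict \<mu> Q k)) = \<omega>"
    using \<mu> PiE_arb[OF \<omega>] by (auto simp: fun_eq_iff restrict_def)
  ultimately have "H_alog M D C M' \<sigma> Q (x, \<nu>', restrict \<mu> Q) = ((y, \<nu>), (y, \<omega>))"
    using x(2) by (simp add: H_alog_def)
  then show ?thesis using mem by blast
qed

lemma sigma_N_alog_eq:
  assumes p: "(x, \<nu>', \<mu>) \<in> exc_normal_star K D C M' \<sigma> Q" and xU: "\<sigma> x \<in> U"
  shows "sigma_N_alog M K D C M' \<sigma> Q (x, \<nu>', \<mu>) = h_alog M K D Q (H_alog M D C M' \<sigma> Q (x, \<nu>', \<mu>))"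
proof -
  have x: "x \<in> E" and xQ: "\<And>k. k \<in> K \<Longrightarrow> x \<in> S k \<longleftrightarrow> k \<in> Q" and \<nu>': "\<nu>' \<in> nonzero_normals M' E x"
    and \<mu>: "\<mu> \<in> (\<Pi>\<^sub>E k\<in>Q. nonzero_normals M' (S k) x)"
    using p by (auto simp: exc_normal_star_iff)
  have QK: "Q \<subseteq> K" using Q by blast
  obtain \<nu> where \<nu>: "\<nu> \<in> nonzero_normals M C (\<sigma> x)" "compatible x \<nu> \<nu>'" "unlift_normal M C M' \<sigma> (x, \<nu>') = (\<sigma> x, \<nu>)"
    by (rule unlift_normal_at[OF inj x xU \<nu>'])
  have \<nu>s: "\<nu> \<in> normal_space M C (\<sigma> x)" using \<nu>(1) by (simp add: nonzero_normals_def)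
  define f where "f = exc_alog_ident D C M' \<sigma> Q"
  define A where "A = alog_over M' DM' (exc_stratum K D C M' \<sigma> Q)"
  obtain \<Phi>0 where \<Phi>0: "(x, \<Phi>0) \<in> alog M' DM'" "f (x, \<Phi>0) = (x, \<nu>', \<mu>)"
    unfolding f_def by (rule exc_alog_surject[OF x xU QK xQ \<nu>' \<mu>])
  have "x \<in> exc_stratum K D C M' \<sigma> Q" using exc_stratum_iff x xQ QK by blast
  then have "(x, \<Phi>0) \<in> A" using \<Phi>0(1) by (simp add: A_def alog_over_def)
  then have "(x, \<nu>', \<mu>) \<in> f ` A" using \<Phi>0(2) by force
  \<comment> \<open>The inverse may select a point different from \<open>\<Phi>0\<close>, but with
    the same normal vectors, and \<open>alog_ident_alog_map\<close> holds for each of them.\<close>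
  then have inv: "inv_into A f (x, \<nu>', \<mu>) \<in> A" "f (inv_into A f (x, \<nu>', \<mu>)) = (x, \<nu>', \<mu>)"
    by (auto intro: inv_into_into f_inv_into_f)
  obtain x1 \<Phi> where x1: "inv_into A f (x, \<nu>', \<mu>) = (x1, \<Phi>)" by fastforce
  have "x1 = x" using inv(2) x1 by (simp add: f_def exc_alog_ident_def)
  then have \<Phi>: "(x, \<Phi>) \<in> alog M' DM'" "exc_alog_ident D C M' \<sigma> Q (x, \<Phi>) = (x, \<nu>', \<mu>)"
    using inv x1 by (auto simp: A_def alog_over_def f_def)
  have "sigma_N_alog M K D C M' \<sigma> Q (x, \<nu>', \<mu>) = alog_ident M K D (alog_map M DM \<sigma> (x, \<Phi>))"
    using x1 \<open>x1 = x\<close> by (simp add: sigma_N_alog_def A_def f_def DM'_def DM_def)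
  also have "\<dots> = (\<sigma> x, \<lambda>k\<in>K. if k \<in> Q then normal_mult M C M' \<sigma> (D k) x \<nu>' (\<mu> k) else normal_proj M (D k) (\<sigma> x) \<nu>)"
    by (rule alog_ident_alog_map[OF x xU QK xQ \<nu>' PiE_mem[OF \<mu>] \<nu>s \<nu>(2) \<Phi>])
  also have "\<dots> = h_alog M K D Q (H_alog M D C M' \<sigma> Q (x, \<nu>', \<mu>))"
    using \<nu>(3) by (auto simp: h_alog_def H_alog_def fun_eq_iff restrict_def)
  finally show ?thesis .
qed

end

end

section \<open>Existence of charts\<close>

text \<open>All components contain \<open>C\<close>, so they all pass through \<open>x\<close>, and
  their equations occur among the coordinates of the normal crossings chart. By \<open>iJ\<close>
  they belong to the generators of the ideal of \<open>C\<close>, and an enumeration of the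
  generators gives the homogeneous coordinates.\<close>

lemma blowup_point_exists:
  fixes M :: "'a func_space" and M' :: "'b func_space" and K :: "'k set"
  assumes varM: "variety M" and nsM: "nonsingular M" and K: "finite K" "K \<noteq> {}"
    and closedD: "\<And>k. k \<in> K \<Longrightarrow> closedin (zar M) (D k)" and closedC: "closedin (zar M) C"
    and CD: "C \<subseteq> (\<Inter>k\<in>K. D k)" and nc: "normal_crossings_with M K D C"
    and blow: "blowing_up M C M' \<sigma>" and x: "x \<in> C"
  obtains U n r u idx \<theta> \<theta>' \<kappa> where "x \<in> U" "blowup_point M M' \<sigma> C U n r u idx \<theta> \<theta>' K D \<kappa>"
proof -
  interpret M: regular_functions M by (rule variety_regular_functions[OF varM])
  obtain U n u i J where xU: "x \<in> U" and lc: "local_coordinates M U n u"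
    and injK: "inj_on i {k \<in> K. x \<in> D k}"
    and eqD: "\<forall>k\<in>K. x \<in> D k \<longrightarrow> i k < n \<and> (\<forall>y\<in>U. local_equation M (D k) y (u (i k)))"
    and J: "J \<subseteq> {..<n}" and gen: "\<forall>y\<in>U. generates M y (u ` J) (ideal_at M C y)"
    using nc[unfolded normal_crossings_with_def, rule_format, OF x] by (elim exE conjE)
  have xD: "x \<in> D k" if "k \<in> K" for k using CD x that by blast
  have injK: "inj_on i K" using injK xD by (metis (mono_tags, lifting) inj_onD inj_onI mem_Collect_eq)
  have iK: "i k < n" "\<And>y. y \<in> U \<Longrightarrow> local_equation M (D k) y (u (i k))" if "k \<in> K" for k
    using eqD xD that by auto
  have finJ: "finite J" using J finite_subset by blast
  have oU: "openin (zar M) U" using lc by (simp add: local_coordinates_def)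
  have xt: "x \<in> topspace (zar M)" using oU xU openin_subset by blast
  have us: "u m \<in> stalk M x" if "m < n" for m
    by (rule stalkI[OF oU xU]) (use lc that in \<open>simp add: local_coordinates_def\<close>)
  have uC: "u m \<in> ideal_at M C x" if "m \<in> J" for m
    by (rule M.generates_mem[OF gen[rule_format, OF xU]]) (use that in blast)
  have u0: "u m x = 0" if "m \<in> J" for m by (rule ideal_at_zero[OF uC[OF that] x])
  \<comment> \<open>The equation of \<open>D k\<close> lies in the ideal of \<open>C\<close>; if it were not one of the generators, it would be
    congruent to a linear combination of them modulo the square of the maximal ideal.\<close>
  have iJ: "i k \<in> J" if k: "k \<in> K" for k
  proof (rule ccontr)
    assume nJ: "i k \<notin> J"
    have "u (i k) \<in> ideal_at M (D k) x" using iK(2)[OF k xU] by (simp add: M.local_equation_iff)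
    then have uk: "u (i k) \<in> ideal_at M C x" using ideal_at_mono[of C "D k" M x] CD k by blast
    obtain a where a: "\<forall>m\<in>J. a m \<in> stalk M x" "eq_near M x (u (i k)) (\<lambda>y. \<Sum>m\<in>J. a m y * u m y)"
      by (rule M.generates_finiteE[OF gen[rule_format, OF xU] finJ uk])
    define c where "c = (\<lambda>l. if l = i k then 1 else if l \<in> J then - a l x else 0)"
    have "(\<Sum>l<n. c l * (u l y - u l x)) = u (i k) y - (\<Sum>m\<in>J. a m x * u m y)" for y
    proof -
      have "(\<Sum>l<n. c l * (u l y - u l x)) = (\<Sum>l\<in>insert (i k) J. c l * (u l y - u l x))"
        using J iK(1)[OF k] by (intro sum.mono_neutral_right) (auto simp: c_def)
      also have "\<dots> = (u (i k) y - u (i k) x) + (\<Sum>m\<in>J. c m * (u m y - u m x))"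
        using finJ nJ by (simp add: c_def)
      also have "u (i k) x = 0" by (rule ideal_at_zero[OF uk x])
      also have "(\<Sum>m\<in>J. c m * (u m y - u m x)) = - (\<Sum>m\<in>J. a m x * u m y)"
        unfolding sum_negf[symmetric] using nJ u0 by (intro sum.cong) (auto simp: c_def)
      finally show ?thesis by simp
    qed
    then have "eq_near M x (\<lambda>y. \<Sum>m\<in>J. (a m y - a m x) * u m y) (\<lambda>y. \<Sum>l<n. c l * (u l y - u l x))"
      using eq_near_mono[OF a(2)] by (simp add: left_diff_distrib sum_subtractf)
    moreover have "(\<lambda>y. \<Sum>m\<in>J. (a m y - a m x) * u m y) \<in> ideal_span M x (M.square_gens x)"
    proof (rule M.ideal_span_sum[OF M.square_gens_stalk xt])
      fix m assume m: "m \<in> J"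
      show "(\<lambda>y. (a m y - a m x) * u m y) \<in> ideal_span M x (M.square_gens x)"
        by (rule M.square_span_mult[OF M.stalk_diff[OF _ M.stalk_const[OF xt]] us])
           (use a(1) m J u0 in auto)
    qed
    ultimately have "(\<lambda>y. \<Sum>l<n. c l * (u l y - u l x)) \<in> ideal_span M x (M.square_gens x)"
      by (rule M.ideal_span_eq_near[rotated])
    moreover have "regular_parameters M x n (\<lambda>i z. u i z - u i x)"
      using lc xU by (simp add: local_coordinates_def)
    ultimately have "\<forall>l<n. c l = 0" unfolding regular_parameters_def M.square_gens_def by blast
    then show False using iK(1)[OF k] by (auto simp: c_def)
  qed
  have "J \<noteq> {}" using iJ K(2) by blast
  obtain h where h: "bij_betw h {0..<card J} J" using ex_bij_betw_nat_finite[OF finJ] by blast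
  \<comment> \<open>Homogeneous coordinates are indexed from 0 to \<open>r\<close>, one for each
    generator; there is at least one because \<open>K\<close> is nonempty.\<close>
  define r where "r = card J - 1"
  have "card J \<noteq> 0" using \<open>J \<noteq> {}\<close> finJ by simp
  then have "{0..<card J} = {..r}" by (auto simp: r_def)
  then have h: "bij_betw h {..r} J" using h by simp
  define \<kappa> where "\<kappa> = (\<lambda>k. inv_into {..r} h (i k))"
  have hJ: "h ` {..r} = J" using h by (simp add: bij_betw_def)
  have h\<kappa>: "h (\<kappa> k) = i k" "\<kappa> k \<le> r" if "k \<in> K" for k
    using iJ[OF that] hJ f_inv_into_f[of "i k" h "{..r}"] inv_into_into[of "i k" h "{..r}"] by (auto simp: \<kappa>_def)
  have im: "(\<lambda>i. u (h i)) ` {..r} = u ` J" unfolding hJ[symmetric] by (rule image_image[symmetric])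
  have hn: "h m < n" if "m \<le> r" for m using hJ J that by blast
  have "\<exists>\<theta>. isomorphism (induced M' {x \<in> topspace (zar M'). \<sigma> x \<in> U})
                 (graph_closure (induced M U) C r (\<lambda>i. u (h i))) \<theta> \<and>
             (\<forall>x\<in>topspace (zar M'). \<sigma> x \<in> U \<longrightarrow> fst (\<theta> x) = \<sigma> x)"
  proof -
    have "openin (zar M) U \<and> (\<forall>m\<le>r. u (h m) \<in> reg M U) \<and>
        (\<forall>x\<in>U. generates M x ((\<lambda>i. u (h i)) ` {..r}) (ideal_at M C x))"
      using oU lc hn gen unfolding im by (auto simp: local_coordinates_def)
    from blow[unfolded blowing_up_def, THEN conjunct2, THEN conjunct2, THEN spec[of _ U], THEN spec[of _ r],
        THEN spec[of _ "\<lambda>i. u (h i)"], THEN mp, OF this] show ?thesis .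
  qed
  then obtain \<theta> where iso: "isomorphism (induced M' {x \<in> topspace (zar M'). \<sigma> x \<in> U})
                 (graph_closure (induced M U) C r (\<lambda>i. u (h i))) \<theta>"
    and fst\<theta>: "\<forall>x\<in>topspace (zar M'). \<sigma> x \<in> U \<longrightarrow> fst (\<theta> x) = \<sigma> x" by blast
  obtain \<theta>' where \<theta>: "morphism (induced M' {x \<in> topspace (zar M'). \<sigma> x \<in> U})
          (graph_closure (induced M U) C r (\<lambda>i. u (h i))) \<theta>"
    "morphism (graph_closure (induced M U) C r (\<lambda>i. u (h i)))
          (induced M' {x \<in> topspace (zar M'). \<sigma> x \<in> U}) \<theta>'"
    "\<forall>x\<in>topspace (zar (induced M' {x \<in> topspace (zar M'). \<sigma> x \<in> U})). \<theta>' (\<theta> x) = x"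
    "\<forall>p\<in>topspace (zar (graph_closure (induced M U) C r (\<lambda>i. u (h i)))). \<theta> (\<theta>' p) = p"
    using iso unfolding isomorphism_def by blast
  interpret bc: blowup_chart M M' \<sigma> C U n r u h \<theta> \<theta>'
  proof
    show "variety M'" "morphism M' M \<sigma>" using blow by (auto simp: blowing_up_def)
    show "inj_on h {..r}" using h by (simp add: bij_betw_def)
    show "generates M y ((\<lambda>i. u (h i)) ` {..r}) (ideal_at M C y)" if "y \<in> U" for y
      unfolding im using gen that by blast
    show "\<theta>' (\<theta> x) = x" if "x \<in> topspace (zar M')" "\<sigma> x \<in> U" for x
      using \<theta>(3) that by simp
    show "\<theta> (\<theta>' p) = p" if "p \<in> topspace (zar (graph_closure (induced M U) C r (\<lambda>i. u (h i))))" for p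
      using \<theta>(4) that by blast
    show "fst (\<theta> x) = \<sigma> x" if "x \<in> topspace (zar M')" "\<sigma> x \<in> U" for x using fst\<theta> that by blast
  qed (use varM nsM closedC lc hn \<theta>(1,2) in auto)
  have "blowup_point M M' \<sigma> C U n r u h \<theta> \<theta>' K D \<kappa>"
  proof
    show "inj_on \<kappa> K" using injK h\<kappa>(1) by (metis inj_on_def)
    show "local_equation M (D k) y (bc.g (\<kappa> k))" if "k \<in> K" "y \<in> U" for k y
      using iK(2)[OF that] h\<kappa>(1)[OF that(1)] by (simp add: bc.g_def)
  qed (use K closedD CD h\<kappa>(2) in auto)
  then show ?thesis by (rule that[OF xU])
qed

theorem theorem6p7:
  fixes M :: "'a func_space" and M' :: "'b func_space" and \<sigma> :: "'b \<Rightarrow> 'a"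
    and K Q :: "'k set" and D :: "'k \<Rightarrow> 'a set" and C :: "'a set"
  assumes "variety M" and "nonsingular M"
    and "finite K" and "K \<noteq> {}"
    and "simple_normal_crossings M K D"
    and "closedin (zar M) C" and "C \<subseteq> (\<Inter>k\<in>K. D k)" and "nonsingular (induced M C)"
    and "normal_crossings_with M K D C"
    and "blowing_up M C M' \<sigma>"
    and "Q \<subset> K"
  shows "bij_betw (H_alog M D C M' \<sigma> Q)
             (exc_normal_star K D C M' \<sigma> Q) (mixed_star M K D C Q) \<and>
         h_alog M K D Q \<in> mixed_star M K D C Q \<rightarrow> normal_star M D C K \<and>
         (\<forall>p \<in> exc_normal_star K D C M' \<sigma> Q.
             sigma_N_alog M K D C M' \<sigma> Q p = (h_alog M K D Q \<circ> H_alog M D C M' \<sigma> Q) p)"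
proof -
  have closedD: "\<And>k. k \<in> K \<Longrightarrow> closedin (zar M) (D k)"
    using assms(5) by (simp add: simple_normal_crossings_def)
  note chart = blowup_point_exists[OF assms(1-4) closedD assms(6,7,9,10)]
  define L where "L = lift_normal M C M' \<sigma>"
  define E where "E = inverse_image M' \<sigma> C"
  have EC: "\<sigma> x \<in> C" if "x \<in> E" for x using that by (simp add: E_def inverse_image_def)
  \<comment> \<open>The lift of a normal vector at \<open>y\<close> lies over \<open>y\<close>, so
    vectors at different points have different lifts, and injectivity can be tested at one point in
    one chart.\<close>
  have L_exists: "\<exists>x \<nu>'. L (y, \<nu>) = (x, \<nu>') \<and> x \<in> E \<and> \<sigma> x = y \<and> \<nu>' \<in> nonzero_normals M' E x"
    if y: "y \<in> C" and \<nu>: "\<nu> \<in> nonzero_normals M C y" for y \<nu>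
  proof -
    obtain U n r u idx \<theta> \<theta>' \<kappa> where yU: "y \<in> U" and bp: "blowup_point M M' \<sigma> C U n r u idx \<theta> \<theta>' K D \<kappa>"
      by (rule chart[OF _ y])
    interpret bp: blowup_point M M' \<sigma> C U n r u idx \<theta> \<theta>' K D \<kappa> by (rule bp)
    obtain x \<nu>' where "x \<in> bp.E" "\<sigma> x = y" "\<nu>' \<in> nonzero_normals M' bp.E x" "lift_normal M C M' \<sigma> (y, \<nu>) = (x, \<nu>')"
      by (rule bp.lift_normal_exists[OF y yU \<nu>])
    then show ?thesis by (auto simp: L_def E_def bp.E_def)
  qed
  have inj: "inj_on L (normal_bundle_nz M C)"
  proof (rule inj_onI)
    fix v w assume v: "v \<in> normal_bundle_nz M C" and w: "w \<in> normal_bundle_nz M C" and eq: "L v = L w"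
    obtain y \<nu> where v': "v = (y, \<nu>)" "y \<in> C" "\<nu> \<in> nonzero_normals M C y"
      using v by (auto simp: normal_bundle_nz_def)
    obtain z \<mu> where w': "w = (z, \<mu>)" "z \<in> C" "\<mu> \<in> nonzero_normals M C z"
      using w by (auto simp: normal_bundle_nz_def)
    have "y = z" using L_exists[OF v'(2,3)] L_exists[OF w'(2,3)] eq v'(1) w'(1) by auto
    obtain U n r u idx \<theta> \<theta>' \<kappa> where yU: "y \<in> U" and bp: "blowup_point M M' \<sigma> C U n r u idx \<theta> \<theta>' K D \<kappa>"
      by (rule chart[OF _ v'(2)])
    interpret bp: blowup_point M M' \<sigma> C U n r u idx \<theta> \<theta>' K D \<kappa> by (rule bp)
    have "\<nu> = \<mu>"
      by (rule bp.lift_normal_inject[OF v'(2) yU v'(3)]) (use w' eq v'(1) \<open>y = z\<close> in \<open>auto simp: L_def\<close>)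
    then show "v = w" using v'(1) w'(1) \<open>y = z\<close> by simp
  qed
  \<comment> \<open>Serves the injectivity of \<open>H_alog\<close>: \<open>inv_into\<close> is
    injective on the image of \<open>L\<close>, so both exceptional vectors must be known to lie
    there.\<close>
  have surj: "(x, \<nu>') \<in> L ` normal_bundle_nz M C" if x: "x \<in> E" and \<nu>': "\<nu>' \<in> nonzero_normals M' E x" for x \<nu>'
  proof -
    obtain U n r u idx \<theta> \<theta>' \<kappa> where xU: "\<sigma> x \<in> U" and bp: "blowup_point M M' \<sigma> C U n r u idx \<theta> \<theta>' K D \<kappa>"
      by (rule chart[OF _ EC[OF x]])
    interpret bp: blowup_point M M' \<sigma> C U n r u idx \<theta> \<theta>' K D \<kappa> by (rule bp)
    obtain \<nu> where "\<nu> \<in> nonzero_normals M C (\<sigma> x)" "lift_normal M C M' \<sigma> (\<sigma> x, \<nu>) = (x, \<nu>')"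
      using x \<nu>' by (auto simp: E_def bp.E_def[symmetric] intro: bp.lift_normal_at[OF _ xU])
    then show ?thesis
      using EC[OF x] by (intro image_eqI[of _ _ "(\<sigma> x, \<nu>)"]) (auto simp: L_def normal_bundle_nz_def)
  qed
  have star: "x \<in> E" "\<nu>' \<in> nonzero_normals M' E x" if "(x, \<nu>', \<mu>) \<in> exc_normal_star K D C M' \<sigma> Q" for x \<nu>' \<mu>
    using that by (auto simp: exc_normal_star_def exc_stratum_def E_def)
  have "H_alog M D C M' \<sigma> Q p \<in> mixed_star M K D C Q \<and>
      sigma_N_alog M K D C M' \<sigma> Q p = h_alog M K D Q (H_alog M D C M' \<sigma> Q p)"
    if p: "p \<in> exc_normal_star K D C M' \<sigma> Q" for p
  proof -
    obtain x \<nu>' \<mu> where p': "p = (x, \<nu>', \<mu>)" by (cases p)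
    have p: "(x, \<nu>', \<mu>) \<in> exc_normal_star K D C M' \<sigma> Q" using p p' by simp
    obtain U n r u idx \<theta> \<theta>' \<kappa> where xU: "\<sigma> x \<in> U" and bp: "blowup_point M M' \<sigma> C U n r u idx \<theta> \<theta>' K D \<kappa>"
      by (rule chart[OF _ EC[OF star(1)[OF p]]])
    interpret bp: blowup_point M M' \<sigma> C U n r u idx \<theta> \<theta>' K D \<kappa> by (rule bp)
    show ?thesis
      unfolding p' using bp.H_alog_mem[OF assms(11) inj[unfolded L_def] p xU]
        bp.sigma_N_alog_eq[OF assms(11) inj[unfolded L_def] p xU] by blast
  qed
  moreover have "bij_betw (H_alog M D C M' \<sigma> Q) (exc_normal_star K D C M' \<sigma> Q) (mixed_star M K D C Q)"
  proof (rule bij_betw_imageI)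
    show "inj_on (H_alog M D C M' \<sigma> Q) (exc_normal_star K D C M' \<sigma> Q)"
    proof (rule inj_onI)
      fix p p1 assume "p \<in> exc_normal_star K D C M' \<sigma> Q" "p1 \<in> exc_normal_star K D C M' \<sigma> Q"
        and eq: "H_alog M D C M' \<sigma> Q p = H_alog M D C M' \<sigma> Q p1"
      then obtain x \<nu>' \<mu> x1 \<nu>1' \<mu>1 where p: "p = (x, \<nu>', \<mu>)" "(x, \<nu>', \<mu>) \<in> exc_normal_star K D C M' \<sigma> Q"
        and p1: "p1 = (x1, \<nu>1', \<mu>1)" "(x1, \<nu>1', \<mu>1) \<in> exc_normal_star K D C M' \<sigma> Q" by (metis prod_cases3)
      have "inv_into (normal_bundle_nz M C) L (x, \<nu>') = inv_into (normal_bundle_nz M C) L (x1, \<nu>1')"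
        using eq by (simp add: H_alog_def unlift_normal_def L_def p(1) p1(1))
      then have xx: "x1 = x" "\<nu>1' = \<nu>'"
        using inv_into_injective[OF _ surj[OF star[OF p(2)]] surj[OF star[OF p1(2)]]] by auto
      obtain U n r u idx \<theta> \<theta>' \<kappa> where xU: "\<sigma> x \<in> U" and bp: "blowup_point M M' \<sigma> C U n r u idx \<theta> \<theta>' K D \<kappa>"
        by (rule chart[OF _ EC[OF star(1)[OF p(2)]]])
      interpret bp: blowup_point M M' \<sigma> C U n r u idx \<theta> \<theta>' K D \<kappa> by (rule bp)
      show "p = p1"
        using bp.H_alog_inject[OF assms(11) inj[unfolded L_def] p(2) _ xU, of \<mu>1] p1 p(1) eq xx by simp
    qed
    show "H_alog M D C M' \<sigma> Q ` exc_normal_star K D C M' \<sigma> Q = mixed_star M K D C Q"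
    proof (intro equalityI subsetI)
      fix w assume "w \<in> H_alog M D C M' \<sigma> Q ` exc_normal_star K D C M' \<sigma> Q"
      then show "w \<in> mixed_star M K D C Q" using calculation by blast
    next
      fix w assume w: "w \<in> mixed_star M K D C Q"
      then obtain y \<nu> \<omega> where w': "w = ((y, \<nu>), (y, \<omega>))" "y \<in> C"
        by (auto simp: mixed_star_def normal_part_def normal_bundle_def)
      obtain U n r u idx \<theta> \<theta>' \<kappa> where yU: "y \<in> U" and bp: "blowup_point M M' \<sigma> C U n r u idx \<theta> \<theta>' K D \<kappa>"
        by (rule chart[OF _ w'(2)])
      interpret bp: blowup_point M M' \<sigma> C U n r u idx \<theta> \<theta>' K D \<kappa> by (rule bp)
      show "w \<in> H_alog M D C M' \<sigma> Q ` exc_normal_star K D C M' \<sigma> Q"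
        using bp.H_alog_surject[OF assms(11) inj[unfolded L_def], of y \<nu> \<omega>] w w'(1) yU by force
    qed
  qed
  moreover have "h_alog M K D Q \<in> mixed_star M K D C Q \<rightarrow> normal_star M D C K"
  proof
    interpret M: regular_functions M by (rule variety_regular_functions[OF assms(1)])
    fix w assume "w \<in> mixed_star M K D C Q"
    then obtain y \<nu> \<omega> where w: "w = ((y, \<nu>), (y, \<omega>))" "y \<in> C" "\<nu> \<in> normal_space M C y"
      and out: "\<And>k. k \<in> K - Q \<Longrightarrow> normal_proj M (D k) y \<nu> \<noteq> zero_normal M (D k) y"
      and \<omega>: "\<omega> \<in> (\<Pi>\<^sub>E k\<in>Q. nonzero_normals M (D k) y)"
      by (auto simp: mixed_star_def normal_part_def normal_bundle_def normal_star_def)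
    \<comment> \<open>Outside \<open>Q\<close> the component is nonzero by the definition of
      \<open>normal_part\<close>, inside \<open>Q\<close> by that of
      \<open>normal_star\<close>.\<close>
    have "(if k \<in> Q then \<omega> k else normal_proj M (D k) y \<nu>) \<in> nonzero_normals M (D k) y" if "k \<in> K" for k
      using that out PiE_mem[OF \<omega>] M.normal_proj_space(1)[OF w(3), of "D k"] assms(7)
      by (auto simp: nonzero_normals_def)
    then show "h_alog M K D Q w \<in> normal_star M D C K"
      using w(1,2) by (simp add: h_alog_def normal_star_def)
  qed
  ultimately show ?thesis by (simp add: o_def)
qed

end
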